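(* Let $b_1,\dots,b_6$ be complex numbers with $b_1\cdots b_6=q$, such that $b_i/b_j\notin q^{\mathbb Z}$ for $1\le i<j\le 6$ and $b_ib_j\notin q^{\mathbb Z}$ for $1\le i\le j\le 6$, and let $N_1,\dots,N_6$ be integers with $N_1+\dots+N_6=0$. Let $V=V(b_1,\dots,b_6)$ and $\mathbf J$ be the space and the Rahman functional with parameters $(b_1,\dots,b_6)$, and let $V'$ and $\mathbf J'$ be the space and the Rahman functional with parameters $(b_1q^{N_1},\dots,b_6q^{N_6})$, as defined in the context. Then, for $f\in V$ and $g\in V'$, $$\sum_{x=-\infty}^\infty\oint\frac{(1-q^x z^2)(1-q^xz^{-2})}{q^xz^{6x}}\prod_{j=1}^6\frac{(q^{1+x/2}/b_jz,\,q^{1-x/2}z/b_j)_\infty}{(q^{N_j+x/2}b_jz,\,q^{N_j-x/2}b_j/z)_\infty}\; f\left(\frac{q^{-x/2}z+q^{x/2}z^{-1}}2\right)g\left(\frac{q^{x/2}z+q^{-x/2}z^{-1}}2\right)\frac{dz}{2\pi\mathrm i z}$$ $$=\frac 2{\prod_{j=1}^6q^{\binom{N_j}2} b_j^{N_j}}\prod_{1\leq i<j\leq 6}\frac{(q/b_ib_j)_\infty}{(b_ib_jq^{N_i+N_j})_\infty}\;\mathbf J(f)\,\mathbf J'(g).$$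
   Context: Throughout, $q$ is a fixed complex number with $0<|q|<1$, with a fixed choice of square root $q^{1/2}$ (the base $q$ is suppressed from the notation). For $k\in\mathbb Z_{\ge 0}$, $(a)_k=(1-a)(1-aq)\cdots(1-aq^{k-1})$; for $k\in\mathbb Z_{<0}$, $(a)_k=\left((1-aq^{-1})\cdots(1-aq^{k})\right)^{-1}$; $(a)_\infty=\prod_{j=0}^\infty(1-aq^j)$. Repeated arguments and $\pm$ denote products, e.g. $(x,y)_\infty=(x)_\infty(y)_\infty$, $(bz^\pm)_k=(bz)_k(b/z)_k$; $q^{1+x/2}/b_jz$ means $q^{1+x/2}/(b_jz)$ and $q/b_ib_j$ means $q/(b_ib_j)$. $V(b_1,\dots,b_6)$ is the vector space of rational functions in the variable $(z+z^{-1})/2$ that are regular, including at infinity (the degree of the numerator does not exceed the degree of the denominator), except for possible single (simple) poles at the points with $z\in b_jq^{\mathbb Z_{<0}}$ or $z^{-1}\in b_jq^{\mathbb Z_{<0}}$, $1\leq j\leq 6$. It is spanned by the functions $(b_1z^\pm)_{k_1}\cdots(b_6z^\pm)_{k_6}$ with $k_j\in\mathbb Z$, $k_1+\dots+k_6=0$. The Rahman functional $\mathbf J$ with parameters $(b_1,\dots,b_6)$ is the linear functional on $V(b_1,\dots,b_6)$ determined by $$\mathbf J\left((b_1z^\pm)_{k_1}\cdots(b_6z^\pm)_{k_6}\right)=\frac{\prod_{1\leq i<j\leq 6}(b_ib_j)_{k_i+k_j}}{\prod_{j=1}^6q^{\binom{k_j}2}b_j^{k_j}},\qquad k_1+\dots+k_6=0.$$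 For each $x$, the integration is over a positively oriented contour (depending on $x$, $f$, $g$) separating the geometric sequences of poles of the integrand tending to $0$ (inside the contour) from those tending to $\infty$ (outside); that is, poles of the form $z\in b_jq^{-x/2}q^{\mathbb Z}$ are inside and poles of the form $z\in b_j^{-1}q^{-x/2}q^{\mathbb Z}$ are outside. *)

theory Defs
  imports
    "HOL-Complex_Analysis.Complex_Analysis"
    "HOL-Computational_Algebra.Fraction_Field"
    "HOL-Computational_Algebra.Normalized_Fraction"
    "HOL-Computational_Algebra.Polynomial_Factorial"
    "HOL-Computational_Algebra.Field_as_Ring"
begin

text \<open>
  The six parameters are the values at 1, ..., 6 of a function on \<^typ>\<open>nat\<close>; its other
  values never matter.
\<close>

definition qpoch :: "complex \<Rightarrow> complex \<Rightarrow> int \<Rightarrow> complex" where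
  "qpoch q a k =
     (if k \<ge> 0 then \<Prod>i<nat k. 1 - a * q ^ i
      else inverse (\<Prod>i=1..nat (- k). 1 - a * q powi (- int i)))"

definition qpoch_inf :: "complex \<Rightarrow> complex \<Rightarrow> complex" where
  "qpoch_inf q a = (\<Prod>j. 1 - a * q ^ j)"

definition qbinom2 :: "complex \<Rightarrow> int \<Rightarrow> complex" where
  "qbinom2 q k = q powi (k * (k - 1) div 2)"

definition qpowers :: "complex \<Rightarrow> complex set" where
  "qpowers q = range (\<lambda>n::int. q powi n)"

text \<open>
  Rational functions are elements of the fraction field of \<open>complex poly\<close>, so that they form
  a vector space; they are evaluated in lowest terms. The value at a pole is 0 by convention.
\<close>

definition reval :: "complex poly fract \<Rightarrow> complex \<Rightarrow> complex" where
  "reval r u = poly (fst (quot_of_fract r)) u / poly (snd (quot_of_fract r)) u"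

text \<open>
  Here \<open>u = (z + z\<^sup>-\<^sup>1) / 2\<close> is the variable of the rational functions. When no \<open>b\<^sub>j\<^sup>2\<close> is a power
  of \<open>q\<close>, the points \<open>z = 1, -1\<close> do not occur, so that simple poles in \<open>u\<close> and in \<open>z\<close> agree.
\<close>

definition rahman_space :: "complex \<Rightarrow> (nat \<Rightarrow> complex) \<Rightarrow> complex poly fract set" where
  "rahman_space q b =
     {r. degree (fst (quot_of_fract r)) \<le> degree (snd (quot_of_fract r)) \<and>
         (\<forall>u. poly (snd (quot_of_fract r)) u = 0 \<longrightarrow>
            order u (snd (quot_of_fract r)) = 1 \<and>
            (\<exists>z. z \<noteq> 0 \<and> u = (z + inverse z) / 2 \<and>
               (\<exists>j\<in>{1..6}. \<exists>n::int. n < 0 \<and> (z = b j * q powi n \<or> inverse z = b j * q powi n))))}"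

text \<open>
  With \<open>u = (z + z\<^sup>-\<^sup>1) / 2\<close> one has \<open>(1 - c z) (1 - c / z) = 1 + c\<^sup>2 - 2 c u\<close>. Hence
  \<open>qpoch_pm q b k\<close> is the product \<open>(b z)\<^sub>k (b / z)\<^sub>k\<close> as a rational function of \<open>u\<close>; see the
  lemma \<open>reval_prod_qpoch_pm\<close>.
\<close>

definition pm_factor :: "complex \<Rightarrow> complex poly fract" where
  "pm_factor c = to_fract [:1 + c ^ 2, - 2 * c:]"

definition qpoch_pm :: "complex \<Rightarrow> complex \<Rightarrow> int \<Rightarrow> complex poly fract" where
  "qpoch_pm q b k =
     (if k \<ge> 0 then \<Prod>i<nat k. pm_factor (b * q ^ i)
      else inverse (\<Prod>i=1..nat (- k). pm_factor (b * q powi (- int i))))"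

definition is_rahman_functional ::
  "complex \<Rightarrow> (nat \<Rightarrow> complex) \<Rightarrow> (complex poly fract \<Rightarrow> complex) \<Rightarrow> bool" where
  "is_rahman_functional q b J \<longleftrightarrow>
     (\<forall>f\<in>rahman_space q b. \<forall>g\<in>rahman_space q b. J (f + g) = J f + J g) \<and>
     (\<forall>c. \<forall>f\<in>rahman_space q b. J (to_fract [:c:] * f) = c * J f) \<and>
     (\<forall>k::nat \<Rightarrow> int. (\<Sum>j=1..6. k j) = 0 \<longrightarrow>
        J (\<Prod>j=1..6. qpoch_pm q (b j) (k j)) =
          (\<Prod>i=1..6. \<Prod>j\<in>{i<..6}. qpoch q (b i * b j) (k i + k j)) /
          (\<Prod>j=1..6. qbinom2 q (k j) * b j powi k j))"

text \<open>
  In the integrand \<open>s\<close> is the chosen square root of \<open>q\<close>, so that \<open>s powi x\<close> stands for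
  \<open>q\<^bsup>x/2\<^esup>\<close>. The factor \<open>1 / (2 \<pi> i z)\<close> of the measure is included.
\<close>

definition rahman_integrand ::
  "complex \<Rightarrow> complex \<Rightarrow> (nat \<Rightarrow> complex) \<Rightarrow> (nat \<Rightarrow> int) \<Rightarrow>
   complex poly fract \<Rightarrow> complex poly fract \<Rightarrow> int \<Rightarrow> complex \<Rightarrow> complex" where
  "rahman_integrand q s b N f g x z =
     (1 - q powi x * z ^ 2) * (1 - q powi x * z powi (- 2)) / (q powi x * z powi (6 * x)) *
     (\<Prod>j=1..6.
        (qpoch_inf q (q * s powi x / (b j * z)) * qpoch_inf q (q * s powi (- x) * z / b j)) /
        (qpoch_inf q (q powi N j * s powi x * b j * z) *
         qpoch_inf q (q powi N j * s powi (- x) * b j / z))) *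
     reval f ((s powi (- x) * z + s powi x * inverse z) / 2) *
     reval g ((s powi x * z + s powi (- x) * inverse z) / 2) *
     (1 / (2 * of_real pi * \<i> * z))"

text \<open>
  Only actual poles of the integrand \<open>F\<close> matter, which is why the contour depends on \<open>f\<close> and
  \<open>g\<close>. The predicate \<open>is_pole\<close> looks at punctured neighbourhoods only, hence ignores the
  values at removable singularities that result from division by zero. The sequences of poles
  to be enclosed converge to 0, so 0 lies inside too.
\<close>

definition separating_contour ::
  "complex \<Rightarrow> complex \<Rightarrow> (nat \<Rightarrow> complex) \<Rightarrow> int \<Rightarrow> (complex \<Rightarrow> complex) \<Rightarrow>
   (real \<Rightarrow> complex) \<Rightarrow> bool" where
  "separating_contour q s b x F \<gamma> \<longleftrightarrow>
     valid_path \<gamma> \<and> simple_path \<gamma> \<and> pathfinish \<gamma> = pathstart \<gamma> \<and>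
     0 \<in> inside (path_image \<gamma>) \<and> winding_number \<gamma> 0 = 1 \<and>
     (\<forall>z j. j \<in> {1..6} \<longrightarrow> is_pole F z \<longrightarrow>
        (z \<in> (\<lambda>t. b j * s powi (- x) * t) ` qpowers q \<longrightarrow> z \<in> inside (path_image \<gamma>)) \<and>
        (z \<in> (\<lambda>t. inverse (b j) * s powi (- x) * t) ` qpowers q \<longrightarrow>
           z \<in> outside (path_image \<gamma>)))"

lemma reval_Fract:
  assumes "poly d u \<noteq> 0"
  shows "reval (Fraction_Field.Fract n d) u = poly n u / poly d u"
proof -
  define P where "P = fst (quot_of_fract (Fraction_Field.Fract n d))"
  define Q where "Q = snd (quot_of_fract (Fraction_Field.Fract n d))"
  have d0: "d \<noteq> 0" using assms by auto
  have Q0: "Q \<noteq> 0" by (simp add: Q_def)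
  have "Fraction_Field.Fract P Q = Fraction_Field.Fract n d"
    by (simp add: P_def Q_def)
  hence eq: "P * d = n * Q"
    using d0 Q0 by (simp add: eq_fract)
  have "coprime Q P"
    unfolding P_def Q_def by (simp add: coprime_quot_of_fract coprime_commute)
  moreover have "Q dvd P * d" using eq by simp
  ultimately have "Q dvd d" by (simp add: coprime_dvd_mult_right_iff)
  hence "poly Q u \<noteq> 0" using assms by (auto elim!: dvdE)
  moreover have "poly P u * poly d u = poly n u * poly Q u"
    using arg_cong[OF eq, of "\<lambda>p. poly p u"] by simp
  ultimately have "poly P u / poly Q u = poly n u / poly d u"
    using assms by (subst frac_eq_eq)
  thus ?thesis by (simp only: reval_def P_def Q_def)
qed

text \<open>\<open>represents r u v\<close>: the rational function \<open>r\<close> is regular at \<open>u\<close> with value \<open>v\<close>.\<close>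

definition represents :: "complex poly fract \<Rightarrow> complex \<Rightarrow> complex \<Rightarrow> bool" where
  "represents r u v \<longleftrightarrow>
     (\<exists>n d. r = Fraction_Field.Fract n d \<and> poly d u \<noteq> 0 \<and> v = poly n u / poly d u)"

lemma represents_reval: "represents r u v \<Longrightarrow> reval r u = v"
  by (auto simp: represents_def reval_Fract)

lemma represents_1: "represents 1 u 1"
  unfolding represents_def by (rule exI[of _ 1], rule exI[of _ 1]) (simp add: One_fract_def)

lemma represents_mult:
  assumes "represents r u v" "represents r' u v'"
  shows "represents (r * r') u (v * v')"
proof -
  obtain n d where 1: "r = Fraction_Field.Fract n d" "poly d u \<noteq> 0" "v = poly n u / poly d u"
    using assms(1) unfolding represents_def by blast
  obtain n' d' where 2: "r' = Fraction_Field.Fract n' d'" "poly d' u \<noteq> 0"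
      "v' = poly n' u / poly d' u"
    using assms(2) unfolding represents_def by blast
  show ?thesis
    unfolding represents_def using 1 2
    by (intro exI[of _ "n * n'"] exI[of _ "d * d'"]) simp
qed

lemma represents_inverse:
  assumes "represents r u v" "v \<noteq> 0"
  shows "represents (inverse r) u (inverse v)"
proof -
  obtain n d where 1: "r = Fraction_Field.Fract n d" "poly d u \<noteq> 0" "v = poly n u / poly d u"
    using assms(1) unfolding represents_def by blast
  show ?thesis
    unfolding represents_def using 1 assms(2)
    by (intro exI[of _ d] exI[of _ n]) (simp add: inverse_fract)
qed

lemma represents_prod:
  assumes "\<And>i. i \<in> A \<Longrightarrow> represents (r i) u (v i)"
  shows "represents (\<Prod>i\<in>A. r i) u (\<Prod>i\<in>A. v i)"
  using assms
  by (induction A rule: infinite_finite_induct) (auto intro: represents_1 represents_mult)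

lemma represents_pm_factor:
  assumes "z \<noteq> 0"
  shows "represents (pm_factor c) ((z + inverse z) / 2) ((1 - c * z) * (1 - c / z))"
proof -
  have "z * inverse z = 1" using assms by simp
  moreover have "poly [:1 + c ^ 2, - 2 * c:] ((z + inverse z) / 2) = 1 + c ^ 2 - c * (z + inverse z)"
    by simp
  ultimately have "poly [:1 + c ^ 2, - 2 * c:] ((z + inverse z) / 2) = (1 - c * z) * (1 - c * inverse z)"
    by algebra
  thus ?thesis
    unfolding represents_def pm_factor_def to_fract_def
    by (intro exI[of _ "[:1 + c ^ 2, - 2 * c:]"] exI[of _ 1])
       (simp only: divide_inverse poly_1 inverse_1 mult_1_right one_neq_zero not_False_eq_True)
qed

lemma represents_qpoch_pm:
  assumes "z \<noteq> 0" "\<And>n::int. b * q powi n * z \<noteq> 1 \<and> b * q powi n / z \<noteq> 1"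
  shows "represents (qpoch_pm q b k) ((z + inverse z) / 2) (qpoch q (b * z) k * qpoch q (b / z) k)"
proof (cases "k \<ge> 0")
  case True
  have "represents (\<Prod>i<nat k. pm_factor (b * q ^ i)) ((z + inverse z) / 2)
      (\<Prod>i<nat k. (1 - b * q ^ i * z) * (1 - b * q ^ i / z))"
    by (intro represents_prod represents_pm_factor assms(1))
  thus ?thesis using True by (simp add: qpoch_pm_def qpoch_def prod.distrib mult_ac)
next
  case False
  let ?v = "\<Prod>i=1..nat (- k). (1 - b * q powi (- int i) * z) * (1 - b * q powi (- int i) / z)"
  have "represents (inverse (\<Prod>i=1..nat (- k). pm_factor (b * q powi (- int i))))
      ((z + inverse z) / 2) (inverse ?v)"
  proof (intro represents_inverse represents_prod represents_pm_factor assms(1))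
    have "1 - b * q powi (- int i) * z \<noteq> 0" "1 - b * q powi (- int i) / z \<noteq> 0" for i
      using assms(2)[of "- int i"] by (metis eq_iff_diff_eq_0)+
    thus "?v \<noteq> 0" by (simp only: prod_zero_iff finite_atLeastAtMost mult_eq_0_iff) blast
  qed
  moreover have "inverse ?v = qpoch q (b * z) k * qpoch q (b / z) k"
  proof -
    have "?v = (\<Prod>i=1..nat (- k). (1 - b * z * q powi (- int i)) * (1 - b / z * q powi (- int i)))"
      by (rule prod.cong) (simp_all only: times_divide_eq_left mult.assoc mult.commute mult.left_commute)
    thus ?thesis using False by (simp only: qpoch_def if_False prod.distrib inverse_mult_distrib)
  qed
  ultimately show ?thesis
    using False by (simp only: qpoch_pm_def if_False)
qed

lemma reval_prod_qpoch_pm: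
  assumes "z \<noteq> 0"
    and "\<And>j n. j \<in> {1..6} \<Longrightarrow> b j * q powi n * z \<noteq> 1 \<and> b j * q powi n / z \<noteq> 1"
  shows "reval (\<Prod>j=1..6. qpoch_pm q (b j) (k j)) ((z + inverse z) / 2) =
    (\<Prod>j=1..(6::nat). qpoch q (b j * z) (k j) * qpoch q (b j / z) (k j))"
proof (rule represents_reval, rule represents_prod)
  fix j :: nat assume "j \<in> {1..6}"
  thus "represents (qpoch_pm q (b j) (k j)) ((z + inverse z) / 2)
      (qpoch q (b j * z) (k j) * qpoch q (b j / z) (k j))"
    using assms by (intro represents_qpoch_pm) blast+
qed

end

theory Submission
  imports Defs "HOL-Computational_Algebra.Fundamental_Theorem_Algebra"
begin

text \<open>
  Put \<open>u = q\<^bsup>-x/2\<^esup> z\<close>, \<open>v = q\<^bsup>x/2\<^esup> z\<close> and \<open>c\<^sub>j = b\<^sub>j q\<^bsup>N\<^sub>j\<^esup>\<close>. Everything is built on the function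
  \<open>X\<^sub>b(u) = - u (1 - u\<^sup>2) \<Prod>\<^sub>j (q u / b\<^sub>j)\<^sub>\<infinity> / (b\<^sub>j u)\<^sub>\<infinity>\<close>, called \<open>Xf b u\<close> below. Multiplying it by a
  spanning function of \<open>V\<close> with exponents \<open>k\<close> gives \<open>X\<close> with the parameters \<open>b\<^sub>j q\<^bsup>k\<^sub>j\<^esup>\<close>, up to the constant
  \<open>\<Prod>\<^sub>j q\<^bsup>binom(k\<^sub>j,2)\<^esup> b\<^sub>j\<^bsup>k\<^sub>j\<^esup>\<close> (\<open>Xf_mult_qpoch\<close>). By the quasi-periodicity of theta functions the
  integrand is \<open>- \<mu> f(u) X\<^sub>b(u) g(v) X\<^sub>c(v) h(v) / (2 \<pi> i z)\<close>. Here \<open>f(u)\<close> is short for the value of \<open>f\<close> at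
  \<open>(u + u\<^sup>-\<^sup>1) / 2\<close>, \<open>\<mu>\<close> is the product in the denominator of the right-hand side, and \<open>h\<close> is elliptic, that is \<open>h(q v) = h(v)\<close>
  (\<open>integrand_core\<close>, \<open>hq_q\<close>).

  Shrinking the contour to 0 turns the integral for \<open>x\<close> into the sum of the residues at
  \<open>z = b\<^sub>k q\<^bsup>m - x/2\<^esup>\<close>, where \<open>u = b\<^sub>k q\<^bsup>m - x\<^esup>\<close> and \<open>v = b\<^sub>k q\<^bsup>m\<^esup>\<close> (\<open>integrand_has_contour_integral\<close>).
  Since \<open>h\<close> is elliptic, its contribution \<open>\<eta>\<^sub>k\<close> to a residue depends on neither \<open>x\<close> nor \<open>m\<close>. After summation
  over \<open>x\<close> the variables \<open>m - x\<close> and \<open>m\<close> are independent, and the left-hand side becomes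
  \<open>- \<mu> \<Sum>\<^sub>k \<eta>\<^sub>k x\<^sub>k y\<^sub>k\<close> with \<open>x\<^sub>k\<close> and \<open>y\<^sub>k\<close> the sums of \<open>f X\<^sub>b\<close> and \<open>g X\<^sub>c\<close> over \<open>b\<^sub>k q\<^bsup>\<int>\<^esup>\<close>.

  For \<open>f = 1\<close> the \<open>x\<^sub>k\<close> are very-well-poised series, and the nonterminating form of Jackson's summation
  evaluates their differences: \<open>x\<^sub>k - x\<^sub>l = H\<^sub>k\<^sub>l\<close> with an explicit product \<open>H\<^sub>k\<^sub>l\<close>
  (\<open>nonterminating_jackson\<close>). When the parameters are shifted, \<open>H\<^sub>k\<^sub>l\<close> times the constant from
  \<open>Xf_mult_qpoch\<close> is multiplied by exactly the value that defines the Rahman functional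
  (\<open>Hf_shiftp\<close>), so that \<open>x\<^sub>k - x\<^sub>l = \<J>(f) H\<^sub>k\<^sub>l\<close> for all \<open>f\<close> in \<open>V\<close>, and
  likewise for \<open>y\<^sub>k\<close>. The residue theorem on the torus \<open>\<complex>\<^sup>* / q\<^bsup>\<int>\<^esup>\<close> gives \<open>\<Sum>\<^sub>k \<eta>\<^sub>k = 0\<close>,
  \<open>\<Sum>\<^sub>k \<eta>\<^sub>k H\<^sub>k\<^sub>l = 0\<close> and a closed form of \<open>\<Sum>\<^sub>k \<eta>\<^sub>k H\<^sub>k\<^sub>l H\<^sub>k\<^sub>m\<close>
  (\<open>eta_sum\<close>, \<open>eta_Hf_sum\<close>, \<open>eta_Hf_Hf_sum\<close>); hence only the product of the two functionals survives
  (\<open>eta_sum_bilinear\<close>).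
\<close>

section \<open>q-shifted factorials and the theta function\<close>

locale qbase =
  fixes q :: complex
  assumes q_nz: "q \<noteq> 0" and norm_q: "norm q < 1"
begin

abbreviation qp :: "complex \<Rightarrow> complex" where "qp \<equiv> qpoch_inf q"

lemma summable_q: "summable (\<lambda>n. norm (a * q ^ n))"
  unfolding norm_mult norm_power using norm_q by (intro summable_mult summable_geometric) simp

lemma qp_convergent: "convergent_prod (\<lambda>n. 1 - a * q ^ n)"
proof -
  have "summable (\<lambda>n. norm ((1 - a * q ^ n) - 1))" using summable_q[of a] by simp
  thus ?thesis
    by (intro abs_convergent_prod_imp_convergent_prod summable_imp_abs_convergent_prod)
qed

lemma qp_has_prod: "(\<lambda>n. 1 - a * q ^ n) has_prod qp a"
  unfolding qpoch_inf_def using qp_convergent by (rule convergent_prod_has_prod)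

lemma qp_0 [simp]: "qp 0 = 1"
  by (simp add: qpoch_inf_def)

lemma qp_tendsto: "(\<lambda>n. \<Prod>k<n. 1 - a * q ^ k) \<longlonglongrightarrow> qp a"
  using has_prod_imp_tendsto'[OF qp_has_prod] .

lemma qp_rec: "qp a = (1 - a) * qp (a * q)"
proof -
  have "(\<lambda>n. \<Prod>k<Suc n. 1 - a * q ^ k) \<longlonglongrightarrow> qp a"
    using qp_tendsto[of a] by (rule LIMSEQ_Suc)
  also have "(\<lambda>n. \<Prod>k<Suc n. 1 - a * q ^ k) = (\<lambda>n. (1 - a) * (\<Prod>k<n. 1 - (a * q) * q ^ k))"
    by (subst prod.lessThan_Suc_shift) (simp add: mult_ac)
  finally have "(\<lambda>n. (1 - a) * (\<Prod>k<n. 1 - (a * q) * q ^ k)) \<longlonglongrightarrow> qp a" .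
  moreover have "(\<lambda>n. (1 - a) * (\<Prod>k<n. 1 - (a * q) * q ^ k)) \<longlonglongrightarrow> (1 - a) * qp (a * q)"
    by (intro tendsto_intros qp_tendsto)
  ultimately show ?thesis by (rule LIMSEQ_unique)
qed

lemma qp_eq_0_iff: "qp a = 0 \<longleftrightarrow> (\<exists>n. a * q ^ n = 1)"
  using has_prod_eq_0_iff[OF qp_has_prod[of a]] by (auto simp: image_iff)

lemma qp_holomorphic: "qp holomorphic_on A"
proof (rule holomorphic_on_subset)
  show "qp holomorphic_on UNIV"
  proof (rule holomorphic_uniform_sequence)
    fix z :: complex
    define P where "P = (\<lambda>n a. \<Prod>k<n. 1 - a * q ^ k)"
    have "uniformly_convergent_on (cball z 1) P"
      unfolding P_def
    proof (rule uniformly_convergent_on_prod')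
      show "uniformly_convergent_on (cball z 1) (\<lambda>N x. \<Sum>n<N. norm (1 - x * q ^ n - 1))"
      proof (rule Weierstrass_m_test')
        fix n x assume "x \<in> cball z 1"
        hence "norm x \<le> norm z + 1"
          using norm_triangle_sub[of x z] by (simp add: dist_norm norm_minus_commute)
        thus "norm (norm (1 - x * q ^ n - 1)) \<le> norm (of_real (norm z + 1) * q ^ n)"
          by (simp add: norm_mult mult_right_mono del: of_real_add)
      qed (rule summable_q)
    qed (auto intro!: continuous_intros)
    then obtain g where g: "uniform_limit (cball z 1) P g sequentially"
      by (auto simp: uniformly_convergent_on_def)
    have "g x = qp x" if "x \<in> cball z 1" for x
      using tendsto_uniform_limitI[OF g that] qp_tendsto[of x] LIMSEQ_unique
      unfolding P_def by blast
    hence "uniform_limit (cball z 1) P qp sequentially"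
      using g uniform_limit_cong'[of "cball z 1" P P g qp] by auto
    thus "\<exists>d>0. cball z d \<subseteq> UNIV \<and> uniform_limit (cball z d) P qp sequentially"
      by (intro exI[of _ 1]) auto
    show "P n holomorphic_on UNIV" for n
      unfolding P_def by (intro holomorphic_intros)
  qed auto
qed auto

lemma qp_holomorphic_compose [holomorphic_intros]:
  "f holomorphic_on A \<Longrightarrow> (\<lambda>z. qp (f z)) holomorphic_on A"
  using holomorphic_on_compose_gen[of f A qp UNIV] qp_holomorphic by (auto simp: o_def)

lemma qp_tendsto_compose [tendsto_intros]:
  "(f \<longlongrightarrow> l) F \<Longrightarrow> ((\<lambda>x. qp (f x)) \<longlongrightarrow> qp l) F"
proof -
  have "continuous_on UNIV qp" by (rule holomorphic_on_imp_continuous_on[OF qp_holomorphic])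
  hence "isCont qp l" by (simp add: continuous_on_eq_continuous_at)
  thus "(f \<longlongrightarrow> l) F \<Longrightarrow> ((\<lambda>x. qp (f x)) \<longlongrightarrow> qp l) F" by (rule isCont_tendsto_compose)
qed

lemma norm_q_powi_eq_1D: "norm (q powi n) = 1 \<Longrightarrow> n = 0"
proof -
  assume *: "norm (q powi n) = 1"
  have nq: "0 < norm q" using q_nz by simp
  have "norm q powi n = 1" using * by (simp add: norm_power_int)
  hence "norm q powr (real_of_int n) = 1" using nq by (simp add: powr_real_of_int')
  thus "n = 0" using nq norm_q powr_eq_one_iff_gen[of "norm q"] by auto
qed

lemma q_powi_inj: "q powi m = q powi n \<Longrightarrow> m = n"
proof -
  assume "q powi m = q powi n"
  hence "q powi (m - n) = 1" using q_nz by (simp add: power_int_diff)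
  thus "m = n" using norm_q_powi_eq_1D[of "m - n"] by simp
qed

lemma qpowers_powi [simp]: "q powi n \<in> qpowers q" by (auto simp: qpowers_def)
lemma qpowers_1 [simp]: "1 \<in> qpowers q" using qpowers_powi[of 0] by simp

lemma qpowers_mult: "x \<in> qpowers q \<Longrightarrow> y \<in> qpowers q \<Longrightarrow> x * y \<in> qpowers q"
  using q_nz by (auto simp: qpowers_def power_int_add[symmetric])

lemma qpowers_inverse: "x \<in> qpowers q \<Longrightarrow> inverse x \<in> qpowers q"
  using q_nz by (auto simp: qpowers_def power_int_minus[symmetric])

lemma qpowers_cancel: "x * q powi n \<in> qpowers q \<longleftrightarrow> x \<in> qpowers q"
proof
  assume *: "x * q powi n \<in> qpowers q"
  have "(x * q powi n) * q powi (-n) \<in> qpowers q" by (rule qpowers_mult[OF * qpowers_powi])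
  moreover have "(x * q powi n) * q powi (-n) = x" using q_nz by (simp add: power_int_minus)
  ultimately show "x \<in> qpowers q" by (simp only:)
next
  assume "x \<in> qpowers q"
  thus "x * q powi n \<in> qpowers q" by (intro qpowers_mult qpowers_powi)
qed

lemma qpowers_inverse_iff: "inverse x \<in> qpowers q \<longleftrightarrow> x \<in> qpowers q"
  using qpowers_inverse[of x] qpowers_inverse[of "inverse x"] by auto

lemma not_qpowers_qp: "x \<notin> qpowers q \<Longrightarrow> qp x \<noteq> 0"
proof
  assume "x \<notin> qpowers q" "qp x = 0"
  then obtain n where n: "x * q ^ n = 1" by (auto simp: qp_eq_0_iff)
  hence "x = q powi (- int n)" using q_nz by (simp add: power_int_minus field_simps)
  with \<open>x \<notin> qpowers q\<close> show False by simp
qed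

text \<open>The modified theta function of nome \<open>q\<close>, with simple zeros at the integer powers of \<open>q\<close>.\<close>

definition th :: "complex \<Rightarrow> complex" where
  "th x = qp x * qp (q / x)"

lemma th_eq_0_iff: "x \<noteq> 0 \<Longrightarrow> th x = 0 \<longleftrightarrow> x \<in> qpowers q"
proof
  assume x: "x \<noteq> 0" and "th x = 0"
  then consider "qp x = 0" | "qp (q / x) = 0" by (auto simp: th_def)
  thus "x \<in> qpowers q"
  proof cases
    case 2
    hence "q / x \<in> qpowers q" using not_qpowers_qp by blast
    hence "inverse (q / x) * q powi 1 \<in> qpowers q"
      by (intro qpowers_mult qpowers_inverse qpowers_powi)
    thus ?thesis using q_nz by simp
  qed (use not_qpowers_qp in blast)
next
  assume x: "x \<noteq> 0" and "x \<in> qpowers q"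
  then obtain n where n: "x = q powi n" by (auto simp: qpowers_def)
  show "th x = 0"
  proof (cases "n \<le> 0")
    case True
    have "x * q ^ nat (-n) = 1" using n True q_nz
      by (simp flip: power_int_of_nat power_int_add)
    thus ?thesis using qp_eq_0_iff by (auto simp: th_def)
  next
    case False
    have "q / x * q ^ nat (n - 1) = q powi (1 + (n - 1)) / x"
      using False q_nz by (subst power_int_add) (simp_all flip: power_int_of_nat)
    also have "\<dots> = 1" using n x by simp
    finally show ?thesis using qp_eq_0_iff by (auto simp: th_def)
  qed
qed

lemma th_nz: "x \<notin> qpowers q \<Longrightarrow> x \<noteq> 0 \<Longrightarrow> th x \<noteq> 0"
  by (simp add: th_eq_0_iff)

lemma th_holomorphic [holomorphic_intros]:
  "f holomorphic_on A \<Longrightarrow> (\<And>z. z \<in> A \<Longrightarrow> f z \<noteq> 0) \<Longrightarrow> (\<lambda>z. th (f z)) holomorphic_on A"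
  unfolding th_def by (intro holomorphic_intros) auto

lemma th_tendsto [tendsto_intros]:
  "(f \<longlongrightarrow> l) F \<Longrightarrow> l \<noteq> 0 \<Longrightarrow> ((\<lambda>z. th (f z)) \<longlongrightarrow> th l) F"
  unfolding th_def by (intro tendsto_intros) auto

lemma th_reflect: "x \<noteq> 0 \<Longrightarrow> th (q / x) = th x"
  using q_nz by (simp add: th_def mult.commute)

lemma th_q: assumes "x \<noteq> 0" shows "th (q * x) = - th x / x"
proof -
  have "th (q * x) * ((1 - x)) = th x * (1 - 1 / x)"
    using assms q_nz qp_rec[of x] qp_rec[of "1/x"] by (simp add: th_def mult_ac)
  also have "th x * (1 - 1 / x) = - th x / x * (1 - x)" using assms by (simp add: field_simps)
  finally have *: "th (q * x) * (1 - x) = - th x / x * (1 - x)" .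
  show ?thesis
  proof (cases "x = 1")
    case True
    have "th q = th 1" using th_reflect[of q] q_nz by simp
    moreover have "th 1 = 0" by (simp add: th_eq_0_iff)
    ultimately show ?thesis using True by simp
  next
    case False
    hence "1 - x \<noteq> 0" by simp
    thus ?thesis using * by (metis mult_right_cancel)
  qed
qed

lemma th_inverse: assumes "x \<noteq> 0" shows "th (1 / x) = - th x / x"
  using th_reflect[of "q * x"] th_q[of x] assms q_nz by simp

lemma th_simple_zero: assumes "x \<noteq> 0" shows "th x = (1 - x) * qp (q * x) * qp (q / x)"
  unfolding th_def by (subst qp_rec) (simp add: mult_ac)

lemma qp_q_nz: "qp q \<noteq> 0"
proof
  assume "qp q = 0"
  then obtain n where "q ^ (Suc n) = 1" by (auto simp: qp_eq_0_iff)
  hence "norm q ^ Suc n = 1" by (metis norm_one norm_power)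
  thus False using norm_q power_Suc_less_one[of "norm q" n] q_nz by simp
qed

abbreviation qb :: "int \<Rightarrow> complex" where "qb \<equiv> qbinom2 q"

lemma qb_nz [simp]: "qb m \<noteq> 0" using q_nz by (simp add: qbinom2_def)

lemma qb_Suc: "qb (m + 1) = qb m * q powi m"
proof -
  have "(m + 1) * (m + 1 - 1) div 2 = m * (m - 1) div 2 + m"
  proof -
    have "(m + 1) * (m + 1 - 1) = m * (m - 1) + m * 2" by (simp add: algebra_simps)
    thus ?thesis by simp
  qed
  thus ?thesis using q_nz by (simp add: qbinom2_def power_int_add)
qed

lemma qb_0 [simp]: "qb 0 = 1" by (simp add: qbinom2_def)

text \<open>
  Induction over all integers in both directions at once, for statements that are equivalent at
  neighbouring integers.
\<close>

lemma int_shift_induct [case_names zero step]: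
  fixes P :: "int \<Rightarrow> bool"
  assumes "P 0" "\<And>m. P m \<longleftrightarrow> P (m + 1)"
  shows "P m"
proof (induction m rule: int_induct[where k = 0])
  case (step2 i)
  thus ?case using assms(2)[of "i - 1"] by simp
qed (use assms in auto)

text \<open>
  This iterates \<open>th_q\<close>. The automorphy factor \<open>(- x)\<^bsup>m\<^esup> q\<^bsup>binom(m,2)\<^esup>\<close> is the source of the powers of \<open>q\<close>
  and of the parameters in all later formulas.
\<close>

lemma th_powi:
  assumes "x \<noteq> 0"
  shows "th (x * q powi m) * ((-x) powi m * qb m) = th x"
proof (induction m rule: int_shift_induct)
  case (step m)
  have "th (x * q powi (m+1)) = th (q * (x * q powi m))"
    using q_nz by (simp add: power_int_add mult_ac)
  also have "\<dots> = - th (x * q powi m) / (x * q powi m)"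
    using assms q_nz by (intro th_q) simp
  finally have *: "th (x * q powi (m+1)) = - th (x * q powi m) / (x * q powi m)" .
  have "th (x * q powi (m+1)) * ((-x) powi (m+1) * qb (m+1)) = th (x * q powi m) * ((-x) powi m * qb m)"
    unfolding * qb_Suc using assms q_nz by (simp add: power_int_add)
  thus ?case by simp
qed auto

end

section \<open>Residue sums of elliptic functions\<close>

text \<open>
  The residue theorem for the difference of two loops. Running through the first loop, then along
  a connecting path, backwards through the second loop and back along the path gives a single
  loop that winds around no point outside \<open>S\<close>. In this form \<open>S\<close> may have holes; below it is an
  annulus.
\<close>

lemma two_loop_residue:
  fixes f :: "complex \<Rightarrow> complex"
  assumes S: "open S" "connected S" "finite pts" and f: "f holomorphic_on S - pts"
    and g: "valid_path g" "pathfinish g = pathstart g" "path_image g \<subseteq> S - pts"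
    and h: "valid_path h" "pathfinish h = pathstart h" "path_image h \<subseteq> S - pts"
    and homo: "\<And>z. z \<notin> S \<Longrightarrow> winding_number g z = winding_number h z"
  shows "contour_integral g f - contour_integral h f =
    2 * pi * \<i> * (\<Sum>p\<in>pts. (winding_number g p - winding_number h p) * residue f p)"
proof -
  have U: "open (S - pts)" "connected (S - pts)"
    using S by (auto intro: finite_imp_closed connected_open_delete_finite)
  have "pathstart g \<in> S - pts" "pathstart h \<in> S - pts"
    using g h pathstart_in_path_image by blast+
  then obtain \<sigma> where \<sigma>: "polynomial_function \<sigma>" "path_image \<sigma> \<subseteq> S - pts"
      "pathstart \<sigma> = pathstart g" "pathfinish \<sigma> = pathstart h"
    using connected_open_polynomial_connected[OF U] by blast
  have v\<sigma>: "valid_path \<sigma>" using \<sigma>(1) by (rule valid_path_polynomial_function)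
  define L where "L = g +++ (\<sigma> +++ (reversepath h +++ reversepath \<sigma>))"
  have vL: "valid_path L" "pathfinish L = pathstart L"
    unfolding L_def using g h \<sigma> v\<sigma> by (auto intro!: valid_path_join)
  have iL: "path_image L \<subseteq> S - pts"
    unfolding L_def using g h \<sigma> v\<sigma> by (intro subset_path_image_join) auto
  have wn: "winding_number L z = winding_number g z - winding_number h z" if "z \<notin> S - pts" for z
  proof -
    have z: "z \<notin> path_image g" "z \<notin> path_image h" "z \<notin> path_image \<sigma>" using that g h \<sigma> by auto
    show ?thesis
      unfolding L_def using g h \<sigma> v\<sigma> z
      by (subst winding_number_join winding_number_reversepath |
          auto simp: valid_path_imp_path path_image_join)+
  qed
  have "contour_integral L f = 2 * pi * \<i> * (\<Sum>p\<in>pts. winding_number L p * residue f p)"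
    using wn homo by (intro Residue_theorem[OF S(1,2,3) f vL iL]) auto
  moreover have "contour_integral L f = contour_integral g f - contour_integral h f"
  proof -
    have int: "f contour_integrable_on g" "f contour_integrable_on h" "f contour_integrable_on \<sigma>"
      using contour_integrable_holomorphic_simple[OF f U(1)] g h \<sigma> v\<sigma> by auto
    show ?thesis unfolding L_def using int g h \<sigma> v\<sigma>
      by (simp add: contour_integral_reversepath contour_integrable_reversepath)
  qed
  moreover have "(\<Sum>p\<in>pts. winding_number L p * residue f p) =
      (\<Sum>p\<in>pts. (winding_number g p - winding_number h p) * residue f p)"
    using wn by (intro sum.cong) auto
  ultimately show ?thesis by simp
qed

context qbase begin

lemma qpowers_same_class:
  assumes "x \<noteq> 0" "y \<noteq> 0" "x * q powi m = y * q powi n"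
  shows "x / y \<in> qpowers q"
proof -
  have "x / y = q powi (n - m)" using assms q_nz by (simp add: power_int_diff field_simps)
  thus ?thesis by simp
qed

text \<open>Every class modulo powers of \<open>q\<close> meets the fundamental annulus \<open>\<bar>q\<bar> R \<le> \<bar>w\<bar> < R\<close>.\<close>

lemma annulus_representative:
  fixes r R :: real
  assumes "R > 0" "r > 0"
  shows "\<exists>n::int. r * norm q powi n < R \<and> R \<le> r * norm q powi (n - 1)"
proof -
  have nq: "0 < norm q" "norm q < 1" using q_nz norm_q by auto
  define t where "t = ln (R / r) / ln (norm q)"
  have ln: "ln (norm q) < 0" using nq by simp
  have pw: "r * norm q powi n = exp (ln r + n * ln (norm q))" for n :: int
    using nq assms by (simp add: exp_add powr_real_of_int'[symmetric] powr_def)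
  have R: "R = exp (ln R)" using assms by simp
  have t: "ln R = ln r + t * ln (norm q)" using ln assms by (simp add: t_def ln_div)
  define n where "n = \<lfloor>t\<rfloor> + 1"
  have "t < n" "n - 1 \<le> t" unfolding n_def by linarith+
  hence "n * ln (norm q) < t * ln (norm q)" "t * ln (norm q) \<le> (n - 1) * ln (norm q)"
    using ln by (auto intro: mult_strict_right_mono_neg mult_right_mono_neg)
  hence "exp (ln r + n * ln (norm q)) < exp (ln R)" "exp (ln R) \<le> exp (ln r + (n - 1) * ln (norm q))"
    by (simp_all add: t)
  hence "r * norm q powi n < R" "R \<le> r * norm q powi (n - 1)"
    unfolding pw R[symmetric] by auto
  thus ?thesis by blast
qed

lemma finite_annulus_powers:
  fixes a r R :: real
  assumes "a > 0" "r > 0" "R > 0"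
  shows "finite {m::int. r \<le> a * norm q powi m \<and> a * norm q powi m \<le> R}"
proof -
  have nq: "0 < norm q" "norm q < 1" using q_nz norm_q by auto
  obtain n1 where n1: "a * norm q powi n1 < r" using annulus_representative[of r a] assms by auto
  obtain n2 where n2: "R \<le> a * norm q powi (n2 - 1)" using annulus_representative[of R a] assms by auto
  have mono: "norm q powi m \<le> norm q powi n" if "n \<le> m" for m n :: int
  proof -
    have "norm q powi m = norm q powi n * norm q ^ nat (m - n)"
      using that nq by (simp flip: power_int_of_nat power_int_add)
    thus ?thesis using nq by (simp add: mult_left_le power_le_one)
  qed
  have smono: "norm q powi m < norm q powi n" if "n < m" for m n :: int
  proof -
    have "norm q powi m = norm q powi n * norm q ^ nat (m - n)"
      using that nq by (simp flip: power_int_of_nat power_int_add)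
    moreover have "norm q ^ nat (m - n) < 1" using that nq by (intro power_less_one_iff[THEN iffD2]) auto
    ultimately show ?thesis using nq by simp
  qed
  have "{m::int. r \<le> a * norm q powi m \<and> a * norm q powi m \<le> R} \<subseteq> {n2 - 1..n1}"
  proof safe
    fix m assume m: "r \<le> a * norm q powi m" "a * norm q powi m \<le> R"
    have "m \<le> n1"
    proof (rule ccontr)
      assume "\<not> m \<le> n1"
      hence "a * norm q powi m \<le> a * norm q powi n1" using mono[of n1 m] assms by simp
      thus False using n1 m by simp
    qed
    moreover have "n2 - 1 \<le> m"
    proof (rule ccontr)
      assume "\<not> n2 - 1 \<le> m"
      hence "a * norm q powi (n2 - 1) < a * norm q powi m" using smono[of m "n2 - 1"] assms by simp
      thus False using n2 m by simp
    qed
    ultimately show "m \<in> {n2 - 1..n1}" by simp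
  qed
  thus ?thesis by (rule finite_subset) simp
qed

lemma th_div_q: assumes "x \<noteq> 0" shows "th (x / q) = - (x / q) * th x"
  using th_q[of "x / q"] assms q_nz by (simp add: field_simps)

text \<open>
  By \<open>th_simple_zero\<close>, \<open>th (c / w)\<close> is \<open>(w - c) / w\<close> times a function with the value \<open>(qp q)\<^sup>2\<close> at \<open>w = c\<close>.
\<close>

lemma th_pole_limit:
  assumes "c \<noteq> 0"
  shows "((\<lambda>w. (w - c) / th (c / w)) \<longlongrightarrow> c / (qp q)\<^sup>2) (at c)"
proof -
  have "((\<lambda>w. w / (qp (q * (c / w)) * qp (q / (c / w)))) \<longlongrightarrow> c / (qp (q * (c / c)) * qp (q / (c / c)))) (at c)"
    using assms qp_q_nz by (intro tendsto_intros) auto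
  hence "((\<lambda>w. w / (qp (q * (c / w)) * qp (q / (c / w)))) \<longlongrightarrow> c / (qp q)\<^sup>2) (at c)"
    using assms by (simp add: power2_eq_square)
  moreover have "eventually (\<lambda>w. w / (qp (q * (c / w)) * qp (q / (c / w))) = (w - c) / th (c / w)) (at c)"
  proof -
    have "eventually (\<lambda>w. w \<in> -{0}) (at c)" using assms by (intro eventually_at_in_open') auto
    moreover have "eventually (\<lambda>w. w \<noteq> c) (at c)" by (simp add: eventually_at_filter)
    ultimately show ?thesis
    proof eventually_elim
      case (elim w)
      have "th (c / w) = (w - c) * (qp (q * (c / w)) * qp (q / (c / w))) / w"
        using elim assms by (subst th_simple_zero) (auto simp: field_simps)
      thus ?case using elim by simp
    qed
  qed
  ultimately show ?thesis by (rule Lim_transform_eventually)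
qed

lemma winding_number_circle_lt: "0 < R \<Longrightarrow> norm p < R \<Longrightarrow> winding_number (circlepath 0 R) p = 1"
  by (rule winding_number_circlepath) simp

lemma winding_number_circle_gt:
  assumes "0 < R" "norm p > R" shows "winding_number (circlepath 0 R) p = 0"
  using assms by (intro winding_number_zero_outside[of _ "cball 0 R"]) auto

text \<open>
  The circle of radius \<open>\<bar>q\<bar> R\<close> is parametrized as the image of the circle of radius \<open>R\<close> under
  multiplication by \<open>q\<close>, so that substitution compares integrals over the two.
\<close>

lemma q_circle_integral:
  "contour_integral ((*) q \<circ> circlepath 0 R) f = contour_integral (circlepath 0 R) (\<lambda>w. q * f (q * w))"
  by (subst contour_integral_comp_analyticW[where s = UNIV]) (auto intro: analytic_intros)

lemma q_circle_path: "valid_path ((*) q \<circ> circlepath 0 R)"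
    "pathfinish ((*) q \<circ> circlepath 0 R) = pathstart ((*) q \<circ> circlepath 0 R)"
  by (auto intro!: valid_path_compose_holomorphic[where S = UNIV] holomorphic_intros
      simp: pathfinish_compose pathstart_compose)

lemma q_circle_image: assumes "0 \<le> R" shows "path_image ((*) q \<circ> circlepath 0 R) = sphere 0 (norm q * R)"
proof -
  have "path_image ((*) q \<circ> circlepath 0 R) = (*) q ` sphere 0 R"
    using assms by (simp add: path_image_compose)
  also have "\<dots> = sphere 0 (norm q * R)"
  proof safe
    fix x :: complex assume "x \<in> sphere 0 (norm q * R)"
    hence "x = q * (x / q)" "x / q \<in> sphere 0 R" using q_nz by (auto simp: norm_divide)
    thus "x \<in> (*) q ` sphere 0 R" by blast
  qed (auto simp: norm_mult)
  finally show ?thesis .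
qed

lemma q_circle_winding:
  assumes "0 < R" "norm p \<noteq> norm q * R"
  shows "winding_number ((*) q \<circ> circlepath 0 R) p = winding_number (circlepath 0 R) (p / q)"
proof -
  have 1: "p \<notin> path_image ((*) q \<circ> circlepath 0 R)" using assms by (subst q_circle_image) auto
  have 2: "p / q \<notin> path_image (circlepath 0 R)" using assms q_nz by (auto simp: norm_divide field_simps)
  have "(\<lambda>w. q * (1 / (q * w - p))) = (\<lambda>w. 1 / (w - p / q))" using q_nz by (auto simp: field_simps)
  thus ?thesis
    using 1 2 by (simp add: winding_number_valid_path q_circle_path q_circle_integral)
qed

text \<open>
  The residues of an elliptic function with respect to \<open>dw / w\<close> add up to 0. The quasi-periodicity
  required of \<open>N\<close> is that of the product of the \<open>th (c\<^sub>k / w)\<close>, so the quotient is invariant under \<open>w \<mapsto>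
  q w\<close>. Its integrals over the circles of radius \<open>R\<close> and \<open>\<bar>q\<bar> R\<close> therefore agree, and between them
  lies one pole of each class \<open>c\<^sub>k q\<^bsup>\<int>\<^esup>\<close>.
\<close>

lemma elliptic_residue_sum:
  fixes c :: "'k \<Rightarrow> complex" and N :: "complex \<Rightarrow> complex"
  assumes K: "finite K" and c0: "\<And>k. k \<in> K \<Longrightarrow> c k \<noteq> 0"
    and cd: "\<And>i j. i \<in> K \<Longrightarrow> j \<in> K \<Longrightarrow> i \<noteq> j \<Longrightarrow> c i / c j \<notin> qpowers q"
    and N: "N holomorphic_on -{0}"
    and Nq: "\<And>w. w \<noteq> 0 \<Longrightarrow> N (q * w) = (\<Prod>k\<in>K. - c k / (q * w)) * N w"
  shows "(\<Sum>k\<in>K. N (c k) / (\<Prod>j\<in>K-{k}. th (c j / c k))) = 0"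
proof -
  define f where "f w = N w / (\<Prod>k\<in>K. th (c k / w)) / w" for w
  have fq: "q * f (q * w) = f w" if w: "w \<noteq> 0" for w
  proof -
    have "(\<Prod>k\<in>K. th (c k / (q * w))) = (\<Prod>k\<in>K. - c k / (q * w) * th (c k / w))"
      using th_div_q[of "c k / w" for k] w c0 by (intro prod.cong) (auto simp: field_simps)
    hence "(\<Prod>k\<in>K. th (c k / (q * w))) = (\<Prod>k\<in>K. - c k / (q * w)) * (\<Prod>k\<in>K. th (c k / w))"
      by (simp only: prod.distrib)
    moreover have "(\<Prod>k\<in>K. - c k / (q * w)) \<noteq> 0" using K c0 w q_nz by (simp add: prod_zero_iff)
    ultimately show ?thesis unfolding f_def using Nq[OF w] q_nz w by simp
  qed
  have fqn: "f (w * q powi n) * q powi n = f w" if w: "w \<noteq> 0" for w n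
  proof (induction n rule: int_shift_induct)
    case (step m)
    have "q * f (q * (w * q powi m)) = f (w * q powi m)" using w q_nz by (intro fq) simp
    moreover have "w * q powi (m + 1) = q * (w * q powi m)" using q_nz by (simp add: power_int_add)
    ultimately have "f (w * q powi (m+1)) * q powi (m+1) = f (w * q powi m) * q powi m"
      using q_nz by (simp add: power_int_add mult_ac)
    thus ?case by simp
  qed simp
  define Q where "Q = {c k * q powi m |k m. k \<in> K}"
  have fholo: "f holomorphic_on A" if "A \<subseteq> -{0}" "A \<inter> Q = {}" for A
  proof -
    have "th (c k / w) \<noteq> 0" if "w \<in> A" "k \<in> K" for w k
    proof (rule th_nz)
      have w0: "w \<noteq> 0" using that \<open>A \<subseteq> -{0}\<close> by auto
      show "c k / w \<noteq> 0" using w0 c0 that by auto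
      show "c k / w \<notin> qpowers q"
      proof
        assume "c k / w \<in> qpowers q"
        then obtain m where "c k / w = q powi m" by (auto simp: qpowers_def)
        hence "w = c k * q powi (- m)" using w0 q_nz by (simp add: power_int_minus field_simps)
        hence "w \<in> Q" using that by (auto simp: Q_def)
        thus False using that \<open>A \<inter> Q = {}\<close> by auto
      qed
    qed
    thus ?thesis unfolding f_def using that(1) N K c0
      by (intro holomorphic_intros holomorphic_on_subset[OF N that(1)]) (auto simp: prod_zero_iff)
  qed
  \<comment> \<open>The poles have countably many moduli, so some circle contains none of them. The circle with the radius
    multiplied by \<open>\<bar>q\<bar>\<close> then contains none either.\<close>
  have "countable ((\<lambda>(k, m). norm (c k) * norm q powi m) ` (K \<times> (UNIV :: int set)))"
    using K by (intro countable_image countable_SIGMA) (auto simp: countable_finite)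
  hence "\<not> {0<..<(1::real)} \<subseteq> (\<lambda>(k, m). norm (c k) * norm q powi m) ` (K \<times> (UNIV :: int set))"
    using countable_subset uncountable_open_interval[of 0 "1::real"] by (metis zero_less_one)
  then obtain R :: real where R: "0 < R" "\<And>k m. k \<in> K \<Longrightarrow> R \<noteq> norm (c k) * norm q powi m" by force
  have "\<forall>k\<in>K. \<exists>n::int. norm (c k) * norm q powi n < R \<and> R \<le> norm (c k) * norm q powi (n - 1)"
    using annulus_representative[OF R(1)] c0 by simp
  then obtain n where n: "\<And>k. k \<in> K \<Longrightarrow> norm (c k) * norm q powi (n k) < R"
      "\<And>k. k \<in> K \<Longrightarrow> R \<le> norm (c k) * norm q powi (n k - 1)" by metis
  define p where "p k = c k * q powi (n k)" for k
  have pn: "norm q * R < norm (p k)" "norm (p k) < R" if "k \<in> K" for k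
  proof -
    have "R < norm (c k) * norm q powi (n k - 1)" using n(2)[OF that] R(2)[OF that, of "n k - 1"] by simp
    also have "\<dots> = norm (p k) / norm q" using q_nz by (simp add: p_def norm_mult norm_power_int power_int_diff)
    finally show "norm q * R < norm (p k)" using q_nz by (simp add: field_simps)
  qed (use n that in \<open>simp add: p_def norm_mult norm_power_int\<close>)
  have p0: "p k \<noteq> 0" if "k \<in> K" for k using c0 that q_nz by (simp add: p_def)
  define S :: "complex set" where "S = {w. norm q * R / 2 < norm w \<and> norm w < 2 * R}"
  have "\<not> norm q * R < 0" using R(1) by (simp add: not_less)
  hence S0: "S \<subseteq> -{0}" by (auto simp: S_def)
  have nq: "0 < norm q" using q_nz by simp
  have qR: "norm q * R < R" "0 < norm q * R" using R(1) norm_q nq mult_strict_right_mono[of "norm q" 1 R] by simp_all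
  define pts where "pts = Q \<inter> S"
  have finpts: "finite pts"
  proof -
    have "pts \<subseteq> (\<Union>k\<in>K. (\<lambda>m. c k * q powi m) ` {m. norm q * R / 2 \<le> norm (c k) * norm q powi m \<and> norm (c k) * norm q powi m \<le> 2 * R})"
      by (fastforce simp: pts_def Q_def S_def norm_mult norm_power_int)
    moreover have "finite \<dots>" using K c0 qR R(1)
      by (intro finite_UN_I finite_imageI finite_annulus_powers) auto
    ultimately show ?thesis by (rule finite_subset)
  qed
  have ptsR: "norm w \<noteq> R" "norm w \<noteq> norm q * R" if wQ: "w \<in> Q" for w
  proof -
    obtain k m where k: "k \<in> K" "w = c k * q powi m" using wQ by (auto simp: Q_def)
    show "norm w \<noteq> R" using R(2)[of k m] k by (simp add: norm_mult norm_power_int)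
    have "R \<noteq> norm (c k) * norm q powi (m - 1)" using R(2) k by blast
    thus "norm w \<noteq> norm q * R" using k nq by (auto simp: norm_mult norm_power_int power_int_diff)
  qed
  let ?g = "circlepath 0 R" and ?h = "(*) q \<circ> circlepath 0 R"
  have wng: "winding_number ?g w = (if norm w < R then 1 else 0)" if "norm w \<noteq> R" for w
    using that R(1) winding_number_circle_lt winding_number_circle_gt by auto
  have wnh: "winding_number ?h w = (if norm w < norm q * R then 1 else 0)" if "norm w \<noteq> norm q * R" for w
  proof -
    have "norm (w / q) \<noteq> R" "norm (w / q) < R \<longleftrightarrow> norm w < norm q * R" using that nq by (auto simp: norm_divide field_simps)
    thus ?thesis using q_circle_winding[OF R(1) that] wng[of "w / q"] by simp
  qed
  have openS: "open S"
  proof -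
    have "S = ball 0 (2 * R) - cball 0 (norm q * R / 2)" by (auto simp: S_def)
    thus ?thesis by (metis open_ball closed_cball open_Diff)
  qed
  have "contour_integral ?g f - contour_integral ?h f = 
     2 * pi * \<i> * (\<Sum>w\<in>pts. (winding_number ?g w - winding_number ?h w) * residue f w)"
  proof (rule two_loop_residue)
    show "open S" by fact
    show "connected S" unfolding S_def using connected_annulus(1)[where 'N = complex, of "norm q * R / 2" 0 "2 * R"] by simp
    show "finite pts" by fact
    show "f holomorphic_on S - pts" by (rule fholo) (use S0 in \<open>auto simp: pts_def\<close>)
    show "path_image ?g \<subseteq> S - pts" using R(1) qR ptsR norm_q by (auto simp: S_def pts_def)
    show "path_image ?h \<subseteq> S - pts" using R(1) qR ptsR norm_q by (subst q_circle_image) (auto simp: S_def pts_def mult.commute)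
    show "winding_number ?g z = winding_number ?h z" if "z \<notin> S" for z
    proof -
      have *: "norm z \<le> norm q * R / 2 \<or> 2 * R \<le> norm z" using that by (auto simp: S_def)
      have "norm z \<noteq> R" "norm z \<noteq> norm q * R" using * qR R(1) by linarith+
      moreover have "norm z < R \<longleftrightarrow> norm z < norm q * R" using * qR R(1) by linarith
      ultimately show ?thesis using wng[of z] wnh[of z] by presburger
    qed
  qed (use q_circle_path in auto)
  moreover have "contour_integral ?h f = contour_integral ?g f"
    unfolding q_circle_integral using R(1) fq by (intro contour_integral_cong) auto
  ultimately have sum0: "(\<Sum>w\<in>pts. (winding_number ?g w - winding_number ?h w) * residue f w) = 0" by simp
  have pinj: "inj_on p K"
  proof (rule inj_onI, rule ccontr)
    fix i j assume ij: "i \<in> K" "j \<in> K" "p i = p j" "i \<noteq> j"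
    hence "c i / c j \<in> qpowers q" using qpowers_same_class[of "c i" "c j"] c0 by (simp add: p_def)
    thus False using cd ij by blast
  qed
  have pQ: "p ` K \<subseteq> pts" using pn R(1) qR by (fastforce simp: pts_def Q_def S_def p_def)
  have "(\<Sum>w\<in>pts. (winding_number ?g w - winding_number ?h w) * residue f w) = (\<Sum>w\<in>p ` K. residue f w)"
  proof (rule sum.mono_neutral_cong_right[OF finpts pQ])
    show "\<forall>w\<in>pts - p ` K. (winding_number ?g w - winding_number ?h w) * residue f w = 0"
    proof
      fix w assume w: "w \<in> pts - p ` K"
      then obtain k m where k: "k \<in> K" "w = c k * q powi m" by (auto simp: pts_def Q_def)
      have wQ: "w \<in> Q" using w by (auto simp: pts_def)
      have ne: "m \<noteq> n k" using w k by (auto simp: p_def)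
      have *: "norm w = norm (p k) * norm q powi (m - n k)"
        using k q_nz by (simp add: p_def norm_mult norm_power_int power_int_diff)
      have "norm w < norm q * R \<or> R < norm w"
      proof (cases "m > n k")
        case True
        have "norm w = norm (p k) * norm q * norm q ^ nat (m - n k - 1)"
          unfolding * using True nq by (simp flip: power_int_of_nat add: power_int_diff power_int_add)
        also have "\<dots> \<le> norm (p k) * norm q" using norm_q by (intro mult_left_le power_le_one) auto
        also have "\<dots> < norm q * R" using pn(2)[OF k(1)] nq by (simp add: mult.commute)
        finally show ?thesis by simp
      next
        case False
        hence lt: "m < n k" using ne by simp
        have "R < norm (p k) / norm q" using pn(1)[OF k(1)] nq by (simp add: field_simps)
        also have "\<dots> \<le> norm (p k) / norm q * (1 / norm q ^ nat (n k - m - 1))"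
        proof -
          have "1 \<le> 1 / norm q ^ nat (n k - m - 1)" using norm_q nq by (simp add: power_le_one)
          from mult_left_mono[OF this, of "norm (p k) / norm q"] show ?thesis by simp
        qed
        also have "\<dots> = norm w"
          unfolding * using lt nq by (simp flip: power_int_of_nat add: power_int_diff)
        finally show ?thesis by simp
      qed
      thus "(winding_number ?g w - winding_number ?h w) * residue f w = 0"
        using wng[OF ptsR(1)[OF wQ]] wnh[OF ptsR(2)[OF wQ]] qR by auto
    qed
    show "(winding_number ?g w - winding_number ?h w) * residue f w = residue f w" if wp: "w \<in> p ` K" for w
    proof -
      obtain k where k: "k \<in> K" "w = p k" using wp by blast
      have wQ: "w \<in> Q" using that pQ by (auto simp: pts_def)
      show ?thesis using wng[OF ptsR(1)[OF wQ]] wnh[OF ptsR(2)[OF wQ]] pn[OF k(1)] k by simp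
    qed
  qed
  also have "\<dots> = (\<Sum>k\<in>K. residue f (p k))" using pinj by (simp add: sum.reindex)
  also have "\<dots> = (\<Sum>k\<in>K. N (c k) / (\<Prod>j\<in>K-{k}. th (c j / c k)) / (qp q)\<^sup>2)"
  proof (rule sum.cong)
    fix k assume k: "k \<in> K"
    let ?L = "N (c k) / (\<Prod>j\<in>K-{k}. th (c j / c k)) / (qp q)\<^sup>2"
    have "((\<lambda>w. N w / (w * (\<Prod>j\<in>K-{k}. th (c j / w))) * ((w - c k) / th (c k / w))) \<longlongrightarrow>
        N (c k) / (c k * (\<Prod>j\<in>K-{k}. th (c j / c k))) * (c k / (qp q)\<^sup>2)) (at (c k))"
    proof (rule tendsto_mult[OF _ th_pole_limit[OF c0[OF k]]], intro tendsto_intros)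
      have "continuous_on (-{0}) N" using N by (rule holomorphic_on_imp_continuous_on)
      hence "isCont N (c k)" using c0[OF k] by (simp add: continuous_on_eq_continuous_at open_Compl)
      thus "N \<midarrow>c k\<rightarrow> N (c k)" by (simp add: isCont_def)
      show "c k * (\<Prod>j\<in>K-{k}. th (c j / c k)) \<noteq> 0"
        using c0 k K cd by (auto simp: prod_zero_iff th_eq_0_iff)
    qed (use c0 k in auto)
    moreover have "N w / (w * (\<Prod>j\<in>K-{k}. th (c j / w))) * ((w - c k) / th (c k / w)) = f w * (w - c k)" for w
      unfolding f_def using prod.remove[OF K k, of "\<lambda>j. th (c j / w)"] by simp
    moreover have "N (c k) / (c k * (\<Prod>j\<in>K-{k}. th (c j / c k))) * (c k / (qp q)\<^sup>2) = ?L" using c0[OF k] by simp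
    ultimately have lim: "((\<lambda>w. f w * (w - c k)) \<longlongrightarrow> ?L) (at (c k))" by simp
    have "filterlim (\<lambda>w. w * q powi (- n k)) (at (c k)) (at (p k))"
    proof (rule filterlim_atI)
      have "((\<lambda>w. w * q powi (- n k)) \<longlongrightarrow> p k * q powi (- n k)) (at (p k))" by (intro tendsto_intros)
      moreover have "p k * q powi (- n k) = c k" using q_nz by (simp add: p_def power_int_minus)
      ultimately show "((\<lambda>w. w * q powi (- n k)) \<longlongrightarrow> c k) (at (p k))" by (simp only:)
      show "\<forall>\<^sub>F x in at (p k). x * q powi - n k \<noteq> c k"
        using q_nz by (auto simp: eventually_at_filter p_def power_int_minus field_simps)
    qed
    hence "((\<lambda>w. f (w * q powi (- n k)) * (w * q powi (- n k) - c k)) \<longlongrightarrow> ?L) (at (p k))"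
      using lim by (rule filterlim_compose[rotated])
    moreover have "eventually (\<lambda>w. f (w * q powi (- n k)) * (w * q powi (- n k) - c k) = f w * (w - p k)) (at (p k))"
    proof -
      have "eventually (\<lambda>w. w \<in> -{0}) (at (p k))" using p0[OF k] by (intro eventually_at_in_open') auto
      thus ?thesis
      proof eventually_elim
        case (elim w)
        have "f (w * q powi (- n k)) * q powi (- n k) = f w" using elim by (intro fqn) auto
        hence "f w * (w - p k) = f (w * q powi (- n k)) * (q powi (- n k) * (w - p k))" by (metis mult.assoc)
        also have "q powi (- n k) * (w - p k) = w * q powi (- n k) - c k"
          using q_nz by (simp add: p_def power_int_minus field_simps)
        finally show ?case ..
      qed
    qed
    ultimately have "((\<lambda>w. f w * (w - p k)) \<longlongrightarrow> ?L) (at (p k))" by (rule Lim_transform_eventually)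
    thus "residue f (p k) = ?L"
    proof (rule residue_simple'[rotated 3])
      show "open (S - (pts - {p k}))" using openS finpts by (auto intro: finite_imp_closed)
      show "p k \<in> S - (pts - {p k})" using pQ k by (auto simp: pts_def)
      show "f holomorphic_on S - (pts - {p k}) - {p k}"
        by (rule fholo) (use S0 in \<open>auto simp: pts_def\<close>)
    qed
  qed auto
  also have "\<dots> = (\<Sum>k\<in>K. N (c k) / (\<Prod>j\<in>K-{k}. th (c j / c k))) / (qp q)\<^sup>2"
    by (simp add: sum_divide_distrib)
  finally show ?thesis using sum0 qp_q_nz by simp
qed

end

section \<open>Contiguous relations for very-well-poised series\<close>

lemma card_4_obtain:
  assumes "card O4 = 4"
  obtains a b c d where "O4 = {a, b, c, d}" "distinct [a, b, c, d]"
proof -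
  have "finite O4" using assms by (simp add: card_ge_0_finite)
  then obtain xs where xs: "set xs = O4" "distinct xs" using finite_distinct_list by blast
  hence "length xs = 4" using assms distinct_card[of xs] by simp
  then obtain a b c d where "xs = [a, b, c, d]" by (auto simp: length_Suc_conv numeral_eq_Suc)
  thus ?thesis using that xs by auto
qed

text \<open>
  Here \<open>x\<close> and \<open>y\<close> are two of six numbers with product 1 and \<open>e1, ..., e4\<close> are the elementary symmetric
  functions of the other four.
\<close>

lemma telescoping_polynomial:
  fixes x y u :: complex
  assumes "x * y * e4 = 1"
  shows "(x - y) * ((1 - x * u) * (1 - y * u) * (1 - e1 * u + e2 * u^2 - e3 * u^3 + e4 * u^4)
            - (x - u) * (y - u) * (e4 - e3 * u + e2 * u^2 - e1 * u^3 + u^4)) * (x * y)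
       = u * (1 - u^2) * (x * (1 - e1 * y + e2 * y^2 - e3 * y^3 + e4 * y^4) * (x - u) * (1 - x * u)
            - y * (1 - e1 * x + e2 * x^2 - e3 * x^3 + e4 * x^4) * (y - u) * (1 - y * u))"
  using assms by algebra

definition I6 :: "nat set" where "I6 = {1..6}"

lemma finite_I6 [simp]: "finite I6" and card_I6 [simp]: "card I6 = 6"
  by (simp_all add: I6_def)

lemma prod_I6_remove2:
  fixes f :: "nat \<Rightarrow> complex"
  assumes "i \<in> I6" "j \<in> I6" "i \<noteq> j"
  shows "(\<Prod>m\<in>I6. f m) = f i * f j * (\<Prod>m\<in>I6-{i,j}. f m)"
proof -
  have "(\<Prod>m\<in>I6. f m) = f i * (\<Prod>m\<in>I6-{i}. f m)" using assms by (intro prod.remove) auto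
  also have "(\<Prod>m\<in>I6-{i}. f m) = f j * (\<Prod>m\<in>I6-{i}-{j}. f m)" using assms by (intro prod.remove) auto
  also have "I6-{i}-{j} = I6-{i,j}" by auto
  finally show ?thesis by (simp add: mult_ac)
qed

lemma card_I6_remove2: "i \<in> I6 \<Longrightarrow> j \<in> I6 \<Longrightarrow> i \<noteq> j \<Longrightarrow> card (I6 - {i,j}) = 4"
  by (subst card_Diff_subset) auto

text \<open>
  Multiplied by \<open>\<Prod>\<^sub>m (q u / c\<^sub>m)\<^sub>\<infinity> / (c\<^sub>m u)\<^sub>\<infinity>\<close>, the left-hand side becomes a difference \<open>\<Psi>(q
  u) - \<Psi>(u)\<close> and the two terms on the right become, up to sign, multiples of summands of
  series with one raised parameter; see \<open>Psi_step\<close>.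
\<close>

lemma telescoping_identity:
  fixes c :: "nat \<Rightarrow> complex" and u :: complex
  assumes ij: "i \<in> I6" "j \<in> I6" "i \<noteq> j" and c0: "\<And>m. m \<in> I6 \<Longrightarrow> c m \<noteq> 0"
    and c1: "(\<Prod>m\<in>I6. c m) = 1" and cij: "c i \<noteq> c j"
  defines "lam \<equiv> \<lambda>i j. (\<Prod>m\<in>I6-{i,j}. 1 - c m * c j) / (c j * (1 - c j / c i))"
  shows "(\<Prod>m\<in>I6. 1 - c m * u) - (\<Prod>m\<in>I6. 1 - u / c m) =
    u * (1 - u^2) * (lam i j * ((1 - u / c i) * (1 - c i * u)) + lam j i * ((1 - u / c j) * (1 - c j * u)))"
proof -
  obtain p r s t where O4: "I6 - {i,j} = {p, r, s, t}" and dist: "distinct [p, r, s, t]"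
    using card_4_obtain[OF card_I6_remove2[OF ij]] by blast
  have O4': "I6 - {j,i} = {p, r, s, t}" using O4 by (simp add: insert_commute)
  define x y where "x = c i" and "y = c j"
  have pO: "(\<Prod>m\<in>I6-{i,j}. f m) = f p * f r * f s * f t" for f :: "nat \<Rightarrow> complex"
    using dist by (simp add: O4 mult_ac)
  have pI: "(\<Prod>m\<in>I6. f m) = f i * f j * (f p * f r * f s * f t)" for f :: "nat \<Rightarrow> complex"
    by (simp only: prod_I6_remove2[OF ij] pO)
  have x0: "x \<noteq> 0" "y \<noteq> 0" "x - y \<noteq> 0" using ij c0 cij by (auto simp: x_def y_def)
  have e4: "x * y * (c p * c r * c s * c t) = 1" using c1 unfolding pI by (simp add: x_def y_def)
  define e1 where "e1 = c p + c r + c s + c t"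
  define e2 where "e2 = c p * c r + c p * c s + c p * c t + c r * c s + c r * c t + c s * c t"
  define e3 where "e3 = c p * c r * c s + c p * c r * c t + c p * c s * c t + c r * c s * c t"
  define e4 where "e4 = c p * c r * c s * c t"
  have E: "(1 - c p * v) * (1 - c r * v) * (1 - c s * v) * (1 - c t * v) = 1 - e1 * v + e2 * v^2 - e3 * v^3 + e4 * v^4" for v
    unfolding e1_def e2_def e3_def e4_def by algebra
  have E': "(c p - u) * (c r - u) * (c s - u) * (c t - u) = e4 - e3 * u + e2 * u^2 - e1 * u^3 + u^4"
    unfolding e1_def e2_def e3_def e4_def by algebra
  have "(\<Prod>m\<in>I6. 1 - u / c m) = (\<Prod>m\<in>I6. (c m - u) / c m)"
    using c0 by (intro prod.cong) (auto simp: field_simps)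
  also have "\<dots> = (\<Prod>m\<in>I6. c m - u)" by (simp only: prod_dividef c1) simp
  finally have L2: "(\<Prod>m\<in>I6. 1 - u / c m) = (x - u) * (y - u) * (e4 - e3 * u + e2 * u^2 - e1 * u^3 + u^4)"
    unfolding pI E' by (simp only: x_def y_def)
  have L1: "(\<Prod>m\<in>I6. 1 - c m * u) = (1 - x * u) * (1 - y * u) * (1 - e1 * u + e2 * u^2 - e3 * u^3 + e4 * u^4)"
    unfolding pI E by (simp only: x_def y_def)
  define Px where "Px = 1 - e1 * x + e2 * x^2 - e3 * x^3 + e4 * x^4"
  define Py where "Py = 1 - e1 * y + e2 * y^2 - e3 * y^3 + e4 * y^4"
  have lij: "lam i j = Py * x / (y * (x - y))"
    unfolding lam_def pO E x_def[symmetric] y_def[symmetric] Py_def[symmetric] using x0 by (simp add: field_simps)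
  have lji: "lam j i = - (Px * y / (x * (x - y)))"
  proof -
    have "1 - x / y = - (x - y) / y" using x0 by (simp add: field_simps)
    thus ?thesis
      unfolding lam_def insert_commute[of j i] pO E x_def[symmetric] y_def[symmetric] Px_def[symmetric] using x0
      by (simp add: divide_simps) (simp add: algebra_simps)
  qed
  let ?L = "(\<Prod>m\<in>I6. 1 - c m * u) - (\<Prod>m\<in>I6. 1 - u / c m)"
  have "(x - y) * ?L * (x * y) = u * (1 - u^2) * (x * Py * (x - u) * (1 - x * u) - y * Px * (y - u) * (1 - y * u))"
    unfolding L1 L2 Px_def Py_def using telescoping_polynomial[OF e4[folded e4_def], of u e1 e2 e3] by (simp only: mult_ac)
  hence "?L = u * (1 - u^2) * (x * Py * (x - u) * (1 - x * u) - y * Px * (y - u) * (1 - y * u)) / ((x - y) * (x * y))"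
    using x0 by (simp add: eq_divide_eq mult_ac)
  also have "\<dots> = u * (1 - u^2) * (lam i j * ((1 - u / x) * (1 - x * u)) + lam j i * ((1 - u / y) * (1 - y * u)))"
  proof -
    have a: "1 - u / x = (x - u) / x" "1 - u / y = (y - u) / y" using x0 by (auto simp: field_simps)
    have b: "lam i j * ((1 - u / x) * (1 - x * u)) = x * Py * (x - u) * (1 - x * u) / ((x - y) * (x * y))"
      unfolding lij a using x0 by simp
    have c: "lam j i * ((1 - u / y) * (1 - y * u)) = - (y * Px * (y - u) * (1 - y * u) / ((x - y) * (x * y)))"
      unfolding lji a using x0 by simp
    show ?thesis unfolding b c by (simp only: times_divide_eq_right[symmetric] diff_divide_distrib add_uminus_conv_diff)
  qed
  finally show ?thesis by (simp only: x_def y_def)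
qed

definition pair_prod :: "nat set \<Rightarrow> (nat \<Rightarrow> nat \<Rightarrow> complex) \<Rightarrow> complex" where
  "pair_prod A F = (\<Prod>i\<in>A. \<Prod>j\<in>{j\<in>A. i < j}. F i j)"

text \<open>
  The order of the indices only selects one orientation of each pair. For symmetric \<open>F\<close> it is
  immaterial, and any index can be split off.
\<close>

lemma pair_prod_insert:
  assumes "finite A" "a \<notin> A" "\<And>i j. F i j = F j i"
  shows "pair_prod (insert a A) F = (\<Prod>j\<in>A. F a j) * pair_prod A F"
proof -
  have "pair_prod (insert a A) F = (\<Prod>j\<in>{j\<in>A. a < j}. F a j) * (\<Prod>i\<in>A. \<Prod>j\<in>{j\<in>insert a A. i < j}. F i j)"
  proof -
    have "{j\<in>insert a A. a < j} = {j\<in>A. a < j}" by auto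
    thus ?thesis using assms by (simp add: pair_prod_def)
  qed
  also have "(\<Prod>i\<in>A. \<Prod>j\<in>{j\<in>insert a A. i < j}. F i j) = (\<Prod>i\<in>A. (if i < a then F a i else 1) * (\<Prod>j\<in>{j\<in>A. i < j}. F i j))"
  proof (rule prod.cong)
    fix i assume i: "i \<in> A"
    show "(\<Prod>j\<in>{j\<in>insert a A. i < j}. F i j) = (if i < a then F a i else 1) * (\<Prod>j\<in>{j\<in>A. i < j}. F i j)"
    proof (cases "i < a")
      case True
      have "{j\<in>insert a A. i < j} = insert a {j\<in>A. i < j}" using True by auto
      thus ?thesis using True assms by simp
    next
      case False
      have "{j\<in>insert a A. i < j} = {j\<in>A. i < j}" using False by auto
      thus ?thesis using False by simp
    qed
  qed auto
  also have "\<dots> = (\<Prod>i\<in>A. if i < a then F a i else 1) * pair_prod A F"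
    by (simp add: prod.distrib pair_prod_def)
  also have "(\<Prod>j\<in>{j\<in>A. a < j}. F a j) = (\<Prod>j\<in>A. if a < j then F a j else 1)"
    using assms(1) by (simp add: prod.inter_filter)
  finally have "pair_prod (insert a A) F = ((\<Prod>j\<in>A. if a < j then F a j else 1) * (\<Prod>i\<in>A. if i < a then F a i else 1)) * pair_prod A F"
    by simp
  also have "(\<Prod>j\<in>A. if a < j then F a j else 1) * (\<Prod>i\<in>A. if i < a then F a i else 1) = (\<Prod>j\<in>A. F a j)"
    unfolding prod.distrib[symmetric] using assms by (intro prod.cong) auto
  finally show ?thesis .
qed

lemma pair_prod_remove:
  assumes "finite A" "a \<in> A" "\<And>i j. F i j = F j i"
  shows "pair_prod A F = (\<Prod>j\<in>A-{a}. F a j) * pair_prod (A-{a}) F"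
  using pair_prod_insert[of "A - {a}" a F] assms by (simp add: insert_absorb)

lemma pair_prod_cong:
  "(\<And>i j. i \<in> A \<Longrightarrow> j \<in> A \<Longrightarrow> i \<noteq> j \<Longrightarrow> F i j = G i j) \<Longrightarrow> pair_prod A F = pair_prod A G"
  unfolding pair_prod_def by (intro prod.cong) auto

lemma pair_prod_I6: "pair_prod I6 F = (\<Prod>i=1..6. \<Prod>j\<in>{i<..6}. F i j)"
  unfolding pair_prod_def I6_def by (intro prod.cong) auto

lemma pair_prod_remove2_I6:
  assumes "k \<in> I6" "l \<in> I6" "k \<noteq> l" "\<And>i j. F i j = F j i"
  shows "pair_prod I6 F = F k l * (\<Prod>j\<in>I6-{k,l}. F k j) * (\<Prod>j\<in>I6-{k,l}. F l j) * pair_prod (I6-{k,l}) F"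
proof -
  have "pair_prod I6 F = (\<Prod>j\<in>I6-{k}. F k j) * pair_prod (I6-{k}) F"
    using assms by (intro pair_prod_remove) auto
  also have "pair_prod (I6-{k}) F = (\<Prod>j\<in>I6-{k}-{l}. F l j) * pair_prod (I6-{k}-{l}) F"
    using assms by (intro pair_prod_remove) auto
  also have "(\<Prod>j\<in>I6-{k}. F k j) = F k l * (\<Prod>j\<in>I6-{k}-{l}. F k j)" using assms by (intro prod.remove) auto
  also have "I6-{k}-{l} = I6-{k,l}" by auto
  finally show ?thesis by (simp add: mult_ac)
qed

context qbase begin

definition generic :: "(nat \<Rightarrow> complex) \<Rightarrow> bool" where
  "generic b \<longleftrightarrow> (\<forall>j\<in>I6. b j \<noteq> 0) \<and> (\<forall>i\<in>I6. \<forall>j\<in>I6. i \<noteq> j \<longrightarrow> b i / b j \<notin> qpowers q) \<and>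
     (\<forall>i\<in>I6. \<forall>j\<in>I6. b i * b j \<notin> qpowers q)"

lemma genericD:
  assumes "generic b" "i \<in> I6" "j \<in> I6"
  shows "b i \<noteq> 0" "i \<noteq> j \<Longrightarrow> b i / b j \<notin> qpowers q" "b i * b j \<notin> qpowers q"
  using assms unfolding generic_def by blast+

definition shiftp :: "(nat \<Rightarrow> complex) \<Rightarrow> (nat \<Rightarrow> int) \<Rightarrow> nat \<Rightarrow> complex" where
  "shiftp b e = (\<lambda>j. b j * q powi e j)"

lemma shiftp_shiftp: "shiftp (shiftp b e) e' = shiftp b (\<lambda>j. e j + e' j)"
  using q_nz by (simp add: shiftp_def power_int_add mult_ac)

text \<open>Genericity only depends on the classes of the parameters modulo powers of \<open>q\<close>.\<close>

lemma generic_shiftp: assumes "generic b" shows "generic (shiftp b e)"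
proof -
  have 1: "shiftp b e i / shiftp b e j = b i / b j * q powi (e i - e j)" for i j
    using q_nz by (simp add: shiftp_def power_int_diff)
  have 2: "shiftp b e i * shiftp b e j = b i * b j * q powi (e i + e j)" for i j
    using q_nz by (simp add: shiftp_def power_int_add)
  show ?thesis unfolding generic_def 1 2 qpowers_cancel
    using assms q_nz by (auto simp: generic_def shiftp_def)
qed

lemma prod_powi_sum: "(\<Prod>j\<in>A. q powi e j) = q powi (\<Sum>j\<in>A. e j)"
  using q_nz by (induction A rule: infinite_finite_induct) (auto simp: power_int_add)

lemma prod_shiftp: "(\<Prod>j\<in>I6. shiftp b e j) = (\<Prod>j\<in>I6. b j) * q powi (\<Sum>j\<in>I6. e j)"
  by (simp add: shiftp_def prod.distrib prod_powi_sum)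

text \<open>
  For \<open>u = b\<^sub>k q\<^sup>n\<close> this is, up to a factor that does not depend on \<open>n\<close>, the term with index \<open>n\<close> of the
  very-well-poised series 8W7 with leading parameter \<open>b\<^sub>k\<^sup>2\<close>, the other parameters \<open>b\<^sub>k b\<^sub>j\<close> and argument
  \<open>q\<close>.
\<close>

definition Xf :: "(nat \<Rightarrow> complex) \<Rightarrow> complex \<Rightarrow> complex" where
  "Xf b u = - u * (1 - u^2) * (\<Prod>j\<in>I6. qp (q * u / b j) / qp (b j * u))"

definition xs :: "(nat \<Rightarrow> complex) \<Rightarrow> nat \<Rightarrow> complex" where
  "xs b k = (\<Sum>n. Xf b (b k * q ^ n))"

lemma q_power_tendsto_0: "(\<lambda>n. a * q ^ n) \<longlonglongrightarrow> 0"
  using tendsto_mult_right_zero[OF LIMSEQ_power_zero[OF norm_q]] by blast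

lemma Xf_summable: "summable (\<lambda>n. norm (Xf b (z * q ^ n)))"
proof -
  define E where "E u = - ((1 - u^2) * (\<Prod>j\<in>I6. qp (q * u / b j) / qp (b j * u)))" for u
  have "(\<lambda>n. E (z * q ^ n)) \<longlonglongrightarrow> - ((1 - 0^2) * (\<Prod>j\<in>I6. qp (q * 0 / b j) / qp (b j * 0)))"
    unfolding E_def divide_inverse[of _ "b _"] by (intro tendsto_intros q_power_tendsto_0) auto
  hence "Bseq (\<lambda>n. E (z * q ^ n))" by (intro convergent_imp_Bseq) (auto simp: convergent_def)
  then obtain C where C: "\<And>n. norm (E (z * q ^ n)) \<le> C" by (auto simp: Bseq_def)
  show ?thesis
  proof (rule summable_comparison_test_ev)
    have X: "Xf b u = u * E u" for u by (simp add: Xf_def E_def mult.assoc)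
    have "norm (norm (Xf b (z * q ^ n))) \<le> C * norm (z * q ^ n)" for n
    proof -
      have "norm (Xf b (z * q ^ n)) = norm (E (z * q ^ n)) * norm (z * q ^ n)"
        unfolding X[of "z * q ^ n"] by (simp only: norm_mult mult.commute)
      also have "\<dots> \<le> C * norm (z * q ^ n)" using C[of n] by (rule mult_right_mono) simp
      finally show ?thesis by simp
    qed
    thus "\<forall>\<^sub>F n in sequentially. norm (norm (Xf b (z * q ^ n))) \<le> C * norm (z * q ^ n)" by simp
    show "summable (\<lambda>n. C * norm (z * q ^ n))" by (intro summable_mult summable_q)
  qed
qed

lemma Xf_summable': "summable (\<lambda>n. Xf b (z * q ^ n))"
  by (rule summable_norm_cancel[OF Xf_summable])

definition Psi :: "(nat \<Rightarrow> complex) \<Rightarrow> complex \<Rightarrow> complex" where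
  "Psi c u = (\<Prod>j\<in>I6. qp (u / c j) / qp (c j * u))"

definition up :: "(nat \<Rightarrow> complex) \<Rightarrow> nat \<Rightarrow> nat \<Rightarrow> complex" where
  "up c i = c(i := q * c i)"

definition lam :: "(nat \<Rightarrow> complex) \<Rightarrow> nat \<Rightarrow> nat \<Rightarrow> complex" where
  "lam c i j = (\<Prod>m\<in>I6-{i,j}. 1 - c m * c j) / (c j * (1 - c j / c i))"

lemma Xf_up:
  assumes "i \<in> I6" "\<And>m. m \<in> I6 \<Longrightarrow> c m \<noteq> 0" "\<And>m. m \<in> I6 \<Longrightarrow> qp (c m * u) \<noteq> 0"
  shows "Xf (up c i) u = - u * (1 - u^2) * (\<Prod>j\<in>I6. qp (q * u / c j) / qp (c j * u)) * ((1 - u / c i) * (1 - c i * u))"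
proof -
  have "(\<Prod>j\<in>I6. qp (q * u / up c i j) / qp (up c i j * u)) =
     qp (q * u / (q * c i)) / qp (q * c i * u) * (\<Prod>j\<in>I6-{i}. qp (q * u / c j) / qp (c j * u))"
    using assms(1) by (subst prod.remove[of _ i]) (auto simp: up_def)
  also have "qp (q * u / (q * c i)) / qp (q * c i * u) = (1 - u / c i) * (1 - c i * u) * (qp (q * u / c i) / qp (c i * u))"
  proof -
    have B: "qp (q * u / (q * c i)) = (1 - u / c i) * qp (q * u / c i)"
      using q_nz qp_rec[of "u / c i"] by (simp add: mult_ac)
    have A: "qp (c i * u) = (1 - c i * u) * qp (q * c i * u)" using qp_rec[of "c i * u"] by (simp add: mult_ac)
    hence "1 - c i * u \<noteq> 0" using assms(3)[OF assms(1)] by auto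
    thus ?thesis unfolding A B by simp
  qed
  finally have "(\<Prod>j\<in>I6. qp (q * u / up c i j) / qp (up c i j * u)) =
      (1 - u / c i) * (1 - c i * u) * ((qp (q * u / c i) / qp (c i * u)) * (\<Prod>j\<in>I6-{i}. qp (q * u / c j) / qp (c j * u)))"
    by (simp only: mult.assoc)
  also have "(qp (q * u / c i) / qp (c i * u)) * (\<Prod>j\<in>I6-{i}. qp (q * u / c j) / qp (c j * u)) =
      (\<Prod>j\<in>I6. qp (q * u / c j) / qp (c j * u))"
    using assms(1) by (subst (2) prod.remove[of _ i]) auto
  finally show ?thesis by (simp only: Xf_def mult_ac)
qed

text \<open>\<open>Psi c\<close> is an indefinite sum of a combination of two contiguous summands.\<close>

lemma Psi_step:
  assumes ij: "i \<in> I6" "j \<in> I6" "i \<noteq> j" and c0: "\<And>m. m \<in> I6 \<Longrightarrow> c m \<noteq> 0"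
    and c1: "(\<Prod>m\<in>I6. c m) = 1" and cij: "c i \<noteq> c j"
    and u: "\<And>m. m \<in> I6 \<Longrightarrow> qp (c m * u) \<noteq> 0"
  shows "Psi c (q * u) - Psi c u = - (lam c i j * Xf (up c i) u + lam c j i * Xf (up c j) u)"
proof -
  let ?W = "\<Prod>j\<in>I6. qp (q * u / c j) / qp (c j * u)"
  have "Psi c u = (\<Prod>m\<in>I6. (1 - u / c m) * (qp (q * u / c m) / qp (c m * u)))"
    unfolding Psi_def using qp_rec[of "u / c m" for m] by (intro prod.cong) (auto simp: mult_ac)
  hence 1: "Psi c u = (\<Prod>m\<in>I6. 1 - u / c m) * ?W" by (simp only: prod.distrib)
  have "Psi c (q * u) = (\<Prod>m\<in>I6. (1 - c m * u) * (qp (q * u / c m) / qp (c m * u)))"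
    unfolding Psi_def
  proof (rule prod.cong)
    fix m assume m: "m \<in> I6"
    have "qp (c m * u) = (1 - c m * u) * qp (c m * (q * u))" using qp_rec[of "c m * u"] by (simp add: mult_ac)
    thus "qp (q * u / c m) / qp (c m * (q * u)) = (1 - c m * u) * (qp (q * u / c m) / qp (c m * u))"
      using u[OF m] by auto
  qed auto
  hence 2: "Psi c (q * u) = (\<Prod>m\<in>I6. 1 - c m * u) * ?W" by (simp only: prod.distrib)
  have "Psi c (q * u) - Psi c u = ((\<Prod>m\<in>I6. 1 - c m * u) - (\<Prod>m\<in>I6. 1 - u / c m)) * ?W"
    unfolding 1 2 by (simp only: left_diff_distrib)
  also have "\<dots> = u * (1 - u^2) * (lam c i j * ((1 - u / c i) * (1 - c i * u)) + lam c j i * ((1 - u / c j) * (1 - c j * u))) * ?W"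
    unfolding lam_def by (subst telescoping_identity[OF ij c0 c1 cij]) auto
  also have "\<dots> = - (lam c i j * Xf (up c i) u + lam c j i * Xf (up c j) u)"
  proof -
    have ring: "u * v * (l * A + m * B) * W = - (l * (- u * v * W * A) + m * (- u * v * W * B))"
      for v l A m B W :: complex by (simp add: algebra_simps)
    show ?thesis unfolding ring using Xf_up[of i c u] Xf_up[of j c u] ij c0 u by simp
  qed
  finally show ?thesis .
qed

text \<open>
  The sum telescopes: \<open>Psi c\<close> vanishes at \<open>c\<^sub>k\<close> and tends to 1 along \<open>c\<^sub>k q\<^sup>n\<close>. The value \<open>-1\<close> is the same
  for all \<open>k\<close>, so differences over \<open>k\<close> satisfy a homogeneous relation.
\<close>

lemma xs_contiguous:
  assumes ij: "i \<in> I6" "j \<in> I6" "i \<noteq> j" and k: "k \<in> I6" and gen: "generic c"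
    and c1: "(\<Prod>m\<in>I6. c m) = 1"
  shows "lam c i j * xs (up c i) k + lam c j i * xs (up c j) k = -1"
proof -
  have c0: "c m \<noteq> 0" if "m \<in> I6" for m using genericD[OF gen that that] by simp
  have cij: "c i \<noteq> c j" using genericD(2)[OF gen ij(1,2) ij(3)] c0[OF ij(2)] by auto
  have nz: "qp (c m * (c k * q ^ n)) \<noteq> 0" if "m \<in> I6" for m n
  proof (rule not_qpowers_qp)
    have "c m * c k * q powi int n \<notin> qpowers q" unfolding qpowers_cancel by (rule genericD(3)[OF gen that k])
    thus "c m * (c k * q ^ n) \<notin> qpowers q" by (simp add: mult_ac)
  qed
  have xs_up: "(\<lambda>n. Xf (up c i) (c k * q ^ n)) sums xs (up c i) k" if i: "i \<in> I6" for i
  proof (cases "i = k")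
    case True
    \<comment> \<open>The series for the raised parameter starts at \<open>q c\<^sub>k\<close>, but its summand vanishes at \<open>c\<^sub>k\<close>.\<close>
    have "(\<lambda>n. Xf (up c k) (up c k k * q ^ n)) sums xs (up c k) k"
      unfolding xs_def by (intro summable_sums Xf_summable')
    hence "(\<lambda>n. Xf (up c k) (c k * q ^ Suc n)) sums xs (up c k) k" by (simp add: up_def mult_ac)
    moreover have "Xf (up c k) (c k * q ^ 0) = 0"
    proof -
      have "qp 1 = 0" by (auto simp: qp_eq_0_iff intro: exI[of _ 0])
      hence "qp (q * c k / up c k k) / qp (up c k k * c k) = 0" using c0[OF k] q_nz by (simp add: up_def)
      hence "(\<Prod>j\<in>I6. qp (q * c k / up c k j) / qp (up c k j * c k)) = 0" using k by (intro prod_zero) (simp, blast)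
      thus ?thesis unfolding Xf_def by simp
    qed
    ultimately show ?thesis using True by (subst (asm) sums_Suc_iff) simp
  next
    case False
    have "(\<lambda>n. Xf (up c i) (up c i k * q ^ n)) sums xs (up c i) k"
      unfolding xs_def by (intro summable_sums Xf_summable')
    thus ?thesis using False by (simp add: up_def)
  qed
  have "(\<lambda>n. Psi c (c k * q ^ n)) \<longlonglongrightarrow> (\<Prod>j\<in>I6. qp (0 / c j) / qp (c j * 0))"
    unfolding Psi_def divide_inverse[of _ "c _"] by (intro tendsto_intros q_power_tendsto_0) auto
  hence "(\<lambda>n. Psi c (c k * q ^ n)) \<longlonglongrightarrow> 1" by simp
  hence "(\<lambda>n. Psi c (c k * q ^ Suc n) - Psi c (c k * q ^ n)) sums (1 - Psi c (c k * q ^ 0))"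
    by (rule telescope_sums)
  moreover have "Psi c (c k * q ^ 0) = 0"
  proof -
    have "qp 1 = 0" by (auto simp: qp_eq_0_iff intro: exI[of _ 0])
    hence "qp (c k / c k) / qp (c k * c k) = 0" using c0[OF k] by simp
    thus ?thesis unfolding Psi_def using k by (intro prod_zero) (auto intro!: bexI[of _ k])
  qed
  moreover have "Psi c (c k * q ^ Suc n) - Psi c (c k * q ^ n) =
      - (lam c i j * Xf (up c i) (c k * q ^ n) + lam c j i * Xf (up c j) (c k * q ^ n))" for n
    using Psi_step[OF ij c0 c1 cij nz, of n] by (simp add: mult_ac)
  ultimately have 1: "(\<lambda>n. - (lam c i j * Xf (up c i) (c k * q ^ n) + lam c j i * Xf (up c j) (c k * q ^ n))) sums 1"
    by simp
  have 2: "(\<lambda>n. - (lam c i j * Xf (up c i) (c k * q ^ n) + lam c j i * Xf (up c j) (c k * q ^ n)))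
     sums (- (lam c i j * xs (up c i) k + lam c j i * xs (up c j) k))"
    by (intro sums_minus sums_add sums_mult xs_up ij)
  have "1 = - (lam c i j * xs (up c i) k + lam c j i * xs (up c j) k)" using sums_unique2[OF 1 2] .
  thus ?thesis by (simp add: equation_minus_iff)
qed

definition Pp :: "(nat \<Rightarrow> complex) \<Rightarrow> complex" where
  "Pp b = pair_prod I6 (\<lambda>i j. qp (q / (b i * b j)))"

text \<open>
  \<open>Gf\<close> collects the theta functions in the closed form \<open>Hf\<close> of the differences \<open>xs b k - xs b l\<close>. It is
  separated from \<open>Pp\<close> because its behaviour under shifts only involves automorphy factors.
\<close>

definition Gf :: "(nat \<Rightarrow> complex) \<Rightarrow> nat \<Rightarrow> nat \<Rightarrow> complex" where
  "Gf b k l = - qp q * b k * th (b l / b k) /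
     (th (b k * b l) * (\<Prod>j\<in>I6-{k,l}. th (b j * b k) * th (b j * b l)))"

definition Hf :: "(nat \<Rightarrow> complex) \<Rightarrow> nat \<Rightarrow> nat \<Rightarrow> complex" where
  "Hf b k l = Pp b * Gf b k l"

lemma Pp_up:
  assumes i: "i \<in> I6" and c0: "\<And>m. m \<in> I6 \<Longrightarrow> c m \<noteq> 0"
  shows "Pp (up c i) = (\<Prod>m\<in>I6-{i}. 1 - 1 / (c i * c m)) * Pp c"
proof -
  have "Pp (up c i) = (\<Prod>m\<in>I6-{i}. qp (q / (up c i i * up c i m))) * pair_prod (I6-{i}) (\<lambda>k m. qp (q / (up c i k * up c i m)))"
    unfolding Pp_def using i by (intro pair_prod_remove) (auto simp: mult.commute)
  also have "pair_prod (I6-{i}) (\<lambda>k m. qp (q / (up c i k * up c i m))) = pair_prod (I6-{i}) (\<lambda>k m. qp (q / (c k * c m)))"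
    by (intro pair_prod_cong) (auto simp: up_def)
  also have "(\<Prod>m\<in>I6-{i}. qp (q / (up c i i * up c i m))) = (\<Prod>m\<in>I6-{i}. (1 - 1 / (c i * c m)) * qp (q / (c i * c m)))"
  proof (rule prod.cong)
    fix m assume "m \<in> I6 - {i}"
    thus "qp (q / (up c i i * up c i m)) = (1 - 1 / (c i * c m)) * qp (q / (c i * c m))"
      using q_nz qp_rec[of "1 / (c i * c m)"] by (simp add: up_def)
  qed auto
  finally have "Pp (up c i) = (\<Prod>m\<in>I6-{i}. 1 - 1 / (c i * c m)) *
     ((\<Prod>m\<in>I6-{i}. qp (q / (c i * c m))) * pair_prod (I6-{i}) (\<lambda>k m. qp (q / (c k * c m))))"
    by (simp only: prod.distrib mult.assoc)
  also have "(\<Prod>m\<in>I6-{i}. qp (q / (c i * c m))) * pair_prod (I6-{i}) (\<lambda>k m. qp (q / (c k * c m))) = Pp c"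
    unfolding Pp_def using i by (intro pair_prod_remove[symmetric]) (auto simp: mult.commute)
  finally show ?thesis .
qed

lemma prod_th_up:
  assumes "finite A" "x \<noteq> 0" "\<And>m. m \<in> A \<Longrightarrow> c m \<noteq> 0" "even (card A)"
  shows "(\<Prod>j\<in>A. th (c j * (q * x))) = (\<Prod>j\<in>A. th (c j * x)) / (x ^ card A * (\<Prod>j\<in>A. c j))"
proof -
  have "(\<Prod>j\<in>A. th (c j * (q * x))) = (\<Prod>j\<in>A. (-1) * (th (c j * x) / (x * c j)))"
    using th_q[of "c j * x" for j] assms by (intro prod.cong) (auto simp: mult_ac)
  also have "\<dots> = (-1) ^ card A * ((\<Prod>j\<in>A. th (c j * x)) / (x ^ card A * (\<Prod>j\<in>A. c j)))"
    by (simp only: prod.distrib prod_constant prod_dividef)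
  finally show ?thesis using assms(4) by simp
qed

text \<open>
  The product of the \<open>c\<^sub>m\<close> being 1, the automorphy factors combine to the same expression whether
  the raised parameter has index \<open>k\<close>, \<open>l\<close> or another one.
\<close>

lemma Gf_up:
  assumes i: "i \<in> I6" and kl: "k \<in> I6" "l \<in> I6" "k \<noteq> l" and c0: "\<And>m. m \<in> I6 \<Longrightarrow> c m \<noteq> 0"
    and c1: "(\<Prod>m\<in>I6. c m) = 1"
  shows "Gf (up c i) k l = c i ^ 2 * c k * c l * Gf c k l"
proof -
  let ?O = "I6 - {k,l}"
  have ck: "c k \<noteq> 0" "c l \<noteq> 0" using c0 kl by auto
  have cO: "card ?O = 4" "finite ?O" using card_I6_remove2[OF kl] by auto
  have pO: "c k * c l * (\<Prod>j\<in>?O. c j) = 1" using c1 prod_I6_remove2[OF kl, of c] by simp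
  have pO': "(\<Prod>j\<in>?O. c j) = 1 / (c k * c l)" using pO ck by (simp add: field_simps)
  have D: "th (q * (c k * c l)) = - th (c k * c l) / (c k * c l)" using ck by (intro th_q) auto
  define T D W V where "T = th (c l / c k)" and "D = th (c k * c l)"
    and "W = (\<Prod>j\<in>?O. th (c j * c k))" and "V = (\<Prod>j\<in>?O. th (c j * c l))"
  have Gc: "Gf c k l = - qp q * c k * T / (D * (W * V))"
    unfolding Gf_def T_def D_def W_def V_def by (simp add: prod.distrib)
  consider "i = k" | "i = l" | "i \<in> ?O" using i by auto
  thus ?thesis
  proof cases
    case 1
    have "(\<Prod>j\<in>?O. th (up c k j * up c k k) * th (up c k j * up c k l)) =
        (\<Prod>j\<in>?O. th (c j * (q * c k))) * (\<Prod>j\<in>?O. th (c j * c l))"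
      unfolding prod.distrib[symmetric] using kl by (intro prod.cong) (auto simp: up_def)
    also have "\<dots> = W / (c k ^ 4 * (1 / (c k * c l))) * V"
      using prod_th_up[of ?O "c k" c] cO ck c0 pO' by (simp add: W_def V_def)
    finally have e: "(\<Prod>j\<in>?O. th (up c k j * up c k k) * th (up c k j * up c k l)) =
        W / (c k ^ 4 * (1 / (c k * c l))) * V" .
    have e2: "th (up c k l / up c k k) = - (c l / (q * c k)) * T"
      using th_div_q[of "c l / c k"] ck kl q_nz by (simp add: up_def T_def mult_ac)
    have e3: "th (up c k k * up c k l) = - D / (c k * c l)"
      using D kl unfolding D_def by (simp add: up_def mult.assoc)
    have "Gf (up c k) k l = - qp q * (q * c k) * (- (c l / (q * c k)) * T) / (- D / (c k * c l) * (W / (c k ^ 4 * (1 / (c k * c l))) * V))"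
      unfolding Gf_def e e2 e3 by (simp add: up_def)
    also have "\<dots> = c k ^ 2 * c k * c l * (- qp q * c k * T / (D * (W * V)))"
      using ck q_nz by (simp add: field_simps power2_eq_square eval_nat_numeral)
    finally show ?thesis using 1 Gc by simp
  next
    case 2
    have "(\<Prod>j\<in>?O. th (up c l j * up c l k) * th (up c l j * up c l l)) =
        (\<Prod>j\<in>?O. th (c j * c k)) * (\<Prod>j\<in>?O. th (c j * (q * c l)))"
      unfolding prod.distrib[symmetric] using kl by (intro prod.cong) (auto simp: up_def)
    also have "\<dots> = W * (V / (c l ^ 4 * (1 / (c k * c l))))"
      using prod_th_up[of ?O "c l" c] cO ck c0 pO' by (simp add: W_def V_def)
    finally have e: "(\<Prod>j\<in>?O. th (up c l j * up c l k) * th (up c l j * up c l l)) =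
        W * (V / (c l ^ 4 * (1 / (c k * c l))))" .
    have e2: "th (up c l l / up c l k) = - T / (c l / c k)"
      using th_q[of "c l / c k"] ck kl q_nz by (simp add: up_def T_def)
    have e3: "th (up c l k * up c l l) = - D / (c k * c l)"
      using D kl unfolding D_def by (simp add: up_def mult_ac)
    have "Gf (up c l) k l = - qp q * c k * (- T / (c l / c k)) / (- D / (c k * c l) * (W * (V / (c l ^ 4 * (1 / (c k * c l))))))"
      unfolding Gf_def e e2 e3 using kl by (simp add: up_def)
    also have "\<dots> = c l ^ 2 * c k * c l * (- qp q * c k * T / (D * (W * V)))"
      using ck by (simp add: field_simps power2_eq_square eval_nat_numeral)
    finally show ?thesis using 2 Gc by simp
  next
    case 3
    have ci: "c i \<noteq> 0" "i \<noteq> k" "i \<noteq> l" using c0 3 by auto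
    have pr: "(\<Prod>j\<in>?O. f j) = f i * (\<Prod>j\<in>?O-{i}. f j)" for f :: "nat \<Rightarrow> complex"
      using 3 cO by (intro prod.remove) auto
    have "(\<Prod>j\<in>?O. th (up c i j * up c i k) * th (up c i j * up c i l)) =
        th (q * (c i * c k)) * th (q * (c i * c l)) * (\<Prod>j\<in>?O-{i}. th (c j * c k) * th (c j * c l))"
      unfolding pr[of "\<lambda>j. th (up c i j * up c i k) * th (up c i j * up c i l)"] using ci
      by (intro arg_cong2[of _ _ _ _ "(*)"] prod.cong) (auto simp: up_def mult_ac)
    also have "th (q * (c i * c k)) = - th (c i * c k) / (c i * c k)" using ci ck by (intro th_q) auto
    also have "th (q * (c i * c l)) = - th (c i * c l) / (c i * c l)" using ci ck by (intro th_q) auto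
    also have "- th (c i * c k) / (c i * c k) * (- th (c i * c l) / (c i * c l)) * (\<Prod>j\<in>?O-{i}. th (c j * c k) * th (c j * c l)) =
       (\<Prod>j\<in>?O. th (c j * c k) * th (c j * c l)) / (c i ^ 2 * c k * c l)"
      unfolding pr[of "\<lambda>j. th (c j * c k) * th (c j * c l)"] using ci ck by (simp add: power2_eq_square)
    finally have e: "(\<Prod>j\<in>?O. th (up c i j * up c i k) * th (up c i j * up c i l)) =
      (W * V) / (c i ^ 2 * c k * c l)" by (simp add: prod.distrib W_def V_def)
    have e1: "up c i k = c k" "up c i l = c l" using ci by (auto simp: up_def)
    have "Gf (up c i) k l = - qp q * c k * T / (D * ((W * V) / (c i ^ 2 * c k * c l)))"
      using e unfolding Gf_def e1 T_def D_def by simp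
    thus ?thesis unfolding Gc by simp
  qed
qed

text \<open>
  The closed form satisfies the homogeneous relation that \<open>xs_contiguous\<close> implies for the
  differences of the series.
\<close>

lemma lam_Hf:
  assumes ij: "i \<in> I6" "j \<in> I6" "i \<noteq> j" and kl: "k \<in> I6" "l \<in> I6" "k \<noteq> l"
    and c0: "\<And>m. m \<in> I6 \<Longrightarrow> c m \<noteq> 0" and c1: "(\<Prod>m\<in>I6. c m) = 1" and cij: "c i \<noteq> c j"
  shows "lam c i j * Hf (up c i) k l + lam c j i * Hf (up c j) k l = 0"
proof -
  define x y where "x = c i" and "y = c j"
  let ?O = "I6 - {i,j}"
  have x0: "x \<noteq> 0" "y \<noteq> 0" "x - y \<noteq> 0" using ij c0 cij by (auto simp: x_def y_def)
  have cO: "card ?O = 4" "finite ?O" using card_I6_remove2[OF ij] by auto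
  have pO: "(\<Prod>j\<in>?O. c j) = 1 / (x * y)"
    using c1 prod_I6_remove2[OF ij, of c] x0 by (simp add: field_simps x_def y_def)
  define A B where "A = (\<Prod>m\<in>?O. 1 - c m * y)" and "B = (\<Prod>m\<in>?O. 1 - c m * x)"
  have pr: "(\<Prod>m\<in>?O. 1 - 1 / (z * c m)) = (\<Prod>m\<in>?O. 1 - c m * z) * (x * y) / z ^ 4" if "z \<noteq> 0" for z
  proof -
    have "(\<Prod>m\<in>?O. 1 - 1 / (z * c m)) = (\<Prod>m\<in>?O. (-1) * ((1 - c m * z) / (z * c m)))"
      using that c0 by (intro prod.cong) (auto simp: field_simps)
    also have "\<dots> = (\<Prod>m\<in>?O. 1 - c m * z) / (z ^ 4 * (1 / (x * y)))"
      by (simp only: prod.distrib prod_constant prod_dividef cO pO) simp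
    finally show ?thesis by simp
  qed
  have rem: "(\<Prod>m\<in>I6-{i}. f m) = f j * (\<Prod>m\<in>?O. f m)" "(\<Prod>m\<in>I6-{j}. f m) = f i * (\<Prod>m\<in>?O. f m)"
    for f :: "nat \<Rightarrow> complex"
  proof -
    have "(\<Prod>m\<in>I6-{i}. f m) = f j * (\<Prod>m\<in>I6-{i}-{j}. f m)" using ij by (intro prod.remove) auto
    moreover have "I6-{i}-{j} = ?O" by auto
    ultimately show "(\<Prod>m\<in>I6-{i}. f m) = f j * (\<Prod>m\<in>?O. f m)" by simp
    have "(\<Prod>m\<in>I6-{j}. f m) = f i * (\<Prod>m\<in>I6-{j}-{i}. f m)" using ij by (intro prod.remove) auto
    moreover have "I6-{j}-{i} = ?O" by auto
    ultimately show "(\<Prod>m\<in>I6-{j}. f m) = f i * (\<Prod>m\<in>?O. f m)" by simp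
  qed
  have Hi: "Hf (up c i) k l = (1 - 1 / (x * y)) * (B * (x * y) / x ^ 4) * Pp c * (x ^ 2 * c k * c l * Gf c k l)"
    using Pp_up[OF ij(1), of c] Gf_up[OF ij(1) kl, of c] c0 c1 pr[OF x0(1)]
    unfolding Hf_def rem by (simp add: x_def y_def B_def)
  have Hj: "Hf (up c j) k l = (1 - 1 / (x * y)) * (A * (x * y) / y ^ 4) * Pp c * (y ^ 2 * c k * c l * Gf c k l)"
    using Pp_up[OF ij(2), of c] Gf_up[OF ij(2) kl, of c] c0 c1 pr[OF x0(2)]
    unfolding Hf_def rem by (simp add: x_def y_def A_def mult.commute)
  have li: "lam c i j = A * x / (y * (x - y))"
    unfolding lam_def x_def[symmetric] y_def[symmetric] A_def[symmetric] using x0 by (simp add: field_simps)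
  have lj: "lam c j i = - (B * y / (x * (x - y)))"
    unfolding lam_def insert_commute[of j i] x_def[symmetric] y_def[symmetric] B_def[symmetric] using x0
    by (simp add: divide_simps) (simp add: algebra_simps)
  define Z where "Z = (1 - 1 / (x * y)) * Pp c * (c k * c l * Gf c k l)"
  have "lam c i j * Hf (up c i) k l = A * B / (x - y) * Z"
    unfolding Hi li Z_def using x0 by (simp add: field_simps power2_eq_square eval_nat_numeral)
  moreover have "lam c j i * Hf (up c j) k l = - (A * B / (x - y) * Z)"
    unfolding Hj lj Z_def using x0 by (simp add: field_simps power2_eq_square eval_nat_numeral)
  ultimately show ?thesis by simp
qed

lemma Gf_nz: assumes "generic b" "k \<in> I6" "l \<in> I6" "k \<noteq> l" shows "Gf b k l \<noteq> 0"
proof -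
  have "b k \<noteq> 0" "b l \<noteq> 0" using genericD(1) assms by blast+
  moreover have "th (b l / b k) \<noteq> 0" using assms genericD(2)[of b l k] calculation by (intro th_nz) auto
  moreover have "th (b i * b j) \<noteq> 0" if "i \<in> I6" "j \<in> I6" for i j
    using that assms genericD[of b] by (intro th_nz) auto
  ultimately show ?thesis using assms qp_q_nz by (auto simp: Gf_def prod_zero_iff)
qed

lemma pair_prod_nz: "finite A \<Longrightarrow> (\<And>i j. i \<in> A \<Longrightarrow> j \<in> A \<Longrightarrow> i \<noteq> j \<Longrightarrow> F i j \<noteq> 0) \<Longrightarrow> pair_prod A F \<noteq> 0"
  unfolding pair_prod_def by (auto simp: prod_zero_iff)

lemma generic_inv_qpowers: assumes "generic b" "i \<in> I6" "j \<in> I6" shows "q / (b i * b j) \<notin> qpowers q"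
proof
  assume "q / (b i * b j) \<in> qpowers q"
  hence "inverse (b i * b j) * q powi 1 \<in> qpowers q" by (simp add: field_simps)
  hence "b i * b j \<in> qpowers q" unfolding qpowers_cancel qpowers_inverse_iff .
  thus False using genericD(3)[OF assms] by blast
qed

lemma Pp_nz: "generic b \<Longrightarrow> Pp b \<noteq> 0"
  unfolding Pp_def by (intro pair_prod_nz not_qpowers_qp generic_inv_qpowers) simp_all

lemma Hf_nz: "generic b \<Longrightarrow> k \<in> I6 \<Longrightarrow> l \<in> I6 \<Longrightarrow> k \<noteq> l \<Longrightarrow> Hf b k l \<noteq> 0"
  by (simp add: Hf_def Pp_nz Gf_nz)

definition njq :: "(nat \<Rightarrow> complex) \<Rightarrow> nat \<Rightarrow> nat \<Rightarrow> complex" where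
  "njq b k l = (xs b k - xs b l) / Hf b k l"

lemma up_shiftp: "up b i = shiftp b (\<lambda>m. if m = i then 1 else 0)"
  by (auto simp: up_def shiftp_def)

text \<open>
  Numerator and denominator satisfy the same homogeneous relation with two terms, by
  \<open>xs_contiguous\<close> and \<open>lam_Hf\<close>.
\<close>

lemma njq_up:
  assumes ij: "i \<in> I6" "j \<in> I6" "i \<noteq> j" and kl: "k \<in> I6" "l \<in> I6" "k \<noteq> l" and gen: "generic c"
    and c1: "(\<Prod>m\<in>I6. c m) = 1"
  shows "njq (up c i) k l = njq (up c j) k l"
proof -
  have c0: "c m \<noteq> 0" if "m \<in> I6" for m using genericD[OF gen that that] by simp
  have cij: "c i \<noteq> c j" using genericD(2)[OF gen ij] c0[OF ij(2)] by auto
  have gu: "generic (up c m)" for m unfolding up_shiftp by (rule generic_shiftp[OF gen])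
  have H: "Hf (up c m) k l \<noteq> 0" for m using Hf_nz[OF gu kl] .
  have l0: "lam c m n \<noteq> 0" if "m \<in> I6" "n \<in> I6" "c m \<noteq> c n" for m n
  proof -
    have "1 - c h * c n \<noteq> 0" if "h \<in> I6" for h
      using genericD(3)[OF gen that \<open>n \<in> I6\<close>] qpowers_1 by (metis eq_iff_diff_eq_0)
    thus ?thesis using that c0 by (auto simp: lam_def prod_zero_iff)
  qed
  have "lam c i j * xs (up c i) k + lam c j i * xs (up c j) k = -1"
    by (rule xs_contiguous[OF ij kl(1) gen c1])
  moreover have "lam c i j * xs (up c i) l + lam c j i * xs (up c j) l = -1"
    by (rule xs_contiguous[OF ij kl(2) gen c1])
  ultimately have "lam c i j * (xs (up c i) k - xs (up c i) l) + lam c j i * (xs (up c j) k - xs (up c j) l) = 0"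
    by (simp add: algebra_simps)
  hence 1: "lam c i j * (xs (up c i) k - xs (up c i) l) = - (lam c j i * (xs (up c j) k - xs (up c j) l))"
    by (simp add: eq_neg_iff_add_eq_0)
  have 2: "lam c i j * Hf (up c i) k l = - (lam c j i * Hf (up c j) k l)"
    using lam_Hf[OF ij kl c0 c1 cij] by (simp add: eq_neg_iff_add_eq_0)
  have "njq (up c i) k l = (lam c i j * (xs (up c i) k - xs (up c i) l)) / (lam c i j * Hf (up c i) k l)"
    using l0[OF ij(1,2) cij] by (simp add: njq_def)
  also have "\<dots> = njq (up c j) k l"
    unfolding 1 2 using l0[of j i] ij cij by (simp add: njq_def)
  finally show ?thesis .
qed

text \<open>
  A factor \<open>q\<close> moves from parameter \<open>j\<close> to parameter \<open>i\<close>: both sets of parameters arise from a common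
  one with product 1, by raising \<open>j\<close> or by raising \<open>i\<close>.
\<close>

lemma njq_move:
  assumes ij: "i \<in> I6" "j \<in> I6" "i \<noteq> j" and kl: "k \<in> I6" "l \<in> I6" "k \<noteq> l" and gen: "generic b"
    and b1: "(\<Prod>m\<in>I6. b m) = q"
  shows "njq (shiftp b (\<lambda>m. if m = i then int M else if m = j then - int M else 0)) k l = njq b k l"
proof (induction M)
  case 0
  have "shiftp b (\<lambda>m. if m = i then int 0 else if m = j then - int 0 else 0) = b" by (auto simp: shiftp_def)
  thus ?case by simp
next
  case (Suc M)
  define c where "c = shiftp b (\<lambda>m. if m = i then int M else if m = j then - int M - 1 else 0)"
  have "(\<Sum>m\<in>I6. if m = i then int M else if m = j then - int M - 1 else 0) =
     (\<Sum>m\<in>I6. (if m = i then int M else 0) + (if m = j then - int M - 1 else 0))"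
    using ij by (intro sum.cong) auto
  also have "\<dots> = -1" using ij by (simp add: sum.distrib sum.delta)
  finally have "(\<Prod>m\<in>I6. c m) = 1"
    unfolding c_def prod_shiftp b1 using q_nz by (simp add: power_int_minus)
  moreover have "generic c" unfolding c_def by (rule generic_shiftp[OF gen])
  ultimately have "njq (up c i) k l = njq (up c j) k l" by (intro njq_up ij kl)
  moreover have "up c i = shiftp b (\<lambda>m. if m = i then int (Suc M) else if m = j then - int (Suc M) else 0)"
    unfolding up_shiftp c_def shiftp_shiftp using ij by (intro arg_cong[of _ _ "shiftp b"]) auto
  moreover have "up c j = shiftp b (\<lambda>m. if m = i then int M else if m = j then - int M else 0)"
    unfolding up_shiftp c_def shiftp_shiftp using ij by (intro arg_cong[of _ _ "shiftp b"]) auto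
  ultimately show ?case using Suc.IH by simp
qed

end

section \<open>The nonterminating Jackson summation\<close>

lemma prod_lessThan_add:
  fixes f :: "nat \<Rightarrow> 'a::comm_monoid_mult"
  shows "(\<Prod>i<m+k. f i) = (\<Prod>i<m. f i) * (\<Prod>i<k. f (m + i))"
  by (induction k) (auto simp: mult_ac)

context qbase begin

lemma qp_split: "qp a = (\<Prod>i<n. 1 - a * q ^ i) * qp (a * q ^ n)"
proof (induction n)
  case (Suc n)
  have "qp (a * q ^ n) = (1 - a * q ^ n) * qp (a * q ^ Suc n)"
    using qp_rec[of "a * q ^ n"] by (simp add: mult_ac)
  thus ?case using Suc.IH by simp
qed simp

text \<open>
  The product is bounded below by a multiple of its first factor, uniformly in its length. The
  factors with \<open>\<bar>w q\<^bsup>i-M\<^esup>\<bar> \<ge> 2\<close> have modulus at least 1, and the remaining ones are the first factors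
  of a single convergent infinite product without zeros.
\<close>

lemma poch_lower:
  assumes w: "w \<notin> qpowers q" "w \<noteq> 0"
  obtains c :: real and M0 :: nat where "c > 0"
    "\<And>M n. M \<ge> M0 \<Longrightarrow> n \<ge> 1 \<Longrightarrow>
      c * norm (1 - w * q powi (- int M)) \<le> norm (\<Prod>i<n. 1 - w * q powi (- int M) * q ^ i)"
proof -
  have nq: "0 < norm q" "norm q < 1" using q_nz norm_q by auto
  have "(\<lambda>n. norm q ^ n) \<longlonglongrightarrow> 0" using nq by (intro LIMSEQ_power_zero) auto
  hence "eventually (\<lambda>n. norm q ^ n < norm w / 2) sequentially"
    using w by (intro order_tendstoD) auto
  then obtain e where e: "norm q ^ e < norm w / 2" by (auto simp: eventually_sequentially)
  define v where "v = w * q powi (- int e)"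
  have v: "v * q \<notin> qpowers q"
  proof -
    have "v * q = w * q powi (- int e + 1)" unfolding v_def using q_nz power_int_add[of q "- int e" 1] by simp
    thus ?thesis using w by (simp only: qpowers_cancel not_False_eq_True)
  qed
  define T where "T n = (\<Prod>i<n. 1 - v * q * q ^ i)" for n
  have T0: "T n \<noteq> 0" for n
  proof
    assume "T n = 0"
    hence "qp (v * q) = 0" using qp_split[of "v * q" n] by (simp add: T_def)
    thus False using v not_qpowers_qp by blast
  qed
  have "T \<longlonglongrightarrow> qp (v * q)" unfolding T_def by (rule qp_tendsto)
  hence "(\<lambda>n. inverse (T n)) \<longlonglongrightarrow> inverse (qp (v * q))"
    using v not_qpowers_qp by (intro tendsto_inverse) auto
  hence "Bseq (\<lambda>n. inverse (T n))" by (intro convergent_imp_Bseq) (auto simp: convergent_def)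
  then obtain C where C: "C > 0" "\<And>n. norm (inverse (T n)) \<le> C" by (auto simp: Bseq_def)
  have TC: "1 / C \<le> norm (T n)" for n
    using C(2)[of n] C(1) T0[of n] unfolding norm_inverse by (simp add: field_simps)
  define c where "c = min 1 (1 / C)"
  have c: "c > 0" "c \<le> 1" "c \<le> norm (T n)" for n using C(1) TC[of n] by (auto simp: c_def)
  show ?thesis
  proof (rule that[OF c(1)])
    fix M n :: nat assume M: "M \<ge> e" and n: "n \<ge> 1"
    define y where "y = w * q powi (- int M)"
    define f where "f i = 1 - y * q ^ i" for i
    have big: "1 \<le> norm (f i)" if "i \<le> M - e" for i
    proof -
      have "y * q ^ i = w * q powi (- int (M - i))"
        using that M q_nz by (simp add: y_def power_int_diff power_int_minus of_nat_diff field_simps)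
      hence "norm (y * q ^ i) = norm w / norm q ^ (M - i)"
        by (simp add: norm_mult norm_power_int power_int_minus norm_inverse norm_power norm_divide field_simps)
      also have "\<dots> \<ge> 2"
      proof -
        have "norm q ^ (M - i) \<le> norm q ^ e" using that M nq by (intro power_decreasing) auto
        also note e
        finally show ?thesis using nq by (simp add: field_simps)
      qed
      finally have "2 \<le> norm (y * q ^ i)" .
      thus ?thesis unfolding f_def using norm_triangle_ineq2[of "y * q ^ i" 1] by (simp add: norm_minus_commute)
    qed
    have head: "norm (f 0) \<le> norm (\<Prod>i<m. f i)" if m1: "m \<ge> 1" "m \<le> M - e + 1" for m
    proof -
      obtain m' where m': "m = Suc m'" using m1 by (cases m) auto
      have "1 \<le> norm (\<Prod>i<m'. f (Suc i))"
        unfolding prod_norm[symmetric] using big m1 m' by (intro prod_ge_1) auto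
      hence "norm (f 0) * 1 \<le> norm (f 0) * norm (\<Prod>i<m'. f (Suc i))" by (intro mult_left_mono) auto
      thus ?thesis unfolding m' prod.lessThan_Suc_shift by (simp add: norm_mult)
    qed
    have "c * norm (f 0) \<le> norm (\<Prod>i<n. f i)"
    proof (cases "n \<le> M - e + 1")
      case True
      have "c * norm (f 0) \<le> 1 * norm (f 0)" using c by (intro mult_right_mono) auto
      thus ?thesis using head[OF n True] by simp
    next
      case False
      define r where "r = n - (M - e + 1)"
      have n': "n = (M - e + 1) + r" using False by (simp add: r_def)
      have "f (M - e + 1 + i) = 1 - v * q * q ^ i" for i
      proof -
        have "y * q ^ (M - e + 1 + i) = v * q * q ^ i"
          using M q_nz by (simp add: y_def v_def power_add power_int_minus field_simps flip: power_add)
        thus ?thesis by (simp add: f_def)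
      qed
      hence "(\<Prod>i<n. f i) = (\<Prod>i<M - e + 1. f i) * T r"
        unfolding n' T_def by (subst prod_lessThan_add) simp
      hence "norm (\<Prod>i<n. f i) = norm (\<Prod>i<M - e + 1. f i) * norm (T r)" by (simp add: norm_mult)
      also have "\<dots> \<ge> norm (f 0) * c" using head[of "M - e + 1"] c by (intro mult_mono) auto
      finally show ?thesis by (simp add: mult.commute)
    qed
    thus "c * norm (1 - w * q powi (- int M)) \<le> norm (\<Prod>i<n. 1 - w * q powi (- int M) * q ^ i)"
      by (simp add: f_def y_def)
  qed
qed

lemma inverse_one_minus_tendsto_0:
  assumes "w \<noteq> 0"
  shows "(\<lambda>M. inverse (1 - w * q powi (- int M))) \<longlonglongrightarrow> 0"
proof -
  have "(\<lambda>M. 1 * q ^ M / (1 * q ^ M - w)) \<longlonglongrightarrow> 0 / (0 - w)"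
    using assms by (intro tendsto_divide tendsto_diff tendsto_const q_power_tendsto_0) auto
  moreover have "1 * q ^ M / (1 * q ^ M - w) = inverse (1 - w * q powi (- int M))" for M
  proof -
    have "q ^ M * (1 - w * q powi (- int M)) = q ^ M - w"
      using q_nz by (simp add: power_int_minus field_simps)
    hence "1 * q ^ M / (1 * q ^ M - w) = q ^ M / (q ^ M * (1 - w * q powi (- int M)))" by simp
    thus ?thesis using q_nz by (simp add: divide_inverse)
  qed
  ultimately show ?thesis by simp
qed

text \<open>Below, \<open>n\<close> is a summation index and \<open>M\<close> the size of a shift of the parameters.\<close>

definition bd :: "(nat \<Rightarrow> nat \<Rightarrow> complex) \<Rightarrow> bool" where
  "bd F \<longleftrightarrow> (\<exists>C. \<forall>n M. norm (F n M) \<le> C)"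

lemma bd_const: "bd (\<lambda>n M. c)" by (auto simp: bd_def)

lemma bd_mult: assumes "bd F" "bd G" shows "bd (\<lambda>n M. F n M * G n M)"
proof -
  obtain C D where "\<And>n M. norm (F n M) \<le> C" "\<And>n M. norm (G n M) \<le> D" using assms by (auto simp: bd_def)
  hence "norm (F n M * G n M) \<le> C * D" for n M
    unfolding norm_mult by (intro mult_mono) (auto intro: order_trans[OF norm_ge_zero])
  thus ?thesis by (auto simp: bd_def)
qed

lemma bd_prod: "finite A \<Longrightarrow> (\<And>i. i \<in> A \<Longrightarrow> bd (F i)) \<Longrightarrow> bd (\<lambda>n M. \<Prod>i\<in>A. F i n M)"
  by (induction A rule: finite_induct) (auto intro: bd_mult bd_const)

lemma bd_diff_sq: assumes "bd F" shows "bd (\<lambda>n M. 1 - (F n M)^2)"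
proof -
  obtain C where C: "\<And>n M. norm (F n M) \<le> C" using assms by (auto simp: bd_def)
  have "norm (1 - (F n M)^2) \<le> 1 + C^2" for n M
    using norm_triangle_ineq4[of 1 "(F n M)^2"] power_mono[OF C[of n M], of 2] by (simp add: norm_power)
  thus ?thesis by (auto simp: bd_def)
qed

lemma powi_nonneg: "e \<ge> 0 \<Longrightarrow> q powi e = q ^ nat e"
  by (metis nat_0_le power_int_of_nat)

lemma bd_powi: assumes "\<And>n M. e n M \<ge> 0" shows "bd (\<lambda>n M. a * q powi e n M)"
proof -
  have "norm (a * q powi e n M) \<le> norm a" for n M
    using norm_q assms[of n M] by (simp add: powi_nonneg norm_mult norm_power mult_left_le power_le_one)
  thus ?thesis by (auto simp: bd_def)
qed

lemma bd_qp: assumes "\<And>n M. e n M \<ge> 0" shows "bd (\<lambda>n M. qp (a * q powi e n M))"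
proof -
  have "(\<lambda>n. qp (a * q ^ n)) \<longlonglongrightarrow> qp 0" by (intro tendsto_intros q_power_tendsto_0)
  hence "Bseq (\<lambda>n. qp (a * q ^ n))" by (intro convergent_imp_Bseq) (auto simp: convergent_def)
  then obtain C where "\<And>n. norm (qp (a * q ^ n)) \<le> C" by (auto simp: Bseq_def)
  hence "norm (qp (a * q powi e n M)) \<le> C" for n M using powi_nonneg[OF assms[of n M]] by simp
  thus ?thesis by (auto simp: bd_def)
qed

lemma bd_inv_qp: assumes "a \<notin> qpowers q" "\<And>n M. e n M \<ge> 0" shows "bd (\<lambda>n M. inverse (qp (a * q powi e n M)))"
proof -
  have "(\<lambda>n. inverse (qp (a * q ^ n))) \<longlonglongrightarrow> inverse (qp 0)" by (intro tendsto_intros q_power_tendsto_0) simp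
  hence "Bseq (\<lambda>n. inverse (qp (a * q ^ n)))" by (intro convergent_imp_Bseq) (auto simp: convergent_def)
  then obtain C where "\<And>n. norm (inverse (qp (a * q ^ n))) \<le> C" by (auto simp: Bseq_def)
  hence "norm (inverse (qp (a * q powi e n M))) \<le> C" for n M using powi_nonneg[OF assms(2)[of n M]] by simp
  thus ?thesis by (auto simp: bd_def)
qed

lemma q_powi_tendsto_0: assumes "e \<ge> (1::int)" shows "(\<lambda>M. a * q powi (int M * e)) \<longlonglongrightarrow> 0"
proof -
  have "q powi (int M * e) = (q ^ nat e) ^ M" for M
    using assms powi_nonneg[of "int M * e"] by (simp add: nat_mult_distrib power_mult[symmetric] mult.commute)
  moreover have "norm (q ^ nat e) < 1" using assms norm_q by (simp add: norm_power power_less_one_iff)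
  hence "(\<lambda>M. a * (q ^ nat e) ^ M) \<longlonglongrightarrow> 0" using tendsto_mult_right_zero[OF LIMSEQ_power_zero] by blast
  ultimately show ?thesis by simp
qed

lemma qp_powi_tendsto_1: assumes "e \<ge> (1::int)" shows "(\<lambda>M. qp (a * q powi (int M * e))) \<longlonglongrightarrow> 1"
  using qp_tendsto_compose[OF q_powi_tendsto_0[OF assms], of a] by simp

lemma Gf_antisym: assumes "b k \<noteq> 0" "b l \<noteq> 0" shows "Gf b l k = - Gf b k l"
proof -
  have "th (b k / b l) = - th (b l / b k) / (b l / b k)" using th_inverse[of "b l / b k"] assms by simp
  hence "b l * th (b k / b l) = - (b k * th (b l / b k))" using assms by simp
  hence "- qp q * b l * th (b k / b l) = - (- qp q * b k * th (b l / b k))" by (metis mult.assoc mult_minus_right)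
  moreover have "(\<Prod>j\<in>I6-{l,k}. th (b j * b l) * th (b j * b k)) = (\<Prod>j\<in>I6-{k,l}. th (b j * b k) * th (b j * b l))"
    by (rule prod.cong) (auto simp: insert_commute)
  moreover have "th (b l * b k) = th (b k * b l)" by (simp add: mult.commute)
  ultimately show ?thesis unfolding Gf_def by simp
qed

text \<open>
  What remains of a summand, divided by \<open>Hf b k l\<close>, when the power \<open>q\<^sup>n\<close> and the factors that contain
  \<open>b\<^sub>k / b\<^sub>l\<close> are split off. After the shifts in \<open>nonterminating_jackson\<close> the latter contain growing
  powers of \<open>q\<^sup>-\<^sup>1\<close>.
\<close>

definition jt :: "(nat \<Rightarrow> complex) \<Rightarrow> nat \<Rightarrow> nat \<Rightarrow> nat \<Rightarrow> complex" where
  "jt b k l n = (1 - (b k * q ^ n)^2) * (qp (q * q ^ n) * inverse (qp q)) *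
     (\<Prod>j\<in>I6-{k,l}. qp (q * (b k / b j) * q ^ n)) *
     (qp (b k * b l) * (\<Prod>j\<in>I6-{k,l}. qp (b k * b j) * qp (b l * b j))) *
     (inverse (qp (b k * b k * q ^ n)) * inverse (qp (b k * b l * q ^ n)) * (\<Prod>j\<in>I6-{k,l}. inverse (qp (b k * b j * q ^ n)))) *
     (\<Prod>i\<in>I6-{k,l}. \<Prod>j\<in>{j\<in>I6-{k,l}. i < j}. inverse (qp (q / (b i * b j))))"

lemma Xf_over_Hf:
  assumes gen: "generic b" and kl: "k \<in> I6" "l \<in> I6" "k \<noteq> l"
  shows "Xf b (b k * q ^ n) / Hf b k l = q ^ n * jt b k l n * (qp (q * (b k / b l) * q ^ n) / th (b l / b k))"
proof -
  let ?O = "I6 - {k,l}" and ?u = "b k * q ^ n"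
  have b0: "b j \<noteq> 0" if "j \<in> I6" for j using genericD(1)[OF gen that that] .
  have nz1: "qp (b i * b j) \<noteq> 0" if "i \<in> I6" "j \<in> I6" for i j
    using not_qpowers_qp[OF genericD(3)[OF gen that]] .
  have nz2: "qp (q / (b i * b j)) \<noteq> 0" if "i \<in> I6" "j \<in> I6" for i j
    using not_qpowers_qp[OF generic_inv_qpowers[OF gen that]] .
  have nzth: "th (b l / b k) \<noteq> 0" using genericD(2)[OF gen kl(2,1)] b0 kl by (intro th_nz) auto
  define P3 where "P3 = (\<Prod>i\<in>?O. \<Prod>j\<in>{j\<in>?O. i < j}. inverse (qp (q / (b i * b j))))"
  have P3: "pair_prod ?O (\<lambda>i j. qp (q / (b i * b j))) = inverse P3"
    unfolding P3_def pair_prod_def by (simp add: prod_inversef[symmetric])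
  define A where "A = (\<Prod>j\<in>?O. qp (q / (b k * b j)))"
  define B where "B = (\<Prod>j\<in>?O. qp (q / (b l * b j)))"
  define C where "C = (\<Prod>j\<in>?O. qp (b k * b j))"
  define D where "D = (\<Prod>j\<in>?O. qp (b l * b j))"
  have ABCD: "A \<noteq> 0" "B \<noteq> 0" "C \<noteq> 0" "D \<noteq> 0" using nz1 nz2 kl by (auto simp: A_def B_def C_def D_def prod_zero_iff)
  have P30: "P3 \<noteq> 0" using nz2 by (auto simp: P3_def prod_zero_iff)
  have Pp: "Pp b = qp (q / (b k * b l)) * A * B * inverse P3"
    unfolding Pp_def A_def B_def P3[symmetric] using kl by (intro pair_prod_remove2_I6) (auto simp: mult.commute)
  have th: "th (b k * b l) = qp (b k * b l) * qp (q / (b k * b l))" by (simp add: th_def)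
  have thO: "(\<Prod>j\<in>?O. th (b j * b k) * th (b j * b l)) = C * A * (D * B)"
    unfolding A_def B_def C_def D_def prod.distrib[symmetric] by (intro prod.cong) (auto simp: th_def mult_ac)
  have H: "Hf b k l = - (qp q * b k * th (b l / b k)) / (qp (b k * b l) * (C * D) * P3)"
    unfolding Hf_def Gf_def Pp th thO using ABCD nz2[OF kl(1,2)] by (simp add: field_simps)
  define X1 where "X1 = (\<Prod>j\<in>?O. qp (q * (b k / b j) * q ^ n))"
  define X2 where "X2 = (\<Prod>j\<in>?O. inverse (qp (b k * b j * q ^ n)))"
  have "(\<Prod>j\<in>?O. qp (q * ?u / b j) / qp (b j * ?u)) = X1 * X2"
    unfolding X1_def X2_def prod.distrib[symmetric] by (intro prod.cong) (auto simp: field_simps)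
  hence X: "Xf b ?u = - ?u * (1 - ?u^2) * (qp (q * q ^ n) / qp (b k * b k * q ^ n) * (qp (q * (b k / b l) * q ^ n) / qp (b k * b l * q ^ n)) * (X1 * X2))"
    unfolding Xf_def using b0[OF kl(1)]
    by (subst prod_I6_remove2[OF kl]) (simp add: mult_ac)
  have J: "jt b k l n = (1 - ?u^2) * (qp (q * q ^ n) * inverse (qp q)) * X1 * (qp (b k * b l) * (C * D)) *
     (inverse (qp (b k * b k * q ^ n)) * inverse (qp (b k * b l * q ^ n)) * X2) * P3"
    unfolding jt_def X1_def X2_def C_def D_def P3_def prod.distrib ..
  have ring: "- (bk * Q) * v * (a / d * (e / f) * (X1 * X2)) / (- (qq * bk * t) / (g * (C * D) * P3)) =
     Q * (v * (a * inverse qq) * X1 * (g * (C * D)) * (inverse d * inverse f * X2) * P3) * (e / t)"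
    if "bk \<noteq> 0" for bk Q v a d e f X1 X2 qq t g C D P3 :: complex
    using that by (simp add: divide_simps)
  show ?thesis unfolding X H J using ring[OF b0[OF kl(1)], of "q ^ n" "1 - ?u^2" "qp (q*q^n)" "qp (b k * b k * q ^ n)" "qp (q * (b k / b l) * q ^ n)" "qp (b k * b l * q ^ n)" X1 X2 "qp q" "th (b l / b k)" "qp (b k * b l)" C D P3] by (simp only:)
qed

lemma shiftp_mult: "shiftp b e i * shiftp b e j = b i * b j * q powi (e i + e j)"
  using q_nz by (simp add: shiftp_def power_int_add)

lemma shiftp_div: "shiftp b e i / shiftp b e j = b i / b j * q powi (e i - e j)"
  using q_nz by (simp add: shiftp_def power_int_diff)

lemma powi_mult_pow: "x * q powi m * q ^ n = x * q powi (m + int n)"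
  using q_nz by (simp add: power_int_add)

lemma div_powi: "q / (x * q powi m) = q / x * q powi (- m)"
  using q_nz by (simp add: power_int_minus field_simps)

lemma jt_shiftp:
  "jt (shiftp b e) k l n = (1 - (b k * q powi (e k + int n))^2) * (qp (q * q powi (int n)) * inverse (qp q)) *
     (\<Prod>j\<in>I6-{k,l}. qp (q * (b k / b j) * q powi (e k - e j + int n))) *
     (qp (b k * b l * q powi (e k + e l)) *
        (\<Prod>j\<in>I6-{k,l}. qp (b k * b j * q powi (e k + e j)) * qp (b l * b j * q powi (e l + e j)))) *
     (inverse (qp (b k * b k * q powi (e k + e k + int n))) * inverse (qp (b k * b l * q powi (e k + e l + int n))) *
        (\<Prod>j\<in>I6-{k,l}. inverse (qp (b k * b j * q powi (e k + e j + int n))))) *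
     (\<Prod>i\<in>I6-{k,l}. \<Prod>j\<in>{j\<in>I6-{k,l}. i < j}. inverse (qp (q / (b i * b j) * q powi (- (e i + e j)))))"
proof -
  have 1: "shiftp b e k * q ^ n = b k * q powi (e k + int n)" by (simp add: shiftp_def powi_mult_pow)
  have 2: "q * (shiftp b e k / shiftp b e j) * q ^ n = q * (b k / b j) * q powi (e k - e j + int n)" for j
    unfolding shiftp_div powi_mult_pow[symmetric] by (simp only: mult.assoc)
  show ?thesis unfolding jt_def 1 2 shiftp_mult powi_mult_pow div_powi by simp
qed

text \<open>The direction \<open>d\<close> makes all exponents of \<open>q\<close> non-negative.\<close>

lemma jt_bd:
  assumes gen: "generic b" and kl: "k \<in> I6" "l \<in> I6"
    and d: "d k \<ge> 1" "d l \<ge> 1" "\<And>j. j \<in> I6 - {k,l} \<Longrightarrow> d j = 0 \<or> d j = -1"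
  shows "bd (\<lambda>n M. jt (shiftp b (\<lambda>j. int M * d j)) k l n)"
proof -
  have dd: "-1 \<le> d j \<and> d j \<le> 0" if "j \<in> I6 - {k,l}" for j using d(3)[OF that] by auto
  have nn: "0 \<le> int M * d k" "0 \<le> int M * d l" for M using d by auto
  have sum2: "0 \<le> int M * d i + int M * d j" if "0 \<le> d i + d j" for M i j
    using mult_nonneg_nonneg[OF _ that, of "int M"] by (simp add: distrib_left)
  have sum2': "int M * d i + int M * d j \<le> 0" if "d i + d j \<le> 0" for M i j
    using mult_nonneg_nonpos[OF _ that, of "int M"] by (simp add: distrib_left)
  have diff2: "0 \<le> int M * d i - int M * d j" if "d j \<le> d i" for M i j
    using mult_left_mono[OF that, of "int M"] by simp
  note g = genericD(3)[OF gen] generic_inv_qpowers[OF gen]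
  show ?thesis
    unfolding jt_shiftp
  proof (intro bd_mult bd_prod bd_const bd_diff_sq)
    show "bd (\<lambda>n M. q powi (int M * d k + int n))" using nn bd_powi[of "\<lambda>n M. int M * d k + int n" 1] by simp
    show "bd (\<lambda>n M. qp (q * q powi int n))" by (intro bd_qp) simp
    show "bd (\<lambda>n M. qp (q * (b k / b j) * q powi (int M * d k - int M * d j + int n)))"
      if "j \<in> I6 - {k,l}" for j
      using diff2[of j k] dd[OF that] d by (intro bd_qp add_nonneg_nonneg) auto
    show "bd (\<lambda>n M. qp (b k * b l * q powi (int M * d k + int M * d l)))" using nn by (intro bd_qp) simp
    show "bd (\<lambda>n M. qp (b k * b j * q powi (int M * d k + int M * d j)))" if "j \<in> I6 - {k,l}" for j
      using sum2[of k j] dd[OF that] d by (intro bd_qp) auto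
    show "bd (\<lambda>n M. qp (b l * b j * q powi (int M * d l + int M * d j)))" if "j \<in> I6 - {k,l}" for j
      using sum2[of l j] dd[OF that] d by (intro bd_qp) auto
    show "bd (\<lambda>n M. inverse (qp (b k * b k * q powi (int M * d k + int M * d k + int n))))"
      using nn kl by (intro bd_inv_qp g) auto
    show "bd (\<lambda>n M. inverse (qp (b k * b l * q powi (int M * d k + int M * d l + int n))))"
      using nn kl by (intro bd_inv_qp g) auto
    show "bd (\<lambda>n M. inverse (qp (b k * b j * q powi (int M * d k + int M * d j + int n))))"
      if "j \<in> I6 - {k,l}" for j
    proof (intro bd_inv_qp g)
      have "0 \<le> d k + d j" using dd[OF that] d by simp
      thus "0 \<le> int M * d k + int M * d j + int n" for n M using sum2[of k j M] by simp
    qed (use that kl in auto)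
    show "bd (\<lambda>n M. inverse (qp (q / (b i * b j) * q powi - (int M * d i + int M * d j))))"
      if "i \<in> I6 - {k,l}" "j \<in> {j \<in> I6 - {k,l}. i < j}" for i j
    proof (intro bd_inv_qp g)
      have "d i + d j \<le> 0" using dd[of i] dd[of j] that by auto
      show "0 \<le> - (int M * d i + int M * d j)" for M using sum2'[OF \<open>d i + d j \<le> 0\<close>, of M] by linarith
    qed (use that in auto)
  qed auto
qed

text \<open>
  The factors with exponent \<open>d\<^sub>k + d\<^sub>j\<close>, which may be 0, cancel for \<open>n = 0\<close>; the exponents that remain
  grow with \<open>M\<close>.
\<close>

lemma jt_0_tendsto:
  assumes gen: "generic b" and kl: "k \<in> I6" "l \<in> I6"
    and d: "d k = 1" "d l = 2" "\<And>j. j \<in> I6 - {k,l} \<Longrightarrow> d j = 0 \<or> d j = -1"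
    and dij: "\<And>i j. i \<in> I6 - {k,l} \<Longrightarrow> j \<in> I6 - {k,l} \<Longrightarrow> i \<noteq> j \<Longrightarrow> d i + d j \<le> -1"
  shows "(\<lambda>M. jt (shiftp b (\<lambda>j. int M * d j)) k l 0) \<longlonglongrightarrow> 1"
proof -
  have eq: "jt (shiftp b (\<lambda>j. int M * d j)) k l 0 = (1 - (b k * q powi (int M * 1))^2) *
     (\<Prod>j\<in>I6-{k,l}. qp (q * (b k / b j) * q powi (int M * (1 - d j)))) *
     (\<Prod>j\<in>I6-{k,l}. qp (b l * b j * q powi (int M * (2 + d j)))) *
     inverse (qp (b k * b k * q powi (int M * 2))) *
     (\<Prod>i\<in>I6-{k,l}. \<Prod>j\<in>{j\<in>I6-{k,l}. i < j}. inverse (qp (q / (b i * b j) * q powi (int M * (- (d i + d j))))))" for M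
  proof -
    have nz: "qp (b i * b j * q powi e) \<noteq> 0" if "i \<in> I6" "j \<in> I6" for i j e
      using genericD(3)[OF gen that] by (intro not_qpowers_qp) (simp only: qpowers_cancel not_False_eq_True)
    define A where "A = (\<Prod>j\<in>I6-{k,l}. qp (b k * b j * q powi (int M * (1 + d j))))"
    have A: "A \<noteq> 0" using nz kl by (auto simp: A_def prod_zero_iff)
    have ring: "v * (Q * inverse Q) * x * (f * (A * y)) * (z * inverse f * inverse A) * p = v * x * y * z * p"
      if "f \<noteq> 0" "Q \<noteq> 0" for v Q x f y z p :: complex using A that by (simp add: field_simps)
    have ex: "int M * d k + int M * d j = int M * (1 + d j)" "int M * d l + int M * d j = int M * (2 + d j)"
        "int M * d k - int M * d j = int M * (1 - d j)" "int M * d k + int M * d k = int M * 2"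
        "- (int M * d i + int M * d j) = int M * (- (d i + d j))" for i j
      using d by (auto simp: algebra_simps)
    show ?thesis
      unfolding jt_shiftp ex prod.distrib of_nat_0 add_0_right prod_inversef[of "\<lambda>j. qp (b k * b j * q powi (int M * (1 + d j)))", unfolded o_def]
        A_def[symmetric] power_int_0_right mult_1_right
      using ring[OF nz[OF kl] qp_q_nz] d by (simp only: mult_1_right one_add_one)
  qed
  have dd: "-1 \<le> d j \<and> d j \<le> 0" if "j \<in> I6 - {k,l}" for j using d(3)[OF that] by auto
  have "(\<lambda>M. jt (shiftp b (\<lambda>j. int M * d j)) k l 0) \<longlonglongrightarrow> (1 - 0^2) * (\<Prod>j\<in>I6-{k,l}. 1) * (\<Prod>j\<in>I6-{k,l}. 1) * inverse 1 *
      (\<Prod>i\<in>I6-{k,l}. \<Prod>j\<in>{j\<in>I6-{k,l}. i < j}. inverse 1)"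
    unfolding eq
  proof (intro tendsto_mult tendsto_prod tendsto_inverse tendsto_diff tendsto_power tendsto_const q_powi_tendsto_0 qp_powi_tendsto_1)
    fix j assume j: "j \<in> I6 - {k,l}"
    show "1 \<le> 1 - d j" "1 \<le> 2 + d j" using dd[OF j] by auto
  next
    fix i j assume "i \<in> I6 - {k,l}" "j \<in> {j \<in> I6 - {k,l}. i < j}"
    thus "1 \<le> - (d i + d j)" using dij[of i j] by auto
  qed auto
  thus ?thesis by simp
qed

text \<open>
  By \<open>njq_move\<close> the quotient of the two sides does not change when the parameters are multiplied by
  \<open>q\<^bsup>M d\<^sub>j\<^esup>\<close> with \<open>d\<close> of sum 0. For \<open>d\<^sub>k = 1\<close>, \<open>d\<^sub>l = 2\<close>, the value \<open>-1\<close> at three of the other indices and 0 at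
  the last one, the first term of the series for \<open>k\<close> dominates as \<open>M\<close> grows, and the quotient tends
  to 1.
\<close>

theorem nonterminating_jackson:
  assumes gen: "generic b" and kl: "k \<in> I6" "l \<in> I6" "k \<noteq> l" and b1: "(\<Prod>m\<in>I6. b m) = q"
  shows "xs b k - xs b l = Hf b k l"
proof -
  obtain m j1 j2 j3 where O4: "I6 - {k,l} = {m, j1, j2, j3}" and dist: "distinct [m, j1, j2, j3]"
    using card_4_obtain[OF card_I6_remove2[OF kl]] by blast
  have inO: "m \<in> I6 - {k,l}" "j1 \<in> I6 - {k,l}" "j2 \<in> I6 - {k,l}" "j3 \<in> I6 - {k,l}" unfolding O4 by auto
  define d :: "nat \<Rightarrow> int" where
    "d x = (if x = k then 1 else if x = l then 2 else if x = j1 \<or> x = j2 \<or> x = j3 then -1 else 0)" for x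
  have d: "d k = 1" "d l = 2" "\<And>j. j \<in> I6 - {k,l} \<Longrightarrow> d j = 0 \<or> d j = -1"
      "\<And>i j. i \<in> I6 - {k,l} \<Longrightarrow> j \<in> I6 - {k,l} \<Longrightarrow> i \<noteq> j \<Longrightarrow> d i + d j \<le> -1"
  proof -
    have dO: "d j = (if j = m then 0 else -1)" if "j \<in> I6 - {k,l}" for j
    proof -
      have "j \<noteq> k" "j \<noteq> l" "j = m \<or> j = j1 \<or> j = j2 \<or> j = j3" using that O4 by blast+
      thus ?thesis using dist by (auto simp: d_def)
    qed
    show "d k = 1" "d l = 2" using kl by (auto simp: d_def)
    show "d j = 0 \<or> d j = -1" if "j \<in> I6 - {k,l}" for j using dO[OF that] by auto
    show "d i + d j \<le> -1" if "i \<in> I6 - {k,l}" "j \<in> I6 - {k,l}" "i \<noteq> j" for i j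
      using dO[OF that(1)] dO[OF that(2)] that(3) by auto
  qed
  define B where "B M = shiftp b (\<lambda>j. int M * d j)" for M
  have genB: "generic (B M)" for M unfolding B_def by (rule generic_shiftp[OF gen])
  \<comment> \<open>The shift by \<open>M d\<close> is composed of three moves as in \<open>njq_move\<close>: two raise the parameter \<open>l\<close>, one raises \<open>k\<close>.\<close>
  have inv: "njq (B M) k l = njq b k l" for M
  proof -
    define mv :: "nat \<Rightarrow> nat \<Rightarrow> nat \<Rightarrow> int" where
      "mv i j = (\<lambda>x. if x = i then int M else if x = j then - int M else 0)" for i j
    have sum0: "(\<Sum>x\<in>I6. mv i j x) = 0" if "i \<in> I6" "j \<in> I6" "i \<noteq> j" for i j
    proof -
      have "(\<Sum>x\<in>I6. mv i j x) = (\<Sum>x\<in>I6. (if x = i then int M else 0) + (if x = j then - int M else 0))"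
        using that by (intro sum.cong) (auto simp: mv_def)
      thus ?thesis using that by (simp add: sum.distrib)
    qed
    have mvinv: "njq (shiftp c (mv i j)) k l = njq c k l \<and> generic (shiftp c (mv i j)) \<and> (\<Prod>x\<in>I6. shiftp c (mv i j) x) = q"
      if "i \<in> I6" "j \<in> I6" "i \<noteq> j" "generic c" "(\<Prod>x\<in>I6. c x) = q" for i j c
      using njq_move[OF that(1-3) kl that(4,5), of M] generic_shiftp[OF that(4)] sum0[OF that(1-3)] that(5)
      by (simp add: mv_def[symmetric] prod_shiftp)
    define c1 where "c1 = shiftp b (mv l j1)"
    define c2 where "c2 = shiftp c1 (mv l j2)"
    define c3 where "c3 = shiftp c2 (mv k j3)"
    have c1: "njq c1 k l = njq b k l" "generic c1" "(\<Prod>x\<in>I6. c1 x) = q"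
      using mvinv[of l j1 b] gen b1 kl inO unfolding c1_def by auto
    have c2: "njq c2 k l = njq b k l" "generic c2" "(\<Prod>x\<in>I6. c2 x) = q"
      using mvinv[of l j2 c1] c1 kl inO unfolding c2_def by auto
    have c3: "njq c3 k l = njq b k l"
      using mvinv[of k j3 c2] c2 kl inO unfolding c3_def by auto
    have "c3 = B M"
      unfolding c3_def c2_def c1_def B_def shiftp_shiftp using kl inO dist
      by (intro arg_cong[of _ _ "shiftp b"] ext) (auto simp: mv_def d_def)
    thus ?thesis using c3 by simp
  qed
  \<comment> \<open>After the shift \<open>b\<^sub>k / b\<^sub>l\<close> is \<open>w q\<^bsup>-M\<^esup>\<close>, which grows with \<open>M\<close>.\<close>
  define w where "w = b k / b l"
  have b0: "b j \<noteq> 0" if "j \<in> I6" for j using genericD(1)[OF gen that that] .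
  have w: "w \<notin> qpowers q" "w \<noteq> 0" using genericD(2)[OF gen kl] b0 kl by (auto simp: w_def)
  have w': "inverse w \<notin> qpowers q" using w by (simp add: qpowers_inverse_iff)
  have qw: "q * w \<notin> qpowers q" "q * w \<noteq> 0" using qpowers_cancel[of w 1] w q_nz by (auto simp: mult.commute)
  have qw': "q * inverse w \<notin> qpowers q" using qpowers_cancel[of "inverse w" 1] w' q_nz by (auto simp: mult.commute)
  have Bkl: "B M k / B M l = w * q powi (- int M)" "B M l / B M k = inverse w * q powi (int M)" for M
    using d by (simp_all add: B_def shiftp_div w_def)
  have bdO: "bd (\<lambda>n M. jt (B M) k l n)" "bd (\<lambda>n M. jt (B M) l k n)"
    unfolding B_def using jt_bd[OF gen kl(1,2)] jt_bd[OF gen kl(2,1)] d by (auto simp: insert_commute)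
  have nq: "0 < norm q" "norm q < 1" using q_nz norm_q by auto
  have geo: "summable (\<lambda>n. K * norm q ^ n * D)" "(\<Sum>n. K * norm q ^ n * D) = K / (1 - norm q) * D" for K D :: real
  proof -
    have s: "summable (\<lambda>n. norm q ^ n)" using nq by (intro summable_geometric) auto
    show "summable (\<lambda>n. K * norm q ^ n * D)" by (intro summable_mult2 summable_mult s)
    have "(\<Sum>n. K * norm q ^ n * D) = K * (\<Sum>n. norm q ^ n) * D"
      by (simp only: suminf_mult2[OF summable_mult[OF s], symmetric] suminf_mult[OF s])
    also have "(\<Sum>n. norm q ^ n) = 1 / (1 - norm q)" using nq by (intro suminf_geometric) auto
    finally show "(\<Sum>n. K * norm q ^ n * D) = K / (1 - norm q) * D" by simp
  qed
  have lim1: "(\<lambda>M. xs (B M) k / Hf (B M) k l) \<longlonglongrightarrow> 1"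
  proof -
    obtain c M0 where c: "c > 0" "\<And>M n. M \<ge> M0 \<Longrightarrow> n \<ge> 1 \<Longrightarrow>
      c * norm (1 - q * w * q powi (- int M)) \<le> norm (\<Prod>i<n. 1 - q * w * q powi (- int M) * q ^ i)"
      using poch_lower[OF qw] by blast
    define R where "R n M = qp (q * (B M k / B M l) * q ^ n) / th (B M l / B M k)" for n M
    have R: "R n M = inverse (qp (inverse w * q powi int M)) * inverse (\<Prod>i<n. 1 - q * w * q powi (- int M) * q ^ i)" for n M
    proof -
      have "q / (inverse w * q powi int M) = q * w * q powi (- int M)"
        using q_nz w by (simp add: power_int_minus field_simps)
      hence "th (B M l / B M k) = qp (inverse w * q powi int M) * qp (q * w * q powi (- int M))"
        unfolding Bkl th_def by simp
      also have "qp (q * w * q powi (- int M)) =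
          (\<Prod>i<n. 1 - q * w * q powi (- int M) * q ^ i) * qp (q * w * q powi (- int M) * q ^ n)" by (rule qp_split)
      finally have t: "th (B M l / B M k) = qp (inverse w * q powi int M) *
         ((\<Prod>i<n. 1 - q * w * q powi (- int M) * q ^ i) * qp (q * w * q powi (- int M) * q ^ n))" .
      have nz: "qp (q * w * q powi (- int M) * q ^ n) \<noteq> 0"
        using qw by (intro not_qpowers_qp) (simp only: powi_mult_pow qpowers_cancel not_False_eq_True)
      have "q * (B M k / B M l) * q ^ n = q * w * q powi (- int M) * q ^ n"
        unfolding Bkl by (simp only: mult.assoc)
      moreover have "Q / (x * (y * Q)) = inverse x * inverse y" if "Q \<noteq> 0" for Q x y :: complex
        using that by (simp add: field_simps)
      ultimately show ?thesis unfolding R_def t using nz by (simp only: not_False_eq_True)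
    qed
    have "bd (\<lambda>n M. jt (B M) k l n * inverse (qp (inverse w * q powi int M)))"
      using w' by (intro bd_mult bdO bd_inv_qp) auto
    then obtain C where C: "\<And>n M. norm (jt (B M) k l n * inverse (qp (inverse w * q powi int M))) \<le> C"
      by (auto simp: bd_def)
    have C0: "C \<ge> 0" using C[of 0 0] norm_ge_zero order_trans by blast
    define T where "T n M = q ^ n * jt (B M) k l n * R n M" for n M
    define del where "del M = norm (inverse (1 - q * w * q powi (- int M)))" for M
    \<comment> \<open>By \<open>poch_lower\<close>, all terms except the first are bounded by multiples of \<open>1 / (1 - q w q\<^bsup>-M\<^esup>)\<close>, which tends to 0.\<close>
    have bound: "norm (T (Suc n) M) \<le> C / c * norm q ^ n * del M" if M: "M \<ge> M0" for n M
    proof -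
      let ?P = "\<Prod>i<Suc n. 1 - q * w * q powi (- int M) * q ^ i"
      have y: "1 - q * w * q powi (- int M) \<noteq> 0"
      proof
        assume "1 - q * w * q powi (- int M) = 0"
        hence "q * w * q powi (- int M) \<in> qpowers q" by simp
        thus False using qw by (simp only: qpowers_cancel)
      qed
      have "0 < c * norm (1 - q * w * q powi (- int M))" using c y by simp
      hence "inverse (norm ?P) \<le> inverse (c * norm (1 - q * w * q powi (- int M)))"
        using c(2)[OF M, of "Suc n"] by (intro le_imp_inverse_le) auto
      hence P: "norm (inverse ?P) \<le> del M / c" by (simp only: norm_inverse del_def inverse_mult_distrib divide_inverse mult.commute)
      have "norm (T (Suc n) M) = norm q ^ Suc n * norm (jt (B M) k l (Suc n) * inverse (qp (inverse w * q powi int M))) * norm (inverse ?P)"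
        unfolding T_def R by (simp add: norm_mult norm_power del: prod.lessThan_Suc)
      also have "\<dots> \<le> norm q ^ n * C * (del M / c)"
      proof (intro mult_mono C P)
        show "norm q ^ Suc n \<le> norm q ^ n" using nq by (intro power_decreasing) auto
      qed (use C0 in auto)
      finally show ?thesis by (simp add: mult_ac)
    qed
    have xsT: "xs (B M) k / Hf (B M) k l = T 0 M + (\<Sum>n. T (Suc n) M)" "summable (\<lambda>n. T n M)" for M
    proof -
      have e: "T n M = Xf (B M) (B M k * q ^ n) / Hf (B M) k l" for n
        unfolding T_def R_def Xf_over_Hf[OF genB kl] ..
      show s: "summable (\<lambda>n. T n M)" unfolding e by (intro summable_divide Xf_summable')
      have "xs (B M) k / Hf (B M) k l = (\<Sum>n. T n M)"
        unfolding xs_def e by (intro suminf_divide[symmetric] Xf_summable')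
      also have "\<dots> = (\<Sum>n. T (Suc n) M) + T 0 M" using suminf_split_head[OF s] by simp
      finally show "xs (B M) k / Hf (B M) k l = T 0 M + (\<Sum>n. T (Suc n) M)" by simp
    qed
    have T0: "(\<lambda>M. T 0 M) \<longlonglongrightarrow> 1"
    proof -
      have "(\<lambda>M. jt (B M) k l 0 * inverse (qp (inverse w * q powi (int M * 1)))) \<longlonglongrightarrow> 1 * inverse 1"
        unfolding B_def by (intro tendsto_mult tendsto_inverse jt_0_tendsto[OF gen kl(1,2) d] qp_powi_tendsto_1) auto
      thus ?thesis unfolding T_def R by simp
    qed
    have "(\<lambda>M. \<Sum>n. T (Suc n) M) \<longlonglongrightarrow> 0"
    proof (rule Lim_null_comparison)
      show "\<forall>\<^sub>F M in sequentially. norm (\<Sum>n. T (Suc n) M) \<le> C / c / (1 - norm q) * del M"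
      proof (rule eventually_sequentiallyI[of M0])
        fix M assume M: "M \<ge> M0"
        have "norm (\<Sum>n. T (Suc n) M) \<le> (\<Sum>n. C / c * norm q ^ n * del M)"
          by (rule norm_suminf_le[OF bound[OF M] geo(1)])
        thus "norm (\<Sum>n. T (Suc n) M) \<le> C / c / (1 - norm q) * del M" unfolding geo(2) .
      qed
      have "(\<lambda>M. C / c / (1 - norm q) * del M) \<longlonglongrightarrow> C / c / (1 - norm q) * norm (0::complex)"
        unfolding del_def by (intro tendsto_mult tendsto_const tendsto_norm inverse_one_minus_tendsto_0 qw)
      thus "(\<lambda>M. C / c / (1 - norm q) * del M) \<longlonglongrightarrow> 0" by simp
    qed
    from tendsto_add[OF T0 this] show ?thesis unfolding xsT by simp
  qed
  have lim2: "(\<lambda>M. xs (B M) l / Hf (B M) k l) \<longlonglongrightarrow> 0"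
  proof -
    obtain c M0 where c: "c > 0" "\<And>M n. M \<ge> M0 \<Longrightarrow> n \<ge> 1 \<Longrightarrow>
      c * norm (1 - w * q powi (- int M)) \<le> norm (\<Prod>i<n. 1 - w * q powi (- int M) * q ^ i)"
      using poch_lower[OF w] by blast
    have c': "c * norm (1 - w * q powi (- int M)) \<le> norm (qp (w * q powi (- int M)))" if "M \<ge> M0" for M
      using c(2)[OF that] tendsto_norm[OF qp_tendsto[of "w * q powi (- int M)"]]
      by (intro LIMSEQ_le_const) (auto intro!: exI[of _ 1])
    define R where "R n M = qp (q * (B M l / B M k) * q ^ n) / th (B M k / B M l)" for n M
    have R: "R n M = qp (q * inverse w * q powi (int M + int n)) * inverse (qp (q * inverse w * q powi int M)) *
        inverse (qp (w * q powi (- int M)))" for n M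
    proof -
      have "q / (w * q powi (- int M)) = q * inverse w * q powi int M"
        using q_nz w by (simp add: power_int_minus field_simps)
      hence "th (B M k / B M l) = qp (w * q powi (- int M)) * qp (q * inverse w * q powi int M)"
        unfolding Bkl th_def by simp
      moreover have "q * (B M l / B M k) * q ^ n = q * inverse w * q powi (int M + int n)"
        unfolding Bkl powi_mult_pow[symmetric] by (simp only: mult.assoc)
      ultimately show ?thesis unfolding R_def by (simp add: field_simps)
    qed
    have "bd (\<lambda>n M. jt (B M) l k n * (qp (q * inverse w * q powi (int M + int n)) * inverse (qp (q * inverse w * q powi int M))))"
      using qw' by (intro bd_mult bdO bd_inv_qp bd_qp) auto
    then obtain C where C: "\<And>n M. norm (jt (B M) l k n * (qp (q * inverse w * q powi (int M + int n)) * inverse (qp (q * inverse w * q powi int M)))) \<le> C"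
      by (auto simp: bd_def)
    have C0: "C \<ge> 0" using C[of 0 0] norm_ge_zero order_trans by blast
    define del where "del M = norm (inverse (1 - w * q powi (- int M)))" for M
    have bound: "norm (q ^ n * jt (B M) l k n * R n M) \<le> C / c * norm q ^ n * del M" if M: "M \<ge> M0" for n M
    proof -
      have y: "1 - w * q powi (- int M) \<noteq> 0"
      proof
        assume "1 - w * q powi (- int M) = 0"
        hence "w * q powi (- int M) \<in> qpowers q" by simp
        thus False using w by (simp only: qpowers_cancel)
      qed
      have "0 < c * norm (1 - w * q powi (- int M))" using c y by simp
      hence "inverse (norm (qp (w * q powi (- int M)))) \<le> inverse (c * norm (1 - w * q powi (- int M)))"
        using c'[OF M] by (intro le_imp_inverse_le) auto
      hence P: "norm (inverse (qp (w * q powi (- int M)))) \<le> del M / c" by (simp only: norm_inverse del_def inverse_mult_distrib divide_inverse mult.commute)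
      have "norm (q ^ n * jt (B M) l k n * R n M) = norm q ^ n * norm (jt (B M) l k n * (qp (q * inverse w * q powi (int M + int n)) * inverse (qp (q * inverse w * q powi int M)))) *
         norm (inverse (qp (w * q powi (- int M))))"
        unfolding R by (simp add: norm_mult norm_power)
      also have "\<dots> \<le> norm q ^ n * C * (del M / c)"
        using C0 by (intro mult_mono C P) auto
      finally show ?thesis by (simp add: mult_ac)
    qed
    have xsT: "xs (B M) l / Hf (B M) k l = - (\<Sum>n. q ^ n * jt (B M) l k n * R n M)" for M
    proof -
      have "Gf (B M) l k = - Gf (B M) k l" using genericD(1)[OF genB] kl by (intro Gf_antisym) blast+
      hence "Hf (B M) k l = - Hf (B M) l k" by (simp add: Hf_def)
      hence "xs (B M) l / Hf (B M) k l = - (xs (B M) l / Hf (B M) l k)" by simp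
      also have "xs (B M) l / Hf (B M) l k = (\<Sum>n. Xf (B M) (B M l * q ^ n) / Hf (B M) l k)"
        unfolding xs_def by (intro suminf_divide[symmetric] Xf_summable')
      also have "\<dots> = (\<Sum>n. q ^ n * jt (B M) l k n * R n M)"
        unfolding R_def using kl by (subst Xf_over_Hf[OF genB]) auto
      finally show ?thesis .
    qed
    show ?thesis
    proof (rule Lim_null_comparison)
      show "\<forall>\<^sub>F M in sequentially. norm (xs (B M) l / Hf (B M) k l) \<le> C / c / (1 - norm q) * del M"
      proof (rule eventually_sequentiallyI[of M0])
        fix M assume M: "M \<ge> M0"
        have "norm (\<Sum>n. q ^ n * jt (B M) l k n * R n M) \<le> (\<Sum>n. C / c * norm q ^ n * del M)"
          by (rule norm_suminf_le[OF bound[OF M] geo(1)])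
        thus "norm (xs (B M) l / Hf (B M) k l) \<le> C / c / (1 - norm q) * del M" unfolding geo(2) xsT by simp
      qed
      have "(\<lambda>M. C / c / (1 - norm q) * del M) \<longlonglongrightarrow> C / c / (1 - norm q) * norm (0::complex)"
        unfolding del_def by (intro tendsto_mult tendsto_const tendsto_norm inverse_one_minus_tendsto_0 w)
      thus "(\<lambda>M. C / c / (1 - norm q) * del M) \<longlonglongrightarrow> 0" by simp
    qed
  qed
  have "(\<lambda>M. xs (B M) k / Hf (B M) k l - xs (B M) l / Hf (B M) k l) \<longlonglongrightarrow> 1 - 0"
    by (intro tendsto_diff lim1 lim2)
  moreover have "xs (B M) k / Hf (B M) k l - xs (B M) l / Hf (B M) k l = njq b k l" for M
    unfolding inv[of M, symmetric] by (simp add: njq_def diff_divide_distrib)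
  ultimately have "njq b k l = 1" using LIMSEQ_unique[OF tendsto_const] by simp
  thus ?thesis using Hf_nz[OF gen kl] by (simp add: njq_def)
qed

end

section \<open>Theta identities for six parameters\<close>

context qbase begin

text \<open>The factors of even and of odd index of \<open>(x\<^sup>2)\<^sub>\<infinity>\<close> are differences of squares.\<close>

lemma qp_square:
  assumes s: "s^2 = q"
  shows "qp (x^2) = qp x * qp (-x) * qp (s * x) * qp (- s * x)"
proof -
  have "(\<lambda>n. \<Prod>k<2*n. 1 - x^2 * q ^ k) \<longlonglongrightarrow> qp (x^2)"
    using qp_tendsto[of "x^2"] by (rule filterlim_compose) (rule filterlim_subseq, simp add: strict_mono_def)
  moreover have "(\<Prod>k<2*n. 1 - x^2 * q ^ k) = (\<Prod>k<n. 1 - x * q ^ k) * (\<Prod>k<n. 1 - (-x) * q ^ k) *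
      (\<Prod>k<n. 1 - (s * x) * q ^ k) * (\<Prod>k<n. 1 - (- s * x) * q ^ k)" for n
  proof (induction n)
    case (Suc n)
    have 1: "1 - x^2 * q ^ (2 * n) = (1 - x * q ^ n) * (1 - (-x) * q ^ n)"
    proof -
      have "q ^ (2 * n) = (q ^ n)^2" by (metis power_mult mult.commute)
      thus ?thesis by (simp add: algebra_simps power2_eq_square)
    qed
    have 2: "1 - x^2 * q ^ Suc (2 * n) = (1 - (s * x) * q ^ n) * (1 - (- s * x) * q ^ n)"
    proof -
      have "q ^ Suc (2 * n) = s^2 * (q ^ n)^2" unfolding s by (simp add: power_even_eq)
      thus ?thesis by (simp add: algebra_simps power2_eq_square)
    qed
    have "(\<Prod>k<2*Suc n. 1 - x^2 * q ^ k) = (\<Prod>k<2*n. 1 - x^2 * q ^ k) * (1 - x^2 * q ^ (2 * n)) * (1 - x^2 * q ^ Suc (2 * n))"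
      by simp
    thus ?case unfolding Suc.IH 1 2 by (simp only: prod.lessThan_Suc mult_ac)
  qed simp
  ultimately have "(\<lambda>n. (\<Prod>k<n. 1 - x * q ^ k) * (\<Prod>k<n. 1 - (-x) * q ^ k) *
      (\<Prod>k<n. 1 - (s * x) * q ^ k) * (\<Prod>k<n. 1 - (- s * x) * q ^ k)) \<longlonglongrightarrow> qp (x^2)" by simp
  moreover have "(\<lambda>n. (\<Prod>k<n. 1 - x * q ^ k) * (\<Prod>k<n. 1 - (-x) * q ^ k) *
      (\<Prod>k<n. 1 - (s * x) * q ^ k) * (\<Prod>k<n. 1 - (- s * x) * q ^ k)) \<longlonglongrightarrow> qp x * qp (-x) * qp (s * x) * qp (- s * x)"
    by (intro tendsto_mult qp_tendsto)
  ultimately show ?thesis by (rule LIMSEQ_unique)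
qed

lemma th_square:
  assumes s: "s^2 = q" and x: "x \<noteq> 0"
  shows "th (x^2) = th x * th (-x) * th (s * x) * th (- s * x)"
proof -
  have s0: "s \<noteq> 0" using s q_nz by auto
  have e: "q / x^2 = (s / x)^2" using s by (simp add: power_divide)
  have e1: "s * (s / x) = q / x" "- s * (s / x) = q / (-x)" "s / x = q / (s * x)" "- (s / x) = q / (- s * x)"
    using s s0 x by (auto simp: power2_eq_square)
  show ?thesis
    unfolding th_def e qp_square[OF s] e1(1,2) by (simp only: e1(4) e1(3)[symmetric]) (simp add: e1(3) mult_ac)
qed

text \<open>
  Both sides of \<open>th_square\<close> have a simple zero at \<open>x = 1\<close>. Dividing by \<open>1 - x\<close> and letting \<open>x \<rightarrow> 1\<close> leaves
  \<open>1 + x = 2\<close> on the left. The numbers \<open>-1\<close>, \<open>s\<close>, \<open>-s\<close> are the half periods of the torus \<open>\<complex>\<^sup>* / q\<^bsup>\<int>\<^esup>\<close>.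
\<close>

lemma th_half_periods:
  assumes s: "s^2 = q"
  shows "th (-1) * th s * th (-s) = 2"
proof -
  have s0: "s \<noteq> 0" using s q_nz by auto
  have l1: "((\<lambda>x. (1 + x) * (qp (q * x^2) * qp (q / x^2))) \<longlongrightarrow> (1 + 1) * (qp (q * 1^2) * qp (q / 1^2))) (at 1)"
    by (intro tendsto_intros) auto
  have l2: "((\<lambda>x. qp (q * x) * qp (q / x) * th (-x) * th (s * x) * th (- s * x)) \<longlongrightarrow>
      qp (q * 1) * qp (q / 1) * th (-1) * th (s * 1) * th (- s * 1)) (at 1)"
    using s0 by (intro tendsto_intros) auto
  have ev: "eventually (\<lambda>x. (1 + x) * (qp (q * x^2) * qp (q / x^2)) =
      qp (q * x) * qp (q / x) * th (-x) * th (s * x) * th (- s * x)) (at 1)"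
  proof -
    have "eventually (\<lambda>x. x \<in> -{0}) (at (1::complex))" by (intro eventually_at_in_open') auto
    moreover have "eventually (\<lambda>x. x \<noteq> 1) (at (1::complex))" by (simp add: eventually_at_filter)
    ultimately show ?thesis
    proof eventually_elim
      case (elim x)
      have "(1 - x) * ((1 + x) * (qp (q * x^2) * qp (q / x^2))) = th (x^2)"
        using th_simple_zero[of "x^2"] elim by (simp add: power2_eq_square algebra_simps)
      also have "\<dots> = (1 - x) * (qp (q * x) * qp (q / x) * th (-x) * th (s * x) * th (- s * x))"
        using th_square[OF s, of x] th_simple_zero[of x] elim by (simp add: mult_ac)
      finally show ?case using elim by simp
    qed
  qed
  have "(1 + 1) * (qp (q * 1^2) * qp (q / 1^2)) = qp (q * 1) * qp (q / 1) * th (-1) * th (s * 1) * th (- s * 1)"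
    using LIM_unique[OF Lim_transform_eventually[OF l1 ev] l2] .
  thus ?thesis using qp_q_nz by (simp add: mult_ac)
qed

lemma minus_one_not_qpowers: "-1 \<notin> qpowers q"
proof
  assume "-1 \<in> qpowers q"
  then obtain n where n: "-1 = q powi n" by (auto simp: qpowers_def)
  hence "norm (q powi n) = 1" by (metis norm_minus_cancel norm_one)
  hence "n = 0" by (rule norm_q_powi_eq_1D)
  thus False using n by simp
qed

lemma sqrt_not_qpowers: assumes "s^2 = q" shows "s \<notin> qpowers q" "-s \<notin> qpowers q"
proof -
  have "x \<notin> qpowers q" if "x^2 = q" for x
  proof
    assume "x \<in> qpowers q"
    then obtain n where "x = q powi n" by (auto simp: qpowers_def)
    hence "q powi (2 * n) = q powi 1" using that q_nz power_int_add[of q n n] by (simp add: power2_eq_square)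
    hence "2 * n = 1" by (rule q_powi_inj)
    thus False by presburger
  qed
  thus "s \<notin> qpowers q" "-s \<notin> qpowers q" using assms by auto
qed

lemma th_q2: assumes "x \<noteq> 0" shows "th (q^2 * x) = th x / (q * x^2)"
  using th_q[of "q * x"] th_q[of x] assms q_nz by (simp add: power2_eq_square mult_ac)

lemma th_inverse_div_q: assumes "y \<noteq> 0" shows "th (1 / (q * y)) = th y / (q * y^2)"
  using th_div_q[of "1 / y"] th_inverse[of y] assms q_nz by (simp add: power2_eq_square mult_ac)

lemma eventually_th_nz: assumes "y \<noteq> 0" shows "eventually (\<lambda>x. th x \<noteq> 0) (at y)"
proof -
  have "eventually (\<lambda>x. th x \<noteq> 0 \<and> x \<in> -{0}) (at y)"
  proof (rule non_zero_neighbour_alt)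
    show "th holomorphic_on -{0}" by (rule th_holomorphic[of "\<lambda>x. x"]) auto
    show "connected (-{0::complex})" by (rule connected_punctured_universe) simp
    show "th (-1) \<noteq> 0" using minus_one_not_qpowers by (intro th_nz) auto
  qed (use assms in auto)
  thus ?thesis by (rule eventually_mono) auto
qed

text \<open>
  The instance of \<open>elliptic_residue_sum\<close> with eight poles: \<open>a, b, c, d\<close> and the four square roots of
  \<open>B = a b c d\<close> modulo powers of \<open>q\<close>. Each of the latter contributes \<open>th B / 2\<close>. The last four
  hypotheses keep the two groups of poles apart.
\<close>

lemma four_theta_nondegenerate:
  fixes a b c d :: complex
  assumes nz: "a \<noteq> 0" "b \<noteq> 0" "c \<noteq> 0" "d \<noteq> 0"
    and r: "th (b / a) \<noteq> 0" "th (c / a) \<noteq> 0" "th (d / a) \<noteq> 0" "th (c / b) \<noteq> 0" "th (d / b) \<noteq> 0" "th (d / c) \<noteq> 0"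
    and nd: "th (b * c * d / a) \<noteq> 0" "th (a * c * d / b) \<noteq> 0" "th (a * b * d / c) \<noteq> 0" "th (a * b * c / d) \<noteq> 0"
  shows "th (a^2) * th (b * c) * th (b * d) * th (c * d) / (a^2 * th (b / a) * th (c / a) * th (d / a))
    + th (b^2) * th (a * c) * th (a * d) * th (c * d) / (b^2 * th (a / b) * th (c / b) * th (d / b))
    + th (c^2) * th (a * b) * th (a * d) * th (b * d) / (c^2 * th (a / c) * th (b / c) * th (d / c))
    + th (d^2) * th (a * b) * th (a * c) * th (b * c) / (d^2 * th (a / d) * th (b / d) * th (c / d))
    = - 2 * th (a * b * c * d)"
proof -
  define s where "s = csqrt q"
  have s: "s^2 = q" by (simp add: s_def)
  have s0: "s \<noteq> 0" using s q_nz by auto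
  define B where "B = a * b * c * d"
  define \<beta> where "\<beta> = csqrt B"
  have \<beta>: "\<beta>^2 = B" by (simp add: \<beta>_def)
  have B0: "B \<noteq> 0" using nz by (simp add: B_def)
  have \<beta>0: "\<beta> \<noteq> 0" using \<beta> B0 by auto
  define N where "N w = th (w^2) * (th (B / (w * a)) * th (B / (w * b)) * th (B / (w * c)) * th (B / (w * d))) / w^2" for w
  define K4 where "K4 = {a, b, c, d}"
  define E where "E = {\<beta>, -\<beta>, s * \<beta>, -(s * \<beta>)}"
  have inv: "th (x / y) \<noteq> 0" if "th (y / x) \<noteq> 0" "x \<noteq> 0" "y \<noteq> 0" for x y
    using that th_inverse[of "y / x"] by simp
  have notq: "x / y \<notin> qpowers q" if "th (x / y) \<noteq> 0" "x \<noteq> 0" "y \<noteq> 0" for x y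
    using that by (auto simp: th_eq_0_iff)
  have K40: "x \<noteq> 0" if "x \<in> K4" for x using that nz by (auto simp: K4_def)
  have E0: "x \<noteq> 0" if "x \<in> E" for x using that \<beta>0 s0 by (auto simp: E_def)
  have K4r: "x / y \<notin> qpowers q" if "x \<in> K4" "y \<in> K4" "x \<noteq> y" for x y
    using that r nz inv[OF r(1)] inv[OF r(2)] inv[OF r(3)] inv[OF r(4)] inv[OF r(5)] inv[OF r(6)]
    by (intro notq) (auto simp: K4_def)
  have prodE: "th (\<beta> / x) * th (- (\<beta> / x)) * th (s * (\<beta> / x)) * th (- s * (\<beta> / x)) = th (B / x^2)" if "x \<noteq> 0" for x
    using th_square[OF s, of "\<beta> / x"] that \<beta>0 \<beta> by (simp add: power_divide)
  have K4E: "th (e / x) \<noteq> 0" if "x \<in> K4" "e \<in> E" for x e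
  proof -
    have "B / a^2 = b * c * d / a" "B / b^2 = a * c * d / b" "B / c^2 = a * b * d / c" "B / d^2 = a * b * c / d"
      using nz by (auto simp: B_def power2_eq_square)
    hence "th (B / x^2) \<noteq> 0" using nd that by (auto simp: K4_def)
    hence "th (\<beta> / x) * th (- (\<beta> / x)) * th (s * (\<beta> / x)) * th (- s * (\<beta> / x)) \<noteq> 0" using prodE K40[OF that(1)] by simp
    thus ?thesis using that by (auto simp: E_def)
  qed
  have Er: "x / y \<notin> qpowers q" if "x \<in> E" "y \<in> E" "x \<noteq> y" for x y
  proof -
    have "x / y \<in> {-1, s, -s, inverse s, inverse (-s)}" using that \<beta>0 s0 by (auto simp: E_def field_simps)
    thus ?thesis using minus_one_not_qpowers sqrt_not_qpowers[OF s] qpowers_inverse_iff[of s] qpowers_inverse_iff[of "-s"] by auto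
  qed
  have disj: "K4 \<inter> E = {}"
  proof -
    have "th (x / x) = 0" if "x \<noteq> 0" for x using that by (simp add: th_eq_0_iff)
    thus ?thesis using K4E K40 by blast
  qed
  have dK: "distinct [a, b, c, d]"
  proof -
    have "x \<noteq> y" if "th (y / x) \<noteq> 0" "x \<noteq> 0" for x y using that by (auto simp: th_eq_0_iff)
    thus ?thesis using r nz by auto
  qed
  have dE: "distinct [\<beta>, -\<beta>, s * \<beta>, -(s * \<beta>)]"
  proof -
    have "s \<noteq> 1" "s \<noteq> -1" using sqrt_not_qpowers[OF s] qpowers_1 by (metis, metis minus_minus)
    hence "s * \<beta> \<noteq> \<beta>" "s * \<beta> \<noteq> - \<beta>" using \<beta>0 by (simp, metis mult_cancel_right mult_minus_left mult_1)
    moreover have "x \<noteq> - x" if "x \<noteq> 0" for x :: complex using that by (simp add: eq_neg_iff_add_eq_0)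
    moreover have "distinct [x, -x, t, -t]" if "t \<noteq> x" "t \<noteq> -x" "x \<noteq> -x" "t \<noteq> -t" for x t :: complex
      using that by (simp, metis minus_minus)
    ultimately show ?thesis using \<beta>0 s0 by (metis mult_eq_0_iff)
  qed
  have pK: "(\<Prod>x\<in>K4. f x) = f a * f b * f c * f d" for f :: "complex \<Rightarrow> complex"
    using dK by (simp add: K4_def mult_ac)
  have pE: "(\<Prod>x\<in>E. f x) = f \<beta> * f (-\<beta>) * f (s * \<beta>) * f (-(s * \<beta>))" for f :: "complex \<Rightarrow> complex"
    using dE by (simp add: E_def mult_ac)
  have fin: "finite K4" "finite E" by (auto simp: K4_def E_def)
  have sum0: "(\<Sum>k\<in>K4 \<union> E. N k / (\<Prod>j\<in>K4 \<union> E - {k}. th (j / k))) = 0"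
  proof (rule elliptic_residue_sum)
    show "i / j \<notin> qpowers q" if "i \<in> K4 \<union> E" "j \<in> K4 \<union> E" "i \<noteq> j" for i j
    proof -
      consider "i \<in> K4" "j \<in> K4" | "i \<in> E" "j \<in> E" | "i \<in> E" "j \<in> K4" | "i \<in> K4" "j \<in> E" using \<open>i \<in> K4 \<union> E\<close> \<open>j \<in> K4 \<union> E\<close> by blast
      thus ?thesis
      proof cases
        case 3 thus ?thesis using K4E[of j i] notq K40 E0 by blast
      next
        case 4 thus ?thesis using inv[OF K4E[of i j]] notq K40 E0 by blast
      qed (use K4r Er that in auto)
    qed
    show "N holomorphic_on -{0}" unfolding N_def using nz B0 by (intro holomorphic_intros) auto
    fix w :: complex assume w: "w \<noteq> 0"
    have 1: "th (B / (q * w * x)) = - (B / (q * (w * x))) * th (B / (w * x))" if "x \<noteq> 0" for x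
      using th_div_q[of "B / (w * x)"] that w B0 by (simp add: mult_ac)
    have 2: "th ((q * w)^2) = th (w^2) / (q * w^4)"
      using th_q2[of "w^2"] w by (simp add: power_mult_distrib)
    have "(\<Prod>k\<in>K4 \<union> E. - k / (q * w)) = (\<Prod>k\<in>K4. - k / (q * w)) * (\<Prod>k\<in>E. - k / (q * w))"
      using fin disj by (intro prod.union_disjoint)
    also have "\<dots> = B * (\<beta>^4 * s^2) / (q * w)^8" unfolding pK pE B_def
      by (simp add: power2_eq_square eval_nat_numeral mult_ac)
    also have "\<dots> = B^3 * q / (q * w)^8" using \<beta> s by (simp add: power2_eq_square eval_nat_numeral mult_ac)
    finally have P: "(\<Prod>k\<in>K4 \<union> E. - k / (q * w)) = B^3 * q / (q * w)^8" .
    have abcd: "B^4 / (a * b * c * d) = B^3" using nz B0 unfolding B_def[symmetric] by (simp add: eval_nat_numeral)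
    have "N (q * w) = N w * ((B^4 / (a * b * c * d)) / (q * w^4 * q^2 * (q * w)^4))"
      unfolding N_def 2 1[OF nz(1)] 1[OF nz(2)] 1[OF nz(3)] 1[OF nz(4)] using nz w q_nz
      by (simp add: field_simps power2_eq_square eval_nat_numeral)
    also have "(B^4 / (a * b * c * d)) / (q * w^4 * q^2 * (q * w)^4) = B^3 * q / (q * w)^8"
      unfolding abcd using w q_nz by (simp add: field_simps eval_nat_numeral)
    finally show "N (q * w) = (\<Prod>k\<in>K4 \<union> E. - k / (q * w)) * N w" unfolding P by simp
  qed (use fin K40 E0 in auto)
  have termK: "N x / (\<Prod>j\<in>K4 \<union> E - {x}. th (j / x)) = th (x^2) / x^2 * (\<Prod>j\<in>K4-{x}. th (B / (x * j)) / th (j / x))" if x: "x \<in> K4" for x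
  proof -
    have x0: "x \<noteq> 0" using K40[OF x] .
    have "K4 \<union> E - {x} = (K4 - {x}) \<union> E" using x disj by auto
    hence "(\<Prod>j\<in>K4 \<union> E - {x}. th (j / x)) = (\<Prod>j\<in>K4-{x}. th (j / x)) * (\<Prod>j\<in>E. th (j / x))"
      using fin disj by (subst prod.union_disjoint[symmetric]) auto
    also have "(\<Prod>j\<in>E. th (j / x)) = th (B / x^2)" unfolding pE prodE[OF x0, symmetric] by simp
    finally have D: "(\<Prod>j\<in>K4 \<union> E - {x}. th (j / x)) = (\<Prod>j\<in>K4-{x}. th (j / x)) * th (B / x^2)" .
    have "(\<Prod>j\<in>E. th (j / x)) \<noteq> 0" using K4E[OF x] fin by (auto simp: prod_zero_iff)
    hence nz: "th (B / x^2) \<noteq> 0" unfolding pE prodE[OF x0, symmetric] by simp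
    have "N x = th (x^2) * (\<Prod>j\<in>K4. th (B / (x * j))) / x^2" unfolding N_def pK by simp
    also have "(\<Prod>j\<in>K4. th (B / (x * j))) = th (B / (x * x)) * (\<Prod>j\<in>K4-{x}. th (B / (x * j)))"
      using x fin by (intro prod.remove) auto
    finally have "N x = th (x^2) * (th (B / x^2) * (\<Prod>j\<in>K4-{x}. th (B / (x * j)))) / x^2" by (simp add: power2_eq_square)
    thus ?thesis unfolding D prod_dividef using nz by simp
  qed
  have termE: "N e / (\<Prod>j\<in>K4 \<union> E - {e}. th (j / e)) = th B / 2" if e: "e \<in> E" for e
  proof -
    have e0: "e \<noteq> 0" using E0[OF e] .
    have "K4 \<union> E - {e} = K4 \<union> (E - {e})" using e disj by auto
    hence "(\<Prod>j\<in>K4 \<union> E - {e}. th (j / e)) = (\<Prod>j\<in>K4. th (j / e)) * (\<Prod>j\<in>E-{e}. th (j / e))"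
      using fin disj by (subst prod.union_disjoint[symmetric]) auto
    moreover have D0: "(\<Prod>j\<in>K4. th (j / e)) \<noteq> 0"
      using K4E inv K40 e0 e fin by (auto simp: prod_zero_iff)
    moreover have "N e = th (e^2) * (\<Prod>j\<in>K4. th (B / (e * j))) / e^2" unfolding N_def pK by simp
    moreover consider "e = \<beta> \<or> e = -\<beta>" | "e = s * \<beta> \<or> e = -(s * \<beta>)" using e by (auto simp: E_def)
    hence "th (e^2) * (\<Prod>j\<in>K4. th (B / (e * j))) / e^2 = (\<Prod>j\<in>K4. th (j / e)) * (\<Prod>j\<in>E-{e}. th (j / e)) * (th B / 2)
      \<and> (\<Prod>j\<in>E-{e}. th (j / e)) \<noteq> 0"
    proof cases
      case 1
      hence e2: "e^2 = B" using \<beta> by auto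
      have "th (B / (e * x)) = - th (x / e) * (e / x)" if "x \<in> K4" for x
        using th_inverse[of "x / e"] K40[OF that] e0 e2 by (simp add: power2_eq_square[symmetric] field_simps)
          (simp add: e2[symmetric] power2_eq_square)
      hence "(\<Prod>j\<in>K4. th (B / (e * j))) = (\<Prod>j\<in>K4. - th (j / e) * (e / j))" by (intro prod.cong) auto
      also have "\<dots> = (\<Prod>j\<in>K4. th (j / e)) * ((e^2)^2 / B)"
        unfolding pK B_def using nz by (simp add: power2_eq_square)
      finally have "(\<Prod>j\<in>K4. th (B / (e * j))) = (\<Prod>j\<in>K4. th (j / e)) * B"
        unfolding e2 using B0 by (simp add: power2_eq_square)
      moreover have "(\<Prod>j\<in>E-{e}. th (j / e)) = 2"
      proof -
        have "E - {e} = {-e, s * e, -(s * e)}" using 1 dE by (auto simp: E_def)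
        moreover have "distinct [-e, s * e, -(s * e)]" using 1 dE by auto
        ultimately show ?thesis using th_half_periods[OF s] e0 by (simp add: mult_ac)
      qed
      ultimately show ?thesis unfolding e2 using B0 by simp
    next
      case 2
      hence e2: "e^2 = q * B" using \<beta> s by (auto simp: power_mult_distrib)
      have "th (B / (e * x)) = th (x / e) * (e^2 / (q * x^2))" if "x \<in> K4" for x
      proof -
        have "B / (e * x) = 1 / (q * (x / e))" using e2 e0 K40[OF that] q_nz by (simp add: field_simps power2_eq_square)
        thus ?thesis using th_inverse_div_q[of "x / e"] K40[OF that] e0 by (simp add: power_divide)
      qed
      hence "(\<Prod>j\<in>K4. th (B / (e * j))) = (\<Prod>j\<in>K4. th (j / e) * (e^2 / (q * j^2)))" by (intro prod.cong) auto
      also have "\<dots> = (\<Prod>j\<in>K4. th (j / e)) * ((e^2)^4 / (q^4 * B^2))"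
        unfolding pK B_def using nz q_nz by (simp add: field_simps eval_nat_numeral)
      finally have p1: "(\<Prod>j\<in>K4. th (B / (e * j))) = (\<Prod>j\<in>K4. th (j / e)) * B^2"
        unfolding e2 using B0 q_nz by (simp add: field_simps eval_nat_numeral)
      have p2: "(\<Prod>j\<in>E-{e}. th (j / e)) = - 2 / q"
      proof -
        have "E - {e} = {-e, e / s, -(e / s)}" using 2 dE s0 by (auto simp: E_def)
        moreover have "distinct [-e, e / s, -(e / s)]" using 2 dE s0 by auto
        ultimately have "(\<Prod>j\<in>E-{e}. th (j / e)) = th (-1) * th (1 / s) * th (1 / (- s))" using e0 by (simp add: mult_ac)
        also have "\<dots> = - (th (-1) * th s * th (-s)) / s^2"
          using th_inverse[of s] th_inverse[of "-s"] s0 by (simp add: power2_eq_square)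
        finally show ?thesis unfolding th_half_periods[OF s] s by simp
      qed
      have "th (e^2) = - th B / B" unfolding e2 using B0 by (rule th_q)
      thus ?thesis unfolding p1 p2 e2 using B0 q_nz by (simp add: power2_eq_square)
    qed
    ultimately show ?thesis by simp
  qed
  have "(\<Sum>k\<in>K4 \<union> E. N k / (\<Prod>j\<in>K4 \<union> E - {k}. th (j / k))) =
      (\<Sum>k\<in>K4. N k / (\<Prod>j\<in>K4 \<union> E - {k}. th (j / k))) + (\<Sum>k\<in>E. N k / (\<Prod>j\<in>K4 \<union> E - {k}. th (j / k)))"
    using fin disj by (intro sum.union_disjoint)
  also have "\<dots> = (\<Sum>x\<in>K4. th (x^2) / x^2 * (\<Prod>j\<in>K4-{x}. th (B / (x * j)) / th (j / x))) + (\<Sum>e\<in>E. th B / 2)"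
    by (intro arg_cong2[of _ _ _ _ "(+)"] sum.cong termK termE refl)
  finally have "(\<Sum>k\<in>K4 \<union> E. N k / (\<Prod>j\<in>K4 \<union> E - {k}. th (j / k))) =
      (\<Sum>x\<in>K4. th (x^2) / x^2 * (\<Prod>j\<in>K4-{x}. th (B / (x * j)) / th (j / x))) + (\<Sum>e\<in>E. th B / 2)" .
  moreover have "card E = 4" using distinct_card[OF dE] by (simp add: E_def)
  ultimately have eq: "(\<Sum>x\<in>K4. th (x^2) / x^2 * (\<Prod>j\<in>K4-{x}. th (B / (x * j)) / th (j / x))) = - 2 * th B"
    using sum0 by (simp add: add_eq_0_iff)
  have sK: "(\<Sum>x\<in>K4. f x) = f a + f b + f c + f d" for f :: "complex \<Rightarrow> complex"
    using dK by (simp add: K4_def add_ac)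
  have rem: "K4 - {a} = {b, c, d}" "K4 - {b} = {a, c, d}" "K4 - {c} = {a, b, d}" "K4 - {d} = {a, b, c}"
    using dK by (auto simp: K4_def)
  have quot: "B / (a * b) = c * d" "B / (a * c) = b * d" "B / (a * d) = b * c" "B / (b * c) = a * d" "B / (b * d) = a * c" "B / (c * d) = a * b"
      "B / (b * a) = c * d" "B / (c * a) = b * d" "B / (d * a) = b * c" "B / (c * b) = a * d" "B / (d * b) = a * c" "B / (d * c) = a * b"
    using nz by (auto simp: B_def)
  have p3: "(\<Prod>j\<in>{b, c, d}. f j) = f b * f c * f d" "(\<Prod>j\<in>{a, c, d}. f j) = f a * f c * f d"
      "(\<Prod>j\<in>{a, b, d}. f j) = f a * f b * f d" "(\<Prod>j\<in>{a, b, c}. f j) = f a * f b * f c" for f :: "complex \<Rightarrow> complex"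
    using dK by (simp_all add: mult_ac)
  have frac: "t / u * (x / x' * (y / y') * (z / z')) = t * z * y * x / (u * x' * y' * z')" for t u x x' y y' z z' :: complex
    by (simp add: mult_ac)
  show ?thesis using eq unfolding sK rem p3 quot frac unfolding B_def by (simp only: mult_ac)
qed

lemma eventually_th_compose_nz:
  assumes "(g \<longlongrightarrow> y) (at a)" "eventually (\<lambda>t. g t \<noteq> y) (at a)" "y \<noteq> 0"
  shows "eventually (\<lambda>t. th (g t) \<noteq> 0) (at (a::complex))"
  using eventually_compose_filterlim[OF eventually_th_nz[OF assms(3)] filterlim_atI[OF assms(1,2)]] .

text \<open>
  The values of \<open>a\<close> excluded in \<open>four_theta_nondegenerate\<close> are isolated, and both sides are
  continuous in \<open>a\<close>.
\<close>

lemma four_theta: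
  fixes a b c d :: complex
  assumes nz: "a \<noteq> 0" "b \<noteq> 0" "c \<noteq> 0" "d \<noteq> 0"
    and r: "th (b / a) \<noteq> 0" "th (c / a) \<noteq> 0" "th (d / a) \<noteq> 0" "th (c / b) \<noteq> 0" "th (d / b) \<noteq> 0" "th (d / c) \<noteq> 0"
  shows "th (a^2) * th (b * c) * th (b * d) * th (c * d) / (a^2 * th (b / a) * th (c / a) * th (d / a))
    + th (b^2) * th (a * c) * th (a * d) * th (c * d) / (b^2 * th (a / b) * th (c / b) * th (d / b))
    + th (c^2) * th (a * b) * th (a * d) * th (b * d) / (c^2 * th (a / c) * th (b / c) * th (d / c))
    + th (d^2) * th (a * b) * th (a * c) * th (b * c) / (d^2 * th (a / d) * th (b / d) * th (c / d))
    = - 2 * th (a * b * c * d)" (is "?L a = ?R a")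
proof -
  have inv: "th (x / y) \<noteq> 0" if "th (y / x) \<noteq> 0" "x \<noteq> 0" "y \<noteq> 0" for x y
    using that th_inverse[of "y / x"] by simp
  have r': "th (a / b) \<noteq> 0" "th (a / c) \<noteq> 0" "th (a / d) \<noteq> 0" "th (b / c) \<noteq> 0" "th (b / d) \<noteq> 0" "th (c / d) \<noteq> 0"
    using inv[OF r(1)] inv[OF r(2)] inv[OF r(3)] inv[OF r(4)] inv[OF r(5)] inv[OF r(6)] nz by auto
  have l1: "(?L \<longlongrightarrow> ?L a) (at a)"
    by (intro tendsto_intros) (simp_all add: nz r r')
  have l2: "(?R \<longlongrightarrow> ?R a) (at a)"
    using nz by (intro tendsto_intros) auto
  have ev: "eventually (\<lambda>t. ?L t = ?R t) (at a)"
  proof -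
    have ne: "eventually (\<lambda>t. t \<noteq> a) (at a)" by (simp add: eventually_at_filter)
    have n0: "eventually (\<lambda>t. t \<noteq> 0) (at a)"
      using eventually_at_in_open'[of "-{0}" a] nz by (simp add: open_Compl)
    have e1: "eventually (\<lambda>t. th (x / t) \<noteq> 0) (at a)" if "th (x / a) \<noteq> 0" "x \<noteq> 0" for x
      using that nz by (intro tendsto_imp_eventually_ne[of _ "th (x / a)"] tendsto_intros) auto
    have e2: "eventually (\<lambda>t. th (x / t) \<noteq> 0) (at a)" if "x \<noteq> 0" for x
    proof (rule eventually_th_compose_nz)
      show "((\<lambda>t. x / t) \<longlongrightarrow> x / a) (at a)" using nz by (intro tendsto_intros) auto
      show "eventually (\<lambda>t. x / t \<noteq> x / a) (at a)"
        using ne n0 by eventually_elim (use that nz in \<open>auto simp: field_simps\<close>)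
    qed (use that nz in auto)
    have e3: "eventually (\<lambda>t. th (t * y * z / x) \<noteq> 0) (at a)" if "x \<noteq> 0" "y \<noteq> 0" "z \<noteq> 0" for x y z
    proof (rule eventually_th_compose_nz)
      show "((\<lambda>t. t * y * z / x) \<longlongrightarrow> a * y * z / x) (at a)" using that by (intro tendsto_intros) auto
      show "eventually (\<lambda>t. t * y * z / x \<noteq> a * y * z / x) (at a)"
        using ne by eventually_elim (use that nz in \<open>auto simp: field_simps\<close>)
    qed (use that nz in auto)
    from n0 e1[OF r(1) nz(2)] e1[OF r(2) nz(3)] e1[OF r(3) nz(4)] e2[of "b * c * d"] e3[of b c d] e3[of c b d] e3[of d b c]
    have ev: "eventually (\<lambda>t. t \<noteq> 0 \<and> th (b / t) \<noteq> 0 \<and> th (c / t) \<noteq> 0 \<and> th (d / t) \<noteq> 0 \<and> th (b * c * d / t) \<noteq> 0 \<and>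
       th (t * c * d / b) \<noteq> 0 \<and> th (t * b * d / c) \<noteq> 0 \<and> th (t * b * c / d) \<noteq> 0) (at a)"
      using nz by (simp add: eventually_conj_iff)
    show ?thesis
      using ev
    proof eventually_elim
      case (elim t)
      show ?case by (rule four_theta_nondegenerate) (use elim nz r in auto)
    qed
  qed
  show ?thesis using LIM_unique[OF Lim_transform_eventually[OF l1 ev] l2] .
qed

text \<open>
  The contribution of the elliptic factor of the integrand to the residues at the class of \<open>c\<^sub>k\<close>;
  see \<open>hq_residue_limit\<close>.
\<close>

definition eta :: "(nat \<Rightarrow> complex) \<Rightarrow> nat \<Rightarrow> complex" where
  "eta c k = (\<Prod>j\<in>I6. th (c j * c k)) / (c k ^ 4 * (qp q)^2 * (\<Prod>j\<in>I6-{k}. th (c j / c k)))"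

lemma th_ratio_nz: "generic c \<Longrightarrow> i \<in> I6 \<Longrightarrow> j \<in> I6 \<Longrightarrow> i \<noteq> j \<Longrightarrow> th (c i / c j) \<noteq> 0"
  using genericD[of c] by (intro th_nz) auto

lemma th_mult_nz: "generic c \<Longrightarrow> i \<in> I6 \<Longrightarrow> j \<in> I6 \<Longrightarrow> th (c i * c j) \<noteq> 0"
  using genericD[of c] by (intro th_nz) auto

text \<open>
  Up to the constant \<open>(qp q)\<^sup>2\<close>, the \<open>eta c k\<close> are the residues of one elliptic function with respect
  to \<open>dw / w\<close>.
\<close>

lemma eta_sum:
  assumes gen: "generic c" and c1: "(\<Prod>j\<in>I6. c j) = q"
  shows "(\<Sum>k\<in>I6. eta c k) = 0"
proof -
  have c0: "c j \<noteq> 0" if "j \<in> I6" for j using genericD(1)[OF gen that that] .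
  define N where "N w = (\<Prod>j\<in>I6. th (c j * w)) / w^4" for w
  have "(\<Sum>k\<in>I6. N (c k) / (\<Prod>j\<in>I6-{k}. th (c j / c k))) = 0"
  proof (rule elliptic_residue_sum)
    show "N holomorphic_on -{0}" unfolding N_def using c0 by (intro holomorphic_intros) auto
    fix w :: complex assume w: "w \<noteq> 0"
    have "(\<Prod>j\<in>I6. th (c j * (q * w))) = (\<Prod>j\<in>I6. th (c j * w)) / (w ^ 6 * q)"
      using prod_th_up[of I6 w c] w c0 c1 by simp
    hence "N (q * w) = N w * (1 / (w ^ 6 * q * q^4))"
      unfolding N_def using w q_nz by (simp add: power_mult_distrib)
    also have "1 / (w ^ 6 * q * q^4) = (\<Prod>k\<in>I6. (-1) * (c k / (q * w)))"
      unfolding prod.distrib prod_dividef prod_constant c1 using w q_nz by (simp add: power_mult_distrib field_simps eval_nat_numeral)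
    finally show "N (q * w) = (\<Prod>k\<in>I6. - c k / (q * w)) * N w" by simp
  qed (use c0 genericD(2)[OF gen] in auto)
  moreover have "eta c k = N (c k) / (\<Prod>j\<in>I6-{k}. th (c j / c k)) / (qp q)^2" for k
    by (simp add: eta_def N_def)
  ultimately show ?thesis by (simp only: sum_divide_distrib[symmetric] div_0)
qed

lemma eta_Gf:
  assumes gen: "generic c" and kl: "k \<in> I6" "l \<in> I6" "k \<noteq> l"
  shows "eta c k * Gf c k l = - (th ((c k)^2) * th (c k * c l) / (c k)^3 / (\<Prod>j\<in>I6-{k,l}. th (c j / c k))) /
     (qp q * (\<Prod>j\<in>I6-{l}. th (c j * c l)))"
proof -
  let ?O = "I6 - {k,l}"
  have c0: "c k \<noteq> 0" "c l \<noteq> 0" using genericD(1)[OF gen] kl by blast+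
  have e: "I6 - {k} - {l} = ?O" "I6 - {l} - {k} = ?O" by auto
  have p1: "(\<Prod>j\<in>I6. th (c j * c k)) = th (c k * c k) * th (c l * c k) * (\<Prod>j\<in>?O. th (c j * c k))"
    by (rule prod_I6_remove2[OF kl])
  have p2: "(\<Prod>j\<in>I6-{k}. th (c j / c k)) = th (c l / c k) * (\<Prod>j\<in>?O. th (c j / c k))"
    using kl prod.remove[of "I6-{k}" l "\<lambda>j. th (c j / c k)"] e by simp
  have p3: "(\<Prod>j\<in>I6-{l}. th (c j * c l)) = th (c k * c l) * (\<Prod>j\<in>?O. th (c j * c l))"
    using kl prod.remove[of "I6-{l}" k "\<lambda>j. th (c j * c l)"] e by simp
  have nz: "(\<Prod>j\<in>?O. th (c j * c k)) \<noteq> 0" "(\<Prod>j\<in>?O. th (c j * c l)) \<noteq> 0" "th (c k * c l) \<noteq> 0" "th (c l / c k) \<noteq> 0"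
      "(\<Prod>j\<in>?O. th (c j / c k)) \<noteq> 0"
    using th_mult_nz[OF gen] th_ratio_nz[OF gen] kl by (auto simp: prod_zero_iff)
  show ?thesis
    unfolding eta_def Gf_def p1 p2 p3 prod.distrib using nz c0 qp_q_nz
    by (simp add: divide_simps mult.commute[of "c l"] power2_eq_square) (simp add: eval_nat_numeral mult_ac)
qed

text \<open>
  In \<open>eta c k * Hf c k l\<close> most theta functions cancel. What remains is the residue at \<open>c\<^sub>k\<close> of an
  elliptic function with poles only at the classes of the five \<open>c\<^sub>j\<close> with \<open>j \<noteq> l\<close>.
\<close>

lemma eta_Hf_sum:
  assumes gen: "generic c" and c1: "(\<Prod>j\<in>I6. c j) = q" and l: "l \<in> I6"
  shows "(\<Sum>k\<in>I6. eta c k * Hf c k l) = 0"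
proof -
  have c0: "c j \<noteq> 0" if "j \<in> I6" for j using genericD(1)[OF gen that that] .
  define N where "N w = th (w^2) * th (w * c l) / w^3" for w
  have cl: "(\<Prod>j\<in>I6-{l}. c j) = q / c l"
    using c1 prod.remove[of I6 l c] l c0[OF l] by (simp add: field_simps)
  have "(\<Sum>k\<in>I6-{l}. N (c k) / (\<Prod>j\<in>I6-{l}-{k}. th (c j / c k))) = 0"
  proof (rule elliptic_residue_sum)
    show "N holomorphic_on -{0}" unfolding N_def using c0[OF l] by (intro holomorphic_intros) auto
    fix w :: complex assume w: "w \<noteq> 0"
    have 1: "th ((q * w)^2) = th (w^2) / (q * w^4)" using th_q2[of "w^2"] w by (simp add: power_mult_distrib)
    have 2: "th (q * w * c l) = - th (w * c l) / (w * c l)" using th_q[of "w * c l"] w c0[OF l] by (simp add: mult_ac)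
    have "N (q * w) = N w * (- 1 / (q * w^4 * (w * c l) * q^3))"
      unfolding N_def 1 2 using w q_nz c0[OF l] by (simp add: power_mult_distrib)
    also have "- 1 / (q * w^4 * (w * c l) * q^3) = (\<Prod>k\<in>I6-{l}. (-1) * (c k / (q * w)))"
      unfolding prod.distrib prod_dividef prod_constant cl using w q_nz l c0[OF l]
      by (simp add: power_mult_distrib field_simps eval_nat_numeral)
    finally show "N (q * w) = (\<Prod>k\<in>I6-{l}. - c k / (q * w)) * N w" by simp
  qed (use c0 genericD(2)[OF gen] in auto)
  moreover have "eta c k * Hf c k l = N (c k) / (\<Prod>j\<in>I6-{l}-{k}. th (c j / c k)) * (- Pp c / (qp q * (\<Prod>j\<in>I6-{l}. th (c j * c l))))"
    if "k \<in> I6 - {l}" for k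
  proof -
    have e: "I6 - {l} - {k} = I6 - {k,l}" by auto
    have "eta c k * Hf c k l = Pp c * (eta c k * Gf c k l)" by (simp add: Hf_def)
    also have "eta c k * Gf c k l = - (N (c k) / (\<Prod>j\<in>I6-{l}-{k}. th (c j / c k))) / (qp q * (\<Prod>j\<in>I6-{l}. th (c j * c l)))"
      unfolding e N_def using eta_Gf[OF gen _ l] that by simp
    finally show ?thesis by simp
  qed
  ultimately have "(\<Sum>k\<in>I6-{l}. eta c k * Hf c k l) = 0"
    by (simp only: sum_distrib_right[symmetric] mult_zero_left cong: sum.cong)
  moreover have "eta c l * Hf c l l = 0"
    using c0[OF l] by (simp add: Hf_def Gf_def th_eq_0_iff)
  ultimately show ?thesis using l by (simp add: sum.remove[of I6 l])
qed

text \<open>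
  The terms with \<open>k = l\<close> and \<open>k = m\<close> vanish. After cancellation, the other four are the terms of
  \<open>four_theta\<close>, up to a common factor.
\<close>

lemma eta_Hf_Hf_sum:
  assumes gen: "generic c" and c1: "(\<Prod>j\<in>I6. c j) = q" and lm: "l \<in> I6" "m \<in> I6" "l \<noteq> m"
  shows "(\<Sum>k\<in>I6. eta c k * Hf c k l * Hf c k m) = - 2 * (Pp c)^2 / pair_prod I6 (\<lambda>i j. th (c i * c j))"
proof -
  let ?O = "I6 - {l,m}"
  have c0: "c j \<noteq> 0" if "j \<in> I6" for j using genericD(1)[OF gen that that] .
  define Ll where "Ll = (\<Prod>j\<in>I6-{l}. th (c j * c l))"
  define Lm where "Lm = (\<Prod>j\<in>I6-{m}. th (c j * c m))"
  have O4: "card ?O = 4" by (rule card_I6_remove2[OF lm])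
  have trm: "eta c k * Gf c k l * Gf c k m = th ((c k)^2) / ((c k)^2 * (\<Prod>j\<in>?O-{k}. th (c j / c k) * th (c j * c k))) / (Ll * Lm)"
    if k: "k \<in> ?O" for k
  proof -
    have kk: "k \<in> I6" "k \<noteq> l" "k \<noteq> m" using k by auto
    have e: "I6 - {k,l} - {m} = ?O - {k}" "I6 - {k,m} - {l} = ?O - {k}" "I6 - {m} - {k} = I6 - {k,m}" by auto
    have p1: "(\<Prod>j\<in>I6-{k,l}. th (c j / c k)) = th (c m / c k) * (\<Prod>j\<in>?O-{k}. th (c j / c k))"
      using kk lm prod.remove[of "I6-{k,l}" m "\<lambda>j. th (c j / c k)"] e by simp
    have p2: "(\<Prod>j\<in>I6-{k,m}. th (c j * c k)) = th (c l * c k) * (\<Prod>j\<in>?O-{k}. th (c j * c k))"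
      using kk lm prod.remove[of "I6-{k,m}" l "\<lambda>j. th (c j * c k)"] e by simp
    have p3: "Lm = th (c k * c m) * (\<Prod>j\<in>I6-{k,m}. th (c j * c m))"
      unfolding Lm_def using kk lm prod.remove[of "I6-{m}" k "\<lambda>j. th (c j * c m)"] e by simp
    have nz: "th (c m / c k) \<noteq> 0" "th (c l * c k) \<noteq> 0" "th (c k * c m) \<noteq> 0" "(\<Prod>j\<in>I6-{k,m}. th (c j * c m)) \<noteq> 0"
      "(\<Prod>j\<in>?O-{k}. th (c j / c k)) \<noteq> 0" "(\<Prod>j\<in>?O-{k}. th (c j * c k)) \<noteq> 0" "c k \<noteq> 0" "Ll \<noteq> 0"
      using th_mult_nz[OF gen] th_ratio_nz[OF gen] kk lm c0 by (auto simp: prod_zero_iff Ll_def)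
    have G: "Gf c k m = - qp q * c k * th (c m / c k) / (th (c l * c k) * (\<Prod>j\<in>?O-{k}. th (c j * c k)) * Lm)"
      unfolding Gf_def prod.distrib p2 p3 by (simp add: mult_ac)
    show ?thesis
      unfolding eta_Gf[OF gen kk(1) lm(1) kk(2)] G p1 Ll_def[symmetric] prod.distrib using nz qp_q_nz
      by (simp add: divide_simps mult.commute[of "c l"]) (simp add: eval_nat_numeral mult_ac)
  qed
  obtain x y z w where O: "?O = {x, y, z, w}" and dist: "distinct [x, y, z, w]"
    using card_4_obtain[OF O4] by blast
  have inO: "x \<in> I6" "y \<in> I6" "z \<in> I6" "w \<in> I6" using O by blast+
  define S4 where "S4 = (\<Sum>k\<in>?O. th ((c k)^2) / ((c k)^2 * (\<Prod>j\<in>?O-{k}. th (c j / c k) * th (c j * c k))))"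
  have rem: "{x,y,z,w} - {x} = {y,z,w}" "{x,y,z,w} - {y} = {x,z,w}" "{x,y,z,w} - {z} = {x,y,w}" "{x,y,z,w} - {w} = {x,y,z}"
    using dist by auto
  have pp: "pair_prod ?O (\<lambda>i j. th (c i * c j)) = th (c x * c y) * th (c x * c z) * th (c x * c w) * th (c y * c z) * th (c y * c w) * th (c z * c w)"
  proof -
    have [simp]: "pair_prod {} F = 1" for F by (simp add: pair_prod_def)
    show ?thesis unfolding O using dist
      by (simp add: pair_prod_insert mult.commute[of "c _" "c _"])
  qed
  define PiO where "PiO = pair_prod ?O (\<lambda>i j. th (c i * c j))"
  have nzm: "th (c i * c j) \<noteq> 0" if "i \<in> I6" "j \<in> I6" for i j using th_mult_nz[OF gen that] .
  have nzr: "th (c i / c j) \<noteq> 0" if "i \<in> {x,y,z,w}" "j \<in> {x,y,z,w}" "i \<noteq> j" for i j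
    using th_ratio_nz[OF gen] that inO by auto
  have Pi0: "PiO \<noteq> 0" unfolding PiO_def by (intro pair_prod_nz nzm) auto
  have B: "c x * c y * c z * c w = q / (c l * c m)"
  proof -
    have "c l * c m * (\<Prod>j\<in>?O. c j) = q" using prod_I6_remove2[OF lm, of c] c1 by simp
    moreover have "(\<Prod>j\<in>?O. c j) = c x * c y * c z * c w" unfolding O using dist by (simp add: mult_ac)
    ultimately show ?thesis using c0 lm by (simp add: field_simps)
  qed
  have "S4 * PiO = - 2 * th (c x * c y * c z * c w)"
  proof -
    have cancel: "t / (a * (r1 * m1 * (r2 * m2 * (r3 * m3)))) * (m1 * m2 * m3 * n1 * n2 * n3) = t * n1 * n2 * n3 / (a * r1 * r2 * r3)"
      if "m1 \<noteq> 0" "m2 \<noteq> 0" "m3 \<noteq> 0" for t a r1 r2 r3 m1 m2 m3 n1 n2 n3 :: complex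
      using that by (simp add: divide_simps)
    have t1: "th ((c x)^2) / ((c x)^2 * (\<Prod>j\<in>?O-{x}. th (c j / c x) * th (c j * c x))) * PiO =
       th ((c x)^2) * th (c y * c z) * th (c y * c w) * th (c z * c w) / ((c x)^2 * th (c y / c x) * th (c z / c x) * th (c w / c x))"
    proof -
      have "PiO = th (c y * c x) * th (c z * c x) * th (c w * c x) * th (c y * c z) * th (c y * c w) * th (c z * c w)"
        unfolding PiO_def pp by (simp only: mult_ac)
      moreover have "(\<Prod>j\<in>?O-{x}. th (c j / c x) * th (c j * c x)) = th (c y / c x) * th (c y * c x) * (th (c z / c x) * th (c z * c x) * (th (c w / c x) * th (c w * c x)))"
        unfolding O rem using dist by simp
      ultimately show ?thesis using inO by (simp only: cancel[OF nzm nzm nzm])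
    qed
    have t2: "th ((c y)^2) / ((c y)^2 * (\<Prod>j\<in>?O-{y}. th (c j / c y) * th (c j * c y))) * PiO =
       th ((c y)^2) * th (c x * c z) * th (c x * c w) * th (c z * c w) / ((c y)^2 * th (c x / c y) * th (c z / c y) * th (c w / c y))"
    proof -
      have "PiO = th (c x * c y) * th (c z * c y) * th (c w * c y) * th (c x * c z) * th (c x * c w) * th (c z * c w)"
        unfolding PiO_def pp by (simp only: mult_ac)
      moreover have "(\<Prod>j\<in>?O-{y}. th (c j / c y) * th (c j * c y)) = th (c x / c y) * th (c x * c y) * (th (c z / c y) * th (c z * c y) * (th (c w / c y) * th (c w * c y)))"
        unfolding O rem using dist by simp
      ultimately show ?thesis using inO by (simp only: cancel[OF nzm nzm nzm])
    qed
    have t3: "th ((c z)^2) / ((c z)^2 * (\<Prod>j\<in>?O-{z}. th (c j / c z) * th (c j * c z))) * PiO =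
       th ((c z)^2) * th (c x * c y) * th (c x * c w) * th (c y * c w) / ((c z)^2 * th (c x / c z) * th (c y / c z) * th (c w / c z))"
    proof -
      have "PiO = th (c x * c z) * th (c y * c z) * th (c w * c z) * th (c x * c y) * th (c x * c w) * th (c y * c w)"
        unfolding PiO_def pp by (simp only: mult_ac)
      moreover have "(\<Prod>j\<in>?O-{z}. th (c j / c z) * th (c j * c z)) = th (c x / c z) * th (c x * c z) * (th (c y / c z) * th (c y * c z) * (th (c w / c z) * th (c w * c z)))"
        unfolding O rem using dist by simp
      ultimately show ?thesis using inO by (simp only: cancel[OF nzm nzm nzm])
    qed
    have t4: "th ((c w)^2) / ((c w)^2 * (\<Prod>j\<in>?O-{w}. th (c j / c w) * th (c j * c w))) * PiO =
       th ((c w)^2) * th (c x * c y) * th (c x * c z) * th (c y * c z) / ((c w)^2 * th (c x / c w) * th (c y / c w) * th (c z / c w))"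
    proof -
      have "PiO = th (c x * c w) * th (c y * c w) * th (c z * c w) * th (c x * c y) * th (c x * c z) * th (c y * c z)"
        unfolding PiO_def pp by (simp only: mult_ac)
      moreover have "(\<Prod>j\<in>?O-{w}. th (c j / c w) * th (c j * c w)) = th (c x / c w) * th (c x * c w) * (th (c y / c w) * th (c y * c w) * (th (c z / c w) * th (c z * c w)))"
        unfolding O rem using dist by simp
      ultimately show ?thesis using inO by (simp only: cancel[OF nzm nzm nzm])
    qed
    have sO: "(\<Sum>k\<in>?O. f k) = f x + f y + f z + f w" for f :: "nat \<Rightarrow> complex"
      unfolding O using dist by (simp add: add_ac)
    have "S4 * PiO = (\<Sum>k\<in>?O. th ((c k)^2) / ((c k)^2 * (\<Prod>j\<in>?O-{k}. th (c j / c k) * th (c j * c k))) * PiO)"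
      unfolding S4_def by (rule sum_distrib_right)
    also have "\<dots> = - 2 * th (c x * c y * c z * c w)"
      unfolding sO t1 t2 t3 t4 by (rule four_theta) (use c0 inO nzr dist in auto)
    finally show ?thesis .
  qed
  also have "th (c x * c y * c z * c w) = th (c l * c m)" unfolding B using c0 lm by (intro th_reflect) auto
  finally have S4: "S4 = - 2 * th (c l * c m) / PiO" using Pi0 by (simp add: field_simps)
  have e: "I6 - {l} - {m} = ?O" "I6 - {m} - {l} = ?O" by auto
  have Llm: "Ll = th (c l * c m) * (\<Prod>j\<in>?O. th (c l * c j))" "Lm = th (c l * c m) * (\<Prod>j\<in>?O. th (c m * c j))"
    unfolding Ll_def Lm_def using lm prod.remove[of "I6-{l}" m "\<lambda>j. th (c j * c l)"] prod.remove[of "I6-{m}" l "\<lambda>j. th (c j * c m)"] e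
    by (simp_all add: mult.commute)
  have pI: "pair_prod I6 (\<lambda>i j. th (c i * c j)) = th (c l * c m) * (\<Prod>j\<in>?O. th (c l * c j)) * (\<Prod>j\<in>?O. th (c m * c j)) * PiO"
    unfolding PiO_def by (rule pair_prod_remove2_I6[OF lm]) (simp add: mult.commute)
  have "(\<Sum>k\<in>I6. eta c k * Gf c k l * Gf c k m) = eta c l * Gf c l l * Gf c l m + eta c m * Gf c m l * Gf c m m + (\<Sum>k\<in>?O. eta c k * Gf c k l * Gf c k m)"
  proof -
    have "(\<Sum>k\<in>I6. f k) = f l + (f m + (\<Sum>k\<in>I6-{l}-{m}. f k))" for f :: "nat \<Rightarrow> complex"
      using lm by (subst sum.remove[of I6 l], simp, simp, subst sum.remove[of "I6-{l}" m]) auto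
    thus ?thesis unfolding e by (simp add: add_ac)
  qed
  moreover have "Gf c l l = 0" "Gf c m m = 0" using c0 lm by (auto simp: Gf_def th_eq_0_iff)
  ultimately have "(\<Sum>k\<in>I6. eta c k * Gf c k l * Gf c k m) = (\<Sum>k\<in>?O. eta c k * Gf c k l * Gf c k m)" by simp
  also have "\<dots> = S4 / (Ll * Lm)"
    unfolding S4_def sum_divide_distrib by (intro sum.cong trm refl)
  also have "\<dots> = - 2 / pair_prod I6 (\<lambda>i j. th (c i * c j))"
    unfolding S4 Llm pI using nzm[OF lm(1,2)] by (simp add: divide_simps)
  finally have "(\<Sum>k\<in>I6. eta c k * Gf c k l * Gf c k m) = - 2 / pair_prod I6 (\<lambda>i j. th (c i * c j))" .
  moreover have "(\<Sum>k\<in>I6. eta c k * Hf c k l * Hf c k m) = (Pp c)^2 * (\<Sum>k\<in>I6. eta c k * Gf c k l * Gf c k m)"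
    unfolding sum_distrib_left by (intro sum.cong) (auto simp: Hf_def power2_eq_square)
  ultimately show ?thesis by simp
qed

end

section \<open>Shifting the parameters by powers of q\<close>

lemma I6_eq: "I6 = {1,2,3,4,5,6}" by (auto simp: I6_def)

lemma pair_prod_mult: "pair_prod A (\<lambda>i j. F i j * G i j) = pair_prod A F * pair_prod A G"
  by (simp add: pair_prod_def prod.distrib)

lemma pair_prod_divide: "pair_prod A (\<lambda>i j. F i j / G i j) = pair_prod A F / pair_prod A G"
  by (simp add: pair_prod_def prod_dividef)

lemma sum_I6: "(\<Sum>j\<in>I6. f j) = f 1 + f 2 + f 3 + f 4 + f 5 + (f 6 :: 'a :: comm_monoid_add)"
  by (simp add: I6_eq add_ac)

lemma pair_prod_I6_expand:
  "pair_prod I6 F = F 1 2 * F 1 3 * F 1 4 * F 1 5 * F 1 6 * F 2 3 * F 2 4 * F 2 5 * F 2 6 * F 3 4 * F 3 5 * F 3 6 * F 4 5 * F 4 6 * F 5 6"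
proof -
  have sets: "{j\<in>I6. 1 < j} = {2,3,4,5,6}" "{j\<in>I6. 2 < j} = {3,4,5,6}" "{j\<in>I6. 3 < j} = {4,5,6}"
    "{j\<in>I6. 4 < j} = {5,6}" "{j\<in>I6. 5 < j} = {6}" "{j\<in>I6. 6 < j} = {}" by (auto simp: I6_eq)
  have "pair_prod I6 F = (\<Prod>j\<in>{j\<in>I6. 1 < j}. F 1 j) * (\<Prod>j\<in>{j\<in>I6. 2 < j}. F 2 j) * (\<Prod>j\<in>{j\<in>I6. 3 < j}. F 3 j)
     * (\<Prod>j\<in>{j\<in>I6. 4 < j}. F 4 j) * (\<Prod>j\<in>{j\<in>I6. 5 < j}. F 5 j) * (\<Prod>j\<in>{j\<in>I6. 6 < j}. F 6 j)"
    unfolding pair_prod_def by (subst (1) I6_eq) (simp only: prod.insert finite_insert finite.emptyI insert_iff empty_iff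
        prod.empty mult_1_right mult.assoc num.distinct numeral_eq_iff numeral_eq_one_iff one_eq_numeral_iff num.inject simp_thms)
  thus ?thesis unfolding sets by (simp add: mult.assoc)
qed

text \<open>
  Exponents of a product over the 15 pairs of six indices. The difference of the two sides is a
  multiple of the sum of the \<open>E\<close>. The number \<open>p\<close> stands for \<open>\<pi> i\<close>, a logarithm of \<open>-1\<close>.
\<close>

lemma pair_exponent_sum:
  fixes E1 E2 E3 E4 E5 E6 p B1 B2 B3 B4 B5 B6 L :: complex
  assumes "E1 + E2 + E3 + E4 + E5 + E6 = 0"
  shows "((E1+E2) * (p + (B1+B2)) + L * ((E1+E2) * (E1+E2-1) / 2)) + ((E1+E3) * (p + (B1+B3)) + L * ((E1+E3) * (E1+E3-1) / 2))
    + ((E1+E4) * (p + (B1+B4)) + L * ((E1+E4) * (E1+E4-1) / 2)) + ((E1+E5) * (p + (B1+B5)) + L * ((E1+E5) * (E1+E5-1) / 2))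
    + ((E1+E6) * (p + (B1+B6)) + L * ((E1+E6) * (E1+E6-1) / 2)) + ((E2+E3) * (p + (B2+B3)) + L * ((E2+E3) * (E2+E3-1) / 2))
    + ((E2+E4) * (p + (B2+B4)) + L * ((E2+E4) * (E2+E4-1) / 2)) + ((E2+E5) * (p + (B2+B5)) + L * ((E2+E5) * (E2+E5-1) / 2))
    + ((E2+E6) * (p + (B2+B6)) + L * ((E2+E6) * (E2+E6-1) / 2)) + ((E3+E4) * (p + (B3+B4)) + L * ((E3+E4) * (E3+E4-1) / 2))
    + ((E3+E5) * (p + (B3+B5)) + L * ((E3+E5) * (E3+E5-1) / 2)) + ((E3+E6) * (p + (B3+B6)) + L * ((E3+E6) * (E3+E6-1) / 2))
    + ((E4+E5) * (p + (B4+B5)) + L * ((E4+E5) * (E4+E5-1) / 2)) + ((E4+E6) * (p + (B4+B6)) + L * ((E4+E6) * (E4+E6-1) / 2))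
    + ((E5+E6) * (p + (B5+B6)) + L * ((E5+E6) * (E5+E6-1) / 2))
   = 4 * ((E1 * B1 + L * (E1 * (E1-1) / 2)) + (E2 * B2 + L * (E2 * (E2-1) / 2)) + (E3 * B3 + L * (E3 * (E3-1) / 2))
      + (E4 * B4 + L * (E4 * (E4-1) / 2)) + (E5 * B5 + L * (E5 * (E5-1) / 2)) + (E6 * B6 + L * (E6 * (E6-1) / 2)))" (is "?l = ?r")
proof -
  define M where "M = L / 2"
  have M: "L * (x / 2) = M * x" for x by (simp add: M_def)
  have "?l - ?r = (E1 + E2 + E3 + E4 + E5 + E6) * (5 * p + (B1 + B2 + B3 + B4 + B5 + B6) + M * (E1 + E2 + E3 + E4 + E5 + E6 - 1))"
    unfolding M by algebra
  thus ?thesis using assms by simp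
qed

context qbase begin

lemma qpoch_0 [simp]: "qpoch q a 0 = 1" by (simp add: qpoch_def)

lemma qpoch_plus_1:
  assumes "a \<notin> qpowers q"
  shows "qpoch q a (m + 1) = qpoch q a m * (1 - a * q powi m)"
proof (cases "m \<ge> 0")
  case True
  hence "nat (m + 1) = Suc (nat m)" by simp
  thus ?thesis using True by (simp add: qpoch_def powi_nonneg)
next
  case False
  define n where "n = nat (- m - 1)"
  have m: "m = - int (Suc n)" using False by (simp add: n_def)
  have nz: "1 - a * q powi m \<noteq> 0"
  proof
    assume "1 - a * q powi m = 0"
    hence "a * q powi m \<in> qpowers q" by simp
    thus False using assms by (simp only: qpowers_cancel)
  qed
  have 1: "qpoch q a m = inverse ((\<Prod>i=1..n. 1 - a * q powi (- int i)) * (1 - a * q powi m))"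
  proof -
    have "nat (- m) = Suc n" by (simp add: m)
    thus ?thesis using False unfolding qpoch_def by (simp add: m)
  qed
  have 2: "qpoch q a (m + 1) = inverse (\<Prod>i=1..n. 1 - a * q powi (- int i))"
  proof (cases "n = 0")
    case True
    thus ?thesis by (simp add: m)
  next
    case False
    hence "\<not> m + 1 \<ge> 0" "nat (- (m + 1)) = n" by (auto simp: m)
    thus ?thesis by (simp only: qpoch_def if_False)
  qed
  show ?thesis unfolding 1 2 using nz by simp
qed

lemma qp_mult_qpoch:
  assumes "a \<notin> qpowers q"
  shows "qp (a * q powi m) * qpoch q a m = qp a"
proof (induction m rule: int_shift_induct)
  case (step m)
  have "qp (a * q powi m) = (1 - a * q powi m) * qp (a * q powi (m + 1))"
    using qp_rec[of "a * q powi m"] q_nz by (simp add: power_int_add mult_ac)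
  hence "qp (a * q powi m) * qpoch q a m = qp (a * q powi (m + 1)) * qpoch q a (m + 1)"
    unfolding qpoch_plus_1[OF assms] by (simp only: mult_ac)
  thus ?case by simp
qed simp

lemma qp_inverse_qpoch:
  assumes "x \<notin> qpowers q" "x \<noteq> 0"
  shows "qp (q / (x * q powi m)) * ((-x) powi m * qb m) = qp (q / x) * qpoch q x m"
proof (induction m rule: int_shift_induct)
  case (step m)
  have "qp (q / (x * q powi (m + 1))) = (1 - 1 / (x * q powi m)) * qp (q / (x * q powi m))"
    using qp_rec[of "q / (x * q powi (m + 1))"] q_nz by (simp add: power_int_add mult_ac)
  moreover have "(1 - 1 / (x * q powi m)) * (-x * q powi m) = 1 - x * q powi m"
    using assms q_nz by (simp add: field_simps)
  moreover have "(-x) powi (m + 1) * qb (m + 1) = (-x) powi m * qb m * (- x * q powi m)"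
    using assms by (simp add: power_int_add qb_Suc)
  ultimately have *: "qp (q / (x * q powi (m + 1))) * ((-x) powi (m + 1) * qb (m + 1)) =
      (qp (q / (x * q powi m)) * ((-x) powi m * qb m)) * (1 - x * q powi m)"
  proof -
    have ring: "A * B * (C * (D * E)) = B * (C * D) * (A * E)" for A B C D E :: complex by (simp only: mult_ac)
    show ?thesis unfolding \<open>qp (q / (x * q powi (m + 1))) = _\<close> \<open>(-x) powi (m + 1) * qb (m + 1) = _\<close>
      using ring[of "1 - 1 / (x * q powi m)" "qp (q / (x * q powi m))" "(-x) powi m" "qb m" "-x * q powi m"]
        \<open>(1 - 1 / (x * q powi m)) * (-x * q powi m) = 1 - x * q powi m\<close> by (simp only: mult.assoc)
  qed
  have nz: "1 - x * q powi m \<noteq> 0"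
  proof
    assume "1 - x * q powi m = 0"
    hence "x * q powi m \<in> qpowers q" by simp
    thus False using assms by (simp only: qpowers_cancel)
  qed
  show ?case unfolding * qpoch_plus_1[OF assms(1)] using nz by simp
qed simp

text \<open>
  The denominator in the values of the Rahman functional, and \<open>jval b e\<close> is the value itself at the
  spanning function with exponents \<open>e\<close>.
\<close>

definition mu :: "(nat \<Rightarrow> complex) \<Rightarrow> (nat \<Rightarrow> int) \<Rightarrow> complex" where
  "mu b e = (\<Prod>j\<in>I6. qb (e j) * b j powi e j)"

definition jval :: "(nat \<Rightarrow> complex) \<Rightarrow> (nat \<Rightarrow> int) \<Rightarrow> complex" where
  "jval b e = pair_prod I6 (\<lambda>i j. qpoch q (b i * b j) (e i + e j)) / mu b e"

text \<open>
  A logarithm of the automorphy factor \<open>(- exp x)\<^bsup>m\<^esup> q\<^bsup>binom(m,2)\<^esup>\<close> for \<open>q = exp L\<close>. Logarithms reduce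
  the identities between products of such factors to polynomial identities.
\<close>

definition qexp :: "complex \<Rightarrow> complex \<Rightarrow> int \<Rightarrow> complex" where
  "qexp L x m = of_int m * (of_real pi * \<i> + x) + L * (of_int m * (of_int m - 1) / 2)"

lemma qb_exp: assumes "q = exp L" shows "qb m = exp (L * (of_int m * (of_int m - 1) / 2))"
proof -
  have "even (m * (m - 1))" by simp
  then obtain k where k: "m * (m - 1) = 2 * k" by (elim evenE)
  have "(of_int (m * (m - 1)) :: complex) = 2 * of_int k" unfolding k by simp
  hence "(of_int m * (of_int m - 1) / 2 :: complex) = of_int k" by simp
  thus ?thesis using k by (simp add: qbinom2_def assms exp_power_int mult.commute)
qed

lemma neg_powi_qb_exp: assumes "q = exp L" shows "(- exp x) powi m * qb m = exp (qexp L x m)"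
proof -
  have "- exp x = exp (of_real pi * \<i> + x)" by (simp add: exp_add)
  hence "(- exp x) powi m = exp (of_int m * (of_real pi * \<i> + x))" by (simp only: exp_power_int)
  thus ?thesis by (simp only: qb_exp[OF assms] qexp_def exp_add)
qed

text \<open>
  The logarithms add up to \<open>L\<close> itself and not just modulo \<open>2 \<pi> i\<close>, because the last one is defined by
  the others.
\<close>

lemma log_parameters:
  assumes "\<And>j. j \<in> I6 \<Longrightarrow> b j \<noteq> 0" "(\<Prod>j\<in>I6. b j) = q"
  obtains L \<beta> where "q = exp L" "\<And>j. j \<in> I6 \<Longrightarrow> b j = exp (\<beta> j)" "(\<Sum>j\<in>I6. \<beta> j) = L"
proof -
  define L where "L = Ln q"
  define \<beta> where "\<beta> j = (if j = 6 then L - (Ln (b 1) + Ln (b 2) + Ln (b 3) + Ln (b 4) + Ln (b 5)) else Ln (b j))" for j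
  have L: "q = exp L" using q_nz by (simp add: L_def)
  have b6: "b 6 = exp (\<beta> 6)"
  proof -
    have nz: "b 1 \<noteq> 0" "b 2 \<noteq> 0" "b 3 \<noteq> 0" "b 4 \<noteq> 0" "b 5 \<noteq> 0" using assms(1) by (auto simp: I6_def)
    have "b 1 * b 2 * b 3 * b 4 * b 5 * b 6 = q" using assms(2) by (simp add: I6_eq mult_ac)
    hence "b 6 = q / (b 1 * b 2 * b 3 * b 4 * b 5)" using nz by (simp add: field_simps)
    thus ?thesis using nz L by (simp add: \<beta>_def exp_diff exp_add)
  qed
  have "b j = exp (\<beta> j)" if "j \<in> I6" for j
    using b6 assms(1)[OF that] by (cases "j = 6") (auto simp: \<beta>_def)
  moreover have "(\<Sum>j\<in>I6. \<beta> j) = L" by (simp add: sum_I6 \<beta>_def)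
  ultimately show ?thesis using that L by blast
qed

lemma mu_exp:
  assumes "q = exp L" "\<And>j. j \<in> I6 \<Longrightarrow> b j = exp (\<beta> j)"
  shows "mu b e = exp (\<Sum>j\<in>I6. of_int (e j) * \<beta> j + L * (of_int (e j) * (of_int (e j) - 1) / 2))"
proof -
  have "mu b e = (\<Prod>j\<in>I6. exp (of_int (e j) * \<beta> j + L * (of_int (e j) * (of_int (e j) - 1) / 2)))"
    unfolding mu_def by (intro prod.cong) (simp_all add: assms(2) qb_exp[OF assms(1)] exp_power_int exp_add)
  thus ?thesis by (simp add: exp_sum)
qed

lemma mu_nz: "(\<And>j. j \<in> I6 \<Longrightarrow> b j \<noteq> 0) \<Longrightarrow> mu b e \<noteq> 0"
  by (auto simp: mu_def prod_zero_iff)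

lemma Pp_shiftp:
  assumes gen: "generic b" and b1: "(\<Prod>j\<in>I6. b j) = q" and e0: "(\<Sum>j\<in>I6. e j) = 0"
  shows "Pp (shiftp b e) * mu b e ^ 4 = Pp b * pair_prod I6 (\<lambda>i j. qpoch q (b i * b j) (e i + e j))"
proof -
  have b0: "b j \<noteq> 0" if "j \<in> I6" for j using genericD(1)[OF gen that that] .
  obtain L \<beta> where L: "q = exp L" and \<beta>: "\<And>j. j \<in> I6 \<Longrightarrow> b j = exp (\<beta> j)" and s\<beta>: "(\<Sum>j\<in>I6. \<beta> j) = L"
    using log_parameters[OF b0 b1] by blast
  have e0': "of_int (e 1) + of_int (e 2) + of_int (e 3) + of_int (e 4) + of_int (e 5) + of_int (e 6) = (0::complex)"
    using e0 unfolding sum_I6 by (metis of_int_add of_int_0)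
  have "pair_prod I6 (\<lambda>i j. (- (b i * b j)) powi (e i + e j) * qb (e i + e j)) = pair_prod I6 (\<lambda>i j. exp (qexp L (\<beta> i + \<beta> j) (e i + e j)))"
    using \<beta> by (intro pair_prod_cong) (simp add: exp_add[symmetric] neg_powi_qb_exp[OF L])
  also have "\<dots> = exp (4 * (\<Sum>j\<in>I6. of_int (e j) * \<beta> j + L * (of_int (e j) * (of_int (e j) - 1) / 2)))"
    unfolding pair_prod_I6_expand exp_add[symmetric] qexp_def of_int_add sum_I6
    using pair_exponent_sum[OF e0', of "of_real pi * \<i>" "\<beta> 1" "\<beta> 2" L "\<beta> 3" "\<beta> 4" "\<beta> 5" "\<beta> 6"]
    by (simp only: add.assoc)
  also have "\<dots> = mu b e ^ 4"
  proof -
    define S where "S = (\<Sum>j\<in>I6. of_int (e j) * \<beta> j + L * (of_int (e j) * (of_int (e j) - 1) / 2))"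
    have "mu b e = exp S" unfolding S_def using \<beta> by (intro mu_exp[OF L])
    thus ?thesis using exp_of_nat_mult[of 4 S] unfolding S_def[symmetric] by simp
  qed
  finally have m: "pair_prod I6 (\<lambda>i j. (- (b i * b j)) powi (e i + e j) * qb (e i + e j)) = mu b e ^ 4" .
  have "Pp (shiftp b e) * mu b e ^ 4 = pair_prod I6 (\<lambda>i j. qp (q / (b i * b j * q powi (e i + e j))) * ((- (b i * b j)) powi (e i + e j) * qb (e i + e j)))"
    unfolding m[symmetric] Pp_def shiftp_mult pair_prod_mult ..
  also have "\<dots> = pair_prod I6 (\<lambda>i j. qp (q / (b i * b j)) * qpoch q (b i * b j) (e i + e j))"
    using genericD[OF gen] by (intro pair_prod_cong qp_inverse_qpoch) auto
  finally show ?thesis by (simp only: pair_prod_mult Pp_def)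
qed

lemma Gf_shiftp:
  assumes gen: "generic b" and b1: "(\<Prod>j\<in>I6. b j) = q" and e0: "(\<Sum>j\<in>I6. e j) = 0"
    and kl: "k \<in> I6" "l \<in> I6" "k \<noteq> l"
  shows "Gf (shiftp b e) k l = mu b e ^ 2 * Gf b k l"
proof -
  have b0: "b j \<noteq> 0" if "j \<in> I6" for j using genericD(1)[OF gen that that] .
  obtain L \<beta> where L: "q = exp L" and \<beta>: "\<And>j. j \<in> I6 \<Longrightarrow> b j = exp (\<beta> j)" and s\<beta>: "(\<Sum>j\<in>I6. \<beta> j) = L"
    using log_parameters[OF b0 b1] by blast
  have th: "th (exp x * q powi m) = th (exp x) * exp (- qexp L x m)" for x m
  proof -
    have "th (exp x * q powi m) * exp (qexp L x m) = th (exp x)"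
      using th_powi[of "exp x" m] unfolding neg_powi_qb_exp[OF L] by simp
    thus ?thesis by (simp add: exp_minus field_simps)
  qed
  obtain x y z w where O: "I6 - {k,l} = {x, y, z, w}" and dist: "distinct [x, y, z, w]"
    using card_4_obtain[OF card_I6_remove2[OF kl]] by blast
  have inO: "x \<in> I6" "y \<in> I6" "z \<in> I6" "w \<in> I6" using O by blast+
  have sumI: "(\<Sum>j\<in>I6. f j) = f k + f l + f x + f y + f z + f w" for f :: "nat \<Rightarrow> 'z::comm_monoid_add"
  proof -
    have "(\<Sum>j\<in>I6. f j) = f k + (f l + (\<Sum>j\<in>I6-{k}-{l}. f j))"
      using kl by (subst sum.remove[of I6 k], simp, simp, subst sum.remove[of "I6-{k}" l]) auto
    moreover have "I6-{k}-{l} = {x, y, z, w}" using O by auto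
    ultimately show ?thesis using dist by (simp add: add_ac)
  qed
  have prodO: "(\<Prod>j\<in>I6-{k,l}. f j) = f x * f y * f z * f w" for f :: "nat \<Rightarrow> complex"
    unfolding O using dist by (simp add: mult_ac)
  have tm: "th (shiftp b e i * shiftp b e j) = th (b i * b j) * exp (- qexp L (\<beta> i + \<beta> j) (e i + e j))" if "i \<in> I6" "j \<in> I6" for i j
    unfolding shiftp_mult \<beta>[OF that(1)] \<beta>[OF that(2)] exp_add[symmetric] th ..
  have td: "th (shiftp b e l / shiftp b e k) = th (b l / b k) * exp (- qexp L (\<beta> l - \<beta> k) (e l - e k))"
    unfolding shiftp_div \<beta>[OF kl(1)] \<beta>[OF kl(2)] exp_diff[symmetric] th ..
  define S where "S = of_int (e k) * L - qexp L (\<beta> l - \<beta> k) (e l - e k) + qexp L (\<beta> k + \<beta> l) (e k + e l)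
    + qexp L (\<beta> x + \<beta> k) (e x + e k) + qexp L (\<beta> y + \<beta> k) (e y + e k) + qexp L (\<beta> z + \<beta> k) (e z + e k) + qexp L (\<beta> w + \<beta> k) (e w + e k)
    + qexp L (\<beta> x + \<beta> l) (e x + e l) + qexp L (\<beta> y + \<beta> l) (e y + e l) + qexp L (\<beta> z + \<beta> l) (e z + e l) + qexp L (\<beta> w + \<beta> l) (e w + e l)"
  have "Gf (shiftp b e) k l = Gf b k l * exp S"
  proof -
    have sk: "shiftp b e k = b k * exp (of_int (e k) * L)" using exp_power_int[of L "e k"] unfolding shiftp_def L[symmetric] by simp
    define P where "P = (\<Prod>j\<in>I6-{k,l}. th (b j * b k) * th (b j * b l))"
    define T where "T = qexp L (\<beta> x + \<beta> k) (e x + e k) + qexp L (\<beta> y + \<beta> k) (e y + e k) + qexp L (\<beta> z + \<beta> k) (e z + e k) + qexp L (\<beta> w + \<beta> k) (e w + e k)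
    + qexp L (\<beta> x + \<beta> l) (e x + e l) + qexp L (\<beta> y + \<beta> l) (e y + e l) + qexp L (\<beta> z + \<beta> l) (e z + e l) + qexp L (\<beta> w + \<beta> l) (e w + e l)"
    have pe: "(\<Prod>j\<in>I6-{k,l}. th (shiftp b e j * shiftp b e k) * th (shiftp b e j * shiftp b e l)) = P * exp (- T)"
      unfolding P_def prodO tm[OF inO(1) kl(1)] tm[OF inO(2) kl(1)] tm[OF inO(3) kl(1)] tm[OF inO(4) kl(1)]
        tm[OF inO(1) kl(2)] tm[OF inO(2) kl(2)] tm[OF inO(3) kl(2)] tm[OF inO(4) kl(2)] T_def minus_add_distrib exp_add
      by (simp only: mult_ac)
    have "Gf (shiftp b e) k l = - qp q * (b k * exp (of_int (e k) * L)) * (th (b l / b k) * exp (- qexp L (\<beta> l - \<beta> k) (e l - e k))) /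
        (th (b k * b l) * exp (- qexp L (\<beta> k + \<beta> l) (e k + e l)) * (P * exp (- T)))"
      unfolding Gf_def td tm[OF kl(1,2)] pe unfolding sk ..
    also have "\<dots> = (- qp q * b k * th (b l / b k) / (th (b k * b l) * P)) *
        (exp (of_int (e k) * L) * exp (- qexp L (\<beta> l - \<beta> k) (e l - e k)) * exp (qexp L (\<beta> k + \<beta> l) (e k + e l)) * exp T)"
      unfolding exp_minus by (simp add: divide_inverse mult_ac)
    also have "exp (of_int (e k) * L) * exp (- qexp L (\<beta> l - \<beta> k) (e l - e k)) * exp (qexp L (\<beta> k + \<beta> l) (e k + e l)) * exp T = exp S"
      unfolding exp_add[symmetric] S_def T_def by (rule arg_cong[of _ _ exp]) (simp add: algebra_simps)
    finally show ?thesis by (simp add: Gf_def P_def)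
  qed
  moreover have "S = 2 * (\<Sum>j\<in>I6. of_int (e j) * \<beta> j + L * (of_int (e j) * (of_int (e j) - 1) / 2)) +
      of_int (2 * e k + e l) * (2 * of_real pi * \<i>)"
  proof -
    have ew: "of_int (e w) = - (of_int (e k) + of_int (e l) + of_int (e x) + of_int (e y) + of_int (e z) :: complex)"
    proof -
      have "e w = - (e k + e l + e x + e y + e z)" using e0 unfolding sumI by linarith
      thus ?thesis by simp
    qed
    have bw: "\<beta> w = L - (\<beta> k + \<beta> l + \<beta> x + \<beta> y + \<beta> z)" using s\<beta> unfolding sumI by (simp add: algebra_simps)
    show ?thesis unfolding sumI S_def qexp_def of_int_add of_int_diff of_int_mult of_int_numeral ew bw
      by (simp add: field_simps)
  qed
  moreover have "exp (of_int n * (2 * of_real pi * \<i>)) = (1::complex)" for n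
    using exp_integer_2pi[of "of_int n"] by (simp add: mult_ac)
  ultimately have "Gf (shiftp b e) k l = Gf b k l * exp (2 * (\<Sum>j\<in>I6. of_int (e j) * \<beta> j + L * (of_int (e j) * (of_int (e j) - 1) / 2)))"
    by (simp add: exp_add del: of_int_add of_int_mult)
  also have "exp (2 * (\<Sum>j\<in>I6. of_int (e j) * \<beta> j + L * (of_int (e j) * (of_int (e j) - 1) / 2))) = mu b e ^ 2"
  proof -
    define S where "S = (\<Sum>j\<in>I6. of_int (e j) * \<beta> j + L * (of_int (e j) * (of_int (e j) - 1) / 2))"
    have "mu b e = exp S" unfolding S_def using \<beta> by (intro mu_exp[OF L])
    thus ?thesis using exp_double[of S] unfolding S_def[symmetric] by simp
  qed
  finally show ?thesis by (simp add: mult.commute)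
qed

text \<open>
  This is the place where the Rahman functional enters: under a shift of the parameters, the
  closed form of the Jackson summation changes by the value of the functional, up to \<open>mu\<close>.
\<close>

lemma Hf_shiftp:
  assumes gen: "generic b" and b1: "(\<Prod>j\<in>I6. b j) = q" and e0: "(\<Sum>j\<in>I6. e j) = 0"
    and kl: "k \<in> I6" "l \<in> I6" "k \<noteq> l"
  shows "mu b e * Hf (shiftp b e) k l = jval b e * Hf b k l"
proof -
  have b0: "b j \<noteq> 0" if "j \<in> I6" for j using genericD(1)[OF gen that that] .
  have m: "mu b e \<noteq> 0" using b0 by (rule mu_nz)
  have "Pp (shiftp b e) = Pp b * pair_prod I6 (\<lambda>i j. qpoch q (b i * b j) (e i + e j)) / mu b e ^ 4"
    using Pp_shiftp[OF gen b1 e0] m by (simp add: field_simps)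
  thus ?thesis unfolding Hf_def Gf_shiftp[OF assms] jval_def using m
    by (simp add: field_simps eval_nat_numeral)
qed

text \<open>
  With \<open>H = Hf c\<close> for the shifted parameters \<open>c\<close> and a constant \<open>r\<close> given by \<open>Hf_shiftp\<close>, write \<open>x\<^sub>k = x\<^sub>5 +
  jx r H\<^sub>k\<^sub>5\<close> and \<open>y\<^sub>k = y\<^sub>6 + jy H\<^sub>k\<^sub>6\<close>. Of the four sums that arise, three vanish by \<open>eta_sum\<close> and
  \<open>eta_Hf_sum\<close>. The reference indices differ because \<open>eta_Hf_Hf_sum\<close> evaluates the fourth sum for two
  different indices.
\<close>

lemma eta_sum_bilinear:
  assumes gen: "generic b" and b1: "(\<Prod>j\<in>I6. b j) = q" and N0: "(\<Sum>j\<in>I6. N j) = 0"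
    and x: "\<And>k l. k \<in> I6 \<Longrightarrow> l \<in> I6 \<Longrightarrow> k \<noteq> l \<Longrightarrow> x k - x l = jx * Hf b k l"
    and y: "\<And>k l. k \<in> I6 \<Longrightarrow> l \<in> I6 \<Longrightarrow> k \<noteq> l \<Longrightarrow> y k - y l = jy * Hf (shiftp b N) k l"
  shows "- mu b N * (\<Sum>k\<in>I6. eta (shiftp b N) k * x k * y k) =
    2 / mu b N * pair_prod I6 (\<lambda>i j. qp (q / (b i * b j)) / qp (b i * b j * q powi (N i + N j))) * jx * jy"
proof -
  define c where "c = shiftp b N"
  have genc: "generic c" unfolding c_def by (rule generic_shiftp[OF gen])
  have c1: "(\<Prod>j\<in>I6. c j) = q" unfolding c_def prod_shiftp b1 N0 by simp
  have b0: "b j \<noteq> 0" if "j \<in> I6" for j using genericD(1)[OF gen that that] .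
  have c0: "c j \<noteq> 0" if "j \<in> I6" for j using genericD(1)[OF genc that that] .
  have m: "mu b N \<noteq> 0" using b0 by (rule mu_nz)
  define Q where "Q = pair_prod I6 (\<lambda>i j. qpoch q (b i * b j) (N i + N j))"
  have Q0: "Q \<noteq> 0"
  proof -
    have "qpoch q (b i * b j) n \<noteq> 0" if "i \<in> I6" "j \<in> I6" for i j n
      using qp_mult_qpoch[OF genericD(3)[OF gen that], of n] not_qpowers_qp[OF genericD(3)[OF gen that]] by auto
    thus ?thesis unfolding Q_def by (intro pair_prod_nz) auto
  qed
  have Hself: "Hf a k k = 0" if "a k \<noteq> 0" for a k using that by (simp add: Hf_def Gf_def th_eq_0_iff)
  define r where "r = (mu b N)^2 / Q"
  have Hb: "Hf b k l = r * Hf c k l" if "k \<in> I6" "l \<in> I6" for k l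
  proof (cases "k = l")
    case True
    thus ?thesis using Hself b0 c0 that by simp
  next
    case False
    have "mu b N * Hf c k l = Q / mu b N * Hf b k l"
      using Hf_shiftp[OF gen b1 N0 that False] by (simp add: c_def jval_def Q_def)
    thus ?thesis using m Q0 by (simp add: r_def field_simps power2_eq_square)
  qed
  have l5: "5 \<in> I6" "6 \<in> I6" "(5::nat) \<noteq> 6" by (auto simp: I6_def)
  have x': "x k = x 5 + jx * r * Hf c k 5" if "k \<in> I6" for k
    using x[OF that l5(1)] Hb[OF that l5(1)] Hself[of c 5] c0 l5 by (cases "k = 5") (auto simp: algebra_simps)
  have y': "y k = y 6 + jy * Hf c k 6" if "k \<in> I6" for k
    using y[OF that l5(2)] Hself[of c 6] c0 l5 by (cases "k = 6") (auto simp: algebra_simps c_def)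
  have "(\<Sum>k\<in>I6. eta c k * x k * y k) =
     (\<Sum>k\<in>I6. x 5 * y 6 * eta c k + x 5 * jy * (eta c k * Hf c k 6) + jx * r * y 6 * (eta c k * Hf c k 5) +
        jx * r * jy * (eta c k * Hf c k 5 * Hf c k 6))"
    using x' y' by (intro sum.cong) (auto simp: algebra_simps)
  also have "\<dots> = x 5 * y 6 * (\<Sum>k\<in>I6. eta c k) + x 5 * jy * (\<Sum>k\<in>I6. eta c k * Hf c k 6) +
      jx * r * y 6 * (\<Sum>k\<in>I6. eta c k * Hf c k 5) + jx * r * jy * (\<Sum>k\<in>I6. eta c k * Hf c k 5 * Hf c k 6)"
    by (simp only: sum.distrib sum_distrib_left)
  also have "\<dots> = jx * r * jy * (- 2 * (Pp c)^2 / pair_prod I6 (\<lambda>i j. th (c i * c j)))"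
    unfolding eta_sum[OF genc c1] eta_Hf_sum[OF genc c1 l5(1)] eta_Hf_sum[OF genc c1 l5(2)] eta_Hf_Hf_sum[OF genc c1 l5] by simp
  also have "pair_prod I6 (\<lambda>i j. th (c i * c j)) = pair_prod I6 (\<lambda>i j. qp (c i * c j)) * Pp c"
    unfolding Pp_def th_def pair_prod_mult ..
  also have "pair_prod I6 (\<lambda>i j. qp (c i * c j)) = pair_prod I6 (\<lambda>i j. qp (b i * b j * q powi (N i + N j)))"
    unfolding c_def shiftp_mult ..
  finally have S: "(\<Sum>k\<in>I6. eta c k * x k * y k) =
     - 2 * (jx * r * jy) * Pp c / pair_prod I6 (\<lambda>i j. qp (b i * b j * q powi (N i + N j)))"
    using Pp_nz[OF genc] by (simp add: power2_eq_square)
  have P: "Pp c = Pp b * Q / mu b N ^ 4"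
    using Pp_shiftp[OF gen b1 N0] m by (simp add: c_def Q_def field_simps)
  show ?thesis unfolding c_def[symmetric] S P r_def pair_prod_divide Pp_def[symmetric] using m Q0
    by (simp add: field_simps eval_nat_numeral)
qed

end

section \<open>Rational functions as combinations of q-shifted factorials\<close>

lemma represents_add:
  assumes "represents r u v" "represents r' u v'"
  shows "represents (r + r') u (v + v')"
proof -
  obtain n d where 1: "r = Fraction_Field.Fract n d" "poly d u \<noteq> 0" "v = poly n u / poly d u"
    using assms(1) unfolding represents_def by blast
  obtain n' d' where 2: "r' = Fraction_Field.Fract n' d'" "poly d' u \<noteq> 0" "v' = poly n' u / poly d' u"
    using assms(2) unfolding represents_def by blast
  have "d \<noteq> 0" "d' \<noteq> 0" using 1 2 by auto
  thus ?thesis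
    unfolding represents_def using 1 2
    by (intro exI[of _ "n * d' + n' * d"] exI[of _ "d * d'"]) (simp add: add_frac_eq)
qed

lemma represents_const: "represents (to_fract [:c:]) u c"
  unfolding represents_def to_fract_def by (intro exI[of _ "[:c:]"] exI[of _ 1]) simp

text \<open>The polynomial underlying \<open>pm_factor\<close>; for \<open>c \<noteq> 0\<close> its root is \<open>ru c\<close>.\<close>

definition pmp :: "complex \<Rightarrow> complex poly" where
  "pmp c = [:1 + c ^ 2, - 2 * c:]"

definition ru :: "complex \<Rightarrow> complex" where
  "ru c = (c + inverse c) / 2"

lemma degree_pmp [simp]: "c \<noteq> 0 \<Longrightarrow> degree (pmp c) = 1" by (simp add: pmp_def)

lemma pmp_nz [simp]: "c \<noteq> 0 \<Longrightarrow> pmp c \<noteq> 0" by (simp add: pmp_def)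

lemma poly_pmp_ru:
  assumes "c \<noteq> 0" "d \<noteq> 0"
  shows "poly (pmp c) (ru d) = (1 - c * d) * (1 - c / d)"
proof -
  have "poly (pmp c) (ru d) = 1 + c^2 - c * (d + inverse d)" by (simp add: pmp_def ru_def)
  moreover have "d * inverse d = 1" using assms by simp
  ultimately have "poly (pmp c) (ru d) = (1 - c * d) * (1 - c * inverse d)" by algebra
  thus ?thesis by (simp add: divide_inverse)
qed

lemma pmp_eq:
  assumes "c \<noteq> 0" shows "pmp c = smult (- 2 * c) [:- ru c, 1:]"
proof -
  have "poly (pmp c) (ru c) = 0" using poly_pmp_ru[OF assms assms] assms by simp
  thus ?thesis by (simp add: pmp_def mult_ac)
qed

lemma prod_to_fract: "(\<Prod>x\<in>A. to_fract (f x)) = to_fract (\<Prod>x\<in>A. f x)"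
  by (induction A rule: infinite_finite_induct) (auto simp: to_fract_mult)

context qbase begin

text \<open>
  The admissible poles in the coordinate \<open>z\<close>. The set \<open>tri n\<close> selects \<open>b\<^sub>j q\<^bsup>-i\<^esup>\<close> with \<open>1 \<le> i \<le> n\<^sub>j\<close>, and \<open>den
  b n\<close> is a common denominator for functions with these poles.
\<close>

definition cc :: "(nat \<Rightarrow> complex) \<Rightarrow> nat \<times> nat \<Rightarrow> complex" where
  "cc b = (\<lambda>(j, i). b j * q powi (- int i))"

definition tri :: "(nat \<Rightarrow> nat) \<Rightarrow> (nat \<times> nat) set" where
  "tri n = (SIGMA j:I6. {1..n j})"

definition den :: "(nat \<Rightarrow> complex) \<Rightarrow> (nat \<Rightarrow> nat) \<Rightarrow> complex poly" where
  "den b n = (\<Prod>x\<in>tri n. pmp (cc b x))"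

lemma finite_tri [simp]: "finite (tri n)" by (simp add: tri_def)

lemma cc_nz: "generic b \<Longrightarrow> x \<in> tri n \<Longrightarrow> cc b x \<noteq> 0"
  using q_nz genericD(1)[of b] by (auto simp: cc_def tri_def)

text \<open>
  By genericity, different admissible poles \<open>z\<close> are neither equal nor inverse to each other, so the
  denominators \<open>den b n\<close> have simple roots.
\<close>

lemma cc_distinct:
  assumes gen: "generic b" and x: "fst x \<in> I6" "fst y \<in> I6" and "x \<noteq> y"
  shows "(1 - cc b x * cc b y) * (1 - cc b x / cc b y) \<noteq> 0"
proof -
  obtain j i j' i' where xy: "x = (j, i)" "y = (j', i')" by (metis surj_pair)
  have j: "j \<in> I6" "j' \<in> I6" using x xy by auto
  have "cc b x * cc b y = b j * b j' * q powi (- int i - int i')"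
    using q_nz by (simp add: xy cc_def power_int_diff power_int_minus field_simps)
  hence "cc b x * cc b y \<notin> qpowers q" using genericD(3)[OF gen j] by (simp only: qpowers_cancel not_False_eq_True)
  hence 1: "cc b x * cc b y \<noteq> 1" by auto
  have quot: "cc b x / cc b y = b j / b j' * q powi (int i' - int i)"
    using q_nz by (simp add: xy cc_def power_int_diff power_int_minus field_simps)
  have 2: "cc b x / cc b y \<noteq> 1"
  proof (cases "j = j'")
    case False
    hence "cc b x / cc b y \<notin> qpowers q" unfolding quot using genericD(2)[OF gen j] by (simp only: qpowers_cancel not_False_eq_True)
    thus ?thesis by auto
  next
    case True
    hence ne: "i \<noteq> i'" using assms xy by auto
    have "b j \<noteq> 0" using genericD(1)[OF gen j(1) j(1)] .
    hence "cc b x / cc b y = q powi (int i' - int i)" unfolding quot using True by simp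
    moreover have "q powi (int i' - int i) \<noteq> q powi 0" using ne q_powi_inj by (metis diff_eq_eq add_0 of_nat_eq_iff)
    ultimately show ?thesis by simp
  qed
  show ?thesis using 1 2 by simp
qed

lemma degree_den: assumes "generic b" shows "degree (den b n) = card (tri n)" and den_nz: "den b n \<noteq> 0"
proof -
  have nz: "pmp (cc b x) \<noteq> 0" if "x \<in> tri n" for x using cc_nz[OF assms that] by simp
  show "den b n \<noteq> 0" unfolding den_def using nz by (auto simp: prod_zero_iff)
  have "degree (den b n) = (\<Sum>x\<in>tri n. degree (pmp (cc b x)))"
    unfolding den_def using nz by (intro degree_prod_eq_sum_degree) auto
  also have "\<dots> = (\<Sum>x\<in>tri n. 1)" using cc_nz[OF assms] by (intro sum.cong) auto
  finally show "degree (den b n) = card (tri n)" by simp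
qed

lemma den_root_order:
  assumes gen: "generic b" and root: "poly (den b n) u = 0"
  shows "order u (den b n) \<le> 1 \<and> (\<exists>x\<in>tri n. u = ru (cc b x))"
proof -
  obtain x where x: "x \<in> tri n" "poly (pmp (cc b x)) u = 0"
    using root by (auto simp: den_def poly_prod prod_zero_iff)
  have c0: "cc b x \<noteq> 0" using cc_nz[OF gen x(1)] .
  have u: "u = ru (cc b x)" using x(2) c0 by (simp add: pmp_eq)
  have den: "den b n = pmp (cc b x) * (\<Prod>y\<in>tri n - {x}. pmp (cc b y))"
    unfolding den_def using x by (intro prod.remove) auto
  have "poly (pmp (cc b y)) u \<noteq> 0" if "y \<in> tri n - {x}" for y
    unfolding u using poly_pmp_ru[OF cc_nz[OF gen] c0, of y n] cc_distinct[OF gen, of y x] that x by (auto simp: tri_def)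
  hence "poly (\<Prod>y\<in>tri n - {x}. pmp (cc b y)) u \<noteq> 0" by (auto simp: poly_prod prod_zero_iff)
  hence "order u (\<Prod>y\<in>tri n - {x}. pmp (cc b y)) = 0" by (rule order_0I)
  moreover have "order u (pmp (cc b x)) \<le> 1" using order_degree[of "pmp (cc b x)" u] c0 by simp
  ultimately have "order u (den b n) \<le> 1"
    using den_nz[OF gen, of n] unfolding den by (subst order_mult) auto
  thus ?thesis using u x by blast
qed

lemma Fract_den_in_space:
  assumes gen: "generic b" and deg: "degree P \<le> degree (den b n)"
  shows "Fraction_Field.Fract P (den b n) \<in> rahman_space q b"
proof -
  define r where "r = Fraction_Field.Fract P (den b n)"
  define p d where "p = fst (quot_of_fract r)" and "d = snd (quot_of_fract r)"
  have D0: "den b n \<noteq> 0" using den_nz[OF gen] .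
  have d0: "d \<noteq> 0" by (simp add: d_def)
  have "Fraction_Field.Fract p d = Fraction_Field.Fract P (den b n)" by (simp add: p_def d_def r_def)
  hence eq: "p * den b n = P * d" using d0 D0 by (simp add: eq_fract)
  have "coprime d p" unfolding p_def d_def by (simp add: coprime_quot_of_fract coprime_commute)
  moreover have "d dvd p * den b n" using eq by simp
  ultimately have dvd: "d dvd den b n" by (simp add: coprime_dvd_mult_right_iff)
  have "degree p \<le> degree d"
  proof (cases "p = 0")
    case False
    hence "P \<noteq> 0" using eq D0 by auto
    hence "degree p + degree (den b n) = degree P + degree d"
      using arg_cong[OF eq, of degree] False D0 d0 by (simp add: degree_mult_eq)
    thus ?thesis using deg by simp
  qed simp
  moreover have "order u d = 1 \<and> (\<exists>z. z \<noteq> 0 \<and> u = (z + inverse z) / 2 \<and>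
               (\<exists>j\<in>{1..6}. \<exists>n::int. n < 0 \<and> (z = b j * q powi n \<or> inverse z = b j * q powi n)))"
    if "poly d u = 0" for u
  proof -
    have "poly (den b n) u = 0" using that dvd by (auto elim!: dvdE)
    from den_root_order[OF gen this] obtain x where x: "order u (den b n) \<le> 1" "x \<in> tri n" "u = ru (cc b x)" by blast
    have "order u d \<le> 1" using dvd_imp_order_le[OF D0 dvd, of u] x by simp
    moreover have "order u d \<noteq> 0" using that d0 by (simp add: order_root)
    moreover obtain j i where ji: "x = (j, i)" "j \<in> {1..6}" "i \<ge> 1" using x(2) by (auto simp: tri_def I6_def)
    ultimately have "order u d = 1" by simp
    moreover have "cc b x = b j * q powi (- int i)" by (simp add: ji cc_def)
    moreover have "- int i < 0" using ji by simp
    ultimately show ?thesis using x(3) cc_nz[OF gen x(2)] ji(2) unfolding ru_def by blast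
  qed
  ultimately show ?thesis unfolding rahman_space_def p_def d_def r_def by blast
qed

text \<open>
  A polynomial with simple roots that are all roots of \<open>den b n\<close> divides it; here this applies to
  the denominator in lowest terms.
\<close>

lemma space_imp_Fract_den:
  assumes gen: "generic b" and r: "r \<in> rahman_space q b"
  obtains P n where "degree P \<le> degree (den b n)" "r = Fraction_Field.Fract P (den b n)"
proof -
  define p d where "p = fst (quot_of_fract r)" and "d = snd (quot_of_fract r)"
  have d0: "d \<noteq> 0" by (simp add: d_def)
  have rpd: "r = Fraction_Field.Fract p d" by (simp add: p_def d_def)
  have deg: "degree p \<le> degree d" using r by (simp add: rahman_space_def p_def d_def)
  have rt: "order u d = 1" "\<exists>x. fst x \<in> I6 \<and> 1 \<le> snd x \<and> u = ru (cc b x)" if u: "poly d u = 0" for u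
  proof -
    have *: "order u d = 1 \<and> (\<exists>z. z \<noteq> 0 \<and> u = (z + inverse z) / 2 \<and>
        (\<exists>j\<in>{1..6}. \<exists>n::int. n < 0 \<and> (z = b j * q powi n \<or> inverse z = b j * q powi n)))"
      using r u unfolding rahman_space_def d_def by blast
    thus "order u d = 1" by blast
    obtain z j m where z: "u = (z + inverse z) / 2" "j \<in> {1..6}" "m < (0::int)" "z = b j * q powi m \<or> inverse z = b j * q powi m"
      using * by blast
    have "u = ru (b j * q powi m)" using z(4)
    proof
      assume "inverse z = b j * q powi m"
      thus ?thesis unfolding z(1) ru_def by (metis add.commute inverse_inverse_eq)
    qed (simp add: z(1) ru_def)
    moreover have "b j * q powi m = cc b (j, nat (- m))" using z(3) by (simp add: cc_def)
    ultimately show "\<exists>x. fst x \<in> I6 \<and> 1 \<le> snd x \<and> u = ru (cc b x)"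
      using z(2,3) by (intro exI[of _ "(j, nat (- m))"]) (simp add: I6_def)
  qed
  define Z where "Z = {u. poly d u = 0}"
  have finZ: "finite Z" unfolding Z_def using d0 by (rule poly_roots_finite)
  obtain X where X: "\<And>u. u \<in> Z \<Longrightarrow> fst (X u) \<in> I6 \<and> 1 \<le> snd (X u) \<and> u = ru (cc b (X u))"
  proof -
    have "\<forall>u\<in>Z. \<exists>x. fst x \<in> I6 \<and> 1 \<le> snd x \<and> u = ru (cc b x)" unfolding Z_def using rt(2) by blast
    from bchoice[OF this] show ?thesis using that by blast
  qed
  obtain M where M: "\<And>u. u \<in> Z \<Longrightarrow> snd (X u) \<le> M"
    using finite_nat_set_iff_bounded_le[of "(\<lambda>u. snd (X u)) ` Z"] finZ by auto
  define n where "n = (\<lambda>j::nat. M)"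
  have XT: "X u \<in> tri n" if "u \<in> Z" for u
    using X[OF that] M[OF that] by (cases "X u") (simp add: tri_def n_def)
  have inj: "inj_on (\<lambda>x. ru (cc b x)) (tri n)"
  proof (rule inj_onI, rule ccontr)
    fix x y assume xy: "x \<in> tri n" "y \<in> tri n" "ru (cc b x) = ru (cc b y)" "x \<noteq> y"
    have "poly (pmp (cc b x)) (ru (cc b x)) = 0" using cc_nz[OF gen xy(1)] by (simp add: poly_pmp_ru)
    hence "(1 - cc b x * cc b y) * (1 - cc b x / cc b y) = 0"
      unfolding xy(3) using poly_pmp_ru[OF cc_nz[OF gen xy(1)] cc_nz[OF gen xy(2)]] by simp
    moreover have "fst x \<in> I6" "fst y \<in> I6" using xy(1,2) by (auto simp: tri_def)
    ultimately show False using cc_distinct[OF gen _ _ xy(4)] by blast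
  qed
  have "den b n = (\<Prod>x\<in>tri n. [:- 2 * cc b x:] * [:- ru (cc b x), 1:])"
    unfolding den_def using cc_nz[OF gen] by (intro prod.cong) (auto simp: pmp_eq)
  also have "\<dots> = (\<Prod>x\<in>tri n. [:- 2 * cc b x:]) * (\<Prod>x\<in>tri n. [:- ru (cc b x), 1:])" by (rule prod.distrib)
  also have "(\<Prod>x\<in>tri n. [:- ru (cc b x), 1:]) = (\<Prod>u\<in>(\<lambda>x. ru (cc b x)) ` tri n. [:- u, 1:])"
    using inj by (simp add: prod.reindex)
  finally have "(\<Prod>u\<in>(\<lambda>x. ru (cc b x)) ` tri n. [:- u, 1:]) dvd den b n" by simp
  moreover have "Z \<subseteq> (\<lambda>x. ru (cc b x)) ` tri n" using X XT by blast
  hence "(\<Prod>u\<in>Z. [:- u, 1:]) dvd (\<Prod>u\<in>(\<lambda>x. ru (cc b x)) ` tri n. [:- u, 1:])"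
    by (intro prod_dvd_prod_subset) auto
  ultimately have "(\<Prod>u\<in>Z. [:- u, 1:]) dvd den b n" by (rule dvd_trans[rotated])
  moreover have "rsquarefree d"
    unfolding rsquarefree_def using rt(1) d0 by (metis order_root)
  hence "smult (lead_coeff d) (\<Prod>u\<in>Z. [:- u, 1:]) = d" unfolding Z_def by (rule complex_poly_decompose_rsquarefree)
  ultimately have "d dvd den b n" using d0 by (metis leading_coeff_0_iff smult_dvd)
  then obtain e where e: "den b n = d * e" by (elim dvdE)
  have e0: "e \<noteq> 0" using den_nz[OF gen, of n] e by auto
  show ?thesis
  proof (rule that)
    show "degree (p * e) \<le> degree (den b n)"
      using deg e0 d0 degree_mult_le[of p e] unfolding e by (simp add: degree_mult_eq)
    show "r = Fraction_Field.Fract (p * e) (den b n)" unfolding rpd e using d0 e0 by (simp add: eq_fract)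
  qed
qed

text \<open>
  The point \<open>u\<close> avoids \<open>b\<^sub>j\<^bsup>\<plusminus>1\<^esup> q\<^bsup>\<int>\<^esup>\<close>, so that all factors \<open>(b\<^sub>j u\<^bsup>\<plusminus>1\<^esup>)\<^sub>k\<close> are finite and nonzero.
\<close>

definition regular_pt :: "(nat \<Rightarrow> complex) \<Rightarrow> complex \<Rightarrow> bool" where
  "regular_pt b u \<longleftrightarrow> u \<noteq> 0 \<and> (\<forall>j\<in>I6. b j * u \<notin> qpowers q \<and> b j / u \<notin> qpowers q)"

text \<open>
  The factor \<open>(b\<^sub>j u)\<^sub>k\<close> shifts the parameter in the denominator of \<open>Xf\<close> and \<open>(b\<^sub>j / u)\<^sub>k\<close> shifts the one
  in the numerator. The remaining powers of \<open>- 1 / u\<close> cancel because the exponents add up to 0.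
\<close>

lemma Xf_mult_qpoch:
  assumes b0: "\<And>j. j \<in> I6 \<Longrightarrow> b j \<noteq> 0" and e0: "(\<Sum>j\<in>I6. e j) = 0" and reg: "regular_pt b u"
  shows "(\<Prod>j\<in>I6. qpoch q (b j * u) (e j) * qpoch q (b j / u) (e j)) * Xf b u = mu b e * Xf (shiftp b e) u"
proof -
  have u0: "u \<noteq> 0" using reg by (simp add: regular_pt_def)
  have "(\<Prod>j\<in>I6. qpoch q (b j * u) (e j) * qpoch q (b j / u) (e j)) * (\<Prod>j\<in>I6. qp (q * u / b j) / qp (b j * u)) =
     (\<Prod>j\<in>I6. (qb (e j) * b j powi e j) * (- 1 / u) powi e j * (qp (q * u / shiftp b e j) / qp (shiftp b e j * u)))"
    unfolding prod.distrib[symmetric]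
  proof (rule prod.cong)
    fix j assume j: "j \<in> I6"
    have n1: "b j * u \<notin> qpowers q" and n2: "b j / u \<notin> qpowers q" using reg j by (auto simp: regular_pt_def)
    have 1: "qp (b j * u) = qp (shiftp b e j * u) * qpoch q (b j * u) (e j)"
      using qp_mult_qpoch[OF n1, of "e j"] by (simp add: shiftp_def mult_ac)
    have nz: "qp (b j * u) \<noteq> 0" using not_qpowers_qp[OF n1] .
    have arg: "q / (b j / u * q powi e j) = q * u / shiftp b e j" "q / (b j / u) = q * u / b j"
      using u0 by (simp_all add: shiftp_def)
    have 2: "qp (q * u / b j) * qpoch q (b j / u) (e j) = qp (q * u / shiftp b e j) * ((- (b j / u)) powi e j * qb (e j))"
      using qp_inverse_qpoch[OF n2, of "e j"] b0[OF j] u0 unfolding arg by simp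
    have 3: "(- (b j / u)) powi e j = b j powi e j * (- 1 / u) powi e j"
      by (simp add: power_int_mult_distrib[symmetric])
    have "qpoch q (b j * u) (e j) * qpoch q (b j / u) (e j) * (qp (q * u / b j) / qp (b j * u)) =
        (qp (q * u / b j) * qpoch q (b j / u) (e j)) * (qpoch q (b j * u) (e j) / qp (b j * u))" by simp
    also have "qpoch q (b j * u) (e j) / qp (b j * u) = 1 / qp (shiftp b e j * u)" using nz unfolding 1 by auto
    finally show "qpoch q (b j * u) (e j) * qpoch q (b j / u) (e j) * (qp (q * u / b j) / qp (b j * u)) =
      (qb (e j) * b j powi e j) * (- 1 / u) powi e j * (qp (q * u / shiftp b e j) / qp (shiftp b e j * u))"
      unfolding 2 3 by simp
  qed auto
  also have "\<dots> = mu b e * (\<Prod>j\<in>I6. (- 1 / u) powi e j) * (\<Prod>j\<in>I6. qp (q * u / shiftp b e j) / qp (shiftp b e j * u))"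
    unfolding prod.distrib mu_def ..
  also have "(\<Prod>j\<in>I6. (- 1 / u) powi e j) = (- 1 / u) powi (\<Sum>j\<in>I6. e j)"
  proof -
    have "(\<Prod>j\<in>A. x powi e j) = x powi (\<Sum>j\<in>A. e j)" if "x \<noteq> (0::complex)" for x A
      using that by (induction A rule: infinite_finite_induct) (auto simp: power_int_add)
    thus ?thesis using u0 by simp
  qed
  finally show ?thesis unfolding Xf_def e0 by simp
qed

text \<open>
  A list of coefficients \<open>c\<close> and exponents \<open>e\<close> stands for a linear combination \<open>f\<close> of the spanning
  functions. Then \<open>combo b fs\<close> is \<open>f\<close> times \<open>Xf b\<close>, by \<open>Xf_mult_qpoch\<close>, and \<open>jcombo b fs\<close> is the value of
  the Rahman functional at \<open>f\<close>.
\<close>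

definition combo :: "(nat \<Rightarrow> complex) \<Rightarrow> (complex \<times> (nat \<Rightarrow> int)) list \<Rightarrow> complex \<Rightarrow> complex" where
  "combo b fs u = (\<Sum>(c, e)\<leftarrow>fs. c * mu b e * Xf (shiftp b e) u)"

definition jcombo :: "(nat \<Rightarrow> complex) \<Rightarrow> (complex \<times> (nat \<Rightarrow> int)) list \<Rightarrow> complex" where
  "jcombo b fs = (\<Sum>(c, e)\<leftarrow>fs. c * jval b e)"

definition expands :: "(nat \<Rightarrow> complex) \<Rightarrow> (complex poly fract \<Rightarrow> complex) \<Rightarrow> complex poly fract \<Rightarrow> (complex \<times> (nat \<Rightarrow> int)) list \<Rightarrow> bool" where
  "expands b J f fs \<longleftrightarrow> (\<forall>(c, e)\<in>set fs. (\<Sum>j\<in>I6. e j) = 0) \<and> J f = jcombo b fs \<and>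
     (\<forall>u. regular_pt b u \<longrightarrow> (\<exists>v. represents f ((u + inverse u) / 2) v \<and> v * Xf b u = combo b fs u))"

lemma expands_product:
  assumes gen: "generic b" and e0: "(\<Sum>j\<in>I6. e j) = 0" and J: "is_rahman_functional q b J"
  shows "expands b J (\<Prod>j\<in>I6. qpoch_pm q (b j) (e j)) [(1, e)]"
  unfolding expands_def
proof (intro conjI allI impI)
  show "\<forall>(c, e)\<in>set [(1::complex, e)]. (\<Sum>j\<in>I6. e j) = 0" using e0 by simp
  have "J (\<Prod>j\<in>I6. qpoch_pm q (b j) (e j)) = jval b e"
    using J e0 unfolding is_rahman_functional_def I6_def[symmetric] jval_def mu_def pair_prod_I6 by blast
  thus "J (\<Prod>j\<in>I6. qpoch_pm q (b j) (e j)) = jcombo b [(1, e)]" by (simp add: jcombo_def)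
  fix u assume reg: "regular_pt b u"
  hence u0: "u \<noteq> 0" by (simp add: regular_pt_def)
  have "represents (\<Prod>j\<in>I6. qpoch_pm q (b j) (e j)) ((u + inverse u) / 2) (\<Prod>j\<in>I6. qpoch q (b j * u) (e j) * qpoch q (b j / u) (e j))"
  proof (rule represents_prod)
    fix j assume j: "j \<in> I6"
    show "represents (qpoch_pm q (b j) (e j)) ((u + inverse u) / 2) (qpoch q (b j * u) (e j) * qpoch q (b j / u) (e j))"
    proof (rule represents_qpoch_pm[OF u0])
      fix n :: int
      have "b j * u * q powi n \<notin> qpowers q" "b j / u * q powi n \<notin> qpowers q"
        using reg j unfolding qpowers_cancel by (auto simp: regular_pt_def)
      hence "b j * u * q powi n \<noteq> 1" "b j / u * q powi n \<noteq> 1" by auto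
      thus "b j * q powi n * u \<noteq> 1 \<and> b j * q powi n / u \<noteq> 1" by (simp add: mult_ac)
    qed
  qed
  moreover have "(\<Prod>j\<in>I6. qpoch q (b j * u) (e j) * qpoch q (b j / u) (e j)) * Xf b u = combo b [(1, e)] u"
    using Xf_mult_qpoch[OF _ e0 reg] genericD(1)[OF gen] by (simp add: combo_def)
  ultimately show "\<exists>v. represents (\<Prod>j\<in>I6. qpoch_pm q (b j) (e j)) ((u + inverse u) / 2) v \<and> v * Xf b u = combo b [(1, e)] u" by blast
qed

lemma expands_lincomb:
  assumes J: "is_rahman_functional q b J" and f: "f \<in> rahman_space q b" "expands b J f fs"
    and g: "g \<in> rahman_space q b" "expands b J g gs" and cf: "to_fract [:c:] * f \<in> rahman_space q b"
  shows "expands b J (to_fract [:c:] * f + g) (map (\<lambda>(a, e). (c * a, e)) fs @ gs)"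
  unfolding expands_def
proof (intro conjI allI impI)
  show "\<forall>(c, e)\<in>set (map (\<lambda>(a, e). (c * a, e)) fs @ gs). (\<Sum>j\<in>I6. e j) = 0"
    using f g by (auto simp: expands_def)
  have "J (to_fract [:c:] * f + g) = c * J f + J g" using J f(1) g(1) cf by (simp add: is_rahman_functional_def)
  moreover have "(\<Sum>(c, e)\<leftarrow>map (\<lambda>(a, e). (c * a, e)) fs. c * F e) = c * (\<Sum>(c, e)\<leftarrow>fs. c * F e)" for F :: "(nat \<Rightarrow> int) \<Rightarrow> complex"
    by (induction fs) (auto simp: algebra_simps)
  note scale = this
  ultimately show "J (to_fract [:c:] * f + g) = jcombo b (map (\<lambda>(a, e). (c * a, e)) fs @ gs)"
    using f(2) g(2) scale[of "jval b"] by (simp add: expands_def jcombo_def)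
  fix u assume reg: "regular_pt b u"
  obtain v where v: "represents f ((u + inverse u) / 2) v" "v * Xf b u = combo b fs u" using f(2) reg by (auto simp: expands_def)
  obtain w where w: "represents g ((u + inverse u) / 2) w" "w * Xf b u = combo b gs u" using g(2) reg by (auto simp: expands_def)
  have "represents (to_fract [:c:] * f + g) ((u + inverse u) / 2) (c * v + w)"
    by (intro represents_add represents_mult represents_const v w)
  moreover have "(c * v + w) * Xf b u = combo b (map (\<lambda>(a, e). (c * a, e)) fs @ gs) u"
    using v(2) w(2) scale[of "\<lambda>e. mu b e * Xf (shiftp b e) u"] by (simp add: combo_def algebra_simps mult.assoc)
  ultimately show "\<exists>v. represents (to_fract [:c:] * f + g) ((u + inverse u) / 2) v \<and> v * Xf b u = combo b (map (\<lambda>(a, e). (c * a, e)) fs @ gs) u" by blast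
qed

lemma expands_zero:
  assumes gen: "generic b" and J: "is_rahman_functional q b J"
  shows "expands b J 0 []"
proof -
  have "Fraction_Field.Fract 0 (den b (\<lambda>_. 0)) \<in> rahman_space q b" by (intro Fract_den_in_space gen) simp
  hence "0 \<in> rahman_space q b" by (simp add: fract_collapse)
  hence "J (to_fract [:0:] * 0) = 0 * J 0" using J unfolding is_rahman_functional_def by blast
  hence "J 0 = 0" by simp
  moreover have "represents 0 u 0" for u using represents_const[of 0 u] by simp
  ultimately show ?thesis unfolding expands_def by (auto simp: jcombo_def combo_def)
qed

text \<open>
  Induction on the number of admissible poles. A suitable multiple of the spanning function with
  exponents \<open>-n\<close> at \<open>j\<close> and \<open>n\<close> at another index has the same residue at the outermost pole \<open>b\<^sub>j q\<^bsup>-n\<^esup>\<close>;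
  subtracting it removes this pole.
\<close>

lemma Fract_den_expands:
  assumes gen: "generic b" and J: "is_rahman_functional q b J"
  shows "(\<Sum>j\<in>I6. n j) = m \<Longrightarrow> degree P \<le> degree (den b n) \<Longrightarrow> \<exists>fs. expands b J (Fraction_Field.Fract P (den b n)) fs"
proof (induction m arbitrary: n P)
  case 0
  hence "tri n = {}" by (auto simp: tri_def)
  hence den: "den b n = 1" by (simp add: den_def)
  with 0 obtain c where P: "P = [:c:]" by (metis degree_1 degree_eq_zeroE le_zero_eq)
  define h where "h = (\<Prod>j\<in>I6. qpoch_pm q (b j) 0)"
  have h: "h = 1" by (simp add: h_def qpoch_pm_def)
  have one: "Fraction_Field.Fract 1 (den b n) \<in> rahman_space q b" "Fraction_Field.Fract P (den b n) \<in> rahman_space q b"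
    using 0 by (auto intro!: Fract_den_in_space gen)
  have f1: "Fraction_Field.Fract 1 (den b n) = h" "Fraction_Field.Fract P (den b n) = to_fract [:c:] * h"
    using h by (simp_all add: den One_fract_def P to_fract_def)
  have "Fraction_Field.Fract 0 (den b n) \<in> rahman_space q b" by (intro Fract_den_in_space gen) simp
  hence z: "0 \<in> rahman_space q b" by (simp add: fract_collapse)
  have "expands b J h [(1, \<lambda>_. 0)]" unfolding h_def by (rule expands_product[OF gen _ J]) simp
  from expands_lincomb[OF J one(1)[unfolded f1] this z expands_zero[OF gen J] one(2)[unfolded f1]]
  show ?case unfolding f1 by auto
next
  case (Suc m)
  then obtain j where j: "j \<in> I6" "n j \<noteq> 0" by (metis sum.neutral nat.simps(3))
  then obtain i where i: "n j = Suc i" by (metis not0_implies_Suc)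
  define n' where "n' = n(j := i)"
  define c0 where "c0 = cc b (j, Suc i)"
  define n1 where "n1 = (\<lambda>x. if x = j then Suc i else 0)"
  have bj: "b j \<noteq> 0" using genericD(1)[OF gen j(1) j(1)] .
  have c0: "c0 \<noteq> 0" using bj q_nz by (simp add: c0_def cc_def)
  have sum': "(\<Sum>j\<in>I6. n' j) = m"
  proof -
    have "(\<Sum>x\<in>I6. n x) = n j + (\<Sum>x\<in>I6-{j}. n x)" using j by (intro sum.remove) auto
    moreover have "(\<Sum>x\<in>I6. n' x) = n' j + (\<Sum>x\<in>I6-{j}. n' x)" using j by (intro sum.remove) auto
    moreover have "(\<Sum>x\<in>I6-{j}. n' x) = (\<Sum>x\<in>I6-{j}. n x)" by (intro sum.cong) (auto simp: n'_def)
    ultimately show ?thesis using Suc.prems(1) i by (simp add: n'_def)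
  qed
  have tri: "tri n = insert (j, Suc i) (tri n')" "(j, Suc i) \<notin> tri n'"
    using j i by (auto simp: tri_def n'_def split: if_splits)
  have den: "den b n = pmp c0 * den b n'" unfolding den_def tri(1) c0_def using tri(2) by (subst prod.insert) auto
  have tri1: "tri n1 \<subseteq> tri n" "(j, Suc i) \<in> tri n1" using j i by (auto simp: tri_def n1_def split: if_splits)
  define R where "R = (\<Prod>x\<in>tri n - tri n1. pmp (cc b x))"
  have denR: "den b n = den b n1 * R"
    unfolding den_def R_def using tri1 by (subst mult.commute) (intro prod.subset_diff, auto)
  obtain j' where j': "j' \<in> I6" "j' \<noteq> j" using that[of 1] that[of 2] by (cases "j = 1") (auto simp: I6_def)
  have bj': "b j' \<noteq> 0" using genericD(1)[OF gen j'(1) j'(1)] .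
  define Nh where "Nh = (\<Prod>t<Suc i. pmp (b j' * q ^ t))"
  define e :: "nat \<Rightarrow> int" where "e = (\<lambda>x. if x = j then - int (Suc i) else if x = j' then int (Suc i) else 0)"
  have e0: "(\<Sum>x\<in>I6. e x) = 0"
  proof -
    have "(\<Sum>x\<in>I6. e x) = (\<Sum>x\<in>I6. (if x = j then - int (Suc i) else 0) + (if x = j' then int (Suc i) else 0))"
      using j' by (intro sum.cong) (auto simp: e_def)
    thus ?thesis using j j' by (simp add: sum.distrib)
  qed
  define h where "h = (\<Prod>x\<in>I6. qpoch_pm q (b x) (e x))"
  have h: "h = Fraction_Field.Fract Nh (den b n1)"
  proof -
    have "h = qpoch_pm q (b j) (e j) * qpoch_pm q (b j') (e j') * (\<Prod>x\<in>I6-{j,j'}. qpoch_pm q (b x) (e x))"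
    proof -
      have "h = qpoch_pm q (b j) (e j) * (\<Prod>x\<in>I6-{j}. qpoch_pm q (b x) (e x))"
        unfolding h_def using j by (intro prod.remove) auto
      also have "(\<Prod>x\<in>I6-{j}. qpoch_pm q (b x) (e x)) = qpoch_pm q (b j') (e j') * (\<Prod>x\<in>I6-{j}-{j'}. qpoch_pm q (b x) (e x))"
        using j' by (intro prod.remove) auto
      also have "I6-{j}-{j'} = I6-{j,j'}" by auto
      finally show ?thesis by (simp add: mult_ac)
    qed
    also have "(\<Prod>x\<in>I6-{j,j'}. qpoch_pm q (b x) (e x)) = 1" by (intro prod.neutral) (auto simp: e_def qpoch_pm_def)
    also have "qpoch_pm q (b j') (e j') = to_fract Nh"
      using j' by (simp add: e_def qpoch_pm_def Nh_def pm_factor_def pmp_def prod_to_fract[symmetric] del: of_nat_Suc prod.lessThan_Suc)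
    also have "qpoch_pm q (b j) (e j) = inverse (to_fract (\<Prod>t=1..Suc i. pmp (b j * q powi - int t)))"
      by (simp add: e_def qpoch_pm_def pm_factor_def pmp_def prod_to_fract[symmetric] del: of_nat_Suc prod.cl_ivl_Suc)
    also have "(\<Prod>t=1..Suc i. pmp (b j * q powi - int t)) = den b n1"
    proof -
      have "tri n1 = (\<lambda>t. (j, t)) ` {1..Suc i}" using j by (auto simp: tri_def n1_def split: if_splits)
      thus ?thesis unfolding den_def by (simp add: prod.reindex inj_on_def cc_def del: prod.cl_ivl_Suc)
    qed
    finally show ?thesis using den_nz[OF gen, of n1] by (simp add: to_fract_def)
  qed
  define u0 where "u0 = ru c0"
  have Nh0: "poly Nh u0 \<noteq> 0"
  proof -
    have "poly (pmp (b j' * q ^ t)) u0 \<noteq> 0" for t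
    proof -
      have z: "b j' * q ^ t \<noteq> 0" using bj' q_nz by simp
      have "b j' * q ^ t * c0 = b j' * b j * q powi (int t - int (Suc i))"
        using q_nz by (simp add: c0_def cc_def power_int_diff power_int_minus field_simps del: of_nat_Suc)
      hence "b j' * q ^ t * c0 \<notin> qpowers q" using genericD(3)[OF gen j'(1) j(1)] by (simp only: qpowers_cancel not_False_eq_True)
      moreover have "b j' * q ^ t / c0 = b j' / b j * q powi (int t + int (Suc i))"
        using q_nz by (simp add: c0_def cc_def power_int_add power_int_minus field_simps del: of_nat_Suc)
      hence "b j' * q ^ t / c0 \<notin> qpowers q" using genericD(2)[OF gen j'(1) j(1) j'(2)] by (simp only: qpowers_cancel not_False_eq_True)
      ultimately have "b j' * q ^ t * c0 \<noteq> 1" "b j' * q ^ t / c0 \<noteq> 1" by auto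
      thus ?thesis unfolding u0_def poly_pmp_ru[OF z c0] by simp
    qed
    thus ?thesis unfolding Nh_def poly_prod by (auto simp: prod_zero_iff simp del: prod.lessThan_Suc)
  qed
  have R0: "poly R u0 \<noteq> 0"
  proof -
    have "poly (pmp (cc b x)) u0 \<noteq> 0" if x: "x \<in> tri n - tri n1" for x
    proof -
      have "x \<noteq> (j, Suc i)" "fst x \<in> I6" "x \<in> tri n" using x tri1 by (auto simp: tri_def)
      thus ?thesis unfolding u0_def
        using poly_pmp_ru[OF cc_nz[OF gen] c0, of x n] cc_distinct[OF gen, of x "(j, Suc i)"] j(1)
        by (simp add: c0_def)
    qed
    thus ?thesis unfolding R_def poly_prod by (auto simp: prod_zero_iff)
  qed
  define c where "c = poly P u0 / (poly Nh u0 * poly R u0)"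
  define Q where "Q = P - smult c (Nh * R)"
  have "poly Q u0 = 0" using Nh0 R0 by (simp add: Q_def c_def)
  hence "[:- u0, 1:] dvd Q" by (simp add: poly_eq_0_iff_dvd)
  hence "pmp c0 dvd Q" unfolding pmp_eq[OF c0] u0_def using c0 by (intro smult_dvd) auto
  then obtain P' where P': "Q = pmp c0 * P'" by (elim dvdE)
  have D0: "den b n \<noteq> 0" "den b n1 \<noteq> 0" "den b n' \<noteq> 0" using den_nz[OF gen] by auto
  have Rn0: "R \<noteq> 0" using denR D0 by auto
  have degNh: "degree Nh \<le> degree (den b n1)"
  proof -
    have "degree Nh \<le> (\<Sum>t<Suc i. degree (pmp (b j' * q ^ t)))" unfolding Nh_def by (rule order_trans[OF degree_prod_sum_le]) (auto simp: o_def)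
    also have "\<dots> = (\<Sum>t<Suc i. 1)" using bj' q_nz by (intro sum.cong) auto
    also have "\<dots> = card (tri n1)"
    proof -
      have "tri n1 = (\<lambda>t. (j, t)) ` {1..Suc i}" using j by (auto simp: tri_def n1_def split: if_splits)
      thus ?thesis by (simp add: card_image inj_on_def)
    qed
    finally show ?thesis using degree_den[OF gen] by simp
  qed
  have degNhR: "degree (Nh * R) \<le> degree (den b n)"
    using degree_mult_le[of Nh R] degNh degree_mult_eq[OF D0(2) Rn0] denR by simp
  have degP': "degree P' \<le> degree (den b n')"
  proof (cases "P' = 0")
    case False
    have "degree Q \<le> degree (den b n)"
      unfolding Q_def using Suc.prems(2) degNhR by (intro degree_diff_le) (auto intro: order_trans[OF degree_smult_le])
    moreover have "degree Q = 1 + degree P'" unfolding P' using False c0 by (subst degree_mult_eq) auto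
    moreover have "degree (den b n) = 1 + degree (den b n')" unfolding den using D0 c0 by (subst degree_mult_eq) auto
    ultimately show ?thesis by simp
  qed simp
  from Suc.IH[OF sum' degP'] obtain gs where gs: "expands b J (Fraction_Field.Fract P' (den b n')) gs" by blast
  have eq: "Fraction_Field.Fract P (den b n) = to_fract [:c:] * h + Fraction_Field.Fract P' (den b n')"
  proof -
    have "to_fract [:c:] * h = Fraction_Field.Fract (smult c Nh) (den b n1)" unfolding h by (simp add: to_fract_def)
    also have "\<dots> = Fraction_Field.Fract (smult c Nh * R) (den b n)"
      unfolding denR using D0 Rn0 by (simp add: eq_fract mult_ac)
    finally have 1: "to_fract [:c:] * h = Fraction_Field.Fract (smult c Nh * R) (den b n)" .
    have 2: "Fraction_Field.Fract P' (den b n') = Fraction_Field.Fract Q (den b n)"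
      unfolding den P' using D0 c0 by (simp add: eq_fract)
    have "Fraction_Field.Fract (smult c Nh * R) (den b n) + Fraction_Field.Fract Q (den b n) = Fraction_Field.Fract (smult c Nh * R + Q) (den b n)"
      using D0 by (simp add: eq_fract distrib_right mult.assoc)
    also have "smult c Nh * R + Q = P" by (simp add: Q_def)
    finally show ?thesis unfolding 1 2 ..
  qed
  have hs: "h \<in> rahman_space q b" "to_fract [:c:] * h \<in> rahman_space q b"
  proof -
    show "h \<in> rahman_space q b" unfolding h by (intro Fract_den_in_space gen degNh)
    have "to_fract [:c:] * h = Fraction_Field.Fract (smult c Nh) (den b n1)" unfolding h by (simp add: to_fract_def)
    thus "to_fract [:c:] * h \<in> rahman_space q b"
      using degNh by (auto intro!: Fract_den_in_space gen order_trans[OF degree_smult_le])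
  qed
  have "expands b J h [(1, e)]" unfolding h_def by (rule expands_product[OF gen e0 J])
  from expands_lincomb[OF J hs(1) this Fract_den_in_space[OF gen degP'] gs hs(2)]
  show ?case unfolding eq by blast
qed

theorem rahman_space_expands:
  assumes gen: "generic b" and J: "is_rahman_functional q b J" and f: "f \<in> rahman_space q b"
  obtains fs where "expands b J f fs"
proof -
  obtain P n where "degree P \<le> degree (den b n)" "f = Fraction_Field.Fract P (den b n)"
    using space_imp_Fract_den[OF gen f] by blast
  thus ?thesis using Fract_den_expands[OF gen J refl, of P n] that by blast
qed

end

section \<open>Factorization of the integrand\<close>

context qbase begin

lemma qb_add: "qb (m + n) = qb m * qb n * q powi (m * n)"
proof (induction n rule: int_shift_induct)
  case (step n)
  have "qb (m + (n + 1)) = qb (m + n) * q powi (m + n)" using qb_Suc[of "m + n"] by (simp add: add.assoc)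
  moreover have "qb m * qb (n + 1) * q powi (m * (n + 1)) = qb m * qb n * q powi (m * n) * q powi (m + n)"
    using q_nz unfolding qb_Suc by (simp add: distrib_left power_int_add)
  moreover have "q powi (m + n) \<noteq> 0" using q_nz by simp
  ultimately show ?case by (metis mult_right_cancel)
qed simp

lemma qb_neg: "qb (- m) = qb m * q powi m"
proof -
  have "(- m) * (- m - 1) div 2 = m * (m - 1) div 2 + m"
  proof -
    have "(- m) * (- m - 1) = m * (m - 1) + m * 2" by (simp add: algebra_simps)
    thus ?thesis by simp
  qed
  thus ?thesis using q_nz by (simp add: qbinom2_def power_int_add)
qed

lemma qb_sq: "qb m ^ 2 = q powi (m * (m - 1))"
proof -
  have "even (m * (m - 1))" by simp
  hence "m * (m - 1) div 2 * 2 = m * (m - 1)" by simp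
  thus ?thesis unfolding qbinom2_def by (metis power_int_mult power_int_numeral)
qed

lemma prod_powi: "x \<noteq> 0 \<Longrightarrow> (\<Prod>j\<in>A. x powi e j) = x powi (\<Sum>j\<in>A. e j)" for x :: complex
  by (induction A rule: infinite_finite_induct) (auto simp: power_int_add)

lemma prod_powi_base: "(\<Prod>j\<in>A. x j powi n) = (\<Prod>j\<in>A. x j) powi n" for x :: "_ \<Rightarrow> complex"
  by (induction A rule: infinite_finite_induct) (auto simp: power_int_mult_distrib)

text \<open>The elliptic factor of the integrand.\<close>

definition hq :: "(nat \<Rightarrow> complex) \<Rightarrow> complex \<Rightarrow> complex" where
  "hq c v = (\<Prod>j\<in>I6. th (c j * v) / th (c j / v)) / v ^ 4"

text \<open>
  Each quotient of theta functions is multiplied by \<open>q / c\<^sub>j\<^sup>2\<close> under \<open>v \<mapsto> q v\<close>. As the product of the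
  \<open>c\<^sub>j\<close> is \<open>q\<close>, the product of these six multipliers is \<open>q\<^sup>4\<close>, which \<open>v\<^sup>4\<close> compensates.
\<close>

lemma hq_q:
  assumes c0: "\<And>j. j \<in> I6 \<Longrightarrow> c j \<noteq> 0" and c1: "(\<Prod>j\<in>I6. c j) = q" and v: "v \<noteq> 0"
  shows "hq c (v * q powi n) = hq c v"
proof (induction n rule: int_shift_induct)
  case (step m)
  define w where "w = v * q powi m"
  have w: "w \<noteq> 0" using v q_nz by (simp add: w_def)
  have "(\<Prod>j\<in>I6. th (c j * (q * w)) / th (c j / (q * w))) = (\<Prod>j\<in>I6. th (c j * w) / th (c j / w) * (q / (c j)^2))"
  proof (rule prod.cong)
    fix j assume j: "j \<in> I6"
    have "th (c j * (q * w)) = - th (c j * w) / (c j * w)" using th_q[of "c j * w"] c0[OF j] w by (simp add: mult_ac)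
    moreover have "th (c j / (q * w)) = - (c j / (q * w)) * th (c j / w)" using th_div_q[of "c j / w"] c0[OF j] w by (simp add: mult_ac)
    ultimately show "th (c j * (q * w)) / th (c j / (q * w)) = th (c j * w) / th (c j / w) * (q / (c j)^2)"
      using c0[OF j] w q_nz by (simp add: power2_eq_square)
  qed auto
  also have "\<dots> = (\<Prod>j\<in>I6. th (c j * w) / th (c j / w)) * (q ^ 6 / q ^ 2)"
    by (simp only: prod.distrib prod_dividef prod_constant card_I6 prod_power_distrib[symmetric] c1)
  also have "q ^ 6 / q ^ 2 = q ^ 4" using q_nz by (simp add: field_simps flip: power_add)
  finally have "hq c (q * w) = hq c w" using w q_nz by (simp add: hq_def power_mult_distrib)
  moreover have "v * q powi (m + 1) = q * w" using q_nz by (simp add: w_def power_int_add)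
  moreover have "hq c w = hq c (v * q powi m)" by (simp add: w_def)
  ultimately have "hq c (v * q powi (m + 1)) = hq c (v * q powi m)" by simp
  thus ?case by (simp only:)
qed simp

text \<open>
  As \<open>b\<^sub>j u = c\<^sub>j v q\<^bsup>-(N\<^sub>j+x)\<^esup>\<close>, the left-hand side differs from \<open>hq\<close> by automorphy factors. Their
  product \<open>W\<close> is computed below; all powers that depend on \<open>x\<close> cancel.
\<close>

lemma theta_quotient:
  fixes x :: int
  assumes b0: "\<And>j. j \<in> I6 \<Longrightarrow> b j \<noteq> 0" and b1: "(\<Prod>j\<in>I6. b j) = q" and N0: "(\<Sum>j\<in>I6. N j) = 0"
    and s: "s^2 = q" and z: "z \<noteq> 0"
  defines "u \<equiv> s powi (- x) * z" and "v \<equiv> s powi x * z"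
  shows "(\<Prod>j\<in>I6. th (b j * u) / th (shiftp b N j / v)) / (u ^ 3 * v * (q powi x * z powi (6 * x))) = mu b N * hq (shiftp b N) v"
proof -
  define c where "c = shiftp b N"
  have s0: "s \<noteq> 0" using s q_nz by auto
  have u0: "u \<noteq> 0" and v0: "v \<noteq> 0" using s0 z by (auto simp: u_def v_def)
  have c0: "c j \<noteq> 0" if "j \<in> I6" for j using b0[OF that] q_nz by (simp add: c_def shiftp_def)
  have c1: "(\<Prod>j\<in>I6. c j) = q" unfolding c_def prod_shiftp b1 N0 by simp
  have sp: "s powi (2 * n) = q powi n" for n using s by (metis power_int_mult power_int_numeral)
  have uv: "u = v * q powi (- x)"
  proof -
    have "s powi (- x) = s powi x * s powi (2 * (- x))" using s0 by (simp flip: power_int_add)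
    also note sp
    finally have "s powi (- x) = s powi x * q powi (- x)" .
    thus ?thesis by (simp only: u_def v_def mult_ac)
  qed
  define W where "W = (\<Prod>j\<in>I6. (- (c j * v)) powi (- (N j + x)) * qb (- (N j + x)))"
  have W0: "W \<noteq> 0" using c0 v0 by (auto simp: W_def prod_zero_iff)
  have th: "(\<Prod>j\<in>I6. th (b j * u)) * W = (\<Prod>j\<in>I6. th (c j * v))"
    unfolding W_def prod.distrib[symmetric]
  proof (rule prod.cong)
    fix j assume j: "j \<in> I6"
    have "b j * u = c j * v * q powi (- (N j + x))"
      using q_nz by (simp add: uv c_def shiftp_def power_int_minus power_int_add power_int_diff field_simps)
    thus "th (b j * u) * ((- (c j * v)) powi (- (N j + x)) * qb (- (N j + x))) = th (c j * v)"
      using th_powi[of "c j * v" "- (N j + x)"] c0[OF j] v0 by simp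
  qed auto
  have W: "W * (u ^ 3 * v * (q powi x * z powi (6 * x))) * mu b N = v ^ 4"
  proof -
    have W1: "W = (\<Prod>j\<in>I6. (-v) powi (- (N j + x)) * (c j powi (- x) * (b j powi (- N j) * q powi (- N j * N j))) *
        (qb (N j) * qb x * q powi (N j * x) * q powi (N j + x)))"
      unfolding W_def
    proof (rule prod.cong)
      fix j assume j: "j \<in> I6"
      have "(- (c j * v)) powi (- (N j + x)) = ((-v) * c j) powi (- (N j + x))" by (simp add: mult.commute)
      also have "\<dots> = (-v) powi (- (N j + x)) * c j powi (- (N j + x))" by (rule power_int_mult_distrib)
      also have "c j powi (- (N j + x)) = c j powi (- x) * c j powi (- N j)"
        using c0[OF j] by (simp add: power_int_add[symmetric] add.commute)
      also have "c j powi (- N j) = b j powi (- N j) * q powi (- N j * N j)"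
        by (simp add: c_def shiftp_def power_int_mult_distrib power_int_mult[symmetric] mult.commute)
      finally show "(- (c j * v)) powi (- (N j + x)) * qb (- (N j + x)) = (-v) powi (- (N j + x)) * (c j powi (- x) * (b j powi (- N j) * q powi (- N j * N j))) *
        (qb (N j) * qb x * q powi (N j * x) * q powi (N j + x))"
        unfolding qb_neg qb_add by simp
    qed auto
    define QN where "QN = (\<Sum>j\<in>I6. N j * N j)"
    have p1: "(\<Prod>j\<in>I6. (-v) powi (- (N j + x))) = v powi (- 6 * x)"
    proof -
      have "(\<Sum>j\<in>I6. - (N j + x)) = - 6 * x" using N0 by (simp add: sum_negf sum.distrib sum_subtractf)
      hence "(\<Prod>j\<in>I6. (-v) powi (- (N j + x))) = (-v) powi (- 6 * x)" using v0 by (simp add: prod_powi)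
      also have "\<dots> = ((-v)^2) powi (- 3 * x)" by (simp add: power_int_mult[symmetric] flip: power_int_numeral)
      also have "(-v)^2 = v^2" by simp
      also have "(v^2) powi (- 3 * x) = v powi (- 6 * x)" by (simp add: power_int_mult[symmetric] flip: power_int_numeral)
      finally show ?thesis .
    qed
    have p2: "(\<Prod>j\<in>I6. c j powi (- x)) = q powi (- x)"
      unfolding prod_powi_base c1 ..
    have p3: "(\<Prod>j\<in>I6. b j powi (- N j)) = inverse (\<Prod>j\<in>I6. b j powi N j)"
      by (simp add: power_int_minus prod_inversef[symmetric] o_def)
    have p4: "(\<Prod>j\<in>I6. q powi (- N j * N j)) = q powi (- QN)"
      unfolding prod_powi[OF q_nz] QN_def by (simp add: sum_negf)
    have p5: "(\<Prod>j\<in>I6. q powi (N j * x)) = 1" unfolding prod_powi[OF q_nz] using N0 by (simp add: sum_distrib_right[symmetric])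
    have p6: "(\<Prod>j\<in>I6. q powi (N j + x)) = q powi (6 * x)" unfolding prod_powi[OF q_nz] using N0 by (simp add: sum.distrib)
    have p7: "(\<Prod>j\<in>I6. qb x) = q powi (3 * (x * (x - 1)))"
    proof -
      have "(\<Prod>j\<in>I6. qb x) = (qb x ^ 2) ^ 3" by (simp add: power_mult[symmetric])
      also have "\<dots> = q powi (3 * (x * (x - 1)))" unfolding qb_sq by (simp add: power_int_mult[symmetric] mult.commute flip: power_int_numeral)
      finally show ?thesis .
    qed
    have p8: "(\<Prod>j\<in>I6. qb (N j)) ^ 2 = q powi QN"
    proof -
      have "(\<Prod>j\<in>I6. qb (N j)) ^ 2 = (\<Prod>j\<in>I6. q powi (N j * (N j - 1)))"
        by (simp only: prod_power_distrib qb_sq)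
      also have "\<dots> = q powi (\<Sum>j\<in>I6. N j * (N j - 1))" by (rule prod_powi[OF q_nz])
      also have "(\<Sum>j\<in>I6. N j * (N j - 1)) = QN" using N0 by (simp add: QN_def right_diff_distrib sum_subtractf)
      finally show ?thesis .
    qed
    define B where "B = (\<Prod>j\<in>I6. b j powi N j)"
    define T where "T = (\<Prod>j\<in>I6. qb (N j))"
    have B0: "B \<noteq> 0" using b0 by (auto simp: B_def prod_zero_iff)
    have W2: "W = v powi (- 6 * x) * (q powi (- x) * (inverse B * q powi (- QN))) * (T * q powi (3 * (x * (x - 1))) * 1 * q powi (6 * x))"
      unfolding W1 prod.distrib p1 p2 p3 p4 p5 p6 p7 B_def T_def ..
    have m: "mu b N = T * B" by (simp add: mu_def prod.distrib T_def B_def)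
    have zz: "z powi (6 * x) = v powi (6 * x) * q powi (- 3 * (x * x))"
    proof -
      have "z = v * s powi (- x)" using s0 by (simp add: v_def power_int_minus)
      hence "z powi (6 * x) = v powi (6 * x) * (s powi (- x)) powi (6 * x)" by (simp only: power_int_mult_distrib)
      also have "(s powi (- x)) powi (6 * x) = s powi (2 * (- 3 * (x * x)))"
        by (simp only: power_int_mult[symmetric]) (simp add: mult_ac)
      finally show ?thesis unfolding sp .
    qed
    have u3: "u ^ 3 = v ^ 3 * q powi (- 3 * x)"
    proof -
      have "(q powi (- x)) ^ 3 = q powi (- x * 3)" by (metis power_int_mult power_int_numeral)
      thus ?thesis unfolding uv by (simp add: power_mult_distrib mult.commute)
    qed
    have "W * (u ^ 3 * v * (q powi x * z powi (6 * x))) * mu b N =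
      (v powi (- 6 * x) * v powi (6 * x)) * (inverse B * B) * (v ^ 3 * v) * (q powi (- QN) * T ^ 2) *
      (q powi (- x) * q powi (3 * (x * (x - 1))) * q powi (6 * x) * q powi (- 3 * x) * q powi x * q powi (- 3 * (x * x)))"
      unfolding W2 m zz u3 by (simp add: power2_eq_square mult_ac)
    also have "v powi (- 6 * x) * v powi (6 * x) = 1" using v0 by (simp flip: power_int_add)
    also have "q powi (- QN) * T ^ 2 = 1" using p8 q_nz unfolding T_def by (simp flip: power_int_add)
    also have "q powi (- x) * q powi (3 * (x * (x - 1))) * q powi (6 * x) * q powi (- 3 * x) * q powi x * q powi (- 3 * (x * x)) =
       q powi (- x + 3 * (x * (x - 1)) + 6 * x + (- 3 * x) + x + (- 3 * (x * x)))"
      by (simp only: power_int_add[OF disjI1[OF q_nz]])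
    also have "- x + 3 * (x * (x - 1)) + 6 * x + (- 3 * x) + x + (- 3 * (x * x)) = 0" by (simp add: algebra_simps)
    finally show ?thesis using B0 by (simp add: eval_nat_numeral)
  qed
  have U0: "u ^ 3 * v * (q powi x * z powi (6 * x)) \<noteq> 0" using u0 v0 z q_nz by simp
  have thb: "(\<Prod>j\<in>I6. th (b j * u)) = (\<Prod>j\<in>I6. th (c j * v)) / W" using th W0 by (simp add: field_simps)
  have mu0: "mu b N \<noteq> 0" using b0 by (rule mu_nz)
  have "hq c v = (\<Prod>j\<in>I6. th (c j * v)) / (\<Prod>j\<in>I6. th (c j / v)) / (W * (u ^ 3 * v * (q powi x * z powi (6 * x))) * mu b N)"
    unfolding hq_def W prod_dividef ..
  thus ?thesis unfolding c_def[symmetric] prod_dividef thb using mu0 by simp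
qed

text \<open>
  The factors \<open>(q / (b\<^sub>j u))\<^sub>\<infinity>\<close> in the numerator and \<open>(c\<^sub>j / v)\<^sub>\<infinity>\<close> in the denominator are completed to
  theta functions. The factors used for the completion, together with the rest of the integrand,
  form \<open>Xf b u\<close> and \<open>Xf c v\<close>.
\<close>

lemma integrand_core:
  assumes b0: "\<And>j. j \<in> I6 \<Longrightarrow> b j \<noteq> 0" and b1: "(\<Prod>j\<in>I6. b j) = q" and N0: "(\<Sum>j\<in>I6. N j) = 0"
    and s: "s^2 = q" and z: "z \<noteq> 0"
    and reg: "regular_pt b (s powi (- x) * z)" "regular_pt (shiftp b N) (s powi x * z)"
  shows "(1 - q powi x * z ^ 2) * (1 - q powi x * z powi (- 2)) / (q powi x * z powi (6 * x)) *
     (\<Prod>j=1..6.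
        (qp (q * s powi x / (b j * z)) * qp (q * s powi (- x) * z / b j)) /
        (qp (q powi N j * s powi x * b j * z) * qp (q powi N j * s powi (- x) * b j / z))) =
     - mu b N * Xf b (s powi (- x) * z) * Xf (shiftp b N) (s powi x * z) * hq (shiftp b N) (s powi x * z)"
proof -
  define u where "u = s powi (- x) * z"
  define v where "v = s powi x * z"
  define c where "c = shiftp b N"
  have s0: "s \<noteq> 0" using s q_nz by auto
  have u0: "u \<noteq> 0" and v0: "v \<noteq> 0" using s0 z by (auto simp: u_def v_def)
  have c0: "c j \<noteq> 0" if "j \<in> I6" for j using b0[OF that] q_nz by (simp add: c_def shiftp_def)
  have sp: "s powi (2 * n) = q powi n" for n using s by (metis power_int_mult power_int_numeral)
  have s2: "(s powi n)^2 = q powi n" for n unfolding sp[symmetric] by (metis mult.commute power_int_mult power_int_numeral)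
  have v2: "q powi x * z ^ 2 = v ^ 2"
    by (simp add: v_def power_mult_distrib s2)
  have u2: "q powi x * z powi (- 2) = 1 / u ^ 2"
  proof -
    have "u ^ 2 = q powi (- x) * z ^ 2"
      by (simp add: u_def power_mult_distrib s2)
    thus ?thesis using q_nz z u0 by (simp add: power_int_minus field_simps)
  qed
  have fac: "(qp (q * s powi x / (b j * z)) * qp (q * s powi (- x) * z / b j)) /
        (qp (q powi N j * s powi x * b j * z) * qp (q powi N j * s powi (- x) * b j / z)) =
      (qp (q * u / b j) / qp (b j * u)) * (qp (q * v / c j) / qp (c j * v)) * (th (b j * u) / th (c j / v))" if j: "j \<in> I6" for j
  proof -
    have a1: "q * s powi x / (b j * z) = q / (b j * u)" using s0 by (simp add: u_def power_int_minus field_simps)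
    have a2: "q * s powi (- x) * z / b j = q * u / b j" by (simp add: u_def mult_ac)
    have a3: "q powi N j * s powi x * b j * z = c j * v" by (simp add: c_def shiftp_def v_def mult_ac)
    have a4: "q powi N j * s powi (- x) * b j / z = c j / v" using s0 by (simp add: c_def shiftp_def v_def power_int_minus field_simps)
    have n1: "qp (b j * u) \<noteq> 0" using reg(1) j not_qpowers_qp by (auto simp: regular_pt_def u_def)
    have "c j / v \<notin> qpowers q" using reg(2) j by (auto simp: regular_pt_def v_def c_def)
    hence "th (c j / v) \<noteq> 0" using c0[OF j] v0 by (intro th_nz) auto
    moreover have t2: "th (c j / v) = qp (c j / v) * qp (q * v / c j)" by (simp add: th_def)
    ultimately have n2: "qp (q * v / c j) \<noteq> 0" by auto
    have t1: "th (b j * u) = qp (b j * u) * qp (q / (b j * u))" by (simp add: th_def)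
    show ?thesis unfolding a1 a2 a3 a4 t1 t2 using n1 n2 by simp
  qed
  define P1 where "P1 = (\<Prod>j\<in>I6. qp (q * u / b j) / qp (b j * u))"
  define P2 where "P2 = (\<Prod>j\<in>I6. qp (q * v / c j) / qp (c j * v))"
  define D where "D = q powi x * z powi (6 * x)"
  have D0: "D \<noteq> 0" using q_nz z by (simp add: D_def)
  have "(1 - q powi x * z ^ 2) * (1 - q powi x * z powi (- 2)) / (q powi x * z powi (6 * x)) *
     (\<Prod>j=1..6.
        (qp (q * s powi x / (b j * z)) * qp (q * s powi (- x) * z / b j)) /
        (qp (q powi N j * s powi x * b j * z) * qp (q powi N j * s powi (- x) * b j / z))) =
     (1 - v^2) * (1 - 1 / u^2) / D * (P1 * P2 * (\<Prod>j\<in>I6. th (b j * u) / th (c j / v)))"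
    unfolding v2 u2 I6_def[symmetric] P1_def P2_def D_def prod.distrib[symmetric] using fac by (simp cong: prod.cong)
  also have "\<dots> = - (- u * (1 - u^2) * P1) * (- v * (1 - v^2) * P2) * ((\<Prod>j\<in>I6. th (b j * u) / th (c j / v)) / (u ^ 3 * v * D))"
  proof -
    have e: "(1 - 1 / u^2) = - (1 - u^2) / u^2" using u0 by (simp add: field_simps)
    show ?thesis unfolding e using u0 v0 D0 by (simp add: field_simps eval_nat_numeral)
  qed
  also have "(\<Prod>j\<in>I6. th (b j * u) / th (c j / v)) / (u ^ 3 * v * D) = mu b N * hq c v"
    unfolding c_def D_def u_def v_def by (rule theta_quotient[OF b0 b1 N0 s z])
  finally show ?thesis unfolding Xf_def P1_def P2_def u_def[symmetric] v_def[symmetric] c_def[symmetric] by (simp add: mult_ac)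
qed

end

section \<open>Contour integrals of functions with infinitely many poles\<close>

text \<open>
  A simple path runs through each point of a finite set at most once, apart from its end points,
  so the integrand may be changed there.
\<close>

lemma has_contour_integral_spike_finite_simple_path:
  assumes "(f has_contour_integral i) \<gamma>" "simple_path \<gamma>" "finite A"
    and "\<And>z. z \<in> path_image \<gamma> - A \<Longrightarrow> g z = f z"
  shows "(g has_contour_integral i) \<gamma>"
proof -
  have "finite (\<gamma> -` A \<inter> {0<..<1})"
    using assms by (intro finite_vimage_IntI simple_path_inj_on) auto
  hence fin: "finite ({0, 1} \<union> \<gamma> -` A \<inter> {0<..<1})" by auto
  show ?thesis
    unfolding has_contour_integral_def
  proof (rule has_integral_spike_finite[OF fin])
    fix t :: real assume "t \<in> {0..1} - ({0, 1} \<union> \<gamma> -` A \<inter> {0<..<1})"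
    hence "\<gamma> t \<in> path_image \<gamma> - A" by (auto simp: path_image_def)
    thus "g (\<gamma> t) * vector_derivative \<gamma> (at t within {0..1}) = f (\<gamma> t) * vector_derivative \<gamma> (at t within {0..1})"
      using assms(4) by simp
  qed (use assms(1) in \<open>simp add: has_contour_integral_def\<close>)
qed

lemma winding_number_inside_eq_1:
  assumes "simple_path \<gamma>" "pathfinish \<gamma> = pathstart \<gamma>" "w \<in> inside (path_image \<gamma>)" "winding_number \<gamma> w = 1"
    and "z \<in> inside (path_image \<gamma>)"
  shows "winding_number \<gamma> z = 1"
proof -
  obtain e :: complex where "\<And>z. z \<in> inside (path_image \<gamma>) \<Longrightarrow> winding_number \<gamma> z = e"
    using simple_closed_path_winding_number_inside[OF assms(1)] assms(2) by metis
  thus ?thesis using assms by metis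
qed

lemma meromorphic_remove_sings_analytic:
  assumes "F meromorphic_on {z}" "\<not> is_pole F z"
  shows "remove_sings F analytic_on {z}"
proof -
  have iso: "isolated_singularity_at F z" using assms(1) by (rule meromorphic_on_isolated_singularity)
  have "not_essential F z" using assms(1) by (rule meromorphic_on_not_essential)
  then obtain c where "F \<midarrow>z\<rightarrow> c" using assms(2) by (auto simp: not_essential_def)
  thus ?thesis by (rule remove_sings_analytic_at[OF iso])
qed

lemma residue_no_pole:
  assumes "F meromorphic_on {z}" "\<not> is_pole F z"
  shows "residue F z = 0"
proof -
  have iso: "isolated_singularity_at F z" using assms(1) by (rule meromorphic_on_isolated_singularity)
  obtain S where S: "open S" "z \<in> S" "remove_sings F holomorphic_on S"
    using meromorphic_remove_sings_analytic[OF assms] analytic_at by blast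
  have "residue (remove_sings F) z = 0" by (rule residue_holo[OF S])
  thus ?thesis using iso by simp
qed

text \<open>
  The poles \<open>p t\<close>, which lie inside \<open>\<gamma>\<close>, may accumulate at 0. Therefore \<open>\<gamma>\<close> is compared with the
  circles of radius \<open>r i\<close>, which avoid all poles and on which \<open>F\<close> is bounded, so that their integrals
  tend to 0. For small \<open>r i\<close>, the poles inside \<open>\<gamma>\<close> and outside the circle are the poles \<open>p t\<close> of
  modulus greater than \<open>r i\<close>. The integrand is \<open>remove_sings F\<close> because \<open>\<gamma>\<close> may pass through removable
  singularities of \<open>F\<close>.
\<close>

lemma contour_integral_eq_residue_sum:
  fixes F :: "complex \<Rightarrow> complex" and p :: "'i \<Rightarrow> complex"
  assumes mero: "F meromorphic_on -{0}" and inj: "inj_on p I" and p0: "\<And>t. t \<in> I \<Longrightarrow> p t \<noteq> 0"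
    and ana: "\<And>z. z \<noteq> 0 \<Longrightarrow> z \<notin> p ` I \<union> D \<Longrightarrow> F analytic_on {z}"
    and fin: "\<And>r R. 0 < r \<Longrightarrow> finite {z \<in> p ` I \<union> D. r \<le> norm z \<and> norm z \<le> R}"
    and \<gamma>: "valid_path \<gamma>" "simple_path \<gamma>" "pathfinish \<gamma> = pathstart \<gamma>"
      "0 \<in> inside (path_image \<gamma>)" "winding_number \<gamma> 0 = 1"
    and insd: "\<And>t. t \<in> I \<Longrightarrow> is_pole F (p t) \<Longrightarrow> p t \<in> inside (path_image \<gamma>)"
    and outd: "\<And>z. z \<in> D \<Longrightarrow> is_pole F z \<Longrightarrow> z \<in> outside (path_image \<gamma>)"
    and r: "\<And>i::nat. 0 < r i" "r \<longlonglongrightarrow> 0"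
    and circ: "\<And>i z. norm z = r i \<Longrightarrow> z \<notin> p ` I \<union> D \<and> norm (F z) \<le> B"
    and sum: "((\<lambda>t. residue F (p t)) has_sum T) I"
  shows "(remove_sings F has_contour_integral 2 * pi * \<i> * T) \<gamma>"
proof -
  define G where "G = remove_sings F"
  have meroz: "F meromorphic_on {z}" if "z \<noteq> 0" for z using mero that by (rule_tac meromorphic_on_subset) auto
  have not_pole: "\<not> is_pole F z" if "z \<noteq> 0" "z \<notin> p ` I \<union> D" for z
    using ana[OF that] analytic_at_imp_no_pole by blast
  have Gana: "G analytic_on {z}" if "z \<noteq> 0" "\<not> is_pole F z" for z
    unfolding G_def using meroz that by (intro meromorphic_remove_sings_analytic) auto
  define U where "U = {z. z \<noteq> 0 \<and> \<not> is_pole F z}"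
  have img: "path_image \<gamma> \<subseteq> U"
  proof
    fix z assume z: "z \<in> path_image \<gamma>"
    hence "z \<notin> inside (path_image \<gamma>)" "z \<notin> outside (path_image \<gamma>)" by (auto simp: inside_def outside_def)
    have z0: "z \<noteq> 0" using \<gamma>(4) \<open>z \<notin> inside (path_image \<gamma>)\<close> by auto
    have "\<not> is_pole F z"
    proof
      assume pole: "is_pole F z"
      hence "z \<in> p ` I \<union> D" using not_pole[OF z0] by blast
      thus False using pole insd outd \<open>z \<notin> inside (path_image \<gamma>)\<close> \<open>z \<notin> outside (path_image \<gamma>)\<close> by blast
    qed
    thus "z \<in> U" using z0 by (simp add: U_def)
  qed
  have GU: "G analytic_on U" by (subst analytic_on_analytic_at) (auto simp: U_def intro: Gana)
  have Gint: "G contour_integrable_on \<gamma>"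
  proof -
    obtain V where "open V" "U \<subseteq> V" "G holomorphic_on V" using GU by (metis analytic_on_holomorphic)
    thus ?thesis using \<gamma>(1) img by (intro contour_integrable_holomorphic_simple[of G V]) auto
  qed
  have bdd: "bounded (path_image \<gamma>)" using \<gamma>(1) by (simp add: bounded_valid_path_image)
  then obtain R0 where R0: "\<And>z. z \<in> path_image \<gamma> \<Longrightarrow> norm z \<le> R0" unfolding bounded_iff by blast
  define R where "R i = \<bar>R0\<bar> + 1 + real i" for i
  have R: "R i > 0" and R2: "z \<in> path_image \<gamma> \<Longrightarrow> norm z < R i" for i z
  proof -
    show "R i > 0" by (simp add: R_def add_pos_nonneg)
    assume "z \<in> path_image \<gamma>"
    hence "norm z \<le> R0" by (rule R0)
    thus "norm z < R i" using of_nat_0_le_iff[of i, where ?'a = real] unfolding R_def by linarith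
  qed
  have wn_in: "winding_number \<gamma> z = 1" if "z \<in> inside (path_image \<gamma>)" for z
    using winding_number_inside_eq_1 \<gamma> that by metis
  have wn_out: "winding_number \<gamma> z = 0" if "z \<in> outside (path_image \<gamma>)" for z
    using winding_number_zero_in_outside[of \<gamma> z] \<gamma> that by (simp add: valid_path_imp_path)
  have wn_far: "winding_number \<gamma> z = 0" if "R i \<le> norm z" for z i
    using R[of i] R2[of _ i] that \<gamma>(1,3)
    by (intro winding_number_zero_outside[of _ "ball 0 (R i)"]) (auto simp: valid_path_imp_path)
  obtain \<delta> where \<delta>: "\<delta> > 0" "ball 0 \<delta> \<subseteq> inside (path_image \<gamma>)"
    using open_inside[of "path_image \<gamma>"] \<gamma>(1,4) by (metis closed_valid_path_image open_contains_ball)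
  have ev_small: "eventually (\<lambda>i. r i < \<delta>) sequentially" using r(2) \<delta>(1) by (rule order_tendstoD)
  define E where "E i = {t \<in> I. r i < norm (p t) \<and> norm (p t) < R i}" for i
  have finE: "finite (E i)" for i
  proof -
    have "p ` E i \<subseteq> {z \<in> p ` I \<union> D. r i \<le> norm z \<and> norm z \<le> R i}" by (auto simp: E_def)
    hence "finite (p ` E i)" using fin[OF r(1)] finite_subset by blast
    moreover have "inj_on p (E i)" using inj by (rule inj_on_subset) (auto simp: E_def)
    ultimately show ?thesis by (rule finite_imageD)
  qed
  have step: "contour_integral \<gamma> G - contour_integral (circlepath 0 (r i)) G =
      2 * pi * \<i> * (\<Sum>t\<in>E i. residue F (p t))" if i: "r i < \<delta>" for i
  proof -
    define S where "S = {z::complex. r i / 2 < norm z \<and> norm z < R i}"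
    define pts where "pts = {z \<in> S. is_pole F z}"
    have ri: "r i > 0" by (rule r)
    have \<delta>R: "\<delta> \<le> R i"
    proof (rule ccontr)
      assume "\<not> \<delta> \<le> R i"
      hence "of_real (R i) \<in> ball (0::complex) \<delta>" using R[of i] by simp
      hence "of_real (R i) \<in> inside (path_image \<gamma>)" using \<delta> by blast
      hence "winding_number \<gamma> (of_real (R i)) = 1" by (rule wn_in)
      thus False using wn_far[of i "of_real (R i)"] R[of i] by simp
    qed
    have oS: "open S" unfolding S_def by (intro open_Collect_conj open_Collect_less continuous_intros)
    have cS: "connected S"
    proof -
      have "connected {z::complex. r i / 2 < norm (z - 0) \<and> norm (z - 0) < R i}"
        by (rule connected_annulus) simp
      thus ?thesis by (simp add: S_def)
    qed
    have fpts: "finite pts"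
    proof -
      have "pts \<subseteq> {z \<in> p ` I \<union> D. r i / 2 \<le> norm z \<and> norm z \<le> R i}"
      proof
        fix z assume z: "z \<in> pts"
        hence "z \<noteq> 0" using ri by (auto simp: pts_def S_def)
        hence "z \<in> p ` I \<union> D" using not_pole z unfolding pts_def by blast
        thus "z \<in> {z \<in> p ` I \<union> D. r i / 2 \<le> norm z \<and> norm z \<le> R i}" using z by (simp add: pts_def S_def)
      qed
      thus ?thesis using fin[of "r i / 2" "R i"] ri finite_subset by auto
    qed
    have hol: "G holomorphic_on S - pts"
      by (rule analytic_imp_holomorphic, rule analytic_on_subset[OF GU]) (use ri in \<open>auto simp: S_def pts_def U_def\<close>)
    have g1: "path_image \<gamma> \<subseteq> S - pts"
    proof
      fix z assume z: "z \<in> path_image \<gamma>"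
      hence "z \<notin> ball 0 \<delta>" using \<delta>(2) by (auto simp: inside_def)
      hence "r i / 2 < norm z" using i ri by simp
      thus "z \<in> S - pts" using R2[OF z, of i] img z by (auto simp: S_def pts_def U_def)
    qed
    have h1: "path_image (circlepath 0 (r i)) \<subseteq> S - pts"
    proof
      fix z assume "z \<in> path_image (circlepath 0 (r i))"
      hence nz: "norm z = r i" using ri by auto
      hence "z \<in> S" using ri i \<delta>R by (simp add: S_def)
      moreover have "z \<noteq> 0" using nz ri by auto
      hence "z \<notin> pts" using not_pole[of z] circ[OF nz] by (auto simp: pts_def)
      ultimately show "z \<in> S - pts" by blast
    qed
    have homo: "winding_number \<gamma> z = winding_number (circlepath 0 (r i)) z" if "z \<notin> S" for z
    proof (cases "norm z < R i")
      case True
      hence z: "norm z \<le> r i / 2" using that by (auto simp: S_def)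
      hence "z \<in> ball 0 \<delta>" using i ri by simp
      hence "winding_number \<gamma> z = 1" using wn_in \<delta>(2) by blast
      moreover have "winding_number (circlepath 0 (r i)) z = 1"
        using z ri by (intro winding_number_circlepath) simp
      ultimately show ?thesis by simp
    next
      case False
      hence "winding_number (circlepath 0 (r i)) z = 0" using ri i \<delta>R
        by (intro winding_number_zero_outside[of _ "cball 0 (r i)"]) auto
      thus ?thesis using wn_far[of i z] False by simp
    qed
    have "contour_integral \<gamma> G - contour_integral (circlepath 0 (r i)) G =
        2 * pi * \<i> * (\<Sum>z\<in>pts. (winding_number \<gamma> z - winding_number (circlepath 0 (r i)) z) * residue G z)"
      using \<gamma> g1 h1 homo by (intro two_loop_residue[OF oS cS fpts hol]) auto
    also have "(\<Sum>z\<in>pts. (winding_number \<gamma> z - winding_number (circlepath 0 (r i)) z) * residue G z) = (\<Sum>z\<in>p ` E i. residue F z)"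
    proof (rule sum.mono_neutral_cong)
      show "finite (p ` E i)" using finE by simp
      show "residue F z = 0" if "z \<in> p ` E i - pts" for z
      proof -
        have "z \<noteq> 0" "z \<in> S" using that p0 ri by (auto simp: E_def S_def)
        moreover from this have "\<not> is_pole F z" using that by (simp add: pts_def)
        ultimately show ?thesis using meroz by (intro residue_no_pole) auto
      qed
      show "(winding_number \<gamma> z - winding_number (circlepath 0 (r i)) z) * residue G z = 0" if z: "z \<in> pts - p ` E i" for z
      proof (cases "norm z < r i")
        case True
        hence "z \<in> ball 0 \<delta>" using i by simp
        hence "winding_number \<gamma> z = 1" using wn_in \<delta>(2) by blast
        moreover have "winding_number (circlepath 0 (r i)) z = 1"
          using True ri by (intro winding_number_circlepath) simp
        ultimately show ?thesis by simp
      next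
        case False
        have zp: "is_pole F z" "norm z < R i" "z \<noteq> 0" using z ri by (auto simp: pts_def S_def)
        have "z \<in> p ` I \<union> D" using not_pole[of z] zp by blast
        hence "norm z \<noteq> r i" using circ[of z i] by blast
        hence gt: "norm z > r i" using False by simp
        hence "z \<notin> p ` I" using z zp by (auto simp: E_def)
        hence "z \<in> D" using zp not_pole[of z] by blast
        hence "winding_number \<gamma> z = 0" using outd zp wn_out by blast
        moreover have "winding_number (circlepath 0 (r i)) z = 0"
          using gt ri by (intro winding_number_zero_outside[of _ "cball 0 (r i)"]) auto
        ultimately show ?thesis by simp
      qed
      show "(winding_number \<gamma> z - winding_number (circlepath 0 (r i)) z) * residue G z = residue F z" if z: "z \<in> pts \<inter> p ` E i" for z
      proof -
        have "z \<noteq> 0" "is_pole F z" using z ri by (auto simp: pts_def S_def)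
        moreover from this(2) z have "winding_number \<gamma> z = 1" using insd wn_in by (auto simp: E_def)
        moreover have "winding_number (circlepath 0 (r i)) z = 0"
          using z ri by (intro winding_number_zero_outside[of _ "cball 0 (r i)"]) (auto simp: E_def)
        moreover have "isolated_singularity_at F z" using meroz \<open>z \<noteq> 0\<close> by (intro meromorphic_on_isolated_singularity)
        ultimately show ?thesis by (simp add: G_def)
      qed
    qed (use fpts in auto)
    also have "\<dots> = (\<Sum>t\<in>E i. residue F (p t))"
      by (rule sum.reindex_cong[of p]) (auto intro: inj_on_subset[OF inj] simp: E_def)
    finally show ?thesis .
  qed
  have circle_lim: "(\<lambda>i. contour_integral (circlepath 0 (r i)) G) \<longlonglongrightarrow> 0"
  proof (rule Lim_null_comparison)
    have "norm (contour_integral (circlepath 0 (r i)) G) \<le> \<bar>B\<bar> * (2 * pi * r i)" for i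
    proof (rule has_contour_integral_bound_circlepath)
      have sph: "z \<in> U" "G z = F z" if "norm z = r i" for z
      proof -
        have z: "z \<noteq> 0" "z \<notin> p ` I \<union> D" using circ[OF that] that r(1)[of i] by auto
        show "z \<in> U" using z not_pole by (simp add: U_def)
        show "G z = F z" unfolding G_def using ana[OF z] by simp
      qed
      obtain V where "open V" "U \<subseteq> V" "G holomorphic_on V" using GU by (metis analytic_on_holomorphic)
      hence "G contour_integrable_on circlepath 0 (r i)" using r(1)[of i] sph(1)
        by (intro contour_integrable_holomorphic_simple[of G V]) auto
      thus "(G has_contour_integral contour_integral (circlepath 0 (r i)) G) (circlepath 0 (r i))"
        by (rule has_contour_integral_integral)
      show "norm (G z) \<le> \<bar>B\<bar>" if "norm (z - 0) = r i" for z
        using circ[of z i] sph[of z] that abs_ge_self[of B] by auto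
    qed (use r in auto)
    thus "eventually (\<lambda>i. norm (contour_integral (circlepath 0 (r i)) G) \<le> \<bar>B\<bar> * (2 * pi * r i)) sequentially" by simp
    show "(\<lambda>i. \<bar>B\<bar> * (2 * pi * r i)) \<longlonglongrightarrow> 0"
      using r(2) by (auto intro!: tendsto_mult_right_zero)
  qed
  have "filterlim E (finite_subsets_at_top I) sequentially"
    unfolding filterlim_finite_subsets_at_top
  proof (intro allI impI)
    fix X assume X: "finite X \<and> X \<subseteq> I"
    have "eventually (\<lambda>i. t \<in> E i) sequentially" if t: "t \<in> X" for t
    proof -
      have tI: "t \<in> I" using X t by auto
      have "eventually (\<lambda>i. r i < norm (p t)) sequentially"
        using r(2) by (rule order_tendstoD) (use p0[OF tI] in simp)
      moreover have "eventually (\<lambda>i. norm (p t) < real i) sequentially"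
        using filterlim_real_sequentially unfolding filterlim_at_top_dense by blast
      ultimately show ?thesis by eventually_elim (use tI in \<open>auto simp: E_def R_def\<close>)
    qed
    hence "eventually (\<lambda>i. \<forall>t\<in>X. t \<in> E i) sequentially" using X by (intro eventually_ball_finite) auto
    thus "eventually (\<lambda>i. finite (E i) \<and> X \<subseteq> E i \<and> E i \<subseteq> I) sequentially"
      by eventually_elim (use finE in \<open>auto simp: E_def\<close>)
  qed
  hence "(\<lambda>i. \<Sum>t\<in>E i. residue F (p t)) \<longlonglongrightarrow> T"
    using sum unfolding has_sum_def by (rule filterlim_compose[rotated])
  hence "(\<lambda>i. 2 * pi * \<i> * (\<Sum>t\<in>E i. residue F (p t)) + contour_integral (circlepath 0 (r i)) G) \<longlonglongrightarrow> 2 * pi * \<i> * T + 0"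
    by (intro tendsto_intros circle_lim)
  moreover have "eventually (\<lambda>i. 2 * pi * \<i> * (\<Sum>t\<in>E i. residue F (p t)) + contour_integral (circlepath 0 (r i)) G = contour_integral \<gamma> G) sequentially"
    using ev_small
  proof eventually_elim
    case (elim i)
    show ?case using step[OF elim] by (simp add: algebra_simps)
  qed
  ultimately have "(\<lambda>i::nat. contour_integral \<gamma> G) \<longlonglongrightarrow> 2 * pi * \<i> * T + 0"
    by (rule Lim_transform_eventually)
  hence "contour_integral \<gamma> G = 2 * pi * \<i> * T" by (simp add: LIMSEQ_const_iff)
  thus ?thesis using Gint has_contour_integral_integral unfolding G_def by metis
qed

section \<open>Residues and contour integrals of the integrand\<close>

context qbase begin

lemma qp_analytic [analytic_intros]: "f analytic_on A \<Longrightarrow> (\<lambda>z. qp (f z)) analytic_on A"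
proof -
  have "qp analytic_on UNIV" by (simp add: analytic_on_open qp_holomorphic)
  thus "f analytic_on A \<Longrightarrow> (\<lambda>z. qp (f z)) analytic_on A"
    using analytic_on_compose_gen[of f A qp UNIV] by (auto simp: o_def)
qed

lemma th_analytic [analytic_intros]:
  "f analytic_on A \<Longrightarrow> (\<And>z. z \<in> A \<Longrightarrow> f z \<noteq> 0) \<Longrightarrow> (\<lambda>z. th (f z)) analytic_on A"
  unfolding th_def by (intro analytic_intros) auto

lemma zero_not_qpowers: "0 \<notin> qpowers q" using q_nz by (auto simp: qpowers_def)

lemma Xf_analytic:
  assumes "f analytic_on A" "\<And>z j. z \<in> A \<Longrightarrow> j \<in> I6 \<Longrightarrow> qp (b j * f z) \<noteq> 0"
  shows "(\<lambda>z. Xf b (f z)) analytic_on A"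
  unfolding Xf_def divide_inverse[of _ "b _"] using assms by (intro analytic_intros) auto

lemma Xf_meromorphic:
  assumes "f analytic_on A"
  shows "(\<lambda>z. Xf b (f z)) meromorphic_on A"
  unfolding Xf_def divide_inverse[of _ "b _"]
  by (intro meromorphic_intros analytic_on_imp_meromorphic_on qp_analytic analytic_intros assms)

lemma combo_Nil: "combo b [] = (\<lambda>u. 0)"
  and combo_Cons: "combo b (ce # fs) = (\<lambda>u. fst ce * mu b (snd ce) * Xf (shiftp b (snd ce)) u + combo b fs u)"
  by (auto simp: combo_def fun_eq_iff case_prod_unfold)

lemma combo_analytic:
  assumes "f analytic_on A" "\<And>z j. z \<in> A \<Longrightarrow> j \<in> I6 \<Longrightarrow> b j * f z \<notin> qpowers q"
  shows "(\<lambda>z. combo b fs (f z)) analytic_on A"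
proof (induction fs)
  case (Cons ce fs)
  have "(\<lambda>z. Xf (shiftp b (snd ce)) (f z)) analytic_on A"
  proof (rule Xf_analytic[OF assms(1)])
    fix z j assume "z \<in> A" "j \<in> I6"
    hence "b j * f z * q powi snd ce j \<notin> qpowers q" using assms(2) by (simp only: qpowers_cancel not_False_eq_True)
    thus "qp (shiftp b (snd ce) j * f z) \<noteq> 0" using not_qpowers_qp by (simp add: shiftp_def mult_ac)
  qed
  thus ?case unfolding combo_Cons using Cons by (intro analytic_intros)
qed (simp add: combo_Nil)

lemma combo_meromorphic:
  assumes "f analytic_on A"
  shows "(\<lambda>z. combo b fs (f z)) meromorphic_on A"
proof (induction fs)
  case (Cons ce fs)
  thus ?case unfolding combo_Cons using Xf_meromorphic[OF assms] by (intro meromorphic_intros)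
qed (auto simp: combo_Nil intro: meromorphic_intros)

lemma combo_0: "combo b fs 0 = 0"
  by (induction fs) (auto simp: combo_Nil combo_Cons Xf_def)

text \<open>
  Because of the factor \<open>u\<close> in \<open>Xf\<close>, the combinations vanish at 0. On small circles this outweighs
  the factor \<open>1 / z\<close> of the measure.
\<close>

lemma combo_linear_bound: "\<exists>C \<delta>. 0 < \<delta> \<and> 0 \<le> C \<and> (\<forall>u. norm u < \<delta> \<longrightarrow> norm (combo b fs u) \<le> C * norm u)"
proof -
  have "(\<lambda>u. combo b fs u) analytic_on {0}"
    by (rule combo_analytic) (auto simp: zero_not_qpowers intro: analytic_intros)
  then obtain D where "(combo b fs has_field_derivative D) (at 0)"
    using analytic_on_imp_differentiable_at field_differentiable_def by (metis singletonI)
  hence "(\<lambda>u. combo b fs u / u) \<midarrow>0\<rightarrow> D" by (simp add: has_field_derivative_iff combo_0)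
  hence "(\<lambda>u. norm (combo b fs u / u)) \<midarrow>0\<rightarrow> norm D" by (rule tendsto_norm)
  hence "eventually (\<lambda>u. norm (combo b fs u / u) < norm D + 1) (at 0)" by (rule order_tendstoD) simp
  then obtain \<delta> where \<delta>: "\<delta> > 0" "\<And>u. u \<noteq> 0 \<Longrightarrow> norm u < \<delta> \<Longrightarrow> norm (combo b fs u / u) < norm D + 1"
    unfolding eventually_at by (auto simp: dist_norm)
  have "norm (combo b fs u) \<le> (norm D + 1) * norm u" if "norm u < \<delta>" for u
  proof (cases "u = 0")
    case False
    thus ?thesis using \<delta>(2)[OF False that] by (simp add: norm_divide field_simps)
  qed (simp add: combo_0)
  thus ?thesis using \<delta>(1) by (intro exI[of _ "norm D + 1"] exI[of _ \<delta>]) auto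
qed

lemma hq_analytic:
  assumes "f analytic_on A" "\<And>z. z \<in> A \<Longrightarrow> f z \<noteq> 0" "\<And>j. j \<in> I6 \<Longrightarrow> c j \<noteq> 0"
    and "\<And>z j. z \<in> A \<Longrightarrow> j \<in> I6 \<Longrightarrow> c j / f z \<notin> qpowers q"
  shows "(\<lambda>z. hq c (f z)) analytic_on A"
  unfolding hq_def using assms th_nz by (intro analytic_intros) auto

lemma hq_meromorphic:
  assumes "f analytic_on A" "\<And>z. z \<in> A \<Longrightarrow> f z \<noteq> 0" "\<And>j. j \<in> I6 \<Longrightarrow> c j \<noteq> 0"
  shows "(\<lambda>z. hq c (f z)) meromorphic_on A"
  unfolding hq_def
  by (intro meromorphic_intros analytic_on_imp_meromorphic_on[OF th_analytic] analytic_on_imp_meromorphic_on[OF assms(1)] analytic_intros)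
     (use assms in auto)

text \<open>
  Among the denominators only \<open>th (c\<^sub>k / w)\<close> vanishes at \<open>c\<^sub>k\<close>, and \<open>th_pole_limit\<close> describes it.
\<close>

lemma hq_residue_limit:
  assumes gen: "generic c" and k: "k \<in> I6"
  shows "((\<lambda>w. (w - c k) * hq c w / w) \<longlongrightarrow> eta c k) (at (c k))"
proof -
  have ck: "c k \<noteq> 0" using genericD(1)[OF gen k k] .
  have "((\<lambda>w. (w - c k) / th (c k / w) * ((\<Prod>j\<in>I6. th (c j * w)) / (\<Prod>j\<in>I6-{k}. th (c j / w)) / w ^ 5))
      \<longlongrightarrow> c k / (qp q)\<^sup>2 * ((\<Prod>j\<in>I6. th (c j * c k)) / (\<Prod>j\<in>I6-{k}. th (c j / c k)) / c k ^ 5)) (at (c k))"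
    using ck genericD(1)[OF gen] th_ratio_nz[OF gen] k
    by (intro tendsto_intros th_pole_limit) (auto simp: prod_zero_iff)
  moreover have "c k / (qp q)\<^sup>2 * ((\<Prod>j\<in>I6. th (c j * c k)) / (\<Prod>j\<in>I6-{k}. th (c j / c k)) / c k ^ 5) = eta c k"
    using ck by (simp add: eta_def eval_nat_numeral)
  moreover have "(w - c k) / th (c k / w) * ((\<Prod>j\<in>I6. th (c j * w)) / (\<Prod>j\<in>I6-{k}. th (c j / w)) / w ^ 5) = (w - c k) * hq c w / w" for w
    unfolding hq_def prod_dividef prod.remove[OF finite_I6 k, of "\<lambda>j. th (c j / w)"] by (simp add: eval_nat_numeral)
  ultimately show ?thesis by simp
qed

lemma regular_pt_powi: "regular_pt b (u * q powi n) \<longleftrightarrow> regular_pt b u"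
proof -
  have 1: "b j * (u * q powi n) \<in> qpowers q \<longleftrightarrow> b j * u \<in> qpowers q" for j
    using qpowers_cancel[of "b j * u" n] by (simp only: mult.assoc)
  have "b j / (u * q powi n) = b j / u * q powi (- n)" for j
    by (simp add: power_int_minus divide_inverse)
  hence 2: "b j / (u * q powi n) \<in> qpowers q \<longleftrightarrow> b j / u \<in> qpowers q" for j
    by (simp only: qpowers_cancel)
  show ?thesis unfolding regular_pt_def 1 2 using q_nz by simp
qed

lemma regular_pt_shiftp: "regular_pt (shiftp b e) u \<longleftrightarrow> regular_pt b u"
proof -
  have 1: "shiftp b e j * u = b j * u * q powi e j" and 2: "shiftp b e j / u = b j / u * q powi e j" for j
    by (simp_all add: shiftp_def)
  show ?thesis unfolding regular_pt_def 1 2 qpowers_cancel ..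
qed

text \<open>The integrand, up to its values at singularities.\<close>

definition icore :: "(nat \<Rightarrow> complex) \<Rightarrow> (nat \<Rightarrow> int) \<Rightarrow> complex \<Rightarrow> (complex \<times> (nat \<Rightarrow> int)) list \<Rightarrow>
    (complex \<times> (nat \<Rightarrow> int)) list \<Rightarrow> int \<Rightarrow> complex \<Rightarrow> complex" where
  "icore b N s fs gs x z = - mu b N * combo b fs (s powi (- x) * z) * combo (shiftp b N) gs (s powi x * z) *
     hq (shiftp b N) (s powi x * z) * (1 / (2 * of_real pi * \<i> * z))"

lemma rahman_integrand_eq_icore:
  assumes b0: "\<And>j. j \<in> I6 \<Longrightarrow> b j \<noteq> 0" and b1: "(\<Prod>j\<in>I6. b j) = q" and N0: "(\<Sum>j\<in>I6. N j) = 0"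
    and s: "s^2 = q" and z: "z \<noteq> 0"
    and f: "expands b J f fs" and g: "expands (shiftp b N) J' g gs"
    and reg: "regular_pt b (s powi (- x) * z)" "regular_pt (shiftp b N) (s powi x * z)"
  shows "rahman_integrand q s b N f g x z = icore b N s fs gs x z"
proof -
  define u where "u = s powi (- x) * z"
  define v where "v = s powi x * z"
  have s0: "s \<noteq> 0" using s q_nz by auto
  have iu: "inverse u = s powi x * inverse z" "inverse v = s powi (- x) * inverse z"
    by (simp_all add: u_def v_def power_int_minus)
  obtain vf where vf: "reval f ((u + inverse u) / 2) = vf" "vf * Xf b u = combo b fs u"
    using f reg(1) represents_reval unfolding expands_def u_def by blast
  obtain vg where vg: "reval g ((v + inverse v) / 2) = vg" "vg * Xf (shiftp b N) v = combo (shiftp b N) gs v"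
    using g reg(2) represents_reval unfolding expands_def v_def by blast
  have "rahman_integrand q s b N f g x z = - mu b N * Xf b u * Xf (shiftp b N) v * hq (shiftp b N) v *
      reval f ((u + inverse u) / 2) * reval g ((v + inverse v) / 2) * (1 / (2 * of_real pi * \<i> * z))"
    unfolding rahman_integrand_def iu unfolding u_def v_def by (subst integrand_core[OF b0 b1 N0 s z reg], assumption, rule refl)
  thus ?thesis
    unfolding vf(1) vg(1) icore_def u_def[symmetric] v_def[symmetric] vf(2)[symmetric] vg(2)[symmetric] by (simp add: mult_ac)
qed

text \<open>
  As \<open>hq\<close> is elliptic, its contribution \<open>eta\<close> is the same for all \<open>m\<close> and \<open>x\<close>. The two other factors are
  regular at the pole, by genericity.
\<close>

lemma residue_icore:
  assumes gen: "generic b" and b1: "(\<Prod>j\<in>I6. b j) = q" and N0: "(\<Sum>j\<in>I6. N j) = 0"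
    and s: "s^2 = q" and k: "k \<in> I6" and mero: "icore b N s fs gs x meromorphic_on -{0}"
  shows "residue (icore b N s fs gs x) (b k * s powi (- x) * q powi m) =
    - mu b N / (2 * pi * \<i>) * (eta (shiftp b N) k * combo b fs (b k * q powi (m - x)) * combo (shiftp b N) gs (b k * q powi m))"
proof -
  define c where "c = shiftp b N"
  define p where "p = b k * s powi (- x) * q powi m"
  have genc: "generic c" unfolding c_def by (rule generic_shiftp[OF gen])
  have c1: "(\<Prod>j\<in>I6. c j) = q" unfolding c_def prod_shiftp b1 N0 by simp
  have c0: "c j \<noteq> 0" if "j \<in> I6" for j using genericD(1)[OF genc that that] .
  have s0: "s \<noteq> 0" using s q_nz by auto
  have sp: "s powi (2 * n) = q powi n" for n using s by (metis power_int_mult power_int_numeral)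
  have bk: "b k \<noteq> 0" using genericD(1)[OF gen k k] .
  have p0: "p \<noteq> 0" using bk s0 q_nz by (simp add: p_def)
  have vp: "s powi x * p = b k * q powi m" using s0 by (simp add: p_def power_int_minus)
  have up: "s powi (- x) * p = b k * q powi (m - x)"
  proof -
    have "s powi (- x) * s powi (- x) = s powi (2 * (- x))" using s0 by (simp flip: power_int_add)
    also note sp
    finally show ?thesis using q_nz by (simp add: p_def power_int_diff power_int_minus field_simps)
  qed
  define \<sigma> where "\<sigma> = s powi x * q powi (N k - m)"
  have \<sigma>0: "\<sigma> \<noteq> 0" using s0 q_nz by (simp add: \<sigma>_def)
  have \<sigma>p: "\<sigma> * p = c k"
  proof -
    have "\<sigma> * p = (s powi x * p) * q powi (N k - m)" by (simp add: \<sigma>_def)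
    also have "\<dots> = b k * (q powi m * q powi (N k - m))" unfolding vp by simp
    also have "q powi m * q powi (N k - m) = q powi N k" using q_nz by (simp flip: power_int_add)
    finally show ?thesis by (simp add: c_def shiftp_def)
  qed
  have "filterlim (\<lambda>z. \<sigma> * z) (at (c k)) (at p)"
    unfolding filterlim_at
  proof
    show "((\<lambda>z. \<sigma> * z) \<longlongrightarrow> c k) (at p)" unfolding \<sigma>p[symmetric] by (intro tendsto_intros)
    show "\<forall>\<^sub>F z in at p. \<sigma> * z \<in> UNIV \<and> \<sigma> * z \<noteq> c k"
      unfolding \<sigma>p[symmetric] using \<sigma>0 by (auto simp: eventually_at_filter)
  qed
  from filterlim_compose[OF hq_residue_limit[OF genc k] this]
  have "((\<lambda>z. (\<sigma> * z - c k) * hq c (\<sigma> * z) / (\<sigma> * z)) \<longlongrightarrow> eta c k) (at p)" .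
  moreover have "eventually (\<lambda>z. (\<sigma> * z - c k) * hq c (\<sigma> * z) / (\<sigma> * z) = (z - p) * hq c (s powi x * z) / z) (at p)"
  proof -
    have "eventually (\<lambda>z. z \<in> -{0}) (at p)" using p0 by (intro eventually_at_in_open') auto
    thus ?thesis
    proof eventually_elim
      case (elim z)
      have "\<sigma> * z = s powi x * z * q powi (N k - m)" by (simp add: \<sigma>_def)
      moreover have "hq c (s powi x * z * q powi (N k - m)) = hq c (s powi x * z)"
        using elim s0 by (intro hq_q[OF c0 c1]) auto
      ultimately have "hq c (\<sigma> * z) = hq c (s powi x * z)" by (simp only:)
      thus ?case unfolding \<sigma>p[symmetric] using \<sigma>0 by (simp add: right_diff_distrib[symmetric])
    qed
  qed
  ultimately have hlim: "((\<lambda>z. (z - p) * hq c (s powi x * z) / z) \<longlongrightarrow> eta c k) (at p)"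
    by (rule Lim_transform_eventually)
  have lim1: "((\<lambda>z. combo b fs (s powi (- x) * z)) \<longlongrightarrow> combo b fs (b k * q powi (m - x))) (at p)"
  proof -
    have "(\<lambda>z. combo b fs (s powi (- x) * z)) analytic_on {p}"
    proof (rule combo_analytic)
      fix z j assume "z \<in> {p}" "j \<in> I6"
      hence "b j * b k * q powi (m - x) \<notin> qpowers q" using genericD(3)[OF gen _ k] by (simp only: qpowers_cancel not_False_eq_True)
      thus "b j * (s powi (- x) * z) \<notin> qpowers q" using \<open>z \<in> {p}\<close> up by (simp add: mult_ac)
    qed (intro analytic_intros)
    from analytic_at_imp_isCont[OF this] show ?thesis unfolding isCont_def up .
  qed
  have lim2: "((\<lambda>z. combo c gs (s powi x * z)) \<longlongrightarrow> combo c gs (b k * q powi m)) (at p)"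
  proof -
    have "(\<lambda>z. combo c gs (s powi x * z)) analytic_on {p}"
    proof (rule combo_analytic)
      fix z j assume "z \<in> {p}" "j \<in> I6"
      hence "b j * b k * q powi (m + N j) \<notin> qpowers q" using genericD(3)[OF gen _ k] by (simp only: qpowers_cancel not_False_eq_True)
      thus "c j * (s powi x * z) \<notin> qpowers q" using \<open>z \<in> {p}\<close> vp q_nz by (simp add: mult_ac c_def shiftp_def power_int_add)
    qed (intro analytic_intros)
    from analytic_at_imp_isCont[OF this] show ?thesis unfolding isCont_def vp .
  qed
  have "((\<lambda>z. - mu b N / (2 * pi * \<i>) * ((z - p) * hq c (s powi x * z) / z * combo b fs (s powi (- x) * z) * combo c gs (s powi x * z)))
      \<longlongrightarrow> - mu b N / (2 * pi * \<i>) * (eta c k * combo b fs (b k * q powi (m - x)) * combo c gs (b k * q powi m))) (at p)"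
    by (intro tendsto_intros hlim lim1 lim2)
  hence lim: "((\<lambda>z. icore b N s fs gs x z * (z - p)) \<longlongrightarrow> - mu b N / (2 * pi * \<i>) * (eta c k * combo b fs (b k * q powi (m - x)) * combo c gs (b k * q powi m))) (at p)"
    by (simp add: icore_def c_def[symmetric] mult_ac)
  have "isolated_singularity_at (icore b N s fs gs x) p"
    by (rule meromorphic_on_isolated_singularity, rule meromorphic_on_subset[OF mero]) (use p0 in auto)
  then obtain r where "r > 0" "icore b N s fs gs x analytic_on ball p r - {p}"
    unfolding isolated_singularity_at_def by blast
  hence "residue (icore b N s fs gs x) p = - mu b N / (2 * pi * \<i>) * (eta c k * combo b fs (b k * q powi (m - x)) * combo c gs (b k * q powi m))"
    using lim by (intro residue_simple'[of "ball p r"] analytic_imp_holomorphic) auto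
  thus ?thesis unfolding p_def c_def .
qed

lemma finite_qpowers_annulus:
  fixes A :: "complex set"
  assumes A: "finite A" "0 \<notin> A" and r: "0 < r"
  shows "finite {z \<in> (\<Union>a\<in>A. (\<lambda>t. a * t) ` qpowers q). r \<le> norm z \<and> norm z \<le> R}"
proof (cases "0 < R")
  case True
  have "{z \<in> (\<Union>a\<in>A. (\<lambda>t. a * t) ` qpowers q). r \<le> norm z \<and> norm z \<le> R} \<subseteq>
      (\<Union>a\<in>A. (\<lambda>m. a * q powi m) ` {m::int. r \<le> norm a * norm q powi m \<and> norm a * norm q powi m \<le> R})"
  proof
    fix z assume "z \<in> {z \<in> (\<Union>a\<in>A. (\<lambda>t. a * t) ` qpowers q). r \<le> norm z \<and> norm z \<le> R}"
    then obtain a t where a: "z = a * t" "a \<in> A" "t \<in> qpowers q" "r \<le> norm (a * t)" "norm (a * t) \<le> R" by blast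
    then obtain m where "t = q powi m" by (auto simp: qpowers_def)
    hence "a * t \<in> (\<lambda>m. a * q powi m) ` {m::int. r \<le> norm a * norm q powi m \<and> norm a * norm q powi m \<le> R}"
      using a by (auto simp: norm_mult norm_power_int)
    thus "z \<in> (\<Union>a\<in>A. (\<lambda>m. a * q powi m) ` {m::int. r \<le> norm a * norm q powi m \<and> norm a * norm q powi m \<le> R})"
      using a(1,2) by blast
  qed
  moreover have "finite (\<Union>a\<in>A. (\<lambda>m. a * q powi m) ` {m::int. r \<le> norm a * norm q powi m \<and> norm a * norm q powi m \<le> R})"
  proof (intro finite_UN_I finite_imageI A(1))
    fix a assume "a \<in> A"
    hence "norm a > 0" using A(2) by auto
    thus "finite {m::int. r \<le> norm a * norm q powi m \<and> norm a * norm q powi m \<le> R}"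
      using finite_annulus_powers r True by blast
  qed
  ultimately show ?thesis by (rule finite_subset)
next
  case False
  hence "{z \<in> (\<Union>a\<in>A. (\<lambda>t. a * t) ` qpowers q). r \<le> norm z \<and> norm z \<le> R} = {}" using r by auto
  thus ?thesis by (simp only: finite.emptyI)
qed

text \<open>Only countably many radii are excluded.\<close>

lemma radius_avoiding_qpowers:
  fixes A :: "complex set"
  assumes "finite A"
  obtains \<rho> :: real where "0 < \<rho>" "\<And>z a t. norm z = \<rho> \<Longrightarrow> a \<in> A \<Longrightarrow> t \<in> qpowers q \<Longrightarrow> z \<noteq> a * t"
proof -
  define C where "C = norm ` (\<Union>a\<in>A. (\<lambda>t. a * t) ` qpowers q)"
  have "countable C" unfolding C_def qpowers_def using assms
    by (intro countable_image countable_UN) (auto intro: countable_finite)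
  hence "\<not> {0<..<1::real} \<subseteq> C" using uncountable_open_interval[of 0 "1::real"] countable_subset by auto
  then obtain \<rho> where "0 < \<rho>" "\<rho> \<notin> C" by (auto simp: subset_iff)
  thus ?thesis by (intro that[of \<rho>]) (auto simp: C_def)
qed

text \<open>
  An application of \<open>contour_integral_eq_residue_sum\<close> to circles of radius \<open>\<rho> \<bar>q\<bar>\<^sup>i\<close>. On all of them
  the elliptic factor takes the same values as on the circle of radius \<open>\<rho>\<close>, and each of the two
  other factors is bounded by a multiple of \<open>\<bar>z\<bar>\<close>.
\<close>

lemma integrand_has_contour_integral:
  assumes gen: "generic b" and b1: "(\<Prod>j\<in>I6. b j) = q" and N0: "(\<Sum>j\<in>I6. N j) = 0"
    and s: "s^2 = q"
    and f: "expands b J f fs" and g: "expands (shiftp b N) J' g gs"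
    and sep: "separating_contour q s b x (rahman_integrand q s b N f g x) \<gamma>"
    and sum: "((\<lambda>(k, m). eta (shiftp b N) k * combo b fs (b k * q powi (m - x)) * combo (shiftp b N) gs (b k * q powi m))
      has_sum T) (I6 \<times> UNIV)"
  shows "(rahman_integrand q s b N f g x has_contour_integral - mu b N * T) \<gamma>"
proof -
  define c where "c = shiftp b N"
  define F where "F = icore b N s fs gs x"
  define F0 where "F0 = rahman_integrand q s b N f g x"
  have genc: "generic c" unfolding c_def by (rule generic_shiftp[OF gen])
  have c1: "(\<Prod>j\<in>I6. c j) = q" unfolding c_def prod_shiftp b1 N0 by simp
  have b0: "b j \<noteq> 0" if "j \<in> I6" for j using genericD(1)[OF gen that that] .
  have c0: "c j \<noteq> 0" if "j \<in> I6" for j using genericD(1)[OF genc that that] .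
  have s0: "s \<noteq> 0" using s q_nz by auto
  have sp: "s powi (2 * n) = q powi n" for n using s by (metis power_int_mult power_int_numeral)
  have uv: "s powi (- x) * z = s powi x * z * q powi (- x)" for z
  proof -
    have "s powi (- x) = s powi x * s powi (2 * (- x))" using s0 by (simp flip: power_int_add)
    also note sp
    finally have "s powi (- x) = s powi x * q powi (- x)" .
    thus ?thesis by (simp only: mult_ac)
  qed
  define p where "p = (\<lambda>(k, m::int). b k * s powi (- x) * q powi m)"
  define I where "I = I6 \<times> (UNIV :: int set)"
  define D where "D = (\<Union>j\<in>I6. (\<lambda>t. inverse (b j) * s powi (- x) * t) ` qpowers q)"
  define A where "A = (\<lambda>j. b j * s powi (- x)) ` I6 \<union> (\<lambda>j. inverse (b j) * s powi (- x)) ` I6"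
  have A: "finite A" "0 \<notin> A" using b0 s0 by (auto simp: A_def)
  have pI: "p ` I = (\<Union>j\<in>I6. (\<lambda>t. b j * s powi (- x) * t) ` qpowers q)"
    by (force simp: p_def I_def qpowers_def)
  have ZA: "p ` I \<union> D = (\<Union>a\<in>A. (\<lambda>t. a * t) ` qpowers q)" unfolding pI D_def A_def by auto
  have reg: "regular_pt b (s powi (- x) * z)" "regular_pt c (s powi x * z)" if z: "z \<noteq> 0" "z \<notin> p ` I \<union> D" for z
  proof -
    define v where "v = s powi x * z"
    have zv: "z = s powi (- x) * v" using s0 by (simp add: v_def power_int_minus)
    have "regular_pt b v"
      unfolding regular_pt_def
    proof (intro conjI ballI)
      show "v \<noteq> 0" using z s0 by (simp add: v_def)
      fix j assume j: "j \<in> I6"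
      have "z = inverse (b j) * s powi (- x) * (b j * v)" using b0[OF j] by (simp add: zv)
      thus "b j * v \<notin> qpowers q" using z(2) j unfolding D_def by blast
      have "z = b j * s powi (- x) * (v / b j)" using b0[OF j] by (simp add: zv)
      hence "v / b j \<notin> qpowers q" using z(2) j unfolding pI by blast
      moreover have "v / b j = inverse (b j / v)" by simp
      ultimately show "b j / v \<notin> qpowers q" using qpowers_inverse_iff by metis
    qed
    thus "regular_pt b (s powi (- x) * z)" "regular_pt c (s powi x * z)"
      unfolding uv c_def v_def by (simp_all only: regular_pt_powi regular_pt_shiftp)
  qed
  have F_eq: "F0 z = F z" if z: "z \<noteq> 0" "z \<notin> p ` I \<union> D" for z
    unfolding F0_def F_def using reg[OF z] z(1) b0
    by (intro rahman_integrand_eq_icore[OF _ b1 N0 s _ f g]) (auto simp: c_def)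
  have mero: "F meromorphic_on -{0}"
    unfolding F_def icore_def c_def[symmetric]
    by (intro meromorphic_intros combo_meromorphic hq_meromorphic analytic_intros analytic_on_imp_meromorphic_on)
       (use s0 c0 in auto)
  have ana: "F analytic_on {z}" if z: "z \<noteq> 0" "z \<notin> p ` I \<union> D" for z
    unfolding F_def icore_def c_def[symmetric] using reg[OF z] z s0 c0
    by (intro analytic_intros combo_analytic hq_analytic) (auto simp: regular_pt_def)
  have fin: "finite {z \<in> p ` I \<union> D. r \<le> norm z \<and> norm z \<le> R}" if "0 < r" for r R
    unfolding ZA by (rule finite_qpowers_annulus[OF A that])
  have ev: "eventually (\<lambda>w. F0 w = F w) (at z)" if z: "z \<noteq> 0" for z
  proof -
    have "finite {w \<in> p ` I \<union> D. norm z / 2 \<le> norm w \<and> norm w \<le> 2 * norm z}"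
      by (rule fin) (use z in simp)
    hence "\<not> z islimpt {w \<in> p ` I \<union> D. norm z / 2 \<le> norm w \<and> norm w \<le> 2 * norm z}" by (rule islimpt_finite)
    hence e1: "eventually (\<lambda>w. w \<notin> {w \<in> p ` I \<union> D. norm z / 2 \<le> norm w \<and> norm w \<le> 2 * norm z}) (at z)"
      by (simp only: islimpt_iff_eventually not_not)
    have e2: "eventually (\<lambda>w. norm z / 2 < norm w) (at z)"
      by (rule order_tendstoD[OF tendsto_norm[OF tendsto_ident_at]]) (use z in simp)
    have e3: "eventually (\<lambda>w. norm w < 2 * norm z) (at z)"
      by (rule order_tendstoD[OF tendsto_norm[OF tendsto_ident_at]]) (use z in simp)
    from e1 e2 e3 show ?thesis
    proof eventually_elim
      case (elim w)
      hence "w \<notin> p ` I \<union> D" by auto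
      moreover have "w \<noteq> 0" using elim z by auto
      ultimately show ?case by (intro F_eq)
    qed
  qed
  have pole: "is_pole F0 z \<longleftrightarrow> is_pole F z" if "z \<noteq> 0" for z using ev[OF that] by (intro is_pole_cong) auto
  have p0: "p t \<noteq> 0" if "t \<in> I" for t using that b0 s0 q_nz by (auto simp: p_def I_def)
  have inj: "inj_on p I"
  proof (rule inj_onI)
    fix t t' assume t: "t \<in> I" "t' \<in> I" "p t = p t'"
    obtain k m k' m' where km: "t = (k, m)" "t' = (k', m')" by (metis surj_pair)
    have k: "k \<in> I6" "k' \<in> I6" and "b k * s powi (- x) * q powi m = b k' * s powi (- x) * q powi m'"
      using t by (auto simp: km I_def p_def)
    hence e: "b k * q powi m = b k' * q powi m'" using s0 by simp
    have "b k / b k' \<in> qpowers q" using qpowers_same_class[OF b0[OF k(1)] b0[OF k(2)] e] .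
    hence kk: "k = k'" using genericD(2)[OF gen k] by blast
    hence "q powi m = q powi m'" using e b0[OF k(1)] by simp
    thus "t = t'" using kk km q_powi_inj by blast
  qed
  have \<gamma>: "valid_path \<gamma>" "simple_path \<gamma>" "pathfinish \<gamma> = pathstart \<gamma>"
      "0 \<in> inside (path_image \<gamma>)" "winding_number \<gamma> 0 = 1"
    and sepb: "\<And>z j. j \<in> I6 \<Longrightarrow> is_pole F0 z \<Longrightarrow> z \<in> (\<lambda>t. b j * s powi (- x) * t) ` qpowers q \<Longrightarrow> z \<in> inside (path_image \<gamma>)"
    and sepd: "\<And>z j. j \<in> I6 \<Longrightarrow> is_pole F0 z \<Longrightarrow> z \<in> (\<lambda>t. inverse (b j) * s powi (- x) * t) ` qpowers q \<Longrightarrow> z \<in> outside (path_image \<gamma>)"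
    using sep unfolding separating_contour_def F0_def I6_def by blast+
  have insd: "p t \<in> inside (path_image \<gamma>)" if t: "t \<in> I" "is_pole F (p t)" for t
  proof -
    have "is_pole F0 (p t)" using t pole p0 by simp
    moreover have "p t \<in> (\<lambda>u. b (fst t) * s powi (- x) * u) ` qpowers q" "fst t \<in> I6"
      using t(1) by (auto simp: p_def I_def)
    ultimately show ?thesis using sepb by blast
  qed
  have outd: "z \<in> outside (path_image \<gamma>)" if z: "z \<in> D" "is_pole F z" for z
  proof -
    have "z \<noteq> 0" using z(1) b0 s0 zero_not_qpowers by (auto simp: D_def)
    hence "is_pole F0 z" using z(2) pole by simp
    thus ?thesis using z(1) sepd unfolding D_def by blast
  qed
  obtain \<rho> where \<rho>: "0 < \<rho>" "\<And>z a t. norm z = \<rho> \<Longrightarrow> a \<in> A \<Longrightarrow> t \<in> qpowers q \<Longrightarrow> z \<noteq> a * t"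
    using radius_avoiding_qpowers[OF A(1)] by blast
  have nq: "0 < norm q" "norm q < 1" using q_nz norm_q by auto
  have avoid: "z \<notin> p ` I \<union> D" if z: "norm z = \<rho> * norm q ^ n" for z n
  proof
    assume "z \<in> p ` I \<union> D"
    then obtain a t where at: "a \<in> A" "t \<in> qpowers q" "z = a * t" unfolding ZA by blast
    have "norm (z * q powi (- int n)) = \<rho>" using z nq by (simp add: norm_mult norm_inverse norm_power power_int_minus)
    moreover have "z * q powi (- int n) = a * (t * q powi (- int n))" using at by simp
    moreover have "t * q powi (- int n) \<in> qpowers q" using at(2) by (simp only: qpowers_cancel)
    ultimately show False using \<rho>(2) at(1) by blast
  qed
  obtain H where H: "\<And>w. norm w = \<rho> \<Longrightarrow> norm (hq c (s powi x * w)) \<le> H"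
  proof -
    have "(\<lambda>w. hq c (s powi x * w)) analytic_on sphere 0 \<rho>"
    proof (intro hq_analytic)
      fix w :: complex and j assume w: "w \<in> sphere 0 \<rho>" and j: "j \<in> I6"
      hence "w \<noteq> 0" "w \<notin> p ` I \<union> D" using \<rho>(1) avoid[of w 0] by auto
      from reg(2)[OF this] show "c j / (s powi x * w) \<notin> qpowers q" using j by (simp add: regular_pt_def)
    qed (use \<rho>(1) s0 c0 in \<open>auto intro!: analytic_intros\<close>)
    hence "continuous_on (sphere 0 \<rho>) (\<lambda>w. hq c (s powi x * w))"
      by (intro holomorphic_on_imp_continuous_on analytic_imp_holomorphic)
    hence "bounded ((\<lambda>w. hq c (s powi x * w)) ` sphere 0 \<rho>)"
      by (intro compact_imp_bounded compact_continuous_image) auto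
    then obtain H where "\<And>w. w \<in> sphere 0 \<rho> \<Longrightarrow> norm (hq c (s powi x * w)) \<le> H"
      unfolding bounded_iff by blast
    thus ?thesis using that[of H] by (simp only: mem_sphere dist_0_norm)
  qed
  obtain C1 \<delta>1 where C1: "0 < \<delta>1" "0 \<le> C1" "\<And>u. norm u < \<delta>1 \<Longrightarrow> norm (combo b fs u) \<le> C1 * norm u"
    using combo_linear_bound by blast
  obtain C2 \<delta>2 where C2: "0 < \<delta>2" "0 \<le> C2" "\<And>u. norm u < \<delta>2 \<Longrightarrow> norm (combo c gs u) \<le> C2 * norm u"
    using combo_linear_bound by blast
  define r0 where "r0 n = \<rho> * norm q ^ n" for n
  have r0: "r0 \<longlonglongrightarrow> 0" unfolding r0_def using nq by (intro tendsto_mult_right_zero LIMSEQ_power_zero) auto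
  have "eventually (\<lambda>n. norm (s powi (- x)) * r0 n < \<delta>1) sequentially"
    by (rule order_tendstoD(2)[OF tendsto_mult_right_zero[OF r0] C1(1)])
  moreover have "eventually (\<lambda>n. norm (s powi x) * r0 n < \<delta>2) sequentially"
    by (rule order_tendstoD(2)[OF tendsto_mult_right_zero[OF r0] C2(1)])
  ultimately have "eventually (\<lambda>n. norm (s powi (- x)) * r0 n < \<delta>1 \<and> norm (s powi x) * r0 n < \<delta>2) sequentially"
    by (rule eventually_conj)
  then obtain n0 where n0: "\<And>n. n \<ge> n0 \<Longrightarrow> norm (s powi (- x)) * r0 n < \<delta>1 \<and> norm (s powi x) * r0 n < \<delta>2"
    unfolding eventually_sequentially by blast
  define r where "r i = r0 (i + n0)" for i
  define B where "B = norm (mu b N) * C1 * C2 * H * \<rho> / (2 * pi)"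
  have r_pos: "0 < r i" for i using \<rho>(1) nq by (simp add: r_def r0_def)
  have r_lim: "r \<longlonglongrightarrow> 0" unfolding r_def using r0 by (rule LIMSEQ_ignore_initial_segment)
  \<comment> \<open>Since \<open>\<bar>u\<bar> \<bar>v\<bar> = \<bar>z\<bar>\<^sup>2\<close>, the two linear bounds outweigh the factor \<open>1 / z\<close>.\<close>
  have circ: "z \<notin> p ` I \<union> D \<and> norm (F z) \<le> B" if z: "norm z = r i" for i z
  proof
    show "z \<notin> p ` I \<union> D" using avoid z unfolding r_def r0_def by blast
    have z0: "z \<noteq> 0" using z r_pos[of i] by auto
    have 1: "norm (combo b fs (s powi (- x) * z)) \<le> C1 * norm (s powi (- x) * z)"
      by (rule C1(3)) (use n0[of "i + n0"] z in \<open>simp add: norm_mult r_def\<close>)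
    have 2: "norm (combo c gs (s powi x * z)) \<le> C2 * norm (s powi x * z)"
      by (rule C2(3)) (use n0[of "i + n0"] z in \<open>simp add: norm_mult r_def\<close>)
    have 3: "norm (hq c (s powi x * z)) \<le> H"
    proof -
      define w where "w = z * q powi (- int (i + n0))"
      have "norm w = \<rho>" using z nq by (simp add: w_def norm_mult norm_inverse norm_power power_int_minus r_def r0_def del: of_nat_add)
      hence "norm (hq c (s powi x * w)) \<le> H" by (rule H)
      moreover have "hq c (s powi x * z * q powi (- int (i + n0))) = hq c (s powi x * z)"
        using z0 s0 by (intro hq_q[OF c0 c1]) auto
      hence "hq c (s powi x * w) = hq c (s powi x * z)" by (simp only: w_def mult.assoc)
      ultimately show ?thesis by simp
    qed
    have H0: "0 \<le> H" using 3 norm_ge_zero order_trans by blast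
    have "norm (F z) = norm (mu b N) * norm (combo b fs (s powi (- x) * z)) * norm (combo c gs (s powi x * z)) *
        norm (hq c (s powi x * z)) / (2 * pi * norm z)"
      unfolding F_def icore_def c_def[symmetric] by (simp add: norm_mult norm_divide)
    also have "\<dots> \<le> norm (mu b N) * (C1 * norm (s powi (- x) * z)) * (C2 * norm (s powi x * z)) * H / (2 * pi * norm z)"
      using 1 2 3 C1(2) C2(2) by (intro divide_right_mono mult_mono) auto
    also have "\<dots> = norm (mu b N) * C1 * C2 * H * norm z / (2 * pi)"
    proof -
      have "norm (s powi (- x) * z) * norm (s powi x * z) = norm z * norm z"
      proof -
        have "s powi (- x) * z * (s powi x * z) = z * z" using s0 by (simp add: power_int_minus field_simps)
        thus ?thesis by (metis norm_mult)
      qed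
      thus ?thesis using z0 by (simp add: field_simps)
    qed
    also have "\<dots> \<le> B"
    proof -
      have "norm z \<le> \<rho>" using z nq \<rho>(1) by (simp add: r_def r0_def mult_left_le power_le_one)
      thus ?thesis unfolding B_def using C1(2) C2(2) H0 by (intro divide_right_mono mult_left_mono) auto
    qed
    finally show "norm (F z) \<le> B" .
  qed
  have res: "residue F (p (k, m)) = - mu b N / (2 * pi * \<i>) * (eta c k * combo b fs (b k * q powi (m - x)) * combo c gs (b k * q powi m))"
    if "k \<in> I6" for k m
    unfolding F_def p_def prod.case c_def by (rule residue_icore[OF gen b1 N0 s that mero[unfolded F_def]])
  have "((\<lambda>t. - mu b N / (2 * pi * \<i>) * (case t of (k, m) \<Rightarrow> eta c k * combo b fs (b k * q powi (m - x)) * combo c gs (b k * q powi m)))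
      has_sum - mu b N / (2 * pi * \<i>) * T) I"
    unfolding I_def c_def by (rule has_sum_cmult_right[OF sum])
  hence "((\<lambda>t. residue F (p t)) has_sum - mu b N / (2 * pi * \<i>) * T) I"
    by (rule has_sum_cong[THEN iffD1, rotated]) (auto simp: I_def res)
  from contour_integral_eq_residue_sum[OF mero inj p0 ana fin \<gamma> insd outd r_pos r_lim circ this]
  have int: "(remove_sings F has_contour_integral 2 * pi * \<i> * (- mu b N / (2 * pi * \<i>) * T)) \<gamma>" .
  obtain \<delta> where \<delta>: "\<delta> > 0" "ball 0 \<delta> \<subseteq> inside (path_image \<gamma>)"
    using open_inside[of "path_image \<gamma>"] \<gamma>(1,4) by (metis closed_valid_path_image open_contains_ball)
  obtain R where R: "\<And>z. z \<in> path_image \<gamma> \<Longrightarrow> norm z \<le> R"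
    using bounded_valid_path_image[OF \<gamma>(1)] unfolding bounded_iff by blast
  have "(F0 has_contour_integral 2 * pi * \<i> * (- mu b N / (2 * pi * \<i>) * T)) \<gamma>"
  proof (rule has_contour_integral_spike_finite_simple_path[OF int \<gamma>(2)])
    show "finite {z \<in> p ` I \<union> D. \<delta> \<le> norm z \<and> norm z \<le> R}" using fin \<delta>(1) .
    fix z assume z: "z \<in> path_image \<gamma> - {z \<in> p ` I \<union> D. \<delta> \<le> norm z \<and> norm z \<le> R}"
    hence "z \<notin> inside (path_image \<gamma>)" by (simp add: inside_def)
    hence "z \<notin> ball 0 \<delta>" using \<delta>(2) by blast
    hence "\<delta> \<le> norm z" by simp
    moreover have "norm z \<le> R" using R z by blast
    ultimately have "z \<noteq> 0" "z \<notin> p ` I \<union> D" using z \<delta>(1) by auto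
    from F_eq[OF this] ana[OF this] show "F0 z = remove_sings F z" by simp
  qed
  thus ?thesis unfolding F0_def by simp
qed

end

section \<open>Summation over all contours\<close>

abbreviation norm_summable_on :: "('a \<Rightarrow> complex) \<Rightarrow> 'a set \<Rightarrow> bool" (infixr "norm'_summable'_on" 46) where
  "f norm_summable_on A \<equiv> (\<lambda>x. norm (f x)) summable_on A"

lemma product_has_sum:
  fixes f :: "'a \<Rightarrow> complex" and g :: "'b \<Rightarrow> complex"
  assumes f: "(f has_sum x) A" "f norm_summable_on A" and g: "(g has_sum y) B" "g norm_summable_on B"
  shows "((\<lambda>(a, b). f a * g b) has_sum x * y) (A \<times> B)" and "(\<lambda>(a, b). f a * g b) norm_summable_on A \<times> B"
proof -
  show abs: "(\<lambda>(a, b). f a * g b) norm_summable_on A \<times> B"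
    unfolding Infinite_Sum.abs_summable_on_Sigma_iff
  proof (intro conjI ballI)
    fix a
    show "(\<lambda>b. case (a, b) of (a, b) \<Rightarrow> f a * g b) norm_summable_on B"
      using summable_on_cmult_right[OF g(2), of "norm (f a)"] by (simp add: norm_mult)
  next
    have "(\<lambda>a. norm (f a) * infsum (\<lambda>b. norm (g b)) B) summable_on A"
      by (rule summable_on_cmult_left[OF f(2)])
    moreover have "0 \<le> infsum (\<lambda>b. norm (g b)) B" by (rule infsum_nonneg) simp
    ultimately show "(\<lambda>a. norm (\<Sum>\<^sub>\<infinity>b\<in>B. norm (case (a, b) of (a, b) \<Rightarrow> f a * g b))) summable_on A"
      using g(2) by (simp add: norm_mult infsum_cmult_right' abs_mult)
  qed
  show "((\<lambda>(a, b). f a * g b) has_sum x * y) (A \<times> B)"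
  proof (rule has_sum_SigmaI)
    show "((\<lambda>b. case (a, b) of (a, b) \<Rightarrow> f a * g b) has_sum f a * y) B" for a
      using has_sum_cmult_right[OF g(1), of "f a"] by simp
    show "((\<lambda>a. f a * y) has_sum x * y) A" by (rule has_sum_cmult_left[OF f(1)])
  qed (rule abs_summable_summable[OF abs])
qed

lemma abs_summable_on_SigmaD:
  fixes f :: "'a \<times> 'b \<Rightarrow> complex"
  shows "f norm_summable_on A \<times> B \<Longrightarrow> a \<in> A \<Longrightarrow> (\<lambda>b. f (a, b)) norm_summable_on B"
  unfolding Infinite_Sum.abs_summable_on_Sigma_iff by blast

lemma has_sum_finite_sum:
  fixes f :: "'k \<Rightarrow> 'a \<Rightarrow> complex"
  assumes "finite K" "\<And>k. k \<in> K \<Longrightarrow> (f k has_sum S k) A"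
  shows "((\<lambda>x. \<Sum>k\<in>K. f k x) has_sum (\<Sum>k\<in>K. S k)) A"
  using assms by (induction K rule: finite_induct) (auto intro!: has_sum_add)

lemma has_sum_finite_Times:
  fixes h :: "'k \<Rightarrow> 'a \<Rightarrow> complex"
  assumes K: "finite K" and h: "\<And>k. k \<in> K \<Longrightarrow> (h k has_sum S k) A" "\<And>k. k \<in> K \<Longrightarrow> h k norm_summable_on A"
  shows "((\<lambda>(k, a). h k a) has_sum (\<Sum>k\<in>K. S k)) (K \<times> A)"
proof (rule has_sum_SigmaI)
  show "((\<lambda>a. case (k, a) of (k, a) \<Rightarrow> h k a) has_sum S k) A" if "k \<in> K" for k using h(1)[OF that] by simp
  show "(S has_sum (\<Sum>k\<in>K. S k)) K" by (rule has_sum_finite[OF K])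
  have "(\<lambda>(k, a). h k a) norm_summable_on K \<times> A"
    unfolding Infinite_Sum.abs_summable_on_Sigma_iff using h(2) K by (auto intro: summable_on_finite)
  thus "(\<lambda>(k, a). h k a) summable_on K \<times> A" by (rule abs_summable_summable)
qed

context qbase begin

text \<open>
  At \<open>b\<^sub>k q\<^sup>n\<close> with negative \<open>n\<close>, a numerator of \<open>Xf\<close> vanishes. Sums over all integers, as they arise
  from residues, are therefore the one-sided series \<open>xs\<close>.
\<close>

lemma Xf_powi_neg:
  assumes "k \<in> I6" "b k \<noteq> 0" "n < 0"
  shows "Xf b (b k * q powi n) = 0"
proof -
  have "q powi (1 + n + (- n - 1)) = q powi 1 * q powi n * q powi (- n - 1)"
    by (simp only: power_int_add[OF disjI1[OF q_nz]])
  hence "q * (b k * q powi n) / b k * q ^ nat (- n - 1) = 1"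
    using assms by (simp flip: power_int_of_nat)
  hence "qp (q * (b k * q powi n) / b k) = 0" unfolding qp_eq_0_iff ..
  thus ?thesis using assms(1) by (auto simp: Xf_def intro!: prod_zero bexI[of _ k])
qed

lemma Xf_has_sum:
  assumes k: "k \<in> I6" "b k \<noteq> 0"
  shows "((\<lambda>n::int. Xf b (b k * q powi n)) has_sum xs b k) UNIV" "(\<lambda>n::int. Xf b (b k * q powi n)) norm_summable_on UNIV"
proof -
  have z: "Xf b (b k * q powi n) = 0" if "n \<in> UNIV - range int" for n
  proof (rule Xf_powi_neg[where b = b, OF k])
    show "n < 0" using that by (metis DiffE int_nat_eq linorder_not_less rangeI)
  qed
  have o: "(\<lambda>n::int. Xf b (b k * q powi n)) \<circ> int = (\<lambda>n. Xf b (b k * q ^ n))" by (simp add: o_def)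
  have "(\<lambda>n. Xf b (b k * q ^ n)) sums xs b k" unfolding xs_def by (rule summable_sums[OF Xf_summable'])
  hence "((\<lambda>n. Xf b (b k * q ^ n)) has_sum xs b k) UNIV" by (rule norm_summable_imp_has_sum[OF Xf_summable])
  hence "((\<lambda>n::int. Xf b (b k * q powi n)) has_sum xs b k) (range int)"
    by (subst has_sum_reindex) (simp_all add: o)
  thus "((\<lambda>n::int. Xf b (b k * q powi n)) has_sum xs b k) UNIV"
    by (rule has_sum_cong_neutral[THEN iffD1, rotated -1]) (use z in auto)
  have on: "(\<lambda>n::int. norm (Xf b (b k * q powi n))) \<circ> int = (\<lambda>n. norm (Xf b (b k * q ^ n)))" by (simp add: o_def)
  have "(\<lambda>n. norm (Xf b (b k * q ^ n))) summable_on UNIV"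
    by (rule norm_summable_imp_summable_on) (use Xf_summable in simp)
  hence "(\<lambda>n::int. norm (Xf b (b k * q powi n))) summable_on (range int)"
    by (subst summable_on_reindex) (simp_all add: on)
  thus "(\<lambda>n::int. Xf b (b k * q powi n)) norm_summable_on UNIV"
    by (rule summable_on_cong_neutral[THEN iffD1, rotated -1]) (use z in auto)
qed

lemma has_sum_int_shift:
  fixes h :: "int \<Rightarrow> complex"
  assumes "(h has_sum S) UNIV" "h norm_summable_on UNIV"
  shows "((\<lambda>n. h (n - d)) has_sum S) UNIV" "(\<lambda>n. h (n - d)) norm_summable_on UNIV"
proof -
  show "((\<lambda>n. h (n - d)) has_sum S) UNIV"
    using assms(1) by (subst has_sum_reindex_bij_witness[of _ "\<lambda>n. n + d" "\<lambda>n. n - d" _ h]) auto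
  show "(\<lambda>n. h (n - d)) norm_summable_on UNIV"
    using assms(2) by (subst summable_on_reindex_bij_witness[of _ "\<lambda>n. n + d" "\<lambda>n. n - d" _ "\<lambda>n. norm (h n)"]) auto
qed

text \<open>The sum of \<open>combo b fs\<close> over \<open>b\<^sub>k q\<^bsup>\<int>\<^esup>\<close>; see \<open>combo_has_sum\<close>.\<close>

definition xcombo :: "(nat \<Rightarrow> complex) \<Rightarrow> (complex \<times> (nat \<Rightarrow> int)) list \<Rightarrow> nat \<Rightarrow> complex" where
  "xcombo b fs k = (\<Sum>(c, e)\<leftarrow>fs. c * mu b e * xs (shiftp b e) k)"

lemma combo_has_sum:
  assumes k: "k \<in> I6" "b k \<noteq> 0"
  shows "((\<lambda>n::int. combo b fs (b k * q powi n)) has_sum xcombo b fs k) UNIV \<and>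
    (\<lambda>n::int. combo b fs (b k * q powi n)) norm_summable_on UNIV"
proof (induction fs)
  case Nil
  show ?case by (simp add: combo_Nil xcombo_def)
next
  case (Cons ce fs)
  define e where "e = snd ce"
  define c where "c = fst ce * mu b e"
  have ek: "shiftp b e k \<noteq> 0" using k q_nz by (simp add: shiftp_def)
  have sh: "shiftp b e k * q powi (n - e k) = b k * q powi n" for n
    using q_nz by (simp add: shiftp_def power_int_diff)
  have X: "((\<lambda>n. Xf (shiftp b e) (b k * q powi n)) has_sum xs (shiftp b e) k) UNIV"
      "(\<lambda>n. Xf (shiftp b e) (b k * q powi n)) norm_summable_on UNIV"
    using has_sum_int_shift[OF Xf_has_sum[where b = "shiftp b e", OF k(1) ek], of "e k"] unfolding sh by blast+
  have "((\<lambda>n. c * Xf (shiftp b e) (b k * q powi n) + combo b fs (b k * q powi n)) has_sum c * xs (shiftp b e) k + xcombo b fs k) UNIV"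
    using Cons X(1) by (intro has_sum_add has_sum_cmult_right) auto
  moreover have "(\<lambda>n. c * Xf (shiftp b e) (b k * q powi n) + combo b fs (b k * q powi n)) norm_summable_on UNIV"
  proof (rule Infinite_Sum.abs_summable_on_comparison_test')
    show "(\<lambda>n. norm c * norm (Xf (shiftp b e) (b k * q powi n)) + norm (combo b fs (b k * q powi n))) summable_on UNIV"
      using Cons X(2) by (intro summable_on_add summable_on_cmult_right) auto
    show "norm (c * Xf (shiftp b e) (b k * q powi n) + combo b fs (b k * q powi n))
        \<le> norm c * norm (Xf (shiftp b e) (b k * q powi n)) + norm (combo b fs (b k * q powi n))" for n
      by (metis norm_mult norm_triangle_ineq)
  qed
  moreover have "xcombo b (ce # fs) k = c * xs (shiftp b e) k + xcombo b fs k"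
    by (simp add: xcombo_def c_def e_def case_prod_unfold)
  ultimately show ?case by (simp add: combo_Cons c_def e_def)
qed

text \<open>
  Jackson's summation for each term, with the shifted closed forms brought to a common one by
  \<open>Hf_shiftp\<close>.
\<close>

lemma xcombo_diff:
  assumes gen: "generic b" and b1: "(\<Prod>j\<in>I6. b j) = q" and e0: "\<forall>(c, e)\<in>set fs. (\<Sum>j\<in>I6. e j) = 0"
    and kl: "k \<in> I6" "l \<in> I6" "k \<noteq> l"
  shows "xcombo b fs k - xcombo b fs l = jcombo b fs * Hf b k l"
  using e0
proof (induction fs)
  case (Cons ce fs)
  define e where "e = snd ce"
  have e: "(\<Sum>j\<in>I6. e j) = 0" using Cons.prems by (auto simp: e_def)
  have b1e: "(\<Prod>j\<in>I6. shiftp b e j) = q" unfolding prod_shiftp b1 e by simp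
  have "mu b e * (xs (shiftp b e) k - xs (shiftp b e) l) = mu b e * Hf (shiftp b e) k l"
    using nonterminating_jackson[OF generic_shiftp[OF gen] kl b1e] by simp
  also have "\<dots> = jval b e * Hf b k l" by (rule Hf_shiftp[OF gen b1 e kl])
  finally have 1: "mu b e * xs (shiftp b e) k - mu b e * xs (shiftp b e) l = jval b e * Hf b k l" by (simp add: algebra_simps)
  have 2: "xcombo b (ce # fs) i = fst ce * (mu b e * xs (shiftp b e) i) + xcombo b fs i" for i
    by (simp add: xcombo_def e_def case_prod_unfold)
  have 3: "jcombo b (ce # fs) = fst ce * jval b e + jcombo b fs" by (simp add: jcombo_def e_def case_prod_unfold)
  have 4: "xcombo b fs k - xcombo b fs l = jcombo b fs * Hf b k l" using Cons by auto
  show ?case unfolding 2 3 using 1 4 by algebra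
qed (simp add: xcombo_def jcombo_def)

text \<open>
  The integral for \<open>x\<close> is a sum over \<open>k\<close> and \<open>m\<close> of products of a function of \<open>m - x\<close> and a function of
  \<open>m\<close>. Everything converges absolutely, so summation over \<open>x\<close> yields, for each \<open>k\<close>, the product of two
  independent sums; \<open>eta_sum_bilinear\<close> combines them.
\<close>

theorem sum_of_contour_integrals:
  fixes \<gamma> :: "int \<Rightarrow> real \<Rightarrow> complex"
  assumes gen: "generic b" and b1: "(\<Prod>j\<in>I6. b j) = q" and N0: "(\<Sum>j\<in>I6. N j) = 0" and s: "s^2 = q"
    and J: "is_rahman_functional q b J" "f \<in> rahman_space q b"
    and J': "is_rahman_functional q (shiftp b N) J'" "g \<in> rahman_space q (shiftp b N)"
    and sep: "\<And>x. separating_contour q s b x (rahman_integrand q s b N f g x) (\<gamma> x)"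
  shows "\<exists>I. (\<forall>x. (rahman_integrand q s b N f g x has_contour_integral I x) (\<gamma> x)) \<and>
    (I has_sum 2 / mu b N * pair_prod I6 (\<lambda>i j. qp (q / (b i * b j)) / qp (b i * b j * q powi (N i + N j))) * J f * J' g) UNIV"
proof -
  define c where "c = shiftp b N"
  have genc: "generic c" unfolding c_def by (rule generic_shiftp[OF gen])
  have c1: "(\<Prod>j\<in>I6. c j) = q" unfolding c_def prod_shiftp b1 N0 by simp
  have b0: "b j \<noteq> 0" if "j \<in> I6" for j using genericD(1)[OF gen that that] .
  have c0: "c j \<noteq> 0" if "j \<in> I6" for j using genericD(1)[OF genc that that] .
  obtain fs where fs: "expands b J f fs" by (rule rahman_space_expands[OF gen J])
  obtain gs where gs: "expands c J' g gs" using rahman_space_expands[OF genc] J' unfolding c_def by blast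
  define X where "X = xcombo b fs"
  define Y where "Y = xcombo c gs"
  define A where "A k n = combo b fs (b k * q powi n)" for k and n :: int
  define B where "B k m = combo c gs (b k * q powi m)" for k and m :: int
  have A: "(A k has_sum X k) UNIV" "A k norm_summable_on UNIV" if "k \<in> I6" for k
    using combo_has_sum[where b = b, OF that b0[OF that]] unfolding A_def X_def by blast+
  have B: "(B k has_sum Y k) UNIV" "B k norm_summable_on UNIV" if k: "k \<in> I6" for k
  proof -
    have "c k * q powi (m - N k) = b k * q powi m" for m
      using q_nz by (simp add: c_def shiftp_def power_int_diff)
    moreover have "((\<lambda>n::int. combo c gs (c k * q powi n)) has_sum Y k) UNIV" "(\<lambda>n::int. combo c gs (c k * q powi n)) norm_summable_on UNIV"
      using combo_has_sum[where b = c, OF k c0[OF k], of gs] unfolding Y_def by blast+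
    note has_sum_int_shift[OF this, of "N k"]
    ultimately show "(B k has_sum Y k) UNIV" "B k norm_summable_on UNIV" unfolding B_def by simp_all
  qed
  \<comment> \<open>The substitution \<open>n = m - x\<close> in the product of the two sums.\<close>
  have AB: "((\<lambda>(x, m). A k (m - x) * B k m) has_sum X k * Y k) (UNIV \<times> UNIV)"
      "(\<lambda>(x, m). A k (m - x) * B k m) norm_summable_on (UNIV \<times> UNIV)" if k: "k \<in> I6" for k
  proof -
    note P = product_has_sum[OF A[OF k] B[OF k]]
    show "((\<lambda>(x, m). A k (m - x) * B k m) has_sum X k * Y k) (UNIV \<times> UNIV)"
      using P(1) by (subst has_sum_reindex_bij_witness[of _ "\<lambda>(n, m). (m - n, m)" "\<lambda>(x, m). (m - x, m)" _ "\<lambda>(n, m). A k n * B k m"]) auto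
    show "(\<lambda>(x, m). A k (m - x) * B k m) norm_summable_on (UNIV \<times> UNIV)"
      using P(2) by (subst summable_on_reindex_bij_witness[of _ "\<lambda>(n, m). (m - n, m)" "\<lambda>(x, m). (m - x, m)" _ "\<lambda>t. norm (case t of (n, m) \<Rightarrow> A k n * B k m)"]) auto
  qed
  define w where "w k x = infsum (\<lambda>m. A k (m - x) * B k m) UNIV" for k x
  have abs: "(\<lambda>m. A k (m - x) * B k m) norm_summable_on UNIV" if "k \<in> I6" for k x
    using abs_summable_on_SigmaD[OF AB(2)[OF that], of x] by simp
  have w: "((\<lambda>m. A k (m - x) * B k m) has_sum w k x) UNIV" if "k \<in> I6" for k x
    unfolding w_def by (rule has_sum_infsum[OF abs_summable_summable[OF abs[OF that]]])
  have wsum: "(w k has_sum X k * Y k) UNIV" if "k \<in> I6" for k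
    by (rule has_sum_SigmaD[OF AB(1)[OF that]]) (use w[OF that] in simp)
  define I where "I x = - mu b N * (\<Sum>k\<in>I6. eta c k * w k x)" for x
  have int: "(rahman_integrand q s b N f g x has_contour_integral I x) (\<gamma> x)" for x
    unfolding I_def
  proof (rule integrand_has_contour_integral[OF gen b1 N0 s fs gs[unfolded c_def] sep])
    have "((\<lambda>(k, m). eta c k * (A k (m - x) * B k m)) has_sum (\<Sum>k\<in>I6. eta c k * w k x)) (I6 \<times> UNIV)"
    proof (rule has_sum_finite_Times)
      fix k assume k: "k \<in> I6"
      show "((\<lambda>m. eta c k * (A k (m - x) * B k m)) has_sum eta c k * w k x) UNIV"
        by (rule has_sum_cmult_right[OF w[OF k]])
      show "(\<lambda>m. eta c k * (A k (m - x) * B k m)) norm_summable_on UNIV"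
        using summable_on_cmult_right[OF abs[OF k, of x], of "norm (eta c k)"] by (simp add: norm_mult)
    qed simp
    thus "((\<lambda>(k, m). eta (shiftp b N) k * combo b fs (b k * q powi (m - x)) * combo (shiftp b N) gs (b k * q powi m))
        has_sum (\<Sum>k\<in>I6. eta c k * w k x)) (I6 \<times> UNIV)"
      by (simp add: A_def B_def c_def[symmetric] mult.assoc)
  qed
  have "(I has_sum - mu b N * (\<Sum>k\<in>I6. eta c k * (X k * Y k))) UNIV"
    unfolding I_def by (intro has_sum_cmult_right has_sum_finite_sum wsum) auto
  also have "- mu b N * (\<Sum>k\<in>I6. eta c k * (X k * Y k)) = - mu b N * (\<Sum>k\<in>I6. eta (shiftp b N) k * X k * Y k)"
    by (simp add: c_def mult.assoc)
  also have "\<dots> = 2 / mu b N * pair_prod I6 (\<lambda>i j. qp (q / (b i * b j)) / qp (b i * b j * q powi (N i + N j))) * J f * J' g"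
  proof (rule eta_sum_bilinear[OF gen b1 N0])
    fix k l assume kl: "k \<in> I6" "l \<in> I6" "k \<noteq> l"
    show "X k - X l = J f * Hf b k l" unfolding X_def using xcombo_diff[OF gen b1 _ kl] fs by (simp add: expands_def)
    show "Y k - Y l = J' g * Hf (shiftp b N) k l" unfolding Y_def using xcombo_diff[OF genc c1 _ kl] gs by (simp add: expands_def c_def)
  qed
  finally show ?thesis using int by blast
qed

end

theorem proposition4p1:
  fixes q s :: complex and b :: "nat \<Rightarrow> complex" and N :: "nat \<Rightarrow> int"
    and J J' :: "complex poly fract \<Rightarrow> complex" and f g :: "complex poly fract"
    and \<gamma> :: "int \<Rightarrow> real \<Rightarrow> complex"
  assumes "0 < norm q" and "norm q < 1" and "s ^ 2 = q"
    and "(\<Prod>j=1..6. b j) = q"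
    and "\<And>i j. 1 \<le> i \<Longrightarrow> i < j \<Longrightarrow> j \<le> 6 \<Longrightarrow> b i / b j \<notin> qpowers q"
    and "\<And>i j. 1 \<le> i \<Longrightarrow> i \<le> j \<Longrightarrow> j \<le> 6 \<Longrightarrow> b i * b j \<notin> qpowers q"
    and "(\<Sum>j=1..6. N j) = 0"
    and "is_rahman_functional q b J"
    and "is_rahman_functional q (\<lambda>j. b j * q powi N j) J'"
    and "f \<in> rahman_space q b"
    and "g \<in> rahman_space q (\<lambda>j. b j * q powi N j)"
    and "\<And>x. separating_contour q s b x (rahman_integrand q s b N f g x) (\<gamma> x)"
  shows "(\<forall>x. rahman_integrand q s b N f g x contour_integrable_on \<gamma> x) \<and>
    ((\<lambda>x. contour_integral (\<gamma> x) (rahman_integrand q s b N f g x)) has_sum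
       2 / (\<Prod>j=1..6. qbinom2 q (N j) * b j powi N j) *
       (\<Prod>i=1..6. \<Prod>j\<in>{i<..6}.
          qpoch_inf q (q / (b i * b j)) / qpoch_inf q (b i * b j * q powi (N i + N j))) *
       J f * J' g) UNIV"
proof -
  interpret qbase q using assms(1,2) by unfold_locales auto
  have b0: "b j \<noteq> 0" if "j \<in> I6" for j
    using assms(1,4) that unfolding I6_def[symmetric] by (metis finite_I6 norm_zero order_less_irrefl prod_zero_iff)
  have gen: "generic b"
    unfolding generic_def
  proof (intro conjI ballI impI)
    fix i j assume ij: "i \<in> I6" "j \<in> I6"
    show "b i * b j \<notin> qpowers q"
      using assms(6)[of i j] assms(6)[of j i] ij by (cases "i \<le> j") (auto simp: I6_def mult.commute)
    assume ne: "i \<noteq> j"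
    have "inverse (b j / b i) = b i / b j" by simp
    thus "b i / b j \<notin> qpowers q"
      using assms(5)[of i j] assms(5)[of j i] ij ne qpowers_inverse_iff[of "b j / b i"]
      by (cases "i < j") (auto simp: I6_def)
  qed (use b0 in auto)
  obtain I where int: "\<And>x. (rahman_integrand q s b N f g x has_contour_integral I x) (\<gamma> x)"
    and sum: "(I has_sum 2 / mu b N * pair_prod I6 (\<lambda>i j. qp (q / (b i * b j)) / qp (b i * b j * q powi (N i + N j))) * J f * J' g) UNIV"
    using sum_of_contour_integrals[OF gen _ _ assms(3) assms(8) assms(10) _ _ assms(12), where J' = J'] assms(4,7,9,11)
    unfolding I6_def shiftp_def by blast
  have "contour_integral (\<gamma> x) (rahman_integrand q s b N f g x) = I x" for x
    using int by (rule contour_integral_unique)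
  moreover have "rahman_integrand q s b N f g x contour_integrable_on \<gamma> x" for x
    using int contour_integrable_on_def by blast
  ultimately show ?thesis using sum unfolding pair_prod_I6 unfolding mu_def I6_def by simp
qed

end
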